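(* Let $\mathcal C$ be a closed symmetric monoidal category and $\mathcal M$ a left $\mathcal C$-actegory satisfying the standing assumptions in the context. (1) The assignment $\mathbf{Mod}_{\mathcal M}:Comm(\mathcal C)\to Cat$, $a\mapsto\mathbf{Mod}_{\mathcal M}(a)$, $(\alpha:a\to b)\mapsto(\alpha^*:\mathbf{Mod}_{\mathcal M}(a)\to\mathbf{Mod}_{\mathcal M}(b))$, is a pseudo-functor to the 2-category $Cat$ of categories. (2) For every $\alpha:a\to b$ in $Comm(\mathcal C)$, the restriction of scalars $\alpha_*:\mathbf{Mod}_{\mathcal M}(b)\to\mathbf{Mod}_{\mathcal M}(a)$ is conservative, i.e. a morphism $\phi$ in $\mathbf{Mod}_{\mathcal M}(b)$ is an isomorphism if and only if $\alpha_*(\phi)$ is an isomorphism in $\mathbf{Mod}_{\mathcal M}(a)$. (3) For any pushout square in $Comm(\mathcal C)$ consisting of morphisms $\alpha:a\to a'$, $\beta:a\to b$, $\alpha':b\to b'$, $\beta':a'\to b'$ (with $\alpha'\circ\beta=\beta'\circ\alpha$ and $b'=b\otimes_a a'$), there is a natural isomorphism $\alpha^*\circ\beta_*\xrightarrow{\ \sim\ }\beta'_*\circ\alpha'^*$ of functors $\mathbf{Mod}_{\mathcal M}(b)\to\mathbf{Mod}_{\mathcal M}(a')$.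
   Context: $(\mathcal C,\otimes,1)$ is a closed symmetric monoidal category which is complete and cocomplete. A left $\mathcal C$-actegory $(\mathcal M,\boxtimes,\lambda,l)$ is a category $\mathcal M$ with a bifunctor $\boxtimes:\mathcal C\times\mathcal M\to\mathcal M$ and natural isomorphisms $\lambda_{a,b,m}:a\boxtimes(b\boxtimes m)\to(a\otimes b)\boxtimes m$ and $l_m:1\boxtimes m\to m$ satisfying the usual pentagon and unit coherence axioms. $\mathcal M$ is a fixed left $\mathcal C$-actegory whose underlying category is complete and cocomplete and such that for all $a\in\mathcal C$, $m\in\mathcal M$ the functors $a\boxtimes -$ and $-\boxtimes m$ preserve colimits. $Comm(\mathcal C)$ is the category of commutative monoid objects in $\mathcal C$. For $a=(a,\mu_a,\iota_a)\in Comm(\mathcal C)$, $\mathbf{Mod}_{\mathcal M}(a)$ is the category of left $a$-modules in $\mathcal M$: objects are pairs $(m,\rho)$ with $\rho:a\boxtimes m\to m$ such that $\rho\circ(\mu_a\boxtimes 1_m)\circ\lambda_{a,a,m}=\rho\circ(1_a\boxtimes\rho)$ and $\rho\circ(\iota_a\boxtimes 1_m)=l_m$; morphisms are morphisms in $\mathcal M$ commuting with the actions. For $\alpha:a\to b$ in $Comm(\mathcal C)$, restriction of scalars is $\alpha_*(n,\tau)=(n,\tau\circ(\alpha\boxtimes 1_n))$. Extension of scalars $\alpha^*=b\boxtimes_a-$ is the left adjoint of $\alpha_*$; the underlying object of $\alpha^*(m,\rho)$ is the coequalizer $b\boxtimes_a m$ in $\mathcal M$ of $1_b\boxtimes\rho$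 and $((\mu_b\circ(1_b\otimes\alpha))\boxtimes1_m)\circ\lambda_{b,a,m}$, both $b\boxtimes(a\boxtimes m)\to b\boxtimes m$. *)

theory Defs
  imports Main "HOL-Library.Equipollence"
begin

section \<open>Categories, functors, natural transformations\<close>

record ('o, 'm) category =
  Obj :: "'o set"
  Arr :: "'m set"
  Dom :: "'m \<Rightarrow> 'o"
  Cod :: "'m \<Rightarrow> 'o"
  Ident :: "'o \<Rightarrow> 'm"
  Comp :: "'m \<Rightarrow> 'm \<Rightarrow> 'm"  (infixr "\<cdot>\<index>" 70)

text \<open>\<open>g \<cdot> f\<close> is \<open>g\<close> after \<open>f\<close>.  Nothing is assumed about values outside \<open>Obj\<close>, \<open>Arr\<close>,
  or about composites of non-composable arrows.\<close>

definition hom :: "('o, 'm, 'z) category_scheme \<Rightarrow> 'o \<Rightarrow> 'o \<Rightarrow> 'm set" where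
  "hom C x y = {f \<in> Arr C. Dom C f = x \<and> Cod C f = y}"

locale category =
  fixes C :: "('o, 'm, 'z) category_scheme" (structure)
  assumes dom_obj: "f \<in> Arr C \<Longrightarrow> Dom C f \<in> Obj C"
    and cod_obj: "f \<in> Arr C \<Longrightarrow> Cod C f \<in> Obj C"
    and ident_hom: "x \<in> Obj C \<Longrightarrow> Ident C x \<in> hom C x x"
    and comp_hom: "\<lbrakk>f \<in> hom C x y; g \<in> hom C y z\<rbrakk> \<Longrightarrow> g \<cdot> f \<in> hom C x z"
    and comp_ident_right: "f \<in> hom C x y \<Longrightarrow> f \<cdot> Ident C x = f"
    and comp_ident_left: "f \<in> hom C x y \<Longrightarrow> Ident C y \<cdot> f = f"
    and comp_assoc: "\<lbrakk>f \<in> hom C w x; g \<in> hom C x y; h \<in> hom C y z\<rbrakk>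
      \<Longrightarrow> (h \<cdot> g) \<cdot> f = h \<cdot> (g \<cdot> f)"

definition is_iso :: "('o, 'm, 'z) category_scheme \<Rightarrow> 'm \<Rightarrow> bool" where
  "is_iso C f \<longleftrightarrow> f \<in> Arr C \<and>
    (\<exists>g \<in> hom C (Cod C f) (Dom C f).
      g \<cdot>\<^bsub>C\<^esub> f = Ident C (Dom C f) \<and> f \<cdot>\<^bsub>C\<^esub> g = Ident C (Cod C f))"

definition prod_cat ::
  "('o1, 'm1, 'z1) category_scheme \<Rightarrow> ('o2, 'm2, 'z2) category_scheme
    \<Rightarrow> ('o1 \<times> 'o2, 'm1 \<times> 'm2) category" where
  "prod_cat C D = \<lparr>
    Obj = Obj C \<times> Obj D,
    Arr = Arr C \<times> Arr D,
    Dom = (\<lambda>(f, g). (Dom C f, Dom D g)),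
    Cod = (\<lambda>(f, g). (Cod C f, Cod D g)),
    Ident = (\<lambda>(x, y). (Ident C x, Ident D y)),
    Comp = (\<lambda>(f', g') (f, g). (f' \<cdot>\<^bsub>C\<^esub> f, g' \<cdot>\<^bsub>D\<^esub> g)) \<rparr>"

record ('o1, 'm1, 'o2, 'm2) func =
  fob :: "'o1 \<Rightarrow> 'o2"
  far :: "'m1 \<Rightarrow> 'm2"

definition is_functor ::
  "('o1, 'm1, 'z1) category_scheme \<Rightarrow> ('o2, 'm2, 'z2) category_scheme
    \<Rightarrow> ('o1, 'm1, 'o2, 'm2) func \<Rightarrow> bool" where
  "is_functor C D F \<longleftrightarrow> category C \<and> category D \<and>
    (\<forall>x \<in> Obj C. fob F x \<in> Obj D) \<and>
    (\<forall>f \<in> Arr C. far F f \<in> hom D (fob F (Dom C f)) (fob F (Cod C f))) \<and>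
    (\<forall>x \<in> Obj C. far F (Ident C x) = Ident D (fob F x)) \<and>
    (\<forall>f \<in> Arr C. \<forall>g \<in> Arr C. Cod C f = Dom C g \<longrightarrow>
      far F (g \<cdot>\<^bsub>C\<^esub> f) = far F g \<cdot>\<^bsub>D\<^esub> far F f)"

definition id_func :: "('o, 'm, 'o, 'm) func" where
  "id_func = \<lparr>fob = (\<lambda>x. x), far = (\<lambda>f. f)\<rparr>"

definition comp_func ::
  "('o2, 'm2, 'o3, 'm3) func \<Rightarrow> ('o1, 'm1, 'o2, 'm2) func \<Rightarrow> ('o1, 'm1, 'o3, 'm3) func"
  (infixr "\<circ>\<circ>" 75) where
  "G \<circ>\<circ> F = \<lparr>fob = (\<lambda>x. fob G (fob F x)), far = (\<lambda>f. far G (far F f))\<rparr>"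

definition nat_trans ::
  "('o1, 'm1, 'z1) category_scheme \<Rightarrow> ('o2, 'm2, 'z2) category_scheme
    \<Rightarrow> ('o1, 'm1, 'o2, 'm2) func \<Rightarrow> ('o1, 'm1, 'o2, 'm2) func \<Rightarrow> ('o1 \<Rightarrow> 'm2) \<Rightarrow> bool" where
  "nat_trans C D F G t \<longleftrightarrow> is_functor C D F \<and> is_functor C D G \<and>
    (\<forall>x \<in> Obj C. t x \<in> hom D (fob F x) (fob G x)) \<and>
    (\<forall>f \<in> Arr C. t (Cod C f) \<cdot>\<^bsub>D\<^esub> far F f = far G f \<cdot>\<^bsub>D\<^esub> t (Dom C f))"

definition nat_iso ::
  "('o1, 'm1, 'z1) category_scheme \<Rightarrow> ('o2, 'm2, 'z2) category_scheme
    \<Rightarrow> ('o1, 'm1, 'o2, 'm2) func \<Rightarrow> ('o1, 'm1, 'o2, 'm2) func \<Rightarrow> ('o1 \<Rightarrow> 'm2) \<Rightarrow> bool" where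
  "nat_iso C D F G t \<longleftrightarrow> nat_trans C D F G t \<and> (\<forall>x \<in> Obj C. is_iso D (t x))"

definition left_adjoint ::
  "('o1, 'm1, 'z1) category_scheme \<Rightarrow> ('o2, 'm2, 'z2) category_scheme
    \<Rightarrow> ('o1, 'm1, 'o2, 'm2) func \<Rightarrow> ('o2, 'm2, 'o1, 'm1) func \<Rightarrow> bool" where
  "left_adjoint C D F G \<longleftrightarrow> is_functor C D F \<and> is_functor D C G \<and>
    (\<exists>\<eta> \<epsilon>. nat_trans C C id_func (G \<circ>\<circ> F) \<eta> \<and> nat_trans D D (F \<circ>\<circ> G) id_func \<epsilon> \<and>
      (\<forall>x \<in> Obj C. \<epsilon> (fob F x) \<cdot>\<^bsub>D\<^esub> far F (\<eta> x) = Ident D (fob F x)) \<and>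
      (\<forall>y \<in> Obj D. far G (\<epsilon> y) \<cdot>\<^bsub>C\<^esub> \<eta> (fob G y) = Ident C (fob G y)))"

definition conservative ::
  "('o1, 'm1, 'z1) category_scheme \<Rightarrow> ('o2, 'm2, 'z2) category_scheme
    \<Rightarrow> ('o1, 'm1, 'o2, 'm2) func \<Rightarrow> bool" where
  "conservative C D F \<longleftrightarrow> is_functor C D F \<and> (\<forall>f \<in> Arr C. is_iso C f \<longleftrightarrow> is_iso D (far F f))"


section \<open>Limits and colimits\<close>

text \<open>The type \<open>'u\<close> plays the role of the universe: a diagram shape is small if its arrows form a
  set of elements of \<open>'u\<close> of cardinality strictly below that of \<open>'u\<close> (its objects are then
  small too, as they embed into the arrows).  If \<open>'u\<close> has the cardinality of a Grothendieck
  universe, this is smallness with respect to that universe.\<close>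

definition small_cat :: "('u, 'u) category \<Rightarrow> bool" where
  "small_cat J \<longleftrightarrow> category J \<and> Arr J \<prec> (UNIV :: 'u set)"

definition is_cone ::
  "('j, 'k, 'y) category_scheme \<Rightarrow> ('o, 'm, 'z) category_scheme
    \<Rightarrow> ('j, 'k, 'o, 'm) func \<Rightarrow> 'o \<Rightarrow> ('j \<Rightarrow> 'm) \<Rightarrow> bool" where
  "is_cone J C D x p \<longleftrightarrow> x \<in> Obj C \<and>
    (\<forall>j \<in> Obj J. p j \<in> hom C x (fob D j)) \<and>
    (\<forall>f \<in> Arr J. far D f \<cdot>\<^bsub>C\<^esub> p (Dom J f) = p (Cod J f))"

definition is_limit ::
  "('j, 'k, 'y) category_scheme \<Rightarrow> ('o, 'm, 'z) category_scheme
    \<Rightarrow> ('j, 'k, 'o, 'm) func \<Rightarrow> 'o \<Rightarrow> ('j \<Rightarrow> 'm) \<Rightarrow> bool" where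
  "is_limit J C D x p \<longleftrightarrow> is_cone J C D x p \<and>
    (\<forall>y q. is_cone J C D y q \<longrightarrow> (\<exists>!h. h \<in> hom C y x \<and> (\<forall>j \<in> Obj J. p j \<cdot>\<^bsub>C\<^esub> h = q j)))"

definition is_cocone ::
  "('j, 'k, 'y) category_scheme \<Rightarrow> ('o, 'm, 'z) category_scheme
    \<Rightarrow> ('j, 'k, 'o, 'm) func \<Rightarrow> 'o \<Rightarrow> ('j \<Rightarrow> 'm) \<Rightarrow> bool" where
  "is_cocone J C D x i \<longleftrightarrow> x \<in> Obj C \<and>
    (\<forall>j \<in> Obj J. i j \<in> hom C (fob D j) x) \<and>
    (\<forall>f \<in> Arr J. i (Cod J f) \<cdot>\<^bsub>C\<^esub> far D f = i (Dom J f))"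

definition is_colimit ::
  "('j, 'k, 'y) category_scheme \<Rightarrow> ('o, 'm, 'z) category_scheme
    \<Rightarrow> ('j, 'k, 'o, 'm) func \<Rightarrow> 'o \<Rightarrow> ('j \<Rightarrow> 'm) \<Rightarrow> bool" where
  "is_colimit J C D x i \<longleftrightarrow> is_cocone J C D x i \<and>
    (\<forall>y q. is_cocone J C D y q \<longrightarrow> (\<exists>!h. h \<in> hom C x y \<and> (\<forall>j \<in> Obj J. h \<cdot>\<^bsub>C\<^esub> i j = q j)))"

definition complete :: "'u itself \<Rightarrow> ('o, 'm, 'z) category_scheme \<Rightarrow> bool" where
  "complete U C \<longleftrightarrow> category C \<and>
    (\<forall>(J :: ('u, 'u) category) D. small_cat J \<and> is_functor J C D \<longrightarrow> (\<exists>x p. is_limit J C D x p))"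

definition cocomplete :: "'u itself \<Rightarrow> ('o, 'm, 'z) category_scheme \<Rightarrow> bool" where
  "cocomplete U C \<longleftrightarrow> category C \<and>
    (\<forall>(J :: ('u, 'u) category) D. small_cat J \<and> is_functor J C D \<longrightarrow> (\<exists>x i. is_colimit J C D x i))"

definition preserves_colimits ::
  "'u itself \<Rightarrow> ('o1, 'm1, 'z1) category_scheme \<Rightarrow> ('o2, 'm2, 'z2) category_scheme
    \<Rightarrow> ('o1, 'm1, 'o2, 'm2) func \<Rightarrow> bool" where
  "preserves_colimits U C C' F \<longleftrightarrow> is_functor C C' F \<and>
    (\<forall>(J :: ('u, 'u) category) D x i. small_cat J \<and> is_functor J C D \<and> is_colimit J C D x i \<longrightarrow>
      is_colimit J C' (F \<circ>\<circ> D) (fob F x) (\<lambda>j. far F (i j)))"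

definition is_coequalizer ::
  "('o, 'm, 'z) category_scheme \<Rightarrow> 'm \<Rightarrow> 'm \<Rightarrow> 'o \<Rightarrow> 'm \<Rightarrow> bool" where
  "is_coequalizer C f g z q \<longleftrightarrow>
    (\<exists>x y. f \<in> hom C x y \<and> g \<in> hom C x y \<and> q \<in> hom C y z \<and> q \<cdot>\<^bsub>C\<^esub> f = q \<cdot>\<^bsub>C\<^esub> g \<and>
      (\<forall>w. \<forall>k \<in> hom C y w. k \<cdot>\<^bsub>C\<^esub> f = k \<cdot>\<^bsub>C\<^esub> g \<longrightarrow> (\<exists>!h. h \<in> hom C z w \<and> h \<cdot>\<^bsub>C\<^esub> q = k)))"

text \<open>\<open>is_pushout K \<alpha> \<beta> \<alpha>' \<beta>'\<close>: the square \<open>\<alpha>' \<cdot> \<beta> = \<beta>' \<cdot> \<alpha>\<close> is a pushout of the span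
  \<open>\<alpha> : a \<rightarrow> a'\<close>, \<open>\<beta> : a \<rightarrow> b\<close>.\<close>

definition is_pushout ::
  "('o, 'm, 'z) category_scheme \<Rightarrow> 'm \<Rightarrow> 'm \<Rightarrow> 'm \<Rightarrow> 'm \<Rightarrow> bool" where
  "is_pushout K \<alpha> \<beta> \<alpha>' \<beta>' \<longleftrightarrow>
    (\<exists>a a' b b'. \<alpha> \<in> hom K a a' \<and> \<beta> \<in> hom K a b \<and> \<alpha>' \<in> hom K b b' \<and> \<beta>' \<in> hom K a' b' \<and>
      \<alpha>' \<cdot>\<^bsub>K\<^esub> \<beta> = \<beta>' \<cdot>\<^bsub>K\<^esub> \<alpha> \<and>
      (\<forall>c. \<forall>u \<in> hom K b c. \<forall>v \<in> hom K a' c. u \<cdot>\<^bsub>K\<^esub> \<beta> = v \<cdot>\<^bsub>K\<^esub> \<alpha> \<longrightarrow>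
        (\<exists>!h. h \<in> hom K b' c \<and> h \<cdot>\<^bsub>K\<^esub> \<alpha>' = u \<and> h \<cdot>\<^bsub>K\<^esub> \<beta>' = v)))"


section \<open>Pseudo-functors from a category to the 2-category of categories\<close>

text \<open>The domain is an ordinary category, regarded as a locally discrete 2-category.  The data are
  the categories \<open>P\<^sub>0 a\<close>, the functors \<open>P\<^sub>1 \<alpha>\<close>, and the components
  \<open>\<gamma> \<beta> \<alpha> x : P\<^sub>1 \<beta> (P\<^sub>1 \<alpha> x) \<rightarrow> P\<^sub>1 (\<beta> \<cdot> \<alpha>) x\<close> and \<open>\<delta> a x : x \<rightarrow> P\<^sub>1 (Ident a) x\<close>
  of the coherence isomorphisms.\<close>

definition pseudofunctor_to_Cat ::
  "('k, 'l, 'z) category_scheme \<Rightarrow> ('k \<Rightarrow> ('o, 'm) category) \<Rightarrow> ('l \<Rightarrow> ('o, 'm, 'o, 'm) func)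
    \<Rightarrow> ('l \<Rightarrow> 'l \<Rightarrow> 'o \<Rightarrow> 'm) \<Rightarrow> ('k \<Rightarrow> 'o \<Rightarrow> 'm) \<Rightarrow> bool" where
  "pseudofunctor_to_Cat K P\<^sub>0 P\<^sub>1 \<gamma> \<delta> \<longleftrightarrow>
    category K \<and>
    (\<forall>a \<in> Obj K. category (P\<^sub>0 a)) \<and>
    (\<forall>\<alpha> \<in> Arr K. is_functor (P\<^sub>0 (Dom K \<alpha>)) (P\<^sub>0 (Cod K \<alpha>)) (P\<^sub>1 \<alpha>)) \<and>
    (\<forall>\<alpha> \<in> Arr K. \<forall>\<beta> \<in> Arr K. Cod K \<alpha> = Dom K \<beta> \<longrightarrow>
      nat_iso (P\<^sub>0 (Dom K \<alpha>)) (P\<^sub>0 (Cod K \<beta>)) (P\<^sub>1 \<beta> \<circ>\<circ> P\<^sub>1 \<alpha>) (P\<^sub>1 (\<beta> \<cdot>\<^bsub>K\<^esub> \<alpha>)) (\<gamma> \<beta> \<alpha>)) \<and>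
    (\<forall>a \<in> Obj K. nat_iso (P\<^sub>0 a) (P\<^sub>0 a) id_func (P\<^sub>1 (Ident K a)) (\<delta> a)) \<and>
    (\<forall>a b c d. \<forall>\<alpha> \<in> hom K a b. \<forall>\<beta> \<in> hom K b c. \<forall>\<theta> \<in> hom K c d. \<forall>x \<in> Obj (P\<^sub>0 a).
      \<gamma> \<theta> (\<beta> \<cdot>\<^bsub>K\<^esub> \<alpha>) x \<cdot>\<^bsub>P\<^sub>0 d\<^esub> far (P\<^sub>1 \<theta>) (\<gamma> \<beta> \<alpha> x) =
      \<gamma> (\<theta> \<cdot>\<^bsub>K\<^esub> \<beta>) \<alpha> x \<cdot>\<^bsub>P\<^sub>0 d\<^esub> \<gamma> \<theta> \<beta> (fob (P\<^sub>1 \<alpha>) x)) \<and>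
    (\<forall>a b. \<forall>\<alpha> \<in> hom K a b. \<forall>x \<in> Obj (P\<^sub>0 a).
      \<gamma> \<alpha> (Ident K a) x \<cdot>\<^bsub>P\<^sub>0 b\<^esub> far (P\<^sub>1 \<alpha>) (\<delta> a x) = Ident (P\<^sub>0 b) (fob (P\<^sub>1 \<alpha>) x) \<and>
      \<gamma> (Ident K b) \<alpha> x \<cdot>\<^bsub>P\<^sub>0 b\<^esub> \<delta> b (fob (P\<^sub>1 \<alpha>) x) = Ident (P\<^sub>0 b) (fob (P\<^sub>1 \<alpha>) x))"


section \<open>Closed symmetric monoidal categories and actegories\<close>

text \<open>The associator is oriented as
  \<open>assoc a b c : a \<otimes> (b \<otimes> c) \<rightarrow> (a \<otimes> b) \<otimes> c\<close>, in accordance with the actegory structure \<open>\<lambda>\<close>.\<close>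

record ('o, 'm) smc = "('o, 'm) category" +
  tensor :: "('o \<times> 'o, 'm \<times> 'm, 'o, 'm) func"
  unit_obj :: 'o  ("\<one>\<index>")
  assoc :: "'o \<Rightarrow> 'o \<Rightarrow> 'o \<Rightarrow> 'm"
  lunit :: "'o \<Rightarrow> 'm"
  runit :: "'o \<Rightarrow> 'm"
  symm :: "'o \<Rightarrow> 'o \<Rightarrow> 'm"

abbreviation tensor_obj :: "('o, 'm, 'z) smc_scheme \<Rightarrow> 'o \<Rightarrow> 'o \<Rightarrow> 'o"  (infixl "\<otimes>\<index>" 75) where
  "a \<otimes>\<^bsub>C\<^esub> b \<equiv> fob (tensor C) (a, b)"

abbreviation tensor_arr :: "('o, 'm, 'z) smc_scheme \<Rightarrow> 'm \<Rightarrow> 'm \<Rightarrow> 'm"  (infixl "\<otimes>\<^sub>a\<index>" 75) where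
  "f \<otimes>\<^sub>a\<^bsub>C\<^esub> g \<equiv> far (tensor C) (f, g)"

locale symmetric_monoidal_category = category C
  for C :: "('o, 'm, 'z) smc_scheme" (structure) +
  assumes tensor_functor: "is_functor (prod_cat C C) C (tensor C)"
    and unit_obj: "\<one> \<in> Obj C"
    and assoc_hom: "\<lbrakk>a \<in> Obj C; b \<in> Obj C; c \<in> Obj C\<rbrakk>
      \<Longrightarrow> assoc C a b c \<in> hom C (a \<otimes> (b \<otimes> c)) ((a \<otimes> b) \<otimes> c)"
    and assoc_iso: "\<lbrakk>a \<in> Obj C; b \<in> Obj C; c \<in> Obj C\<rbrakk> \<Longrightarrow> is_iso C (assoc C a b c)"
    and assoc_natural: "\<lbrakk>f \<in> hom C a a'; g \<in> hom C b b'; h \<in> hom C c c'\<rbrakk>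
      \<Longrightarrow> assoc C a' b' c' \<cdot> (f \<otimes>\<^sub>a (g \<otimes>\<^sub>a h)) = ((f \<otimes>\<^sub>a g) \<otimes>\<^sub>a h) \<cdot> assoc C a b c"
    and lunit_hom: "a \<in> Obj C \<Longrightarrow> lunit C a \<in> hom C (\<one> \<otimes> a) a"
    and lunit_iso: "a \<in> Obj C \<Longrightarrow> is_iso C (lunit C a)"
    and lunit_natural: "f \<in> hom C a a' \<Longrightarrow> lunit C a' \<cdot> (Ident C \<one> \<otimes>\<^sub>a f) = f \<cdot> lunit C a"
    and runit_hom: "a \<in> Obj C \<Longrightarrow> runit C a \<in> hom C (a \<otimes> \<one>) a"
    and runit_iso: "a \<in> Obj C \<Longrightarrow> is_iso C (runit C a)"
    and runit_natural: "f \<in> hom C a a' \<Longrightarrow> runit C a' \<cdot> (f \<otimes>\<^sub>a Ident C \<one>) = f \<cdot> runit C a"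
    and symm_hom: "\<lbrakk>a \<in> Obj C; b \<in> Obj C\<rbrakk> \<Longrightarrow> symm C a b \<in> hom C (a \<otimes> b) (b \<otimes> a)"
    and symm_natural: "\<lbrakk>f \<in> hom C a a'; g \<in> hom C b b'\<rbrakk>
      \<Longrightarrow> symm C a' b' \<cdot> (f \<otimes>\<^sub>a g) = (g \<otimes>\<^sub>a f) \<cdot> symm C a b"
    and symm_symm: "\<lbrakk>a \<in> Obj C; b \<in> Obj C\<rbrakk> \<Longrightarrow> symm C b a \<cdot> symm C a b = Ident C (a \<otimes> b)"
    and pentagon: "\<lbrakk>a \<in> Obj C; b \<in> Obj C; c \<in> Obj C; d \<in> Obj C\<rbrakk>
      \<Longrightarrow> assoc C (a \<otimes> b) c d \<cdot> assoc C a b (c \<otimes> d) =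
        (assoc C a b c \<otimes>\<^sub>a Ident C d) \<cdot> assoc C a (b \<otimes> c) d \<cdot> (Ident C a \<otimes>\<^sub>a assoc C b c d)"
    and triangle: "\<lbrakk>a \<in> Obj C; b \<in> Obj C\<rbrakk>
      \<Longrightarrow> (runit C a \<otimes>\<^sub>a Ident C b) \<cdot> assoc C a \<one> b = Ident C a \<otimes>\<^sub>a lunit C b"
    and hexagon: "\<lbrakk>a \<in> Obj C; b \<in> Obj C; c \<in> Obj C\<rbrakk>
      \<Longrightarrow> assoc C c a b \<cdot> symm C (a \<otimes> b) c \<cdot> assoc C a b c =
        (symm C a c \<otimes>\<^sub>a Ident C b) \<cdot> assoc C a c b \<cdot> (Ident C a \<otimes>\<^sub>a symm C b c)"

locale closed_symmetric_monoidal_category = symmetric_monoidal_category C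
  for C :: "('o, 'm, 'z) smc_scheme" (structure) +
  assumes internal_hom: "b \<in> Obj C \<Longrightarrow>
    \<exists>H. left_adjoint C C \<lparr>fob = (\<lambda>a. a \<otimes> b), far = (\<lambda>f. f \<otimes>\<^sub>a Ident C b)\<rparr> H"

text \<open>The fields \<open>act_assoc\<close> and \<open>act_unit\<close> are the isomorphisms \<open>\<lambda>\<close> and \<open>l\<close>.\<close>

record ('co, 'cm, 'o, 'm) actegory = "('o, 'm) category" +
  act :: "('co \<times> 'o, 'cm \<times> 'm, 'o, 'm) func"
  act_assoc :: "'co \<Rightarrow> 'co \<Rightarrow> 'o \<Rightarrow> 'm"
  act_unit :: "'o \<Rightarrow> 'm"

abbreviation act_obj :: "('co, 'cm, 'o, 'm, 'z) actegory_scheme \<Rightarrow> 'co \<Rightarrow> 'o \<Rightarrow> 'o"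
  (infixr "\<boxtimes>\<index>" 73) where
  "a \<boxtimes>\<^bsub>M\<^esub> m \<equiv> fob (act M) (a, m)"

abbreviation act_arr :: "('co, 'cm, 'o, 'm, 'z) actegory_scheme \<Rightarrow> 'cm \<Rightarrow> 'm \<Rightarrow> 'm"
  (infixr "\<boxtimes>\<^sub>a\<index>" 73) where
  "f \<boxtimes>\<^sub>a\<^bsub>M\<^esub> g \<equiv> far (act M) (f, g)"

locale left_actegory = C: symmetric_monoidal_category C + M: category M
  for C :: "('co, 'cm, 'y) smc_scheme" (structure)
    and M :: "('co, 'cm, 'o, 'm, 'z) actegory_scheme" +
  assumes act_functor: "is_functor (prod_cat C M) M (act M)"
    and act_assoc_hom: "\<lbrakk>a \<in> Obj C; b \<in> Obj C; m \<in> Obj M\<rbrakk>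
      \<Longrightarrow> act_assoc M a b m \<in> hom M (a \<boxtimes>\<^bsub>M\<^esub> (b \<boxtimes>\<^bsub>M\<^esub> m)) ((a \<otimes> b) \<boxtimes>\<^bsub>M\<^esub> m)"
    and act_assoc_iso: "\<lbrakk>a \<in> Obj C; b \<in> Obj C; m \<in> Obj M\<rbrakk> \<Longrightarrow> is_iso M (act_assoc M a b m)"
    and act_assoc_natural: "\<lbrakk>f \<in> hom C a a'; g \<in> hom C b b'; h \<in> hom M m m'\<rbrakk>
      \<Longrightarrow> act_assoc M a' b' m' \<cdot>\<^bsub>M\<^esub> (f \<boxtimes>\<^sub>a\<^bsub>M\<^esub> (g \<boxtimes>\<^sub>a\<^bsub>M\<^esub> h)) =
        ((f \<otimes>\<^sub>a g) \<boxtimes>\<^sub>a\<^bsub>M\<^esub> h) \<cdot>\<^bsub>M\<^esub> act_assoc M a b m"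
    and act_unit_hom: "m \<in> Obj M \<Longrightarrow> act_unit M m \<in> hom M (\<one> \<boxtimes>\<^bsub>M\<^esub> m) m"
    and act_unit_iso: "m \<in> Obj M \<Longrightarrow> is_iso M (act_unit M m)"
    and act_unit_natural: "h \<in> hom M m m'
      \<Longrightarrow> act_unit M m' \<cdot>\<^bsub>M\<^esub> (Ident C \<one> \<boxtimes>\<^sub>a\<^bsub>M\<^esub> h) = h \<cdot>\<^bsub>M\<^esub> act_unit M m"
    and act_pentagon: "\<lbrakk>a \<in> Obj C; b \<in> Obj C; c \<in> Obj C; m \<in> Obj M\<rbrakk>
      \<Longrightarrow> act_assoc M (a \<otimes> b) c m \<cdot>\<^bsub>M\<^esub> act_assoc M a b (c \<boxtimes>\<^bsub>M\<^esub> m) =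
        (assoc C a b c \<boxtimes>\<^sub>a\<^bsub>M\<^esub> Ident M m) \<cdot>\<^bsub>M\<^esub> act_assoc M a (b \<otimes> c) m \<cdot>\<^bsub>M\<^esub>
          (Ident C a \<boxtimes>\<^sub>a\<^bsub>M\<^esub> act_assoc M b c m)"
    and act_runit: "\<lbrakk>a \<in> Obj C; m \<in> Obj M\<rbrakk>
      \<Longrightarrow> (runit C a \<boxtimes>\<^sub>a\<^bsub>M\<^esub> Ident M m) \<cdot>\<^bsub>M\<^esub> act_assoc M a \<one> m = Ident C a \<boxtimes>\<^sub>a\<^bsub>M\<^esub> act_unit M m"
    and act_lunit: "\<lbrakk>a \<in> Obj C; m \<in> Obj M\<rbrakk>
      \<Longrightarrow> (lunit C a \<boxtimes>\<^sub>a\<^bsub>M\<^esub> Ident M m) \<cdot>\<^bsub>M\<^esub> act_assoc M \<one> a m = act_unit M (a \<boxtimes>\<^bsub>M\<^esub> m)"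

definition act_on_left ::
  "('co, 'cm, 'y) smc_scheme \<Rightarrow> ('co, 'cm, 'o, 'm, 'z) actegory_scheme \<Rightarrow> 'co
    \<Rightarrow> ('o, 'm, 'o, 'm) func" where
  "act_on_left C M a = \<lparr>fob = (\<lambda>m. a \<boxtimes>\<^bsub>M\<^esub> m), far = (\<lambda>h. Ident C a \<boxtimes>\<^sub>a\<^bsub>M\<^esub> h)\<rparr>"

definition act_on_right ::
  "('co, 'cm, 'o, 'm, 'z) actegory_scheme \<Rightarrow> 'o \<Rightarrow> ('co, 'cm, 'o, 'm) func" where
  "act_on_right M m = \<lparr>fob = (\<lambda>a. a \<boxtimes>\<^bsub>M\<^esub> m), far = (\<lambda>f. f \<boxtimes>\<^sub>a\<^bsub>M\<^esub> Ident M m)\<rparr>"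


section \<open>Commutative monoids and modules\<close>

text \<open>Arrows of structured objects: an arrow of the base category together with the structured
  objects it goes between, so that domain and codomain are determined by the arrow.\<close>

datatype ('x, 'm) sarr = SArr (sdom: 'x) (und: 'm) (scod: 'x)

datatype ('o, 'm) mon = Mon (carr: 'o) (mult: 'm) (unt: 'm)

definition is_comm_monoid :: "('o, 'm, 'z) smc_scheme \<Rightarrow> ('o, 'm) mon \<Rightarrow> bool" where
  "is_comm_monoid C A \<longleftrightarrow> (case A of Mon a \<mu> \<iota> \<Rightarrow>
    a \<in> Obj C \<and> \<mu> \<in> hom C (a \<otimes>\<^bsub>C\<^esub> a) a \<and> \<iota> \<in> hom C \<one>\<^bsub>C\<^esub> a \<and>
    \<mu> \<cdot>\<^bsub>C\<^esub> (\<mu> \<otimes>\<^sub>a\<^bsub>C\<^esub> Ident C a) \<cdot>\<^bsub>C\<^esub> assoc C a a a = \<mu> \<cdot>\<^bsub>C\<^esub> (Ident C a \<otimes>\<^sub>a\<^bsub>C\<^esub> \<mu>) \<and>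
    \<mu> \<cdot>\<^bsub>C\<^esub> (\<iota> \<otimes>\<^sub>a\<^bsub>C\<^esub> Ident C a) = lunit C a \<and>
    \<mu> \<cdot>\<^bsub>C\<^esub> (Ident C a \<otimes>\<^sub>a\<^bsub>C\<^esub> \<iota>) = runit C a \<and>
    \<mu> \<cdot>\<^bsub>C\<^esub> symm C a a = \<mu>)"

definition is_monoid_hom ::
  "('o, 'm, 'z) smc_scheme \<Rightarrow> ('o, 'm) mon \<Rightarrow> 'm \<Rightarrow> ('o, 'm) mon \<Rightarrow> bool" where
  "is_monoid_hom C A f B \<longleftrightarrow> f \<in> hom C (carr A) (carr B) \<and>
    f \<cdot>\<^bsub>C\<^esub> mult A = mult B \<cdot>\<^bsub>C\<^esub> (f \<otimes>\<^sub>a\<^bsub>C\<^esub> f) \<and> f \<cdot>\<^bsub>C\<^esub> unt A = unt B"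

definition Comm ::
  "('o, 'm, 'z) smc_scheme \<Rightarrow> (('o, 'm) mon, (('o, 'm) mon, 'm) sarr) category" where
  "Comm C = \<lparr>
    Obj = {A. is_comm_monoid C A},
    Arr = {SArr A f B | A f B. is_comm_monoid C A \<and> is_comm_monoid C B \<and> is_monoid_hom C A f B},
    Dom = sdom,
    Cod = scod,
    Ident = (\<lambda>A. SArr A (Ident C (carr A)) A),
    Comp = (\<lambda>g f. SArr (sdom f) (und g \<cdot>\<^bsub>C\<^esub> und f) (scod g)) \<rparr>"

datatype ('o, 'm) lmod = LMod (mcarr: 'o) (maction: 'm)

definition is_module ::
  "('co, 'cm, 'y) smc_scheme \<Rightarrow> ('co, 'cm, 'o, 'm, 'z) actegory_scheme \<Rightarrow> ('co, 'cm) mon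
    \<Rightarrow> ('o, 'm) lmod \<Rightarrow> bool" where
  "is_module C M A X \<longleftrightarrow> (case A of Mon a \<mu> \<iota> \<Rightarrow> case X of LMod m \<rho> \<Rightarrow>
    m \<in> Obj M \<and> \<rho> \<in> hom M (a \<boxtimes>\<^bsub>M\<^esub> m) m \<and>
    \<rho> \<cdot>\<^bsub>M\<^esub> (\<mu> \<boxtimes>\<^sub>a\<^bsub>M\<^esub> Ident M m) \<cdot>\<^bsub>M\<^esub> act_assoc M a a m = \<rho> \<cdot>\<^bsub>M\<^esub> (Ident C a \<boxtimes>\<^sub>a\<^bsub>M\<^esub> \<rho>) \<and>
    \<rho> \<cdot>\<^bsub>M\<^esub> (\<iota> \<boxtimes>\<^sub>a\<^bsub>M\<^esub> Ident M m) = act_unit M m)"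

definition is_module_hom ::
  "('co, 'cm, 'y) smc_scheme \<Rightarrow> ('co, 'cm, 'o, 'm, 'z) actegory_scheme \<Rightarrow> ('co, 'cm) mon
    \<Rightarrow> ('o, 'm) lmod \<Rightarrow> 'm \<Rightarrow> ('o, 'm) lmod \<Rightarrow> bool" where
  "is_module_hom C M A X f Y \<longleftrightarrow> f \<in> hom M (mcarr X) (mcarr Y) \<and>
    f \<cdot>\<^bsub>M\<^esub> maction X = maction Y \<cdot>\<^bsub>M\<^esub> (Ident C (carr A) \<boxtimes>\<^sub>a\<^bsub>M\<^esub> f)"

definition Mod ::
  "('co, 'cm, 'y) smc_scheme \<Rightarrow> ('co, 'cm, 'o, 'm, 'z) actegory_scheme \<Rightarrow> ('co, 'cm) mon
    \<Rightarrow> (('o, 'm) lmod, (('o, 'm) lmod, 'm) sarr) category" where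
  "Mod C M A = \<lparr>
    Obj = {X. is_module C M A X},
    Arr = {SArr X f Y | X f Y. is_module C M A X \<and> is_module C M A Y \<and> is_module_hom C M A X f Y},
    Dom = sdom,
    Cod = scod,
    Ident = (\<lambda>X. SArr X (Ident M (mcarr X)) X),
    Comp = (\<lambda>g f. SArr (sdom f) (und g \<cdot>\<^bsub>M\<^esub> und f) (scod g)) \<rparr>"

definition restrict_obj ::
  "('co, 'cm, 'o, 'm, 'z) actegory_scheme \<Rightarrow> (('co, 'cm) mon, 'cm) sarr
    \<Rightarrow> ('o, 'm) lmod \<Rightarrow> ('o, 'm) lmod" where
  "restrict_obj M \<alpha> X =
    LMod (mcarr X) (maction X \<cdot>\<^bsub>M\<^esub> (und \<alpha> \<boxtimes>\<^sub>a\<^bsub>M\<^esub> Ident M (mcarr X)))"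

definition restriction ::
  "('co, 'cm, 'o, 'm, 'z) actegory_scheme \<Rightarrow> (('co, 'cm) mon, 'cm) sarr
    \<Rightarrow> (('o, 'm) lmod, (('o, 'm) lmod, 'm) sarr, ('o, 'm) lmod, (('o, 'm) lmod, 'm) sarr) func"
  where
  "restriction M \<alpha> = \<lparr>
    fob = restrict_obj M \<alpha>,
    far = (\<lambda>\<phi>. SArr (restrict_obj M \<alpha> (sdom \<phi>)) (und \<phi>) (restrict_obj M \<alpha> (scod \<phi>))) \<rparr>"

text \<open>A functor \<open>E\<close> is an extension of scalars along \<open>\<alpha> : a \<rightarrow> b\<close> if it is left adjoint to the
  restriction along \<open>\<alpha>\<close> and the underlying object of \<open>E (m, \<rho>)\<close> is a coequalizer of
  \<open>1 \<boxtimes> \<rho>\<close> and \<open>((\<mu> \<cdot> (1 \<otimes> \<alpha>)) \<boxtimes> 1) \<cdot> \<lambda>\<close> (with \<open>\<mu>\<close> the multiplication of \<open>b\<close>), both from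
  \<open>b \<boxtimes> (a \<boxtimes> m)\<close> to \<open>b \<boxtimes> m\<close>.\<close>

definition is_extension ::
  "('co, 'cm, 'y) smc_scheme \<Rightarrow> ('co, 'cm, 'o, 'm, 'z) actegory_scheme
    \<Rightarrow> (('co, 'cm) mon, 'cm) sarr
    \<Rightarrow> (('o, 'm) lmod, (('o, 'm) lmod, 'm) sarr, ('o, 'm) lmod, (('o, 'm) lmod, 'm) sarr) func
    \<Rightarrow> bool" where
  "is_extension C M \<alpha> E \<longleftrightarrow> (let A = sdom \<alpha>; B = scod \<alpha>; a = carr A; b = carr B in
    left_adjoint (Mod C M A) (Mod C M B) E (restriction M \<alpha>) \<and>
    (\<forall>m \<rho>. LMod m \<rho> \<in> Obj (Mod C M A) \<longrightarrow>
      (\<exists>q. is_coequalizer M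
        (Ident C b \<boxtimes>\<^sub>a\<^bsub>M\<^esub> \<rho>)
        (((mult B \<cdot>\<^bsub>C\<^esub> (Ident C b \<otimes>\<^sub>a\<^bsub>C\<^esub> und \<alpha>)) \<boxtimes>\<^sub>a\<^bsub>M\<^esub> Ident M m) \<cdot>\<^bsub>M\<^esub> act_assoc M b a m)
        (mcarr (fob E (LMod m \<rho>))) q)))"

text \<open>Extensions of scalars are determined only up to canonical isomorphism; we fix one for each
  \<open>\<alpha>\<close>.  No property of the chosen functor is available unless an extension is shown to exist.\<close>

definition extension ::
  "('co, 'cm, 'y) smc_scheme \<Rightarrow> ('co, 'cm, 'o, 'm, 'z) actegory_scheme
    \<Rightarrow> (('co, 'cm) mon, 'cm) sarr
    \<Rightarrow> (('o, 'm) lmod, (('o, 'm) lmod, 'm) sarr, ('o, 'm) lmod, (('o, 'm) lmod, 'm) sarr) func"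
  where
  "extension C M \<alpha> = (SOME E. is_extension C M \<alpha> E)"

end

theory Submission
  imports Defs
begin

text \<open>
Restriction of scalars is strictly functorial: \<open>(\<beta> \<cdot> \<alpha>)\<^sub>* = \<alpha>\<^sub>* \<circ> \<beta>\<^sub>*\<close>.  Adjunctions enter only through
universal arrows (\<open>universal\<close>): a left adjoint of \<open>G\<close> is the same as a universal arrow from every object
to \<open>G\<close>, and two universal arrows from one object to \<open>G\<close> differ by a unique compatible isomorphism.

Part (1).  The left adjoints of a strictly functorial family of functors form a pseudo-functor, since
all structure isomorphisms are comparisons between universal arrows and all coherence laws are equations
between arrows out of a universal arrow (\<open>pseudofunctor_of_left_adjoints\<close>).  It remains to construct the
left adjoints.  A monoid \<open>a\<close> acts on \<open>M\<close> through the monad \<open>a \<boxtimes> _\<close>, whose algebras are the \<open>a\<close>-modules.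
For \<open>\<alpha> : a \<rightarrow> b\<close> the functor \<open>b \<boxtimes> _\<close> preserves the coequalizer \<open>b \<boxtimes>\<^sub>a m\<close>, which therefore inherits an
action of \<open>b\<close> and receives a universal arrow from \<open>m\<close> (\<open>extension_module\<close>).

Part (2).  The inverse of an invertible module homomorphism is again a homomorphism, so the forgetful
functors to \<open>M\<close> reflect isomorphisms, and restriction does not change the underlying arrow.

Part (3).  The unit \<open>n \<rightarrow> b' \<boxtimes>\<^sub>b n\<close> is universal from \<open>n\<close> to the restriction along \<open>\<alpha>'\<close>.  If it remains
universal, as an \<open>a\<close>-homomorphism, to the restriction along \<open>\<alpha>\<close>, then comparison with the unit of
\<open>a' \<boxtimes>\<^sub>a n\<close> gives the isomorphism \<open>a' \<boxtimes>\<^sub>a n \<rightarrow> b' \<boxtimes>\<^sub>b n\<close>.  It does remain universal as soon as \<open>b'\<close> is,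
as an object of \<open>C\<close>, the coequalizer \<open>a' \<otimes>\<^sub>a b\<close>: then \<open>b' \<boxtimes> n\<close> is a quotient of \<open>a' \<boxtimes> (b \<boxtimes> n)\<close>, and an
\<open>a\<close>-homomorphism \<open>f\<close> from \<open>n\<close> to an \<open>a'\<close>-module extends by \<open>(x, y, t) \<mapsto> x f (y t)\<close>
(\<open>base_change_universal\<close>).

Pushouts of commutative monoids are computed by this coequalizer \<open>q : a' \<otimes> b \<rightarrow> P\<close>, because \<open>P\<close> is itself a
commutative monoid.  The monoids \<open>a'\<close> and \<open>b\<close> act on \<open>P\<close>, the two actions commute, and letting the class of
\<open>x \<otimes> y\<close> act by \<open>y\<close> followed by \<open>x\<close> defines a multiplication \<open>P \<otimes> P \<rightarrow> P\<close>.  Its laws follow from the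
compatibility of the two actions with right multiplication, and commutativity from the centrality of the
images of \<open>a'\<close> and \<open>b\<close>.  Given a pushout \<open>b'\<close>, the universal property yields \<open>b' \<rightarrow> P\<close>, the coequalizer
yields \<open>P \<rightarrow> b'\<close>, and these are mutually inverse (\<open>pushout_coequalizer\<close>).
\<close>

section \<open>Categories\<close>

lemma homD: "f \<in> hom C x y \<Longrightarrow> f \<in> Arr C \<and> Dom C f = x \<and> Cod C f = y"
  by (simp add: hom_def)

lemma homI: "f \<in> Arr C \<Longrightarrow> Dom C f = x \<Longrightarrow> Cod C f = y \<Longrightarrow> f \<in> hom C x y"
  by (simp add: hom_def)

definition iso_inv :: "('o, 'm, 'z) category_scheme \<Rightarrow> 'm \<Rightarrow> 'm" where
  "iso_inv C f = (SOME g. g \<in> hom C (Cod C f) (Dom C f) \<and>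
      g \<cdot>\<^bsub>C\<^esub> f = Ident C (Dom C f) \<and> f \<cdot>\<^bsub>C\<^esub> g = Ident C (Cod C f))"

lemma iso_inv:
  assumes "is_iso C f"
  shows "iso_inv C f \<in> hom C (Cod C f) (Dom C f)"
    and "iso_inv C f \<cdot>\<^bsub>C\<^esub> f = Ident C (Dom C f)"
    and "f \<cdot>\<^bsub>C\<^esub> iso_inv C f = Ident C (Cod C f)"
proof -
  have "\<exists>g. g \<in> hom C (Cod C f) (Dom C f) \<and>
      g \<cdot>\<^bsub>C\<^esub> f = Ident C (Dom C f) \<and> f \<cdot>\<^bsub>C\<^esub> g = Ident C (Cod C f)"
    using assms unfolding is_iso_def by blast
  from someI_ex[OF this, folded iso_inv_def]
  show "iso_inv C f \<in> hom C (Cod C f) (Dom C f)"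
    and "iso_inv C f \<cdot>\<^bsub>C\<^esub> f = Ident C (Dom C f)"
    and "f \<cdot>\<^bsub>C\<^esub> iso_inv C f = Ident C (Cod C f)"
    by blast+
qed

lemma is_iso_arr: "is_iso C f \<Longrightarrow> f \<in> Arr C"
  by (simp add: is_iso_def)

lemma is_isoI:
  assumes "f \<in> hom C x y" "g \<in> hom C y x" "g \<cdot>\<^bsub>C\<^esub> f = Ident C x" "f \<cdot>\<^bsub>C\<^esub> g = Ident C y"
  shows "is_iso C f"
  using assms unfolding is_iso_def hom_def by auto

lemma categoryI:
  assumes "\<And>f. f \<in> Arr C \<Longrightarrow> Dom C f \<in> Obj C" "\<And>f. f \<in> Arr C \<Longrightarrow> Cod C f \<in> Obj C"
    "\<And>x. x \<in> Obj C \<Longrightarrow> Ident C x \<in> hom C x x"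
    "\<And>f g. f \<in> Arr C \<Longrightarrow> g \<in> Arr C \<Longrightarrow> Dom C g = Cod C f \<Longrightarrow> g \<cdot>\<^bsub>C\<^esub> f \<in> hom C (Dom C f) (Cod C g)"
    "\<And>f. f \<in> Arr C \<Longrightarrow> f \<cdot>\<^bsub>C\<^esub> Ident C (Dom C f) = f"
    "\<And>f. f \<in> Arr C \<Longrightarrow> Ident C (Cod C f) \<cdot>\<^bsub>C\<^esub> f = f"
    "\<And>f g h. f \<in> Arr C \<Longrightarrow> g \<in> Arr C \<Longrightarrow> h \<in> Arr C \<Longrightarrow> Dom C g = Cod C f \<Longrightarrow>
      Dom C h = Cod C g \<Longrightarrow> (h \<cdot>\<^bsub>C\<^esub> g) \<cdot>\<^bsub>C\<^esub> f = h \<cdot>\<^bsub>C\<^esub> (g \<cdot>\<^bsub>C\<^esub> f)"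
  shows "category C"
  by unfold_locales (use assms in \<open>auto simp: hom_def\<close>)

context category
begin

declare dom_obj [simp] cod_obj [simp]

lemma ident_arr [simp]:
  assumes "x \<in> Obj C"
  shows "Ident C x \<in> Arr C" "Dom C (Ident C x) = x" "Cod C (Ident C x) = x"
  using ident_hom[OF assms] by (auto simp: hom_def)

lemma comp_arr [simp]:
  assumes "f \<in> Arr C" "g \<in> Arr C" "Dom C g = Cod C f"
  shows "g \<cdot> f \<in> Arr C" "Dom C (g \<cdot> f) = Dom C f" "Cod C (g \<cdot> f) = Cod C g"
  using comp_hom[of f "Dom C f" "Cod C f" g "Cod C g"] assms by (auto simp: hom_def)

lemma comp_id [simp]:
  assumes "f \<in> Arr C"
  shows "Dom C f = x \<Longrightarrow> f \<cdot> Ident C x = f" "Cod C f = y \<Longrightarrow> Ident C y \<cdot> f = f"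
  using comp_ident_right[of f "Dom C f" "Cod C f"] comp_ident_left[of f "Dom C f" "Cod C f"] assms
  by (auto simp: hom_def)

lemma assoc_comp [simp]:
  assumes "f \<in> Arr C" "g \<in> Arr C" "h \<in> Arr C" "Dom C g = Cod C f" "Dom C h = Cod C g"
  shows "(h \<cdot> g) \<cdot> f = h \<cdot> (g \<cdot> f)"
  using comp_assoc[of f "Dom C f" "Cod C f" g "Cod C g" h "Cod C h"] assms by (auto simp: hom_def)

lemma obj_of_hom:
  assumes "f \<in> hom C x y"
  shows "x \<in> Obj C" "y \<in> Obj C"
  using assms by (auto simp: hom_def)

text \<open>Composites are kept bracketed to the right, so an equation between composites is applied
  inside a longer composite in the following form.\<close>

lemma whisker:
  assumes "g \<cdot> f = h" "f \<in> Arr C" "g \<in> Arr C" "Dom C g = Cod C f" "x \<in> Arr C" "Cod C x = Dom C f"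
  shows "g \<cdot> (f \<cdot> x) = h \<cdot> x"
  using assms by (metis assoc_comp)

lemma iso_inv_arr [simp]:
  assumes "is_iso C f"
  shows "iso_inv C f \<in> Arr C" "Dom C (iso_inv C f) = Cod C f" "Cod C (iso_inv C f) = Dom C f"
    "iso_inv C f \<cdot> f = Ident C (Dom C f)" "f \<cdot> iso_inv C f = Ident C (Cod C f)"
  using iso_inv[OF assms] by (auto simp: hom_def)

lemma iso_inv_comp [simp]:
  assumes "is_iso C f" "x \<in> Arr C"
  shows "Cod C x = Dom C f \<Longrightarrow> iso_inv C f \<cdot> (f \<cdot> x) = x"
    "Cod C x = Cod C f \<Longrightarrow> f \<cdot> (iso_inv C f \<cdot> x) = x"
proof -
  have f: "f \<in> Arr C"
    using assms by (simp add: is_iso_arr)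
  show "Cod C x = Dom C f \<Longrightarrow> iso_inv C f \<cdot> (f \<cdot> x) = x"
    using assms f whisker[of "iso_inv C f" f "Ident C (Dom C f)" x] by simp
  show "Cod C x = Cod C f \<Longrightarrow> f \<cdot> (iso_inv C f \<cdot> x) = x"
    using assms f whisker[of f "iso_inv C f" "Ident C (Cod C f)" x] by simp
qed

lemma iso_cancel_left:
  assumes "is_iso C f" "f \<cdot> x = f \<cdot> y" "x \<in> Arr C" "y \<in> Arr C" "Cod C x = Dom C f" "Cod C y = Dom C f"
  shows "x = y"
  using assms by (metis iso_inv_comp(1))

lemma iso_cancel_right:
  assumes "is_iso C f" "x \<cdot> f = y \<cdot> f" "x \<in> Arr C" "y \<in> Arr C" "Dom C x = Cod C f" "Dom C y = Cod C f"
  shows "x = y"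
proof -
  have f: "f \<in> Arr C"
    using assms by (simp add: is_iso_arr)
  have "x = (x \<cdot> f) \<cdot> iso_inv C f" "(y \<cdot> f) \<cdot> iso_inv C f = y"
    using assms(1,3-6) f by simp_all
  then show ?thesis
    using assms(2) by simp
qed

lemma is_iso_inv: "is_iso C f \<Longrightarrow> is_iso C (iso_inv C f)"
  by (rule is_isoI[where g = f and x = "Cod C f" and y = "Dom C f"])
    (auto intro!: homI simp: is_iso_arr)

lemma is_iso_comp:
  assumes "is_iso C f" "is_iso C g" "Dom C g = Cod C f"
  shows "is_iso C (g \<cdot> f)"
proof -
  have "f \<in> Arr C" "g \<in> Arr C"
    using assms by (simp_all add: is_iso_arr)
  with assms show ?thesis
    by (intro is_isoI[where g = "iso_inv C f \<cdot> iso_inv C g" and x = "Dom C f" and y = "Cod C g"])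
      (auto intro!: homI)
qed

end

section \<open>Functors\<close>

lemma functor_arr:
  assumes "is_functor C D F" "f \<in> Arr C"
  shows "far F f \<in> Arr D" "Dom D (far F f) = fob F (Dom C f)" "Cod D (far F f) = fob F (Cod C f)"
  using assms by (auto simp: is_functor_def hom_def)

lemma functor_obj: "is_functor C D F \<Longrightarrow> x \<in> Obj C \<Longrightarrow> fob F x \<in> Obj D"
  by (simp add: is_functor_def)

lemma functor_ident: "is_functor C D F \<Longrightarrow> x \<in> Obj C \<Longrightarrow> far F (Ident C x) = Ident D (fob F x)"
  by (simp add: is_functor_def)

lemma functor_comp:
  "is_functor C D F \<Longrightarrow> f \<in> Arr C \<Longrightarrow> g \<in> Arr C \<Longrightarrow> Dom C g = Cod C f \<Longrightarrow>
    far F (g \<cdot>\<^bsub>C\<^esub> f) = far F g \<cdot>\<^bsub>D\<^esub> far F f"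
  by (simp add: is_functor_def)

lemma functorD: "is_functor C D F \<Longrightarrow> category C \<and> category D"
  by (simp add: is_functor_def)

lemma is_functorI:
  assumes "category C" "category D" "\<And>x. x \<in> Obj C \<Longrightarrow> fob F x \<in> Obj D"
    "\<And>f. f \<in> Arr C \<Longrightarrow> far F f \<in> hom D (fob F (Dom C f)) (fob F (Cod C f))"
    "\<And>x. x \<in> Obj C \<Longrightarrow> far F (Ident C x) = Ident D (fob F x)"
    "\<And>f g. f \<in> Arr C \<Longrightarrow> g \<in> Arr C \<Longrightarrow> Cod C f = Dom C g \<Longrightarrow>
      far F (g \<cdot>\<^bsub>C\<^esub> f) = far F g \<cdot>\<^bsub>D\<^esub> far F f"
  shows "is_functor C D F"
  using assms by (simp add: is_functor_def)

lemmas functor_rules = functor_arr functor_obj functor_ident functor_comp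

lemma functor_iso:
  assumes F: "is_functor C D F" and f: "is_iso C f"
  shows "is_iso D (far F f)"
proof -
  note [simp] = functor_arr[OF F] functor_obj[OF F]
  interpret C: category C using F by (simp add: is_functor_def)
  have "f \<in> Arr C" using f by (rule is_iso_arr)
  with f F show ?thesis
    by (intro is_isoI[where g = "far F (iso_inv C f)" and x = "fob F (Dom C f)" and y = "fob F (Cod C f)"])
      (auto intro!: homI simp flip: functor_comp[OF F] simp: functor_ident[OF F])
qed

lemma id_func_simps [simp]: "fob id_func x = x" "far id_func f = f"
  by (simp_all add: id_func_def)

lemma comp_func_simps [simp]: "fob (G \<circ>\<circ> F) x = fob G (fob F x)" "far (G \<circ>\<circ> F) f = far G (far F f)"
  by (simp_all add: comp_func_def)

lemma is_functor_id: "category C \<Longrightarrow> is_functor C C id_func"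
  by (rule is_functorI) (auto simp: hom_def)

lemma is_functor_comp:
  assumes "is_functor C D F" "is_functor D E G"
  shows "is_functor C E (G \<circ>\<circ> F)"
  using functorD[OF assms(1)] functorD[OF assms(2)]
  by (intro is_functorI)
    (auto simp: hom_def functor_rules[OF assms(1)] functor_rules[OF assms(2)])

section \<open>Universal arrows and adjunctions\<close>

text \<open>A left adjoint of \<open>G\<close> provides such an arrow for every \<open>x\<close>, namely its unit.  All statements
  about adjunctions below are reduced to this property of one object at a time.\<close>

definition universal ::
  "('o1, 'm1, 'z1) category_scheme \<Rightarrow> ('o2, 'm2, 'z2) category_scheme
    \<Rightarrow> ('o2, 'm2, 'o1, 'm1) func \<Rightarrow> 'o1 \<Rightarrow> 'o2 \<Rightarrow> 'm1 \<Rightarrow> bool" where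
  "universal C D G x y u \<longleftrightarrow> y \<in> Obj D \<and> u \<in> hom C x (fob G y) \<and>
    (\<forall>z \<in> Obj D. \<forall>f \<in> hom C x (fob G z). \<exists>!h. h \<in> hom D y z \<and> far G h \<cdot>\<^bsub>C\<^esub> u = f)"

lemma universal_arr:
  assumes "universal C D G x y u"
  shows "y \<in> Obj D" "u \<in> Arr C" "Dom C u = x" "Cod C u = fob G y"
  using assms by (auto simp: universal_def hom_def)

lemma universal_ex1:
  assumes "universal C D G x y u" "z \<in> Obj D" "f \<in> hom C x (fob G z)"
  shows "\<exists>!h. h \<in> hom D y z \<and> far G h \<cdot>\<^bsub>C\<^esub> u = f"
  using assms by (simp add: universal_def)

lemma universal_ex:
  assumes "universal C D G x y u" "z \<in> Obj D" "f \<in> hom C x (fob G z)"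
  obtains h where "h \<in> hom D y z" "far G h \<cdot>\<^bsub>C\<^esub> u = f"
  using assms unfolding universal_def by blast

lemma universal_eq:
  assumes "universal C D G x y u" "is_functor D C G" "h \<in> hom D y z" "h' \<in> hom D y z"
    "far G h \<cdot>\<^bsub>C\<^esub> u = far G h' \<cdot>\<^bsub>C\<^esub> u"
  shows "h = h'"
proof -
  interpret C: category C using assms by (simp add: is_functor_def)
  interpret D: category D using assms by (simp add: is_functor_def)
  note [simp] = functor_arr[OF assms(2)] functor_obj[OF assms(2)]
  have "z \<in> Obj D" "far G h \<cdot>\<^bsub>C\<^esub> u \<in> hom C x (fob G z)"
    using assms universal_arr[OF assms(1)] by (auto simp: hom_def)
  then show ?thesis
    using assms unfolding universal_def by metis
qed

text \<open>The inverse is the comparison in the other direction: the two composites fix the universal arrows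
  \<open>u\<close> and \<open>v\<close>, as the identities do.\<close>

lemma universal_comparison_iso:
  assumes u: "universal C D G x y u" and v: "universal C D G x z v" and G: "is_functor D C G"
    and e: "e \<in> hom D y z" "far G e \<cdot>\<^bsub>C\<^esub> u = v"
  shows "is_iso D e"
proof -
  interpret C: category C using G by (simp add: is_functor_def)
  interpret D: category D using G by (simp add: is_functor_def)
  note [simp] = functor_arr[OF G] functor_obj[OF G] and ua = universal_arr[OF u] universal_arr[OF v] homD[OF e(1)]
  obtain e' where e': "e' \<in> hom D z y" "far G e' \<cdot>\<^bsub>C\<^esub> v = u"
    using universal_ex[OF v, of y u] ua by (auto simp: hom_def)
  note ua = ua homD[OF e'(1)]
  have "e' \<cdot>\<^bsub>D\<^esub> e = Ident D y"
    by (rule universal_eq[OF u G]) (use ua G e(2) e'(2) in \<open>auto simp: hom_def functor_comp[OF G] functor_ident[OF G]\<close>)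
  moreover have "e \<cdot>\<^bsub>D\<^esub> e' = Ident D z"
    by (rule universal_eq[OF v G]) (use ua G e(2) e'(2) in \<open>auto simp: hom_def functor_comp[OF G] functor_ident[OF G]\<close>)
  ultimately show ?thesis
    using e(1) e'(1) by (blast intro: is_isoI)
qed

lemma universal_transfer:
  assumes u: "universal C D G x y u" and G: "is_functor D C G"
    and e: "is_iso D e" "Dom D e = y"
  shows "universal C D G x (Cod D e) (far G e \<cdot>\<^bsub>C\<^esub> u)"
proof -
  interpret C: category C using G by (simp add: is_functor_def)
  interpret D: category D using G by (simp add: is_functor_def)
  note [simp] = functor_arr[OF G] functor_obj[OF G] universal_arr[OF u] is_iso_arr[OF e(1)] e
  show ?thesis
    unfolding universal_def
  proof (intro conjI ballI)
    fix z f assume z: "z \<in> Obj D" and f: "f \<in> hom C x (fob G z)"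
    obtain h where h: "h \<in> hom D y z" "far G h \<cdot>\<^bsub>C\<^esub> u = f"
      using universal_ex[OF u z f] .
    note [simp] = homD[OF h(1)]
    show "\<exists>!h. h \<in> hom D (Cod D e) z \<and> far G h \<cdot>\<^bsub>C\<^esub> far G e \<cdot>\<^bsub>C\<^esub> u = f"
    proof (rule ex1I[of _ "h \<cdot>\<^bsub>D\<^esub> iso_inv D e"])
      have "far G (iso_inv D e) \<cdot>\<^bsub>C\<^esub> far G e \<cdot>\<^bsub>C\<^esub> u = u"
        using C.whisker[of "far G (iso_inv D e)" "far G e" "Ident C (fob G y)" u]
          functor_comp[OF G, of e "iso_inv D e"]
        by (simp add: functor_ident[OF G])
      then show "h \<cdot>\<^bsub>D\<^esub> iso_inv D e \<in> hom D (Cod D e) z \<and>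
          far G (h \<cdot>\<^bsub>D\<^esub> iso_inv D e) \<cdot>\<^bsub>C\<^esub> far G e \<cdot>\<^bsub>C\<^esub> u = f"
        using h by (simp add: functor_comp[OF G] hom_def)
    next
      fix k assume k: "k \<in> hom D (Cod D e) z \<and> far G k \<cdot>\<^bsub>C\<^esub> far G e \<cdot>\<^bsub>C\<^esub> u = f"
      then have [simp]: "k \<in> Arr D" "Dom D k = Cod D e" "Cod D k = z"
        by (auto simp: hom_def)
      have "k \<cdot>\<^bsub>D\<^esub> e = h"
        by (rule universal_eq[OF u G]) (use k h in \<open>auto simp: hom_def functor_comp[OF G]\<close>)
      then show "k = h \<cdot>\<^bsub>D\<^esub> iso_inv D e"
        by (metis D.assoc_comp D.comp_id(1) D.iso_inv_arr(1,3,5) \<open>Cod D k = z\<close> \<open>Dom D k = Cod D e\<close>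
            \<open>k \<in> Arr D\<close> e(1) is_iso_arr)
    qed
  qed (auto intro!: homI)
qed

lemma universal_comp:
  assumes u: "universal C D G x y u" and v: "universal D E H y z v"
    and G: "is_functor D C G" and H: "is_functor E D H"
  shows "universal C E (G \<circ>\<circ> H) x z (far G v \<cdot>\<^bsub>C\<^esub> u)"
proof -
  interpret C: category C using G by (simp add: is_functor_def)
  interpret D: category D using G by (simp add: is_functor_def)
  interpret E: category E using H by (simp add: is_functor_def)
  note [simp] = universal_arr[OF u] universal_arr[OF v] functor_arr[OF G] functor_obj[OF G]
    functor_arr[OF H] functor_obj[OF H]
  show ?thesis
    unfolding universal_def
  proof (intro conjI ballI)
    fix w f assume w: "w \<in> Obj E" and f: "f \<in> hom C x (fob (G \<circ>\<circ> H) w)"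
    obtain h where h: "h \<in> hom D y (fob H w)" "far G h \<cdot>\<^bsub>C\<^esub> u = f"
      using universal_ex[OF u _ f[unfolded comp_func_simps]] functor_obj[OF H w] by blast
    obtain k where k: "k \<in> hom E z w" "far H k \<cdot>\<^bsub>D\<^esub> v = h"
      using universal_ex[OF v w h(1)] .
    note [simp] = homD[OF h(1)] homD[OF k(1)]
    show "\<exists>!h. h \<in> hom E z w \<and> far (G \<circ>\<circ> H) h \<cdot>\<^bsub>C\<^esub> far G v \<cdot>\<^bsub>C\<^esub> u = f"
    proof (rule ex1I[of _ k])
      have "far G (far H k) \<cdot>\<^bsub>C\<^esub> far G v \<cdot>\<^bsub>C\<^esub> u = far G (far H k \<cdot>\<^bsub>D\<^esub> v) \<cdot>\<^bsub>C\<^esub> u"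
        by (simp add: functor_comp[OF G])
      then show "k \<in> hom E z w \<and> far (G \<circ>\<circ> H) k \<cdot>\<^bsub>C\<^esub> far G v \<cdot>\<^bsub>C\<^esub> u = f"
        using k h by simp
    next
      fix l assume l: "l \<in> hom E z w \<and> far (G \<circ>\<circ> H) l \<cdot>\<^bsub>C\<^esub> far G v \<cdot>\<^bsub>C\<^esub> u = f"
      then have [simp]: "l \<in> Arr E" "Dom E l = z" "Cod E l = w"
        by (auto simp: hom_def)
      have "far H l \<cdot>\<^bsub>D\<^esub> v = h"
        by (rule universal_eq[OF u G]) (use l h in \<open>auto simp: hom_def functor_comp[OF G]\<close>)
      then show "l = k"
        using universal_eq[OF v H, of l w k] k l by simp
    qed
  qed (auto intro!: homI)
qed

lemma left_adjoint_universal: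
  assumes "left_adjoint C D F G"
  obtains \<eta> where "\<And>x. x \<in> Obj C \<Longrightarrow> universal C D G x (fob F x) (\<eta> x)"
    "\<And>f. f \<in> Arr C \<Longrightarrow> \<eta> (Cod C f) \<cdot>\<^bsub>C\<^esub> f = far G (far F f) \<cdot>\<^bsub>C\<^esub> \<eta> (Dom C f)"
proof -
  from assms obtain \<eta> \<epsilon> where F: "is_functor C D F" and G: "is_functor D C G"
    and eta: "nat_trans C C id_func (G \<circ>\<circ> F) \<eta>" and eps: "nat_trans D D (F \<circ>\<circ> G) id_func \<epsilon>"
    and z1: "\<forall>x \<in> Obj C. \<epsilon> (fob F x) \<cdot>\<^bsub>D\<^esub> far F (\<eta> x) = Ident D (fob F x)"
    and z2: "\<forall>y \<in> Obj D. far G (\<epsilon> y) \<cdot>\<^bsub>C\<^esub> \<eta> (fob G y) = Ident C (fob G y)"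
    unfolding left_adjoint_def by blast
  interpret C: category C using G by (simp add: is_functor_def)
  interpret D: category D using G by (simp add: is_functor_def)
  have eta_arr [simp]: "\<eta> x \<in> Arr C" "Dom C (\<eta> x) = x" "Cod C (\<eta> x) = fob G (fob F x)" if "x \<in> Obj C" for x
    using eta that by (auto simp: nat_trans_def hom_def)
  have eps_arr [simp]: "\<epsilon> x \<in> Arr D" "Cod D (\<epsilon> x) = x" "Dom D (\<epsilon> x) = fob F (fob G x)" if "x \<in> Obj D" for x
    using eps that by (auto simp: nat_trans_def hom_def)
  have eta_nat: "\<eta> (Cod C f) \<cdot>\<^bsub>C\<^esub> f = far G (far F f) \<cdot>\<^bsub>C\<^esub> \<eta> (Dom C f)" if "f \<in> Arr C" for f
    using eta that by (auto simp: nat_trans_def)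
  have eps_nat: "\<epsilon> (Cod D f) \<cdot>\<^bsub>D\<^esub> far F (far G f) = f \<cdot>\<^bsub>D\<^esub> \<epsilon> (Dom D f)" if "f \<in> Arr D" for f
    using eps that by (auto simp: nat_trans_def)
  note [simp] = functor_arr[OF G] functor_obj[OF G] functor_arr[OF F] functor_obj[OF F]
  have "universal C D G x (fob F x) (\<eta> x)" if x: "x \<in> Obj C" for x
    unfolding universal_def
  proof (intro conjI ballI)
    fix z f assume z: "z \<in> Obj D" and f: "f \<in> hom C x (fob G z)"
    note [simp] = x z homD[OF f]
    show "\<exists>!h. h \<in> hom D (fob F x) z \<and> far G h \<cdot>\<^bsub>C\<^esub> \<eta> x = f"
    proof (rule ex1I[of _ "\<epsilon> z \<cdot>\<^bsub>D\<^esub> far F f"])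
      have "far G (\<epsilon> z) \<cdot>\<^bsub>C\<^esub> far G (far F f) \<cdot>\<^bsub>C\<^esub> \<eta> x = (far G (\<epsilon> z) \<cdot>\<^bsub>C\<^esub> \<eta> (fob G z)) \<cdot>\<^bsub>C\<^esub> f"
        using eta_nat[of f] by (simp flip: eta_nat)
      also have "\<dots> = f"
        using z2 by simp
      finally show "\<epsilon> z \<cdot>\<^bsub>D\<^esub> far F f \<in> hom D (fob F x) z \<and> far G (\<epsilon> z \<cdot>\<^bsub>D\<^esub> far F f) \<cdot>\<^bsub>C\<^esub> \<eta> x = f"
        by (simp add: functor_comp[OF G] hom_def)
    next
      fix k assume k: "k \<in> hom D (fob F x) z \<and> far G k \<cdot>\<^bsub>C\<^esub> \<eta> x = f"
      then have [simp]: "k \<in> Arr D" "Dom D k = fob F x" "Cod D k = z" and kf: "f = far G k \<cdot>\<^bsub>C\<^esub> \<eta> x"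
        by (auto simp: hom_def)
      have "\<epsilon> z \<cdot>\<^bsub>D\<^esub> far F f = (\<epsilon> z \<cdot>\<^bsub>D\<^esub> far F (far G k)) \<cdot>\<^bsub>D\<^esub> far F (\<eta> x)"
        by (simp add: kf functor_comp[OF F])
      also have "\<dots> = k"
        using eps_nat[of k] z1 by simp
      finally show "k = \<epsilon> z \<cdot>\<^bsub>D\<^esub> far F f" by simp
    qed
  qed (auto intro!: homI simp: x)
  with eta_nat show ?thesis by (rule that[rotated])
qed

text \<open>The values of \<open>F\<close> on arrows and the counit are the arrows that the universal property provides;
  functoriality, naturality and the triangle identities are equations between arrows out of a
  universal arrow.  The values on objects are prescribed, because an extension of scalars is required
  to have a coequalizer as its underlying object.\<close>

lemma left_adjoint_of_universal:
  assumes G: "is_functor D C G" and u: "\<And>x. x \<in> Obj C \<Longrightarrow> universal C D G x (F\<^sub>0 x) (\<eta> x)"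
  obtains F where "left_adjoint C D F G" "fob F = F\<^sub>0"
proof -
  interpret C: category C using G by (simp add: is_functor_def)
  interpret D: category D using G by (simp add: is_functor_def)
  note [simp] = functor_arr[OF G] functor_obj[OF G] universal_arr[OF u]
  define F\<^sub>1 where "F\<^sub>1 f = (THE h. h \<in> hom D (F\<^sub>0 (Dom C f)) (F\<^sub>0 (Cod C f)) \<and>
      far G h \<cdot>\<^bsub>C\<^esub> \<eta> (Dom C f) = \<eta> (Cod C f) \<cdot>\<^bsub>C\<^esub> f)" for f
  have F1: "F\<^sub>1 f \<in> hom D (F\<^sub>0 (Dom C f)) (F\<^sub>0 (Cod C f))"
    "far G (F\<^sub>1 f) \<cdot>\<^bsub>C\<^esub> \<eta> (Dom C f) = \<eta> (Cod C f) \<cdot>\<^bsub>C\<^esub> f" if f: "f \<in> Arr C" for f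
  proof -
    have "\<exists>!h. h \<in> hom D (F\<^sub>0 (Dom C f)) (F\<^sub>0 (Cod C f)) \<and> far G h \<cdot>\<^bsub>C\<^esub> \<eta> (Dom C f) = \<eta> (Cod C f) \<cdot>\<^bsub>C\<^esub> f"
      using u[of "Dom C f"] f unfolding universal_def by (auto simp: hom_def)
    from theI'[OF this, folded F\<^sub>1_def]
    show "F\<^sub>1 f \<in> hom D (F\<^sub>0 (Dom C f)) (F\<^sub>0 (Cod C f))"
      "far G (F\<^sub>1 f) \<cdot>\<^bsub>C\<^esub> \<eta> (Dom C f) = \<eta> (Cod C f) \<cdot>\<^bsub>C\<^esub> f" by blast+
  qed
  have F1_arr [simp]: "F\<^sub>1 f \<in> Arr D" "Dom D (F\<^sub>1 f) = F\<^sub>0 (Dom C f)" "Cod D (F\<^sub>1 f) = F\<^sub>0 (Cod C f)"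
    if "f \<in> Arr C" for f
    using F1(1)[OF that] by (auto simp: hom_def)
  define F where "F = \<lparr>fob = F\<^sub>0, far = F\<^sub>1\<rparr>"
  have F_simps [simp]: "fob F = F\<^sub>0" "far F = F\<^sub>1"
    by (simp_all add: F_def)
  have F: "is_functor C D F"
  proof (rule is_functorI)
    fix x assume x: "x \<in> Obj C"
    show "far F (Ident C x) = Ident D (fob F x)"
      by (rule universal_eq[OF u[OF x] G])
        (use x F1(2)[of "Ident C x"] in \<open>auto simp: hom_def functor_ident[OF G]\<close>)
  next
    fix f g assume f: "f \<in> Arr C" and g: "g \<in> Arr C" and fg: "Cod C f = Dom C g"
    note [simp] = f g fg[symmetric]
    have "far G (F\<^sub>1 g) \<cdot>\<^bsub>C\<^esub> far G (F\<^sub>1 f) \<cdot>\<^bsub>C\<^esub> \<eta> (Dom C f) = \<eta> (Cod C g) \<cdot>\<^bsub>C\<^esub> g \<cdot>\<^bsub>C\<^esub> f"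
    proof -
      have "far G (F\<^sub>1 g) \<cdot>\<^bsub>C\<^esub> far G (F\<^sub>1 f) \<cdot>\<^bsub>C\<^esub> \<eta> (Dom C f)
          = (far G (F\<^sub>1 g) \<cdot>\<^bsub>C\<^esub> \<eta> (Dom C g)) \<cdot>\<^bsub>C\<^esub> f"
        by (simp add: F1(2)[OF f])
      also have "\<dots> = \<eta> (Cod C g) \<cdot>\<^bsub>C\<^esub> g \<cdot>\<^bsub>C\<^esub> f"
        unfolding F1(2)[OF g] by simp
      finally show ?thesis .
    qed
    then show "far F (g \<cdot>\<^bsub>C\<^esub> f) = far F g \<cdot>\<^bsub>D\<^esub> far F f"
      using F1(2)[of "g \<cdot>\<^bsub>C\<^esub> f"]
      by (intro universal_eq[OF u[of "Dom C f"] G]) (auto simp: hom_def functor_comp[OF G])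
  qed (use F1 in \<open>auto simp: C.category_axioms D.category_axioms\<close>)
  define \<epsilon> where "\<epsilon> y = (THE h. h \<in> hom D (F\<^sub>0 (fob G y)) y \<and> far G h \<cdot>\<^bsub>C\<^esub> \<eta> (fob G y) = Ident C (fob G y))" for y
  have eps: "\<epsilon> y \<in> hom D (F\<^sub>0 (fob G y)) y" "far G (\<epsilon> y) \<cdot>\<^bsub>C\<^esub> \<eta> (fob G y) = Ident C (fob G y)"
    if y: "y \<in> Obj D" for y
  proof -
    have "\<exists>!h. h \<in> hom D (F\<^sub>0 (fob G y)) y \<and> far G h \<cdot>\<^bsub>C\<^esub> \<eta> (fob G y) = Ident C (fob G y)"
      using u[of "fob G y"] y unfolding universal_def by (auto simp: hom_def)
    from theI'[OF this, folded \<epsilon>_def]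
    show "\<epsilon> y \<in> hom D (F\<^sub>0 (fob G y)) y" "far G (\<epsilon> y) \<cdot>\<^bsub>C\<^esub> \<eta> (fob G y) = Ident C (fob G y)" by blast+
  qed
  have eps_arr [simp]: "\<epsilon> y \<in> Arr D" "Dom D (\<epsilon> y) = F\<^sub>0 (fob G y)" "Cod D (\<epsilon> y) = y"
    if "y \<in> Obj D" for y
    using eps(1)[OF that] by (auto simp: hom_def)
  have "nat_trans C C id_func (G \<circ>\<circ> F) \<eta>"
    unfolding nat_trans_def using F1(2)
    by (auto simp: is_functor_id[OF C.category_axioms] is_functor_comp[OF F G] hom_def)
  moreover have "nat_trans D D (F \<circ>\<circ> G) id_func \<epsilon>"
    unfolding nat_trans_def
  proof (intro conjI ballI)
    fix g assume g: "g \<in> Arr D"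
    have "far G (\<epsilon> (Cod D g)) \<cdot>\<^bsub>C\<^esub> far G (F\<^sub>1 (far G g)) \<cdot>\<^bsub>C\<^esub> \<eta> (fob G (Dom D g))
        = (far G (\<epsilon> (Cod D g)) \<cdot>\<^bsub>C\<^esub> \<eta> (fob G (Cod D g))) \<cdot>\<^bsub>C\<^esub> far G g"
      using F1(2)[of "far G g"] g by simp
    then show "\<epsilon> (Cod D g) \<cdot>\<^bsub>D\<^esub> far (F \<circ>\<circ> G) g = far id_func g \<cdot>\<^bsub>D\<^esub> \<epsilon> (Dom D g)"
      using g eps(2)
      by (intro universal_eq[OF u[of "fob G (Dom D g)"] G]) (auto simp: hom_def functor_comp[OF G])
  qed (use eps in \<open>auto simp: is_functor_id[OF D.category_axioms] is_functor_comp[OF G F]\<close>)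
  moreover have "\<epsilon> (fob F x) \<cdot>\<^bsub>D\<^esub> far F (\<eta> x) = Ident D (fob F x)" if x: "x \<in> Obj C" for x
  proof -
    have "far G (\<epsilon> (F\<^sub>0 x)) \<cdot>\<^bsub>C\<^esub> far G (F\<^sub>1 (\<eta> x)) \<cdot>\<^bsub>C\<^esub> \<eta> x
        = (far G (\<epsilon> (F\<^sub>0 x)) \<cdot>\<^bsub>C\<^esub> \<eta> (fob G (F\<^sub>0 x))) \<cdot>\<^bsub>C\<^esub> \<eta> x"
      using F1(2)[of "\<eta> x"] x by simp
    then show ?thesis
      using x eps(2)
      by (intro universal_eq[OF u[of x] G]) (auto simp: hom_def functor_comp[OF G] functor_ident[OF G])
  qed
  ultimately have "left_adjoint C D F G"
    unfolding left_adjoint_def using F G eps(2) by (simp add: F_def) blast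
  then show ?thesis
    by (rule that) simp
qed

section \<open>Pseudo-functors from families of left adjoints\<close>

text \<open>A comparison between two families of universal arrows is natural, since both sides of a
  naturality square agree after composition with a universal arrow.\<close>

lemma nat_iso_of_universal:
  assumes G: "is_functor D C G" and H: "is_functor X C H"
    and L: "is_functor X D L" and K: "is_functor X D K"
    and u: "\<And>x. x \<in> Obj X \<Longrightarrow> universal C D G (fob H x) (fob L x) (u x)"
    and u_nat: "\<And>f. f \<in> Arr X \<Longrightarrow> u (Cod X f) \<cdot>\<^bsub>C\<^esub> far H f = far G (far L f) \<cdot>\<^bsub>C\<^esub> u (Dom X f)"
    and v: "\<And>x. x \<in> Obj X \<Longrightarrow> universal C D G (fob H x) (fob K x) (v x)"
    and v_nat: "\<And>f. f \<in> Arr X \<Longrightarrow> v (Cod X f) \<cdot>\<^bsub>C\<^esub> far H f = far G (far K f) \<cdot>\<^bsub>C\<^esub> v (Dom X f)"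
    and t: "\<And>x. x \<in> Obj X \<Longrightarrow> t x \<in> hom D (fob L x) (fob K x)"
    and tu: "\<And>x. x \<in> Obj X \<Longrightarrow> far G (t x) \<cdot>\<^bsub>C\<^esub> u x = v x"
  shows "nat_iso X D L K t"
proof -
  interpret C: category C using G by (simp add: is_functor_def)
  interpret D: category D using G by (simp add: is_functor_def)
  interpret X: category X using H by (simp add: is_functor_def)
  have t_arr: "t x \<in> Arr D" "Dom D (t x) = fob L x" "Cod D (t x) = fob K x" if "x \<in> Obj X" for x
    using t[OF that] by (auto simp: hom_def)
  note [simp] = functor_arr[OF G] functor_obj[OF G] functor_arr[OF H] functor_obj[OF H]
    functor_arr[OF L] functor_obj[OF L] functor_arr[OF K] functor_obj[OF K]
    universal_arr[OF u] universal_arr[OF v] t_arr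
  have "t (Cod X f) \<cdot>\<^bsub>D\<^esub> far L f = far K f \<cdot>\<^bsub>D\<^esub> t (Dom X f)" if f: "f \<in> Arr X" for f
  proof (rule universal_eq[OF u G])
    have "far G (t (Cod X f) \<cdot>\<^bsub>D\<^esub> far L f) \<cdot>\<^bsub>C\<^esub> u (Dom X f)
        = (far G (t (Cod X f)) \<cdot>\<^bsub>C\<^esub> u (Cod X f)) \<cdot>\<^bsub>C\<^esub> far H f"
      using f by (simp add: functor_comp[OF G] u_nat)
    also have "\<dots> = far G (far K f) \<cdot>\<^bsub>C\<^esub> (far G (t (Dom X f)) \<cdot>\<^bsub>C\<^esub> u (Dom X f))"
      using f by (simp only: tu v_nat X.dom_obj X.cod_obj)
    also have "\<dots> = far G (far K f \<cdot>\<^bsub>D\<^esub> t (Dom X f)) \<cdot>\<^bsub>C\<^esub> u (Dom X f)"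
      using f by (simp add: functor_comp[OF G])
    finally show "far G (t (Cod X f) \<cdot>\<^bsub>D\<^esub> far L f) \<cdot>\<^bsub>C\<^esub> u (Dom X f) = \<dots>" .
  qed (use f in \<open>auto simp: hom_def\<close>)
  then show ?thesis
    unfolding nat_iso_def nat_trans_def
    using L K t by (auto intro: universal_comparison_iso[OF u v G t tu])
qed

lemma universal_cong:
  assumes "universal C D G x y u" "is_functor D C G" "is_functor D C G'"
    and "\<And>z. z \<in> Obj D \<Longrightarrow> fob G' z = fob G z" "\<And>h. h \<in> Arr D \<Longrightarrow> far G' h = far G h"
  shows "universal C D G' x y u"
proof -
  have "far G' h \<cdot>\<^bsub>C\<^esub> u = far G h \<cdot>\<^bsub>C\<^esub> u" if "h \<in> hom D y z" for h z
    using assms(5) that by (simp add: hom_def)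
  then have "(h \<in> hom D y z \<and> far G' h \<cdot>\<^bsub>C\<^esub> u = f) = (h \<in> hom D y z \<and> far G h \<cdot>\<^bsub>C\<^esub> u = f)" for h z f
    by auto
  then show ?thesis
    using assms(1,4) by (simp add: universal_def)
qed

text \<open>The functors \<open>R \<alpha>\<close> compose strictly, so units compose to universal arrows to \<open>R (\<beta> \<cdot> \<alpha>)\<close>, and the
  structure arrows of the pseudo-functor are the comparisons between universal arrows to the same
  functor.  Each coherence law equates two arrows out of a universal arrow; composed with that
  universal arrow, both sides become the unit of the longest composite.\<close>

lemma pseudofunctor_of_left_adjoints:
  fixes K :: "('k, 'l, 'z) category_scheme" and P :: "'k \<Rightarrow> ('o, 'm) category"
  assumes K: "category K" and P: "\<And>a. a \<in> Obj K \<Longrightarrow> category (P a)"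
    and adj: "\<And>\<alpha>. \<alpha> \<in> Arr K \<Longrightarrow> left_adjoint (P (Dom K \<alpha>)) (P (Cod K \<alpha>)) (L \<alpha>) (R \<alpha>)"
    and R_comp: "\<And>\<alpha> \<beta>. \<alpha> \<in> Arr K \<Longrightarrow> \<beta> \<in> Arr K \<Longrightarrow> Dom K \<beta> = Cod K \<alpha> \<Longrightarrow>
      (\<forall>x \<in> Obj (P (Cod K \<beta>)). fob (R (\<beta> \<cdot>\<^bsub>K\<^esub> \<alpha>)) x = fob (R \<alpha>) (fob (R \<beta>) x)) \<and>
      (\<forall>f \<in> Arr (P (Cod K \<beta>)). far (R (\<beta> \<cdot>\<^bsub>K\<^esub> \<alpha>)) f = far (R \<alpha>) (far (R \<beta>) f))"
    and R_ident: "\<And>a. a \<in> Obj K \<Longrightarrow> (\<forall>x \<in> Obj (P a). fob (R (Ident K a)) x = x) \<and>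
      (\<forall>f \<in> Arr (P a). far (R (Ident K a)) f = f)"
  shows "\<exists>\<gamma> \<delta>. pseudofunctor_to_Cat K P L \<gamma> \<delta>"
proof -
  interpret K: category K by (rule K)
  have "\<forall>\<alpha>\<in>Arr K. \<exists>\<eta>. (\<forall>x \<in> Obj (P (Dom K \<alpha>)).
          universal (P (Dom K \<alpha>)) (P (Cod K \<alpha>)) (R \<alpha>) x (fob (L \<alpha>) x) (\<eta> x)) \<and>
      (\<forall>f \<in> Arr (P (Dom K \<alpha>)). \<eta> (Cod (P (Dom K \<alpha>)) f) \<cdot>\<^bsub>P (Dom K \<alpha>)\<^esub> f
          = far (R \<alpha>) (far (L \<alpha>) f) \<cdot>\<^bsub>P (Dom K \<alpha>)\<^esub> \<eta> (Dom (P (Dom K \<alpha>)) f))"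
  proof
    fix \<alpha> assume "\<alpha> \<in> Arr K"
    then show "\<exists>\<eta>. (\<forall>x \<in> Obj (P (Dom K \<alpha>)).
          universal (P (Dom K \<alpha>)) (P (Cod K \<alpha>)) (R \<alpha>) x (fob (L \<alpha>) x) (\<eta> x)) \<and>
      (\<forall>f \<in> Arr (P (Dom K \<alpha>)). \<eta> (Cod (P (Dom K \<alpha>)) f) \<cdot>\<^bsub>P (Dom K \<alpha>)\<^esub> f
          = far (R \<alpha>) (far (L \<alpha>) f) \<cdot>\<^bsub>P (Dom K \<alpha>)\<^esub> \<eta> (Dom (P (Dom K \<alpha>)) f))"
      by (rule left_adjoint_universal[OF adj]) blast
  qed
  from bchoice[OF this] obtain \<eta> where eta: "\<forall>\<alpha>\<in>Arr K. (\<forall>x \<in> Obj (P (Dom K \<alpha>)).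
          universal (P (Dom K \<alpha>)) (P (Cod K \<alpha>)) (R \<alpha>) x (fob (L \<alpha>) x) (\<eta> \<alpha> x)) \<and>
      (\<forall>f \<in> Arr (P (Dom K \<alpha>)). \<eta> \<alpha> (Cod (P (Dom K \<alpha>)) f) \<cdot>\<^bsub>P (Dom K \<alpha>)\<^esub> f
          = far (R \<alpha>) (far (L \<alpha>) f) \<cdot>\<^bsub>P (Dom K \<alpha>)\<^esub> \<eta> \<alpha> (Dom (P (Dom K \<alpha>)) f))"
    by blast
  have R: "is_functor (P b) (P a) (R \<alpha>)" if "\<alpha> \<in> hom K a b" for \<alpha> a b
    using adj[of \<alpha>] that by (auto simp: left_adjoint_def hom_def)
  have L: "is_functor (P a) (P b) (L \<alpha>)" if "\<alpha> \<in> hom K a b" for \<alpha> a b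
    using adj[of \<alpha>] that by (auto simp: left_adjoint_def hom_def)
  have univ: "universal (P a) (P b) (R \<alpha>) x (fob (L \<alpha>) x) (\<eta> \<alpha> x)"
    if "\<alpha> \<in> hom K a b" "x \<in> Obj (P a)" for \<alpha> a b x
    using eta that by (auto simp: hom_def)
  have eta_nat: "\<eta> \<alpha> y \<cdot>\<^bsub>P a\<^esub> f = far (R \<alpha>) (far (L \<alpha>) f) \<cdot>\<^bsub>P a\<^esub> \<eta> \<alpha> x"
    if "\<alpha> \<in> hom K a b" "f \<in> hom (P a) x y" for \<alpha> a b x y f
    using eta that by (auto simp: hom_def)
  define \<gamma> where "\<gamma> \<beta> \<alpha> x = (THE h.
      h \<in> hom (P (Cod K \<beta>)) (fob (L \<beta>) (fob (L \<alpha>) x)) (fob (L (\<beta> \<cdot>\<^bsub>K\<^esub> \<alpha>)) x) \<and>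
      far (R (\<beta> \<cdot>\<^bsub>K\<^esub> \<alpha>)) h \<cdot>\<^bsub>P (Dom K \<alpha>)\<^esub> (far (R \<alpha>) (\<eta> \<beta> (fob (L \<alpha>) x)) \<cdot>\<^bsub>P (Dom K \<alpha>)\<^esub> \<eta> \<alpha> x)
        = \<eta> (\<beta> \<cdot>\<^bsub>K\<^esub> \<alpha>) x)" for \<beta> \<alpha> x
  have univ2: "universal (P a) (P c) (R (\<beta> \<cdot>\<^bsub>K\<^esub> \<alpha>)) x (fob (L \<beta>) (fob (L \<alpha>) x))
      (far (R \<alpha>) (\<eta> \<beta> (fob (L \<alpha>) x)) \<cdot>\<^bsub>P a\<^esub> \<eta> \<alpha> x)"
    if h: "\<alpha> \<in> hom K a b" "\<beta> \<in> hom K b c" and x: "x \<in> Obj (P a)" for \<alpha> \<beta> a b c x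
  proof (rule universal_cong)
    show "universal (P a) (P c) (R \<alpha> \<circ>\<circ> R \<beta>) x (fob (L \<beta>) (fob (L \<alpha>) x))
      (far (R \<alpha>) (\<eta> \<beta> (fob (L \<alpha>) x)) \<cdot>\<^bsub>P a\<^esub> \<eta> \<alpha> x)"
      by (rule universal_comp[OF univ univ R R]) (use h x functor_obj[OF L] in auto)
    show "is_functor (P c) (P a) (R \<alpha> \<circ>\<circ> R \<beta>)"
      using is_functor_comp R h by blast
    show "is_functor (P c) (P a) (R (\<beta> \<cdot>\<^bsub>K\<^esub> \<alpha>))"
      using R K.comp_hom h by blast
  qed (use R_comp[of \<alpha> \<beta>] h in \<open>auto simp: hom_def\<close>)
  have gam: "\<gamma> \<beta> \<alpha> x \<in> hom (P c) (fob (L \<beta>) (fob (L \<alpha>) x)) (fob (L (\<beta> \<cdot>\<^bsub>K\<^esub> \<alpha>)) x)"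
    "far (R (\<beta> \<cdot>\<^bsub>K\<^esub> \<alpha>)) (\<gamma> \<beta> \<alpha> x) \<cdot>\<^bsub>P a\<^esub> (far (R \<alpha>) (\<eta> \<beta> (fob (L \<alpha>) x)) \<cdot>\<^bsub>P a\<^esub> \<eta> \<alpha> x) = \<eta> (\<beta> \<cdot>\<^bsub>K\<^esub> \<alpha>) x"
    if h: "\<alpha> \<in> hom K a b" "\<beta> \<in> hom K b c" and x: "x \<in> Obj (P a)" for \<alpha> \<beta> a b c x
  proof -
    have "\<exists>!g. g \<in> hom (P c) (fob (L \<beta>) (fob (L \<alpha>) x)) (fob (L (\<beta> \<cdot>\<^bsub>K\<^esub> \<alpha>)) x) \<and>
      far (R (\<beta> \<cdot>\<^bsub>K\<^esub> \<alpha>)) g \<cdot>\<^bsub>P a\<^esub> (far (R \<alpha>) (\<eta> \<beta> (fob (L \<alpha>) x)) \<cdot>\<^bsub>P a\<^esub> \<eta> \<alpha> x) = \<eta> (\<beta> \<cdot>\<^bsub>K\<^esub> \<alpha>) x"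
      by (rule universal_ex1[OF univ2[OF h x]])
        (use univ[OF K.comp_hom[OF h] x] in \<open>simp_all add: universal_def\<close>)
    note ex = theI'[OF this]
    have [simp]: "Dom K \<alpha> = a" "Cod K \<beta> = c"
      using h by (auto simp: hom_def)
    show "\<gamma> \<beta> \<alpha> x \<in> hom (P c) (fob (L \<beta>) (fob (L \<alpha>) x)) (fob (L (\<beta> \<cdot>\<^bsub>K\<^esub> \<alpha>)) x)"
      "far (R (\<beta> \<cdot>\<^bsub>K\<^esub> \<alpha>)) (\<gamma> \<beta> \<alpha> x) \<cdot>\<^bsub>P a\<^esub> (far (R \<alpha>) (\<eta> \<beta> (fob (L \<alpha>) x)) \<cdot>\<^bsub>P a\<^esub> \<eta> \<alpha> x) = \<eta> (\<beta> \<cdot>\<^bsub>K\<^esub> \<alpha>) x"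
      unfolding \<gamma>_def using ex by simp_all
  qed
  have "pseudofunctor_to_Cat K P L \<gamma> (\<lambda>a. \<eta> (Ident K a))"
    unfolding pseudofunctor_to_Cat_def
  proof (intro conjI ballI impI allI)
    fix \<alpha> assume "\<alpha> \<in> Arr K"
    then show "is_functor (P (Dom K \<alpha>)) (P (Cod K \<alpha>)) (L \<alpha>)"
      by (intro L) (simp add: hom_def)
  next
    fix \<alpha> \<beta> assume "\<alpha> \<in> Arr K" "\<beta> \<in> Arr K" "Cod K \<alpha> = Dom K \<beta>"
    then obtain a b c where h: "\<alpha> \<in> hom K a b" "\<beta> \<in> hom K b c" and [simp]: "Dom K \<alpha> = a" "Cod K \<beta> = c"
      by (simp add: hom_def)
    note hc = K.comp_hom[OF h]
    interpret Pa: category "P a" using P K.obj_of_hom h by blast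
    interpret Pb: category "P b" using P K.obj_of_hom h by blast
    interpret Pc: category "P c" using P K.obj_of_hom h by blast
    note [simp] = functor_arr[OF L[OF h(1)]] functor_obj[OF L[OF h(1)]]
      functor_arr[OF R[OF h(1)]] functor_obj[OF R[OF h(1)]]
      functor_arr[OF L[OF h(2)]] functor_obj[OF L[OF h(2)]]
      functor_arr[OF R[OF h(2)]] functor_obj[OF R[OF h(2)]]
      universal_arr[OF univ[OF h(1)]] universal_arr[OF univ[OF h(2)]]
    have "nat_iso (P a) (P c) (L \<beta> \<circ>\<circ> L \<alpha>) (L (\<beta> \<cdot>\<^bsub>K\<^esub> \<alpha>)) (\<gamma> \<beta> \<alpha>)"
    proof (rule nat_iso_of_universal[OF R[OF hc] is_functor_id[OF Pa.category_axioms]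
          is_functor_comp[OF L[OF h(1)] L[OF h(2)]] L[OF hc]])
      fix f assume f: "f \<in> Arr (P a)"
      let ?x = "Dom (P a) f" and ?y = "Cod (P a) f"
      have "(far (R \<alpha>) (\<eta> \<beta> (fob (L \<alpha>) ?y)) \<cdot>\<^bsub>P a\<^esub> \<eta> \<alpha> ?y) \<cdot>\<^bsub>P a\<^esub> f
          = far (R \<alpha>) (\<eta> \<beta> (fob (L \<alpha>) ?y)) \<cdot>\<^bsub>P a\<^esub> far (R \<alpha>) (far (L \<alpha>) f) \<cdot>\<^bsub>P a\<^esub> \<eta> \<alpha> ?x"
        using f eta_nat[OF h(1), of f ?x ?y] by (simp add: hom_def)
      also have "\<dots> = far (R \<alpha>) (\<eta> \<beta> (fob (L \<alpha>) ?y) \<cdot>\<^bsub>P b\<^esub> far (L \<alpha>) f) \<cdot>\<^bsub>P a\<^esub> \<eta> \<alpha> ?x"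
        using f by (simp add: functor_comp[OF R[OF h(1)]])
      also have "\<dots> = far (R \<alpha>) (far (R \<beta>) (far (L \<beta>) (far (L \<alpha>) f)) \<cdot>\<^bsub>P b\<^esub> \<eta> \<beta> (fob (L \<alpha>) ?x)) \<cdot>\<^bsub>P a\<^esub> \<eta> \<alpha> ?x"
        using f eta_nat[OF h(2), of "far (L \<alpha>) f" "fob (L \<alpha>) ?x" "fob (L \<alpha>) ?y"] by (simp add: hom_def)
      also have "\<dots> = far (R \<alpha>) (far (R \<beta>) (far (L \<beta>) (far (L \<alpha>) f))) \<cdot>\<^bsub>P a\<^esub>
          far (R \<alpha>) (\<eta> \<beta> (fob (L \<alpha>) ?x)) \<cdot>\<^bsub>P a\<^esub> \<eta> \<alpha> ?x"
        using f by (simp add: functor_comp[OF R[OF h(1)]])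
      also have "far (R \<alpha>) (far (R \<beta>) (far (L \<beta>) (far (L \<alpha>) f))) = far (R (\<beta> \<cdot>\<^bsub>K\<^esub> \<alpha>)) (far (L \<beta>) (far (L \<alpha>) f))"
        using f R_comp[of \<alpha> \<beta>] h by (simp add: hom_def)
      finally show "(far (R \<alpha>) (\<eta> \<beta> (fob (L \<alpha>) ?y)) \<cdot>\<^bsub>P a\<^esub> \<eta> \<alpha> ?y) \<cdot>\<^bsub>P a\<^esub> far id_func f =
          far (R (\<beta> \<cdot>\<^bsub>K\<^esub> \<alpha>)) (far (L \<beta> \<circ>\<circ> L \<alpha>) f) \<cdot>\<^bsub>P a\<^esub> far (R \<alpha>) (\<eta> \<beta> (fob (L \<alpha>) ?x)) \<cdot>\<^bsub>P a\<^esub> \<eta> \<alpha> ?x"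
        by simp
    next
      fix f assume f: "f \<in> Arr (P a)"
      show "\<eta> (\<beta> \<cdot>\<^bsub>K\<^esub> \<alpha>) (Cod (P a) f) \<cdot>\<^bsub>P a\<^esub> far id_func f =
         far (R (\<beta> \<cdot>\<^bsub>K\<^esub> \<alpha>)) (far (L (\<beta> \<cdot>\<^bsub>K\<^esub> \<alpha>)) f) \<cdot>\<^bsub>P a\<^esub> \<eta> (\<beta> \<cdot>\<^bsub>K\<^esub> \<alpha>) (Dom (P a) f)"
        using f eta_nat[OF hc, of f] by (simp add: hom_def)
    qed (use gam[OF h] univ2[OF h] univ[OF hc] in simp_all)
    then show "nat_iso (P (Dom K \<alpha>)) (P (Cod K \<beta>)) (L \<beta> \<circ>\<circ> L \<alpha>) (L (\<beta> \<cdot>\<^bsub>K\<^esub> \<alpha>)) (\<gamma> \<beta> \<alpha>)"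
      by simp
  next
    fix a assume a: "a \<in> Obj K"
    then interpret Pa: category "P a" by (rule P)
    have h: "Ident K a \<in> hom K a a"
      using a by (rule K.ident_hom)
    show "nat_iso (P a) (P a) id_func (L (Ident K a)) (\<eta> (Ident K a))"
    proof (rule nat_iso_of_universal[OF R[OF h] is_functor_id[OF Pa.category_axioms]
          is_functor_id[OF Pa.category_axioms] L[OF h]])
      fix x assume x: "x \<in> Obj (P a)"
      have "universal (P a) (P a) id_func x x (Ident (P a) x)"
        using x unfolding universal_def by (auto intro!: homI simp: hom_def)
      then show "universal (P a) (P a) (R (Ident K a)) (fob id_func x) (fob id_func x) (Ident (P a) x)"
        using R_ident[OF a] by (auto intro: universal_cong[OF _ is_functor_id[OF Pa.category_axioms] R[OF h]])
      show "\<eta> (Ident K a) x \<in> hom (P a) (fob id_func x) (fob (L (Ident K a)) x)"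
        using universal_arr[OF univ[OF h x]] R_ident[OF a] by (auto intro!: homI)
      show "far (R (Ident K a)) (\<eta> (Ident K a) x) \<cdot>\<^bsub>P a\<^esub> Ident (P a) x = \<eta> (Ident K a) x"
        using universal_arr[OF univ[OF h x]] R_ident[OF a] x by simp
    next
      fix f assume f: "f \<in> Arr (P a)"
      show "Ident (P a) (Cod (P a) f) \<cdot>\<^bsub>P a\<^esub> far id_func f =
          far (R (Ident K a)) (far id_func f) \<cdot>\<^bsub>P a\<^esub> Ident (P a) (Dom (P a) f)"
        using f R_ident[OF a] by simp
      show "\<eta> (Ident K a) (Cod (P a) f) \<cdot>\<^bsub>P a\<^esub> far id_func f =
          far (R (Ident K a)) (far (L (Ident K a)) f) \<cdot>\<^bsub>P a\<^esub> \<eta> (Ident K a) (Dom (P a) f)"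
        using f eta_nat[OF h, of f] by (simp add: hom_def)
    qed (use univ[OF h] in simp)
  next
    fix a b c d \<alpha> \<beta> \<theta> x
    assume h: "\<alpha> \<in> hom K a b" "\<beta> \<in> hom K b c" "\<theta> \<in> hom K c d" and x: "x \<in> Obj (P a)"
    note hs = K.comp_hom[OF h(1,2)] K.comp_hom[OF h(2,3)]
    note hs3 = K.comp_hom[OF hs(1) h(3)] K.comp_hom[OF h(1) hs(2)]
    have assoc: "(\<theta> \<cdot>\<^bsub>K\<^esub> \<beta>) \<cdot>\<^bsub>K\<^esub> \<alpha> = \<theta> \<cdot>\<^bsub>K\<^esub> (\<beta> \<cdot>\<^bsub>K\<^esub> \<alpha>)"
      using K.comp_assoc h by blast
    interpret Pa: category "P a" using P K.obj_of_hom h by blast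
    interpret Pb: category "P b" using P K.obj_of_hom h by blast
    interpret Pc: category "P c" using P K.obj_of_hom h by blast
    interpret Pd: category "P d" using P K.obj_of_hom h by blast
    have Rc: "far (R (\<beta> \<cdot>\<^bsub>K\<^esub> \<alpha>)) f = far (R \<alpha>) (far (R \<beta>) f)" if "f \<in> Arr (P c)" for f
      using R_comp[of \<alpha> \<beta>] h that by (simp add: hom_def)
    have Rc': "far (R (\<theta> \<cdot>\<^bsub>K\<^esub> \<beta>)) f = far (R \<beta>) (far (R \<theta>) f)" if "f \<in> Arr (P d)" for f
      using R_comp[of \<beta> \<theta>] h that by (simp add: hom_def)
    have Rd: "far (R (\<theta> \<cdot>\<^bsub>K\<^esub> \<beta> \<cdot>\<^bsub>K\<^esub> \<alpha>)) f = far (R \<alpha>) (far (R \<beta>) (far (R \<theta>) f))" if "f \<in> Arr (P d)" for f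
      using R_comp[of "\<beta> \<cdot>\<^bsub>K\<^esub> \<alpha>" \<theta>] hs h that Rc functor_arr[OF R[OF h(3)]] by (simp add: hom_def)
    have Rcb: "fob (R (\<beta> \<cdot>\<^bsub>K\<^esub> \<alpha>)) y = fob (R \<alpha>) (fob (R \<beta>) y)" if "y \<in> Obj (P c)" for y
      using R_comp[of \<alpha> \<beta>] h that by (simp add: hom_def)
    have Rcb': "fob (R (\<theta> \<cdot>\<^bsub>K\<^esub> \<beta>)) y = fob (R \<beta>) (fob (R \<theta>) y)" if "y \<in> Obj (P d)" for y
      using R_comp[of \<beta> \<theta>] h that by (simp add: hom_def)
    have Rdb: "fob (R (\<theta> \<cdot>\<^bsub>K\<^esub> \<beta> \<cdot>\<^bsub>K\<^esub> \<alpha>)) y = fob (R \<alpha>) (fob (R \<beta>) (fob (R \<theta>) y))" if "y \<in> Obj (P d)" for y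
      using R_comp[of "\<beta> \<cdot>\<^bsub>K\<^esub> \<alpha>" \<theta>] hs h that Rcb functor_obj[OF R[OF h(3)]] by (simp add: hom_def)
    let ?y = "fob (L \<alpha>) x" let ?z = "fob (L \<beta>) ?y"
    have y: "?y \<in> Obj (P b)" and z: "?z \<in> Obj (P c)" and zx: "fob (L (\<beta> \<cdot>\<^bsub>K\<^esub> \<alpha>)) x \<in> Obj (P c)"
      using x functor_obj[OF L] h hs by blast+
    note g1 = gam[OF h(1,2) x] and g2 = gam[OF h(2,3) y] and g3 = gam[OF hs(1) h(3) x]
      and g4 = gam[OF h(1) hs(2) x, unfolded assoc]
    note [simp] = functor_arr[OF L[OF h(1)]] functor_obj[OF L[OF h(1)]]
      functor_arr[OF R[OF h(1)]] functor_obj[OF R[OF h(1)]]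
      functor_arr[OF L[OF h(2)]] functor_obj[OF L[OF h(2)]]
      functor_arr[OF R[OF h(2)]] functor_obj[OF R[OF h(2)]]
      functor_arr[OF L[OF h(3)]] functor_obj[OF L[OF h(3)]]
      functor_arr[OF R[OF h(3)]] functor_obj[OF R[OF h(3)]]
      functor_obj[OF L[OF hs(1)]] functor_obj[OF L[OF hs(2)]] functor_obj[OF L[OF hs3(1)]]
      universal_arr[OF univ[OF h(1)]] universal_arr[OF univ[OF h(2)]] universal_arr[OF univ[OF h(3)]]
      universal_arr[OF univ[OF hs(1)]] universal_arr[OF univ[OF hs(2)]] universal_arr[OF univ[OF hs3(1)]]
      x y z homD[OF g1(1)] homD[OF g2(1)] homD[OF g3(1)] homD[OF g4(1)]
      Rc Rc' Rd Rcb Rcb' Rdb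
    have u: "universal (P a) (P d) (R (\<theta> \<cdot>\<^bsub>K\<^esub> \<beta> \<cdot>\<^bsub>K\<^esub> \<alpha>)) x (fob (L \<theta>) ?z)
        (far (R \<alpha>) (far (R \<beta>) (\<eta> \<theta> ?z)) \<cdot>\<^bsub>P a\<^esub> (far (R \<alpha>) (\<eta> \<beta> ?y) \<cdot>\<^bsub>P a\<^esub> \<eta> \<alpha> x))"
    proof (rule universal_cong)
      show "universal (P a) (P d) (R (\<beta> \<cdot>\<^bsub>K\<^esub> \<alpha>) \<circ>\<circ> R \<theta>) x (fob (L \<theta>) ?z)
        (far (R \<alpha>) (far (R \<beta>) (\<eta> \<theta> ?z)) \<cdot>\<^bsub>P a\<^esub> (far (R \<alpha>) (\<eta> \<beta> ?y) \<cdot>\<^bsub>P a\<^esub> \<eta> \<alpha> x))"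
        using universal_comp[OF univ2[OF h(1,2) x] univ[OF h(3) z] R[OF hs(1)] R[OF h(3)]] by simp
    qed (use is_functor_comp[OF R[OF h(3)] R[OF hs(1)]] R[OF hs3(1)] in simp_all)
    show "\<gamma> \<theta> (\<beta> \<cdot>\<^bsub>K\<^esub> \<alpha>) x \<cdot>\<^bsub>P d\<^esub> far (L \<theta>) (\<gamma> \<beta> \<alpha> x) =
        \<gamma> (\<theta> \<cdot>\<^bsub>K\<^esub> \<beta>) \<alpha> x \<cdot>\<^bsub>P d\<^esub> \<gamma> \<theta> \<beta> (fob (L \<alpha>) x)" (is "?l = ?r")
    proof (rule universal_eq[OF u R[OF hs3(1)]])
      let ?u = "far (R \<alpha>) (far (R \<beta>) (\<eta> \<theta> ?z)) \<cdot>\<^bsub>P a\<^esub> (far (R \<alpha>) (\<eta> \<beta> ?y) \<cdot>\<^bsub>P a\<^esub> \<eta> \<alpha> x)"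
      note fc = functor_comp[OF R[OF h(1)]] functor_comp[OF R[OF h(2)]] functor_comp[OF R[OF h(3)]]
      have "far (R (\<theta> \<cdot>\<^bsub>K\<^esub> \<beta> \<cdot>\<^bsub>K\<^esub> \<alpha>)) ?l \<cdot>\<^bsub>P a\<^esub> ?u
          = far (R \<alpha>) (far (R \<beta>) (far (R \<theta>) (\<gamma> \<theta> (\<beta> \<cdot>\<^bsub>K\<^esub> \<alpha>) x))) \<cdot>\<^bsub>P a\<^esub>
            far (R \<alpha>) (far (R \<beta>) (far (R \<theta>) (far (L \<theta>) (\<gamma> \<beta> \<alpha> x)) \<cdot>\<^bsub>P c\<^esub> \<eta> \<theta> ?z)) \<cdot>\<^bsub>P a\<^esub>
            far (R \<alpha>) (\<eta> \<beta> ?y) \<cdot>\<^bsub>P a\<^esub> \<eta> \<alpha> x"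
        by (simp add: fc)
      also have "far (R \<theta>) (far (L \<theta>) (\<gamma> \<beta> \<alpha> x)) \<cdot>\<^bsub>P c\<^esub> \<eta> \<theta> ?z
          = \<eta> \<theta> (fob (L (\<beta> \<cdot>\<^bsub>K\<^esub> \<alpha>)) x) \<cdot>\<^bsub>P c\<^esub> \<gamma> \<beta> \<alpha> x"
        using eta_nat[OF h(3) g1(1)] by simp
      also have "far (R \<alpha>) (far (R \<beta>) (far (R \<theta>) (\<gamma> \<theta> (\<beta> \<cdot>\<^bsub>K\<^esub> \<alpha>) x))) \<cdot>\<^bsub>P a\<^esub>
            far (R \<alpha>) (far (R \<beta>) (\<eta> \<theta> (fob (L (\<beta> \<cdot>\<^bsub>K\<^esub> \<alpha>)) x) \<cdot>\<^bsub>P c\<^esub> \<gamma> \<beta> \<alpha> x)) \<cdot>\<^bsub>P a\<^esub>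
            far (R \<alpha>) (\<eta> \<beta> ?y) \<cdot>\<^bsub>P a\<^esub> \<eta> \<alpha> x
         = far (R \<alpha>) (far (R \<beta>) (far (R \<theta>) (\<gamma> \<theta> (\<beta> \<cdot>\<^bsub>K\<^esub> \<alpha>) x))) \<cdot>\<^bsub>P a\<^esub>
            far (R \<alpha>) (far (R \<beta>) (\<eta> \<theta> (fob (L (\<beta> \<cdot>\<^bsub>K\<^esub> \<alpha>)) x))) \<cdot>\<^bsub>P a\<^esub>
            (far (R (\<beta> \<cdot>\<^bsub>K\<^esub> \<alpha>)) (\<gamma> \<beta> \<alpha> x) \<cdot>\<^bsub>P a\<^esub> far (R \<alpha>) (\<eta> \<beta> ?y) \<cdot>\<^bsub>P a\<^esub> \<eta> \<alpha> x)"
        by (simp add: fc zx)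
      also have "\<dots> = \<eta> (\<theta> \<cdot>\<^bsub>K\<^esub> \<beta> \<cdot>\<^bsub>K\<^esub> \<alpha>) x"
        using g3(2) unfolding g1(2) by (simp add: zx)
      finally have l: "far (R (\<theta> \<cdot>\<^bsub>K\<^esub> \<beta> \<cdot>\<^bsub>K\<^esub> \<alpha>)) ?l \<cdot>\<^bsub>P a\<^esub> ?u = \<eta> (\<theta> \<cdot>\<^bsub>K\<^esub> \<beta> \<cdot>\<^bsub>K\<^esub> \<alpha>) x" .
      have "far (R (\<theta> \<cdot>\<^bsub>K\<^esub> \<beta> \<cdot>\<^bsub>K\<^esub> \<alpha>)) ?r \<cdot>\<^bsub>P a\<^esub> ?u
          = far (R (\<theta> \<cdot>\<^bsub>K\<^esub> \<beta> \<cdot>\<^bsub>K\<^esub> \<alpha>)) (\<gamma> (\<theta> \<cdot>\<^bsub>K\<^esub> \<beta>) \<alpha> x) \<cdot>\<^bsub>P a\<^esub>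
            far (R \<alpha>) (far (R (\<theta> \<cdot>\<^bsub>K\<^esub> \<beta>)) (\<gamma> \<theta> \<beta> ?y) \<cdot>\<^bsub>P b\<^esub> (far (R \<beta>) (\<eta> \<theta> ?z) \<cdot>\<^bsub>P b\<^esub> \<eta> \<beta> ?y)) \<cdot>\<^bsub>P a\<^esub> \<eta> \<alpha> x"
        by (simp add: fc)
      also have "\<dots> = \<eta> (\<theta> \<cdot>\<^bsub>K\<^esub> \<beta> \<cdot>\<^bsub>K\<^esub> \<alpha>) x"
        unfolding g2(2) g4(2) ..
      finally show "far (R (\<theta> \<cdot>\<^bsub>K\<^esub> \<beta> \<cdot>\<^bsub>K\<^esub> \<alpha>)) ?l \<cdot>\<^bsub>P a\<^esub> ?u = far (R (\<theta> \<cdot>\<^bsub>K\<^esub> \<beta> \<cdot>\<^bsub>K\<^esub> \<alpha>)) ?r \<cdot>\<^bsub>P a\<^esub> ?u"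
        unfolding l ..
    qed (auto intro!: homI simp: zx)
  next
    fix a b \<alpha> x assume h: "\<alpha> \<in> hom K a b" and x: "x \<in> Obj (P a)"
    have ab: "a \<in> Obj K" "b \<in> Obj K" using K.obj_of_hom[OF h] .
    interpret Pa: category "P a" using P ab by blast
    interpret Pb: category "P b" using P ab by blast
    note hi = K.ident_hom[OF ab(1)] K.ident_hom[OF ab(2)]
    have [simp]: "\<alpha> \<cdot>\<^bsub>K\<^esub> Ident K a = \<alpha>" "Ident K b \<cdot>\<^bsub>K\<^esub> \<alpha> = \<alpha>"
      using h by (auto simp: hom_def)
    note g1 = gam[OF hi(1) h x, simplified] and g2 = gam[OF h hi(2) x, simplified]
    have Ri [simp]: "y \<in> Obj (P a) \<Longrightarrow> fob (R (Ident K a)) y = y" "y \<in> Obj (P b) \<Longrightarrow> fob (R (Ident K b)) y = y"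
       "f \<in> Arr (P a) \<Longrightarrow> far (R (Ident K a)) f = f" "f \<in> Arr (P b) \<Longrightarrow> far (R (Ident K b)) f = f" for y f
      using R_ident ab by blast+
    note [simp] = functor_arr[OF L[OF h]] functor_obj[OF L[OF h]]
      functor_arr[OF R[OF h]] functor_obj[OF R[OF h]]
      functor_arr[OF L[OF hi(1)]] functor_obj[OF L[OF hi(1)]]
      functor_arr[OF L[OF hi(2)]] functor_obj[OF L[OF hi(2)]]
      universal_arr[OF univ[OF h]] universal_arr[OF univ[OF hi(1)]] universal_arr[OF univ[OF hi(2)]]
      x homD[OF g1(1)] homD[OF g2(1)]
    have dx: "\<eta> (Ident K a) x \<in> hom (P a) x (fob (L (Ident K a)) x)"
      by (simp add: hom_def)
    show "\<gamma> \<alpha> (Ident K a) x \<cdot>\<^bsub>P b\<^esub> far (L \<alpha>) (\<eta> (Ident K a) x) = Ident (P b) (fob (L \<alpha>) x)"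
    proof (rule universal_eq[OF univ[OF h x] R[OF h]])
      have "far (R \<alpha>) (\<gamma> \<alpha> (Ident K a) x \<cdot>\<^bsub>P b\<^esub> far (L \<alpha>) (\<eta> (Ident K a) x)) \<cdot>\<^bsub>P a\<^esub> \<eta> \<alpha> x
          = far (R \<alpha>) (\<gamma> \<alpha> (Ident K a) x) \<cdot>\<^bsub>P a\<^esub> (far (R \<alpha>) (far (L \<alpha>) (\<eta> (Ident K a) x)) \<cdot>\<^bsub>P a\<^esub> \<eta> \<alpha> x)"
        by (simp add: functor_comp[OF R[OF h]])
      also have "\<dots> = far (R \<alpha>) (Ident (P b) (fob (L \<alpha>) x)) \<cdot>\<^bsub>P a\<^esub> \<eta> \<alpha> x"
        using g1(2) eta_nat[OF h dx] by (simp add: functor_ident[OF R[OF h]])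
      finally show "far (R \<alpha>) (\<gamma> \<alpha> (Ident K a) x \<cdot>\<^bsub>P b\<^esub> far (L \<alpha>) (\<eta> (Ident K a) x)) \<cdot>\<^bsub>P a\<^esub> \<eta> \<alpha> x = \<dots>" .
    qed (auto intro!: homI)
    show "\<gamma> (Ident K b) \<alpha> x \<cdot>\<^bsub>P b\<^esub> \<eta> (Ident K b) (fob (L \<alpha>) x) = Ident (P b) (fob (L \<alpha>) x)"
      by (rule universal_eq[OF univ[OF h x] R[OF h]])
        (use g2(2) in \<open>auto intro!: homI simp: functor_comp[OF R[OF h]] functor_ident[OF R[OF h]]\<close>)
  qed (use K P in auto)
  then show ?thesis by blast
qed

section \<open>Coequalizers\<close>

lemma coequalizerD:
  assumes "is_coequalizer C f g z q"
  shows "f \<in> hom C (Dom C f) (Dom C q)" "g \<in> hom C (Dom C f) (Dom C q)" "q \<in> hom C (Dom C q) z"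
    "q \<cdot>\<^bsub>C\<^esub> f = q \<cdot>\<^bsub>C\<^esub> g"
  using assms by (auto simp: is_coequalizer_def hom_def)

lemma coequalizer_arr:
  assumes "is_coequalizer C f g z q"
  shows "f \<in> Arr C" "g \<in> Arr C" "q \<in> Arr C" "Cod C f = Dom C q" "Dom C g = Dom C f" "Cod C g = Dom C q" "Cod C q = z"
  using coequalizerD[OF assms] by (auto simp: hom_def)

lemma coequalizer_ex1:
  assumes "is_coequalizer C f g z q" "k \<in> hom C (Dom C q) w" "k \<cdot>\<^bsub>C\<^esub> f = k \<cdot>\<^bsub>C\<^esub> g"
  shows "\<exists>!h. h \<in> hom C z w \<and> h \<cdot>\<^bsub>C\<^esub> q = k"
proof -
  obtain y where "q \<in> hom C y z" and u: "\<forall>w. \<forall>k \<in> hom C y w. k \<cdot>\<^bsub>C\<^esub> f = k \<cdot>\<^bsub>C\<^esub> g \<longrightarrow> (\<exists>!h. h \<in> hom C z w \<and> h \<cdot>\<^bsub>C\<^esub> q = k)"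
    using assms(1) unfolding is_coequalizer_def by blast
  then have "Dom C q = y"
    by (simp add: hom_def)
  with u assms(2,3) show ?thesis
    by simp
qed

lemma coequalizer_factor:
  assumes "is_coequalizer C f g z q" "k \<in> Arr C" "Dom C k = Dom C q" "k \<cdot>\<^bsub>C\<^esub> f = k \<cdot>\<^bsub>C\<^esub> g"
  obtains h where "h \<in> Arr C" "Dom C h = z" "Cod C h = Cod C k" "h \<cdot>\<^bsub>C\<^esub> q = k"
proof -
  have "\<exists>h. h \<in> hom C z (Cod C k) \<and> h \<cdot>\<^bsub>C\<^esub> q = k"
    using coequalizer_ex1[OF assms(1), of k "Cod C k"] assms(2-) by (simp add: hom_def) blast
  then show ?thesis
    using that by (auto simp: hom_def)
qed

lemma coequalizerI:
  assumes "f \<in> hom C x y" "g \<in> hom C x y" "q \<in> hom C y z" "q \<cdot>\<^bsub>C\<^esub> f = q \<cdot>\<^bsub>C\<^esub> g"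
    "\<And>k. k \<in> Arr C \<Longrightarrow> Dom C k = y \<Longrightarrow> k \<cdot>\<^bsub>C\<^esub> f = k \<cdot>\<^bsub>C\<^esub> g \<Longrightarrow>
      \<exists>!h. h \<in> hom C z (Cod C k) \<and> h \<cdot>\<^bsub>C\<^esub> q = k"
  shows "is_coequalizer C f g z q"
  unfolding is_coequalizer_def
proof (rule exI[of _ x], rule exI[of _ y], intro conjI allI ballI impI)
  fix w k assume k: "k \<in> hom C y w" "k \<cdot>\<^bsub>C\<^esub> f = k \<cdot>\<^bsub>C\<^esub> g"
  then show "\<exists>!h. h \<in> hom C z w \<and> h \<cdot>\<^bsub>C\<^esub> q = k"
    using assms(5)[of k] by (simp add: hom_def)
qed (use assms in simp_all)

lemma (in category) coequalizer_eq:
  assumes "is_coequalizer C f g z q" "h \<in> Arr C" "h' \<in> Arr C" "Dom C h = z" "Dom C h' = z"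
    "h \<cdot> q = h' \<cdot> q"
  shows "h = h'"
proof -
  note [simp] = coequalizer_arr[OF assms(1)] assms(2-5)
  have "Cod C h = Cod C (h \<cdot> q)" "Cod C (h' \<cdot> q) = Cod C h'"
    by simp_all
  then have c: "Cod C h' = Cod C h"
    using assms(6) by simp
  have "(h \<cdot> q) \<cdot> f = (h \<cdot> q) \<cdot> g"
    using coequalizerD(4)[OF assms(1)] by simp
  then have ex1: "\<exists>!k. k \<in> hom C z (Cod C h) \<and> k \<cdot> q = h \<cdot> q"
    by (intro coequalizer_ex1[OF assms(1)]) (simp_all add: hom_def)
  have "h \<in> hom C z (Cod C h)" "h' \<in> hom C z (Cod C h)"
    using c by (simp_all add: hom_def)
  then show ?thesis
    using ex1 assms(6) by (metis (no_types))
qed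

lemma (in category) coequalizer_precomp_iso:
  assumes q: "is_coequalizer C f g z q"
    and i: "is_iso C i" "Dom C i = x" "Cod C i = Dom C f"
    and j: "is_iso C j" "Dom C j = y" "Cod C j = Dom C q"
    and f': "f' \<in> hom C x y" "j \<cdot> f' = f \<cdot> i" and g': "g' \<in> hom C x y" "j \<cdot> g' = g \<cdot> i"
  shows "is_coequalizer C f' g' z (q \<cdot> j)"
proof -
  have inv: "f' \<cdot> iso_inv C i = iso_inv C j \<cdot> f" "g' \<cdot> iso_inv C i = iso_inv C j \<cdot> g"
  proof -
    note [simp] = coequalizer_arr[OF q] i j homD[OF f'(1)] homD[OF g'(1)] is_iso_arr[OF i(1)] is_iso_arr[OF j(1)]
    have "f' = iso_inv C j \<cdot> (f \<cdot> i)" "g' = iso_inv C j \<cdot> (g \<cdot> i)"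
      unfolding f'(2)[symmetric] g'(2)[symmetric] by simp_all
    then have "f' \<cdot> iso_inv C i = (iso_inv C j \<cdot> (f \<cdot> i)) \<cdot> iso_inv C i"
        "g' \<cdot> iso_inv C i = (iso_inv C j \<cdot> (g \<cdot> i)) \<cdot> iso_inv C i"
      by simp_all
    then show "f' \<cdot> iso_inv C i = iso_inv C j \<cdot> f" "g' \<cdot> iso_inv C i = iso_inv C j \<cdot> g"
      by (simp_all)
  qed
  note [simp] = coequalizer_arr[OF q] i j homD[OF f'(1)] homD[OF g'(1)] is_iso_arr[OF i(1)] is_iso_arr[OF j(1)]
  show ?thesis
  proof (rule coequalizerI[OF f'(1) g'(1)])
    show "(q \<cdot> j) \<cdot> f' = (q \<cdot> j) \<cdot> g'"
      using whisker[OF coequalizerD(4)[OF q], of i] by (simp add: f' g')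
  next
    fix k assume k [simp]: "k \<in> Arr C" "Dom C k = y" and e: "k \<cdot> f' = k \<cdot> g'"
    have "k \<cdot> (f' \<cdot> iso_inv C i) = k \<cdot> (g' \<cdot> iso_inv C i)"
      using whisker[OF e, of "iso_inv C i"] by simp
    then have "(k \<cdot> iso_inv C j) \<cdot> f = (k \<cdot> iso_inv C j) \<cdot> g"
      by (simp add: inv)
    then obtain h where h [simp]: "h \<in> Arr C" "Dom C h = z" "Cod C h = Cod C k" and hq: "h \<cdot> q = k \<cdot> iso_inv C j"
      using coequalizer_factor[OF q, of "k \<cdot> iso_inv C j"] by auto
    show "\<exists>!h. h \<in> hom C z (Cod C k) \<and> h \<cdot> (q \<cdot> j) = k"
    proof (rule ex1I[of _ h])
      show "h \<in> hom C z (Cod C k) \<and> h \<cdot> (q \<cdot> j) = k"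
        using whisker[OF hq, of j] by (simp add: hom_def)
    next
      fix h' assume h': "h' \<in> hom C z (Cod C k) \<and> h' \<cdot> (q \<cdot> j) = k"
      then have [simp]: "h' \<in> Arr C" "Dom C h' = z" by (auto simp: hom_def)
      have "h' \<cdot> q = (h' \<cdot> (q \<cdot> j)) \<cdot> iso_inv C j"
        by simp
      also have "\<dots> = h \<cdot> q"
        using h' hq by simp
      finally show "h' = h"
        by (rule coequalizer_eq[OF q, rotated 4]) simp_all
    qed
  qed (auto intro!: homI)
qed

lemma (in category) coequalizer_postcomp_iso:
  assumes q: "is_coequalizer C f g z q" and e: "is_iso C e" "Dom C e = z"
  shows "is_coequalizer C f g (Cod C e) (e \<cdot> q)"
proof (rule coequalizerI[OF coequalizerD(1,2)[OF q]])
  note [simp] = coequalizer_arr[OF q] e is_iso_arr[OF e(1)]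
  show "e \<cdot> q \<in> hom C (Dom C q) (Cod C e)"
    by (simp add: hom_def)
  show "(e \<cdot> q) \<cdot> f = (e \<cdot> q) \<cdot> g"
    by (simp add: coequalizerD(4)[OF q])
  fix k assume k [simp]: "k \<in> Arr C" "Dom C k = Dom C q" and c: "k \<cdot> f = k \<cdot> g"
  obtain h where h [simp]: "h \<in> Arr C" "Dom C h = z" "Cod C h = Cod C k" and hq: "h \<cdot> q = k"
    by (rule coequalizer_factor[OF q k c])
  show "\<exists>!h. h \<in> hom C (Cod C e) (Cod C k) \<and> h \<cdot> (e \<cdot> q) = k"
  proof (rule ex1I[of _ "h \<cdot> iso_inv C e"])
    show "h \<cdot> iso_inv C e \<in> hom C (Cod C e) (Cod C k) \<and> (h \<cdot> iso_inv C e) \<cdot> (e \<cdot> q) = k"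
      by (simp add: hom_def hq)
  next
    fix h' assume h': "h' \<in> hom C (Cod C e) (Cod C k) \<and> h' \<cdot> (e \<cdot> q) = k"
    then have [simp]: "h' \<in> Arr C" "Dom C h' = Cod C e" "Cod C h' = Cod C k" by (auto simp: hom_def)
    have "h' \<cdot> e = h"
      by (rule coequalizer_eq[OF q]) (use h' hq in simp_all)
    then have "(h' \<cdot> e) \<cdot> iso_inv C e = h \<cdot> iso_inv C e"
      by simp
    then show "h' = h \<cdot> iso_inv C e"
      by simp
  qed
qed

text \<open>The shape of a parallel pair, drawn in an arbitrary type with four elements: two identities,
  named like the objects \<open>u\<close> and \<open>v\<close>, and two arrows \<open>s\<close>, \<open>t\<close> from \<open>u\<close> to \<open>v\<close>.\<close>

definition parallel_pair :: "'u \<Rightarrow> 'u \<Rightarrow> 'u \<Rightarrow> 'u \<Rightarrow> ('u, 'u) category" where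
  "parallel_pair u v s t = \<lparr>Obj = {u, v}, Arr = {u, v, s, t},
    Dom = (\<lambda>f. if f = v then v else u), Cod = (\<lambda>f. if f = u then u else v),
    Ident = (\<lambda>x. x), Comp = (\<lambda>g f. if f = u \<or> f = v then g else f)\<rparr>"

definition parallel_diagram ::
  "('o, 'm, 'z) category_scheme \<Rightarrow> 'u \<Rightarrow> 'u \<Rightarrow> 'u \<Rightarrow> 'u \<Rightarrow> 'm \<Rightarrow> 'm \<Rightarrow> ('u, 'u, 'o, 'm) func" where
  "parallel_diagram C u v s t f g = \<lparr>fob = (\<lambda>x. if x = u then Dom C f else Cod C f),
    far = (\<lambda>x. if x = u then Ident C (Dom C f) else if x = v then Ident C (Cod C f)
      else if x = s then f else g)\<rparr>"

lemma small_parallel_pair: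
  assumes "infinite (UNIV :: 'u set)" "distinct [u, v, s, t :: 'u]"
  shows "small_cat (parallel_pair u v s t)"
proof -
  have [simp]: "u \<noteq> v" "v \<noteq> u" "u \<noteq> s" "v \<noteq> s" "u \<noteq> t" "v \<noteq> t" "s \<noteq> u" "s \<noteq> v" "t \<noteq> u" "t \<noteq> v"
    using assms(2) by auto
  have Arr: "Arr (parallel_pair u v s t) = {u, v, s, t}"
    by (simp add: parallel_pair_def)
  have "category (parallel_pair u v s t)"
  proof (rule categoryI)
    fix f g assume "f \<in> Arr (parallel_pair u v s t)" "g \<in> Arr (parallel_pair u v s t)"
      "Dom (parallel_pair u v s t) g = Cod (parallel_pair u v s t) f"
    then show "g \<cdot>\<^bsub>parallel_pair u v s t\<^esub> f \<in> hom (parallel_pair u v s t)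
        (Dom (parallel_pair u v s t) f) (Cod (parallel_pair u v s t) g)"
      unfolding Arr by (elim insertE emptyE; simp add: parallel_pair_def hom_def)
  qed (auto simp: parallel_pair_def hom_def)
  moreover have "{u, v, s, t} \<prec> (UNIV :: 'u set)"
    using assms(1) by (intro finite_lesspoll_infinite) auto
  ultimately show ?thesis
    by (simp add: small_cat_def parallel_pair_def)
qed

lemma functor_parallel_diagram:
  assumes C: "category C" and d: "distinct [u, v, s, t]" and f: "f \<in> hom C x y" "g \<in> hom C x y"
    and J: "category (parallel_pair u v s t)"
  shows "is_functor (parallel_pair u v s t) C (parallel_diagram C u v s t f g)"
proof -
  interpret category C by (rule C)
  note [simp] = homD[OF f(1)] homD[OF f(2)]
  have [simp]: "u \<noteq> v" "v \<noteq> u" "u \<noteq> s" "v \<noteq> s" "u \<noteq> t" "v \<noteq> t" "s \<noteq> u" "s \<noteq> v" "t \<noteq> u" "t \<noteq> v" "t \<noteq> s"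
    using d by auto
  have [simp]: "x \<in> Obj C" "y \<in> Obj C" using obj_of_hom[OF f(1)] .
  let ?J = "parallel_pair u v s t" and ?D = "parallel_diagram C u v s t f g"
  have Arr: "Arr ?J = {u, v, s, t}"
    by (simp add: parallel_pair_def)
  show ?thesis
  proof (rule is_functorI[OF J C])
    fix h assume "h \<in> Arr ?J"
    then show "far ?D h \<in> hom C (fob ?D (Dom ?J h)) (fob ?D (Cod ?J h))"
      unfolding Arr by (elim insertE emptyE; simp add: parallel_pair_def parallel_diagram_def hom_def)
  next
    fix h k assume "h \<in> Arr ?J" "k \<in> Arr ?J" "Cod ?J h = Dom ?J k"
    then show "far ?D (k \<cdot>\<^bsub>?J\<^esub> h) = far ?D k \<cdot>\<^bsub>C\<^esub> far ?D h"
      unfolding Arr by (elim insertE emptyE; simp add: parallel_pair_def parallel_diagram_def)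
  qed (auto simp: parallel_pair_def parallel_diagram_def)
qed

text \<open>Coequalizers are colimits of this shape: the component of a cocone at \<open>v\<close> determines the one
  at \<open>u\<close>.\<close>

lemma cocone_parallel_iff:
  assumes "category C" "distinct [u, v, s, t]" "f \<in> hom C x y" "g \<in> hom C x y"
  shows "is_cocone (parallel_pair u v s t) C (parallel_diagram C u v s t f g) z i \<longleftrightarrow>
    i v \<in> hom C y z \<and> i u = i v \<cdot>\<^bsub>C\<^esub> f \<and> i v \<cdot>\<^bsub>C\<^esub> f = i v \<cdot>\<^bsub>C\<^esub> g"
proof -
  interpret category C by fact
  note [simp] = homD[OF assms(3)] homD[OF assms(4)]
  have "x \<in> Obj C" "y \<in> Obj C" using obj_of_hom[OF assms(3)] .
  moreover have "u \<noteq> v" "v \<noteq> u" "s \<noteq> u" "s \<noteq> v" "t \<noteq> u" "t \<noteq> v" "t \<noteq> s"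
    using assms(2) by auto
  ultimately show ?thesis
    unfolding is_cocone_def parallel_diagram_def parallel_pair_def
    by (auto simp: hom_def)
qed

lemma colimit_parallel_iff:
  assumes C: "category C" "distinct [u, v, s, t]" "f \<in> hom C x y" "g \<in> hom C x y"
  shows "is_colimit (parallel_pair u v s t) C (parallel_diagram C u v s t f g) z i \<longleftrightarrow>
    is_coequalizer C f g z (i v) \<and> i u = i v \<cdot>\<^bsub>C\<^esub> f"
proof -
  interpret category C by fact
  note [simp] = homD[OF C(3)] homD[OF C(4)]
  let ?J = "parallel_pair u v s t" and ?D = "parallel_diagram C u v s t f g"
  have uv: "u \<noteq> v" using C(2) by simp
  have ObjJ: "Obj ?J = {u, v}" by (simp add: parallel_pair_def)
  note cc = cocone_parallel_iff[OF C]
  show ?thesis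
  proof
    assume col: "is_colimit ?J C ?D z i"
    then have i: "i v \<in> hom C y z" "i u = i v \<cdot>\<^bsub>C\<^esub> f" "i v \<cdot>\<^bsub>C\<^esub> f = i v \<cdot>\<^bsub>C\<^esub> g"
      unfolding is_colimit_def cc by blast+
    note [simp] = homD[OF i(1)]
    have "is_coequalizer C f g z (i v)"
    proof (rule coequalizerI[OF C(3,4) i(1,3)])
      fix k assume k: "k \<in> Arr C" "Dom C k = y" "k \<cdot>\<^bsub>C\<^esub> f = k \<cdot>\<^bsub>C\<^esub> g"
      let ?q = "\<lambda>j. if j = v then k else k \<cdot>\<^bsub>C\<^esub> f"
      have "is_cocone ?J C ?D (Cod C k) ?q"
        unfolding cc using k uv by (simp add: hom_def)
      then have "\<exists>!h. h \<in> hom C z (Cod C k) \<and> (\<forall>j \<in> Obj ?J. h \<cdot>\<^bsub>C\<^esub> i j = ?q j)"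
        using col unfolding is_colimit_def by blast
      moreover have "(h \<in> hom C z (Cod C k) \<and> (\<forall>j \<in> Obj ?J. h \<cdot>\<^bsub>C\<^esub> i j = ?q j)) \<longleftrightarrow>
          (h \<in> hom C z (Cod C k) \<and> h \<cdot>\<^bsub>C\<^esub> i v = k)" for h
        using uv i(2) by (auto simp: ObjJ hom_def simp flip: assoc_comp)
      ultimately show "\<exists>!h. h \<in> hom C z (Cod C k) \<and> h \<cdot>\<^bsub>C\<^esub> i v = k"
        by simp
    qed
    then show "is_coequalizer C f g z (i v) \<and> i u = i v \<cdot>\<^bsub>C\<^esub> f"
      using i(2) by blast
  next
    assume "is_coequalizer C f g z (i v) \<and> i u = i v \<cdot>\<^bsub>C\<^esub> f"
    then have ce: "is_coequalizer C f g z (i v)" and iu: "i u = i v \<cdot>\<^bsub>C\<^esub> f" by blast+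
    have [simp]: "Dom C (i v) = y"
      using coequalizer_arr[OF ce] by simp
    note [simp] = coequalizer_arr(3,7)[OF ce]
    show "is_colimit ?J C ?D z i"
      unfolding is_colimit_def
    proof (intro conjI allI impI)
      show "is_cocone ?J C ?D z i"
        unfolding cc using iu coequalizerD(4)[OF ce] by (simp add: hom_def)
    next
      fix w k assume "is_cocone ?J C ?D w k"
      then have k: "k v \<in> hom C y w" "k u = k v \<cdot>\<^bsub>C\<^esub> f" "k v \<cdot>\<^bsub>C\<^esub> f = k v \<cdot>\<^bsub>C\<^esub> g"
        unfolding cc by blast+
      have "(h \<in> hom C z w \<and> (\<forall>j \<in> Obj ?J. h \<cdot>\<^bsub>C\<^esub> i j = k j)) \<longleftrightarrow> (h \<in> hom C z w \<and> h \<cdot>\<^bsub>C\<^esub> i v = k v)" for h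
        using uv iu k(2) by (auto simp: ObjJ hom_def simp flip: assoc_comp)
      then show "\<exists>!h. h \<in> hom C z w \<and> (\<forall>j \<in> Obj ?J. h \<cdot>\<^bsub>C\<^esub> i j = k j)"
        using coequalizer_ex1[OF ce, of "k v" w] k by simp
    qed
  qed
qed

lemma infinite_distinct4:
  assumes "infinite (UNIV :: 'u set)"
  obtains u v s t :: 'u where "distinct [u, v, s, t]"
proof -
  obtain S :: "'u set" where S: "card S = 4" "finite S"
    using infinite_arbitrarily_large[OF assms] by blast
  obtain xs where xs: "set xs = S" "distinct xs"
    using finite_distinct_list[OF S(2)] by blast
  then have "length xs = 4"
    using S(1) distinct_card by fastforce
  then show ?thesis
    using xs(2) that by (auto simp: numeral_eq_Suc length_Suc_conv)
qed

lemma cocomplete_coequalizer: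
  assumes inf: "infinite (UNIV :: 'u set)" and C: "cocomplete TYPE('u) C"
    and f: "f \<in> hom C x y" "g \<in> hom C x y"
  obtains z q where "is_coequalizer C f g z q"
proof -
  from inf obtain u v s t :: 'u where d: "distinct [u, v, s, t]"
    by (rule infinite_distinct4)
  have cat: "category C"
    using C by (simp add: cocomplete_def)
  have J: "small_cat (parallel_pair u v s t)"
    using small_parallel_pair[OF inf d] .
  then have "is_functor (parallel_pair u v s t) C (parallel_diagram C u v s t f g)"
    using functor_parallel_diagram[OF cat d f] by (simp add: small_cat_def)
  then obtain z i where "is_colimit (parallel_pair u v s t) C (parallel_diagram C u v s t f g) z i"
    using C J unfolding cocomplete_def by blast
  then show ?thesis
    using that colimit_parallel_iff[OF cat d f] by blast
qed

lemma preserves_coequalizer: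
  assumes inf: "infinite (UNIV :: 'u set)" and F: "preserves_colimits TYPE('u) C D F"
    and q: "is_coequalizer C f g z q"
  shows "is_coequalizer D (far F f) (far F g) (fob F z) (far F q)"
proof -
  from inf obtain u v s t :: 'u where d: "distinct [u, v, s, t]"
    by (rule infinite_distinct4)
  have Ff: "is_functor C D F"
    using F by (simp add: preserves_colimits_def)
  then have cat: "category C" and cat': "category D"
    by (simp_all add: is_functor_def)
  interpret C: category C by fact
  note [simp] = coequalizer_arr[OF q] functor_arr[OF Ff]
  let ?J = "parallel_pair u v s t" and ?D = "parallel_diagram C u v s t f g"
  let ?i = "\<lambda>j. if j = v then q else q \<cdot>\<^bsub>C\<^esub> f"
  note f = coequalizerD(1,2)[OF q]
  have J: "small_cat ?J"
    using small_parallel_pair[OF inf d] .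
  then have "is_functor ?J C ?D"
    using functor_parallel_diagram[OF cat d f] by (simp add: small_cat_def)
  moreover have "is_colimit ?J C ?D z ?i"
    using q d by (simp add: colimit_parallel_iff[OF cat d f])
  ultimately have col: "is_colimit ?J D (F \<circ>\<circ> ?D) (fob F z) (\<lambda>j. far F (?i j))"
    using F J unfolding preserves_colimits_def by blast
  have "F \<circ>\<circ> ?D = parallel_diagram D u v s t (far F f) (far F g)"
    by (auto simp: comp_func_def parallel_diagram_def functor_ident[OF Ff] fun_eq_iff)
  with col have "is_colimit ?J D (parallel_diagram D u v s t (far F f) (far F g)) (fob F z) (\<lambda>j. far F (?i j))"
    by simp
  moreover have "far F f \<in> hom D (fob F (Dom C f)) (fob F (Dom C q))"
    "far F g \<in> hom D (fob F (Dom C f)) (fob F (Dom C q))"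
    by (simp_all add: hom_def)
  ultimately show ?thesis
    using colimit_parallel_iff[OF cat' d] by fastforce
qed

text \<open>Transposition turns the arrows out of \<open>F y\<close> that coequalize \<open>F f\<close> and \<open>F g\<close> into the arrows out of
  \<open>y\<close> that coequalize \<open>f\<close> and \<open>g\<close>.\<close>

lemma left_adjoint_preserves_coequalizer:
  assumes adj: "left_adjoint C D F G" and q: "is_coequalizer C f g z q"
  shows "is_coequalizer D (far F f) (far F g) (fob F z) (far F q)"
proof -
  have F: "is_functor C D F" and G: "is_functor D C G"
    using adj by (simp_all add: left_adjoint_def)
  interpret C: category C using F by (simp add: is_functor_def)
  interpret D: category D using F by (simp add: is_functor_def)
  obtain \<eta> where u: "\<And>x. x \<in> Obj C \<Longrightarrow> universal C D G x (fob F x) (\<eta> x)"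
    and nat: "\<And>f. f \<in> Arr C \<Longrightarrow> \<eta> (Cod C f) \<cdot>\<^bsub>C\<^esub> f = far G (far F f) \<cdot>\<^bsub>C\<^esub> \<eta> (Dom C f)"
    by (rule left_adjoint_universal[OF adj]) blast
  have z [simp]: "z \<in> Obj C" using C.obj_of_hom coequalizerD(3)[OF q] by blast
  note [simp] = coequalizer_arr[OF q] functor_arr[OF F] functor_obj[OF F] functor_arr[OF G] functor_obj[OF G]
    universal_arr[OF u]
  show ?thesis
  proof (rule coequalizerI)
    show "far F f \<in> hom D (fob F (Dom C f)) (fob F (Dom C q))"
      "far F g \<in> hom D (fob F (Dom C f)) (fob F (Dom C q))"
      "far F q \<in> hom D (fob F (Dom C q)) (fob F z)"
      by (simp_all add: hom_def)
    show "far F q \<cdot>\<^bsub>D\<^esub> far F f = far F q \<cdot>\<^bsub>D\<^esub> far F g"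
      using coequalizerD(4)[OF q] by (simp flip: functor_comp[OF F])
  next
    fix k assume k [simp]: "k \<in> Arr D" "Dom D k = fob F (Dom C q)" and e: "k \<cdot>\<^bsub>D\<^esub> far F f = k \<cdot>\<^bsub>D\<^esub> far F g"
    let ?k = "far G k \<cdot>\<^bsub>C\<^esub> \<eta> (Dom C q)"
    have "?k \<cdot>\<^bsub>C\<^esub> f = far G (k \<cdot>\<^bsub>D\<^esub> far F f) \<cdot>\<^bsub>C\<^esub> \<eta> (Dom C f)"
      using nat[of f] by (simp add: functor_comp[OF G])
    also have "\<dots> = ?k \<cdot>\<^bsub>C\<^esub> g"
      unfolding e using nat[of g] by (simp add: functor_comp[OF G])
    finally obtain h' where h' [simp]: "h' \<in> Arr C" "Dom C h' = z" "Cod C h' = fob G (Cod D k)"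
      and hq: "h' \<cdot>\<^bsub>C\<^esub> q = ?k"
      using coequalizer_factor[OF q, of ?k] by auto
    obtain h where h: "h \<in> hom D (fob F z) (Cod D k)" and hh: "far G h \<cdot>\<^bsub>C\<^esub> \<eta> z = h'"
      using universal_ex[OF u[of z], of "Cod D k" h'] by (auto simp: hom_def)
    note [simp] = homD[OF h]
    have iff: "l \<cdot>\<^bsub>D\<^esub> far F q = k \<longleftrightarrow> (far G l \<cdot>\<^bsub>C\<^esub> \<eta> z) \<cdot>\<^bsub>C\<^esub> q = ?k" if l: "l \<in> hom D (fob F z) (Cod D k)" for l
    proof -
      note [simp] = homD[OF l]
      have e: "far G (l \<cdot>\<^bsub>D\<^esub> far F q) \<cdot>\<^bsub>C\<^esub> \<eta> (Dom C q) = (far G l \<cdot>\<^bsub>C\<^esub> \<eta> z) \<cdot>\<^bsub>C\<^esub> q"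
        using nat[of q] by (simp add: functor_comp[OF G])
      show ?thesis
        using universal_eq[OF u[of "Dom C q"] G, of "l \<cdot>\<^bsub>D\<^esub> far F q" "Cod D k" k] e
        by (auto simp: hom_def)
    qed
    show "\<exists>!h. h \<in> hom D (fob F z) (Cod D k) \<and> h \<cdot>\<^bsub>D\<^esub> far F q = k"
    proof (rule ex1I[of _ h])
      show "h \<in> hom D (fob F z) (Cod D k) \<and> h \<cdot>\<^bsub>D\<^esub> far F q = k"
        using h iff[OF h] hh hq by simp
    next
      fix l assume l: "l \<in> hom D (fob F z) (Cod D k) \<and> l \<cdot>\<^bsub>D\<^esub> far F q = k"
      note [simp] = homD[OF conjunct1[OF l]]
      have "(far G l \<cdot>\<^bsub>C\<^esub> \<eta> z) \<cdot>\<^bsub>C\<^esub> q = h' \<cdot>\<^bsub>C\<^esub> q"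
        using l iff[of l] hq by simp
      then have "far G l \<cdot>\<^bsub>C\<^esub> \<eta> z = h'"
        by (rule C.coequalizer_eq[OF q, rotated 4]) simp_all
      then show "l = h"
        using universal_eq[OF u[of z] G, of l "Cod D k" h] hh l h by simp
    qed
  qed
qed

section \<open>Tensor products, commutative monoids and actions\<close>

context symmetric_monoidal_category
begin

lemma tensor_obj [simp]: "a \<in> Obj C \<Longrightarrow> b \<in> Obj C \<Longrightarrow> a \<otimes> b \<in> Obj C"
  using functor_obj[OF tensor_functor, of "(a, b)"] by (simp add: prod_cat_def)

lemma tensor_arr [simp]:
  assumes "f \<in> Arr C" "g \<in> Arr C"
  shows "f \<otimes>\<^sub>a g \<in> Arr C" "Dom C (f \<otimes>\<^sub>a g) = Dom C f \<otimes> Dom C g" "Cod C (f \<otimes>\<^sub>a g) = Cod C f \<otimes> Cod C g"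
  using functor_arr[OF tensor_functor, of "(f, g)"] assms by (simp_all add: prod_cat_def)

lemma tensor_ident [simp]: "a \<in> Obj C \<Longrightarrow> b \<in> Obj C \<Longrightarrow> Ident C a \<otimes>\<^sub>a Ident C b = Ident C (a \<otimes> b)"
  using functor_ident[OF tensor_functor, of "(a, b)"] by (simp add: prod_cat_def)

lemma tensor_comp:
  assumes "f \<in> Arr C" "g \<in> Arr C" "Dom C g = Cod C f" "f' \<in> Arr C" "g' \<in> Arr C" "Dom C g' = Cod C f'"
  shows "(g \<otimes>\<^sub>a g') \<cdot> (f \<otimes>\<^sub>a f') = (g \<cdot> f) \<otimes>\<^sub>a (g' \<cdot> f')"
  using functor_comp[OF tensor_functor, of "(f, f')" "(g, g')"] assms by (simp add: prod_cat_def)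

lemma assoc_arr [simp]:
  assumes "a \<in> Obj C" "b \<in> Obj C" "c \<in> Obj C"
  shows "assoc C a b c \<in> Arr C" "Dom C (assoc C a b c) = a \<otimes> (b \<otimes> c)"
    "Cod C (assoc C a b c) = (a \<otimes> b) \<otimes> c" "is_iso C (assoc C a b c)"
  using assoc_hom[OF assms] assoc_iso[OF assms] by (auto simp: hom_def)

lemma unitor_arr [simp]:
  assumes "a \<in> Obj C"
  shows "lunit C a \<in> Arr C" "Dom C (lunit C a) = \<one> \<otimes> a" "Cod C (lunit C a) = a" "is_iso C (lunit C a)"
    "runit C a \<in> Arr C" "Dom C (runit C a) = a \<otimes> \<one>" "Cod C (runit C a) = a" "is_iso C (runit C a)"
  using lunit_hom[OF assms] lunit_iso[OF assms] runit_hom[OF assms] runit_iso[OF assms]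
  by (auto simp: hom_def)

lemma symm_arr [simp]:
  assumes "a \<in> Obj C" "b \<in> Obj C"
  shows "symm C a b \<in> Arr C" "Dom C (symm C a b) = a \<otimes> b" "Cod C (symm C a b) = b \<otimes> a"
  using symm_hom[OF assms] by (auto simp: hom_def)

declare unit_obj [simp] symm_symm [simp]

end

lemma comm_monoidD:
  assumes "is_comm_monoid C A"
  shows "carr A \<in> Obj C" "mult A \<in> Arr C" "Dom C (mult A) = carr A \<otimes>\<^bsub>C\<^esub> carr A" "Cod C (mult A) = carr A"
    "unt A \<in> Arr C" "Dom C (unt A) = \<one>\<^bsub>C\<^esub>" "Cod C (unt A) = carr A"
    and "mult A \<cdot>\<^bsub>C\<^esub> (mult A \<otimes>\<^sub>a\<^bsub>C\<^esub> Ident C (carr A)) \<cdot>\<^bsub>C\<^esub> assoc C (carr A) (carr A) (carr A) =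
      mult A \<cdot>\<^bsub>C\<^esub> (Ident C (carr A) \<otimes>\<^sub>a\<^bsub>C\<^esub> mult A)"
    "mult A \<cdot>\<^bsub>C\<^esub> (unt A \<otimes>\<^sub>a\<^bsub>C\<^esub> Ident C (carr A)) = lunit C (carr A)"
    "mult A \<cdot>\<^bsub>C\<^esub> (Ident C (carr A) \<otimes>\<^sub>a\<^bsub>C\<^esub> unt A) = runit C (carr A)"
    "mult A \<cdot>\<^bsub>C\<^esub> symm C (carr A) (carr A) = mult A"
  using assms by (cases A; simp add: is_comm_monoid_def hom_def)+

lemma comm_homD:
  assumes "\<alpha> \<in> hom (Comm C) A B"
  shows "is_comm_monoid C A" "is_comm_monoid C B" "sdom \<alpha> = A" "scod \<alpha> = B"
    "und \<alpha> \<in> Arr C" "Dom C (und \<alpha>) = carr A" "Cod C (und \<alpha>) = carr B"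
    "und \<alpha> \<cdot>\<^bsub>C\<^esub> mult A = mult B \<cdot>\<^bsub>C\<^esub> (und \<alpha> \<otimes>\<^sub>a\<^bsub>C\<^esub> und \<alpha>)" "und \<alpha> \<cdot>\<^bsub>C\<^esub> unt A = unt B"
  using assms by (auto simp: hom_def Comm_def is_monoid_hom_def)

lemma comm_homI:
  assumes "is_comm_monoid C A" "is_comm_monoid C B" "f \<in> hom C (carr A) (carr B)"
    "f \<cdot>\<^bsub>C\<^esub> mult A = mult B \<cdot>\<^bsub>C\<^esub> (f \<otimes>\<^sub>a\<^bsub>C\<^esub> f)" "f \<cdot>\<^bsub>C\<^esub> unt A = unt B"
  shows "SArr A f B \<in> hom (Comm C) A B"
  using assms by (auto simp: hom_def Comm_def is_monoid_hom_def)

lemma Comm_simps [simp]: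
  "Obj (Comm C) = {A. is_comm_monoid C A}" "Dom (Comm C) = sdom" "Cod (Comm C) = scod"
  "Ident (Comm C) A = SArr A (Ident C (carr A)) A"
  "\<beta> \<cdot>\<^bsub>Comm C\<^esub> \<alpha> = SArr (sdom \<alpha>) (und \<beta> \<cdot>\<^bsub>C\<^esub> und \<alpha>) (scod \<beta>)"
  by (simp_all add: Comm_def)

lemma Comm_arr_hom: "\<alpha> \<in> Arr (Comm C) \<Longrightarrow> \<alpha> \<in> hom (Comm C) (sdom \<alpha>) (scod \<alpha>)"
  by (simp add: hom_def)

lemma (in symmetric_monoidal_category) category_Comm: "category (Comm C)"
proof (rule categoryI)
  fix \<alpha> \<beta> assume "\<alpha> \<in> Arr (Comm C)" "\<beta> \<in> Arr (Comm C)" "Dom (Comm C) \<beta> = Cod (Comm C) \<alpha>"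
  note a = comm_homD[OF Comm_arr_hom[OF this(1)]] comm_homD[OF Comm_arr_hom[OF this(2)]] this(3)
  have [simp]: "scod \<alpha> = sdom \<beta>" using a by simp
  note [simp] = a(1,5-7,10,11,14-16) comm_monoidD(1-7)[OF a(1)] comm_monoidD(1-7)[OF a(10)] comm_monoidD(1-7)[OF a(11)]
  have "und \<beta> \<cdot> und \<alpha> \<cdot> mult (sdom \<alpha>) = (und \<beta> \<cdot> mult (sdom \<beta>)) \<cdot> (und \<alpha> \<otimes>\<^sub>a und \<alpha>)"
    using a(8) by simp
  also have "\<dots> = mult (scod \<beta>) \<cdot> ((und \<beta> \<cdot> und \<alpha>) \<otimes>\<^sub>a (und \<beta> \<cdot> und \<alpha>))"
    unfolding a(17) by (simp flip: tensor_comp)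
  finally have "SArr (sdom \<alpha>) (und \<beta> \<cdot> und \<alpha>) (scod \<beta>) \<in> hom (Comm C) (sdom \<alpha>) (scod \<beta>)"
    using a(9,18) by (intro comm_homI homI) simp_all
  then show "\<beta> \<cdot>\<^bsub>Comm C\<^esub> \<alpha> \<in> hom (Comm C) (Dom (Comm C) \<alpha>) (Cod (Comm C) \<beta>)"
    by simp
next
  fix A assume "A \<in> Obj (Comm C)"
  then show "Ident (Comm C) A \<in> hom (Comm C) A A"
    using comm_monoidD(1-7)[of C A] by (simp, intro comm_homI homI) simp_all
next
  fix \<alpha> assume "\<alpha> \<in> Arr (Comm C)"
  note a = comm_homD(5-7)[OF Comm_arr_hom[OF this]]
  from a show "\<alpha> \<cdot>\<^bsub>Comm C\<^esub> Ident (Comm C) (Dom (Comm C) \<alpha>) = \<alpha>" by simp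
  from a show "Ident (Comm C) (Cod (Comm C) \<alpha>) \<cdot>\<^bsub>Comm C\<^esub> \<alpha> = \<alpha>" by simp
next
  fix \<alpha> \<beta> \<gamma> assume h: "\<alpha> \<in> Arr (Comm C)" "\<beta> \<in> Arr (Comm C)" "\<gamma> \<in> Arr (Comm C)"
    "Dom (Comm C) \<beta> = Cod (Comm C) \<alpha>" "Dom (Comm C) \<gamma> = Cod (Comm C) \<beta>"
  then show "(\<gamma> \<cdot>\<^bsub>Comm C\<^esub> \<beta>) \<cdot>\<^bsub>Comm C\<^esub> \<alpha> = \<gamma> \<cdot>\<^bsub>Comm C\<^esub> (\<beta> \<cdot>\<^bsub>Comm C\<^esub> \<alpha>)"
    using comm_homD(5-7)[OF Comm_arr_hom[OF h(1)]] comm_homD(5-7)[OF Comm_arr_hom[OF h(2)]]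
      comm_homD(5-7)[OF Comm_arr_hom[OF h(3)]]
    by simp
qed (auto dest: Comm_arr_hom[THEN comm_homD(1)] Comm_arr_hom[THEN comm_homD(2)])

context left_actegory
begin

abbreviation comp_M (infixr "\<bullet>" 70) where "g \<bullet> f \<equiv> g \<cdot>\<^bsub>M\<^esub> f"
abbreviation ract (infixr "\<lhd>" 73) where "f \<lhd> m \<equiv> f \<boxtimes>\<^sub>a\<^bsub>M\<^esub> Ident M m"

lemma act_obj [simp]: "a \<in> Obj C \<Longrightarrow> m \<in> Obj M \<Longrightarrow> a \<boxtimes>\<^bsub>M\<^esub> m \<in> Obj M"
  using functor_obj[OF act_functor, of "(a, m)"] by (simp add: prod_cat_def)

lemma act_arr [simp]:
  assumes "f \<in> Arr C" "g \<in> Arr M"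
  shows "f \<boxtimes>\<^sub>a\<^bsub>M\<^esub> g \<in> Arr M" "Dom M (f \<boxtimes>\<^sub>a\<^bsub>M\<^esub> g) = Dom C f \<boxtimes>\<^bsub>M\<^esub> Dom M g"
    "Cod M (f \<boxtimes>\<^sub>a\<^bsub>M\<^esub> g) = Cod C f \<boxtimes>\<^bsub>M\<^esub> Cod M g"
  using functor_arr[OF act_functor, of "(f, g)"] assms by (simp_all add: prod_cat_def)

lemma act_ident [simp]:
  "a \<in> Obj C \<Longrightarrow> m \<in> Obj M \<Longrightarrow> Ident C a \<lhd> m = Ident M (a \<boxtimes>\<^bsub>M\<^esub> m)"
  using functor_ident[OF act_functor, of "(a, m)"] by (simp add: prod_cat_def)

lemma act_comp:
  assumes "f \<in> Arr C" "g \<in> Arr C" "Dom C g = Cod C f" "f' \<in> Arr M" "g' \<in> Arr M" "Dom M g' = Cod M f'"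
  shows "(g \<boxtimes>\<^sub>a\<^bsub>M\<^esub> g') \<bullet> (f \<boxtimes>\<^sub>a\<^bsub>M\<^esub> f') = (g \<cdot> f) \<boxtimes>\<^sub>a\<^bsub>M\<^esub> (g' \<bullet> f')"
  using functor_comp[OF act_functor, of "(f, f')" "(g, g')"] assms by (simp add: prod_cat_def)

lemma act_assoc_arr [simp]:
  assumes "a \<in> Obj C" "b \<in> Obj C" "m \<in> Obj M"
  shows "act_assoc M a b m \<in> Arr M" "Dom M (act_assoc M a b m) = a \<boxtimes>\<^bsub>M\<^esub> (b \<boxtimes>\<^bsub>M\<^esub> m)"
    "Cod M (act_assoc M a b m) = (a \<otimes> b) \<boxtimes>\<^bsub>M\<^esub> m" "is_iso M (act_assoc M a b m)"
  using act_assoc_hom[OF assms] act_assoc_iso[OF assms] by (auto simp: hom_def)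

lemma act_unit_arr [simp]:
  assumes "m \<in> Obj M"
  shows "act_unit M m \<in> Arr M" "Dom M (act_unit M m) = \<one> \<boxtimes>\<^bsub>M\<^esub> m"
    "Cod M (act_unit M m) = m" "is_iso M (act_unit M m)"
  using act_unit_hom[OF assms] act_unit_iso[OF assms] by (auto simp: hom_def)

section \<open>The monad of a monoid\<close>

text \<open>A monoid \<open>a\<close> acts on \<open>M\<close> through the monad \<open>a \<boxtimes> _\<close>, with multiplication \<open>mu\<close> and unit \<open>eta\<close>,
  and a homomorphism \<open>\<alpha>\<close> gives a morphism of monads \<open>bc \<alpha>\<close> (base change).  The constraints of the
  actegory are absorbed in \<open>mu\<close> and \<open>eta\<close>: the equations below are the strict equations of monads,
  and modules and their homomorphisms are the algebras of these monads.\<close>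

definition lact :: "'co \<Rightarrow> 'm \<Rightarrow> 'm" (infixr "\<rhd>" 74) where
  "a \<rhd> f = Ident C a \<boxtimes>\<^sub>a\<^bsub>M\<^esub> f"

definition mu where
  "mu A m = (mult A \<lhd> m) \<bullet> act_assoc M (carr A) (carr A) m"

definition eta where
  "eta A m = (unt A \<lhd> m) \<bullet> iso_inv M (act_unit M m)"

definition bc where
  "bc \<alpha> m = und \<alpha> \<lhd> m"

lemma lact_arr [simp]:
  assumes "a \<in> Obj C" "f \<in> Arr M"
  shows "a \<rhd> f \<in> Arr M" "Dom M (a \<rhd> f) = a \<boxtimes>\<^bsub>M\<^esub> Dom M f" "Cod M (a \<rhd> f) = a \<boxtimes>\<^bsub>M\<^esub> Cod M f"
  using assms by (simp_all add: lact_def)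

lemma lact_comp [simp]:
  assumes "a \<in> Obj C" "f \<in> Arr M" "g \<in> Arr M" "Dom M g = Cod M f"
  shows "a \<rhd> (g \<bullet> f) = (a \<rhd> g) \<bullet> (a \<rhd> f)"
  using assms act_comp[of "Ident C a" "Ident C a" f g] by (simp add: lact_def)

lemma lact_ident [simp]: "a \<in> Obj C \<Longrightarrow> m \<in> Obj M \<Longrightarrow> a \<rhd> Ident M m = Ident M (a \<boxtimes>\<^bsub>M\<^esub> m)"
  by (simp add: lact_def)

lemma lact_act:
  assumes "f \<in> Arr C" "g \<in> Arr M" "Cod C f = b"
  shows "(b \<rhd> g) \<bullet> (f \<lhd> (Dom M g)) = f \<boxtimes>\<^sub>a\<^bsub>M\<^esub> g"
  using assms(1,2) unfolding assms(3)[symmetric] by (simp add: lact_def act_comp)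

lemma act_lact:
  assumes "f \<in> Arr C" "g \<in> Arr M" "Dom C f = b"
  shows "(f \<lhd> (Cod M g)) \<bullet> (b \<rhd> g) = f \<boxtimes>\<^sub>a\<^bsub>M\<^esub> g"
  using assms(1,2) unfolding assms(3)[symmetric] by (simp add: lact_def act_comp)

lemma assoc_lact:
  assumes "a \<in> Obj C" "b \<in> Obj C" "f \<in> Arr M" "Cod M f = m"
  shows "act_assoc M a b m \<bullet> (a \<rhd> b \<rhd> f) = ((a \<otimes> b) \<rhd> f) \<bullet> act_assoc M a b (Dom M f)"
  using act_assoc_natural[of "Ident C a" a a "Ident C b" b b f "Dom M f" m] assms
  by (simp add: lact_def hom_def)

lemma assoc_ract:
  assumes "b \<in> Obj C" "m \<in> Obj M" "f \<in> Arr C" "Cod C f = a"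
  shows "act_assoc M a b m \<bullet> (f \<lhd> (b \<boxtimes>\<^bsub>M\<^esub> m)) =
    ((f \<otimes>\<^sub>a Ident C b) \<lhd> m) \<bullet> act_assoc M (Dom C f) b m"
  using act_assoc_natural[of f "Dom C f" a "Ident C b" b b "Ident M m" m m] assms
  by (simp add: hom_def)

lemma assoc_lact_ract:
  assumes "a \<in> Obj C" "m \<in> Obj M" "f \<in> Arr C" "Cod C f = b"
  shows "act_assoc M a b m \<bullet> (a \<rhd> (f \<lhd> m)) =
    ((Ident C a \<otimes>\<^sub>a f) \<lhd> m) \<bullet> act_assoc M a (Dom C f) m"
  using act_assoc_natural[of "Ident C a" a a f "Dom C f" b "Ident M m" m m] assms
  by (simp add: hom_def lact_def)

lemma ract_comp:
  assumes "m \<in> Obj M" "f \<in> Arr C" "g \<in> Arr C" "Dom C g = Cod C f"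
  shows "(g \<cdot> f) \<lhd> m = (g \<lhd> m) \<bullet> (f \<lhd> m)"
  using assms by (simp add: act_comp)

lemma act_unit_inv_nat:
  assumes "f \<in> Arr M" "Cod M f = m"
  shows "iso_inv M (act_unit M m) \<bullet> f = (\<one> \<rhd> f) \<bullet> iso_inv M (act_unit M (Dom M f))"
proof (rule M.iso_cancel_left[of "act_unit M m"])
  note [simp] = assms
  have m [simp]: "m \<in> Obj M" using assms M.cod_obj by blast
  have e: "act_unit M m \<bullet> (\<one> \<rhd> f) = f \<bullet> act_unit M (Dom M f)"
    using act_unit_natural[of f "Dom M f" m] assms by (simp add: hom_def lact_def)
  show "act_unit M m \<bullet> iso_inv M (act_unit M m) \<bullet> f =
      act_unit M m \<bullet> (\<one> \<rhd> f) \<bullet> iso_inv M (act_unit M (Dom M f))"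
    by (simp add: M.whisker[OF e])
qed (use assms in auto)

lemma mu_arr [simp]:
  assumes "is_comm_monoid C A" "m \<in> Obj M"
  shows "mu A m \<in> Arr M" "Dom M (mu A m) = carr A \<boxtimes>\<^bsub>M\<^esub> (carr A \<boxtimes>\<^bsub>M\<^esub> m)" "Cod M (mu A m) = carr A \<boxtimes>\<^bsub>M\<^esub> m"
  using assms comm_monoidD(1-7)[OF assms(1)] by (simp_all add: mu_def)

lemma eta_arr [simp]:
  assumes "is_comm_monoid C A" "m \<in> Obj M"
  shows "eta A m \<in> Arr M" "Dom M (eta A m) = m" "Cod M (eta A m) = carr A \<boxtimes>\<^bsub>M\<^esub> m"
  using assms comm_monoidD(1-7)[OF assms(1)] by (simp_all add: eta_def)

lemma mu_nat:
  assumes "is_comm_monoid C A" "f \<in> Arr M" "Cod M f = m"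
  shows "mu A m \<bullet> (carr A \<rhd> carr A \<rhd> f) = (carr A \<rhd> f) \<bullet> mu A (Dom M f)"
proof -
  note [simp] = comm_monoidD(1-7)[OF assms(1)] assms(2,3)
  have m [simp]: "m \<in> Obj M" using assms M.cod_obj by blast
  have "(mult A \<lhd> m) \<bullet> ((carr A \<otimes> carr A) \<rhd> f)
      = (carr A \<rhd> f) \<bullet> (mult A \<lhd> (Dom M f))"
    using lact_act[of "mult A" f "carr A"] act_lact[of "mult A" f "carr A \<otimes> carr A"] by simp
  from M.whisker[OF this] show ?thesis
    by (simp add: mu_def assoc_lact)
qed

lemma eta_nat:
  assumes "is_comm_monoid C A" "f \<in> Arr M" "Cod M f = m"
  shows "eta A m \<bullet> f = (carr A \<rhd> f) \<bullet> eta A (Dom M f)"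
proof -
  note [simp] = comm_monoidD(1-7)[OF assms(1)] assms(2,3)
  have m [simp]: "m \<in> Obj M" using assms M.cod_obj by blast
  have "(unt A \<lhd> m) \<bullet> (\<one> \<rhd> f) = (carr A \<rhd> f) \<bullet> (unt A \<lhd> (Dom M f))"
    using lact_act[of "unt A" f "carr A"] act_lact[of "unt A" f \<one>] by simp
  from M.whisker[OF this] show ?thesis
    by (simp add: eta_def act_unit_inv_nat)
qed

lemma mu_assoc:
  assumes "is_comm_monoid C A" "m \<in> Obj M"
  shows "mu A m \<bullet> mu A (carr A \<boxtimes>\<^bsub>M\<^esub> m) = mu A m \<bullet> (carr A \<rhd> mu A m)"
proof -
  let ?a = "carr A" and ?\<mu> = "mult A" and ?I = "Ident M m" and ?L = "act_assoc M"
  note [simp] = comm_monoidD(1-7)[OF assms(1)] assms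
  have e: "(?\<mu> \<lhd> m) \<bullet> ((?\<mu> \<otimes>\<^sub>a Ident C ?a) \<lhd> m) \<bullet> (assoc C ?a ?a ?a \<lhd> m)
      = (?\<mu> \<lhd> m) \<bullet> ((Ident C ?a \<otimes>\<^sub>a ?\<mu>) \<lhd> m)"
    using comm_monoidD(8)[OF assms(1)] by (simp add: act_comp)
  have "mu A m \<bullet> mu A (?a \<boxtimes>\<^bsub>M\<^esub> m) =
      (?\<mu> \<lhd> m) \<bullet> ((?\<mu> \<otimes>\<^sub>a Ident C ?a) \<lhd> m) \<bullet> ?L (?a \<otimes> ?a) ?a m \<bullet> ?L ?a ?a (?a \<boxtimes>\<^bsub>M\<^esub> m)"
    using M.whisker[OF assoc_ract[of ?a m ?\<mu> ?a]] by (simp add: mu_def)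
  also have "\<dots> = ((?\<mu> \<lhd> m) \<bullet> ((?\<mu> \<otimes>\<^sub>a Ident C ?a) \<lhd> m) \<bullet> (assoc C ?a ?a ?a \<lhd> m)) \<bullet>
      ?L ?a (?a \<otimes> ?a) m \<bullet> (?a \<rhd> ?L ?a ?a m)"
    using act_pentagon[of ?a ?a ?a m] by (simp add: lact_def)
  also have "\<dots> = mu A m \<bullet> (?a \<rhd> mu A m)"
    unfolding e using M.whisker[OF assoc_lact_ract[of ?a m ?\<mu> ?a]] by (simp add: mu_def)
  finally show ?thesis .
qed

lemma mu_eta_left:
  assumes "is_comm_monoid C A" "m \<in> Obj M"
  shows "mu A m \<bullet> eta A (carr A \<boxtimes>\<^bsub>M\<^esub> m) = Ident M (carr A \<boxtimes>\<^bsub>M\<^esub> m)"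
proof -
  let ?a = "carr A" and ?I = "Ident M m" and ?L = "act_assoc M"
  note [simp] = comm_monoidD(1-7)[OF assms(1)] assms
  have e: "(mult A \<lhd> m) \<bullet> ((unt A \<otimes>\<^sub>a Ident C ?a) \<lhd> m) = lunit C ?a \<lhd> m"
    using comm_monoidD(9)[OF assms(1)] by (simp add: act_comp)
  have "mu A m \<bullet> eta A (?a \<boxtimes>\<^bsub>M\<^esub> m) = (mult A \<lhd> m) \<bullet> ((unt A \<otimes>\<^sub>a Ident C ?a) \<lhd> m) \<bullet>
      ?L \<one> ?a m \<bullet> iso_inv M (act_unit M (?a \<boxtimes>\<^bsub>M\<^esub> m))"
    using M.whisker[OF assoc_ract[of ?a m "unt A" ?a]] by (simp add: mu_def eta_def)
  also have "\<dots> = (lunit C ?a \<lhd> m) \<bullet> ?L \<one> ?a m \<bullet> iso_inv M (act_unit M (?a \<boxtimes>\<^bsub>M\<^esub> m))"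
    using M.whisker[OF e] by simp
  also have "\<dots> = Ident M (?a \<boxtimes>\<^bsub>M\<^esub> m)"
    using M.whisker[OF act_lunit[of ?a m]] by simp
  finally show ?thesis .
qed

lemma mu_eta_right:
  assumes "is_comm_monoid C A" "m \<in> Obj M"
  shows "mu A m \<bullet> (carr A \<rhd> eta A m) = Ident M (carr A \<boxtimes>\<^bsub>M\<^esub> m)"
proof -
  let ?a = "carr A" and ?I = "Ident M m" and ?L = "act_assoc M"
  note [simp] = comm_monoidD(1-7)[OF assms(1)] assms
  have e: "(mult A \<lhd> m) \<bullet> ((Ident C ?a \<otimes>\<^sub>a unt A) \<lhd> m) = runit C ?a \<lhd> m"
    using comm_monoidD(10)[OF assms(1)] by (simp add: act_comp)
  have "mu A m \<bullet> (?a \<rhd> eta A m) = (mult A \<lhd> m) \<bullet> ((Ident C ?a \<otimes>\<^sub>a unt A) \<lhd> m) \<bullet>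
      ?L ?a \<one> m \<bullet> (?a \<rhd> iso_inv M (act_unit M m))"
    using M.whisker[OF assoc_lact_ract[of ?a m "unt A" ?a]] by (simp add: mu_def eta_def)
  also have "\<dots> = (runit C ?a \<lhd> m) \<bullet> ?L ?a \<one> m \<bullet> (?a \<rhd> iso_inv M (act_unit M m))"
    using M.whisker[OF e] by simp
  also have "\<dots> = (?a \<rhd> act_unit M m) \<bullet> (?a \<rhd> iso_inv M (act_unit M m))"
    using M.whisker[OF act_runit[of ?a m], folded lact_def] by simp
  also have "\<dots> = ?a \<rhd> (act_unit M m \<bullet> iso_inv M (act_unit M m))"
    by (subst lact_comp) simp_all
  also have "\<dots> = Ident M (?a \<boxtimes>\<^bsub>M\<^esub> m)"
    by (simp del: lact_comp)
  finally show ?thesis .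
qed

lemma bc_arr [simp]:
  assumes "\<alpha> \<in> hom (Comm C) A B" "m \<in> Obj M"
  shows "bc \<alpha> m \<in> Arr M" "Dom M (bc \<alpha> m) = carr A \<boxtimes>\<^bsub>M\<^esub> m" "Cod M (bc \<alpha> m) = carr B \<boxtimes>\<^bsub>M\<^esub> m"
  using assms(2) comm_homD[OF assms(1)] by (simp_all add: bc_def)

lemma bc_nat:
  assumes "\<alpha> \<in> hom (Comm C) A B" "f \<in> Arr M" "Cod M f = m"
  shows "bc \<alpha> m \<bullet> (carr A \<rhd> f) = (carr B \<rhd> f) \<bullet> bc \<alpha> (Dom M f)"
  using assms(2,3) comm_homD[OF assms(1)] lact_act[of "und \<alpha>" f "carr B"] act_lact[of "und \<alpha>" f "carr A"]
  by (simp add: bc_def)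

lemma bc_mu:
  assumes "\<alpha> \<in> hom (Comm C) A B" "m \<in> Obj M"
  shows "bc \<alpha> m \<bullet> mu A m = mu B m \<bullet> (carr B \<rhd> bc \<alpha> m) \<bullet> bc \<alpha> (carr A \<boxtimes>\<^bsub>M\<^esub> m)"
proof -
  note h = comm_homD[OF assms(1)]
  let ?a = "carr A" and ?b = "carr B" and ?I = "Ident M m" and ?L = "act_assoc M" and ?f = "und \<alpha>"
  note [simp] = comm_monoidD(1-7)[OF h(1)] comm_monoidD(1-7)[OF h(2)] assms(2) h(1-7)
  have e: "(?f \<lhd> m) \<bullet> (mult A \<lhd> m) = (mult B \<lhd> m) \<bullet> ((?f \<otimes>\<^sub>a ?f) \<lhd> m)"
    using h(8) by (simp add: act_comp)
  have "bc \<alpha> m \<bullet> mu A m = (mult B \<lhd> m) \<bullet> ((?f \<otimes>\<^sub>a ?f) \<lhd> m) \<bullet> ?L ?a ?a m"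
    using M.whisker[OF e] by (simp add: bc_def mu_def)
  also have "((?f \<otimes>\<^sub>a ?f) \<lhd> m) \<bullet> ?L ?a ?a m = ?L ?b ?b m \<bullet> (?f \<boxtimes>\<^sub>a\<^bsub>M\<^esub> (?f \<lhd> m))"
    using act_assoc_natural[of ?f ?a ?b ?f ?a ?b ?I m m] by (simp add: hom_def)
  also have "?f \<boxtimes>\<^sub>a\<^bsub>M\<^esub> (?f \<lhd> m) = (?b \<rhd> bc \<alpha> m) \<bullet> bc \<alpha> (?a \<boxtimes>\<^bsub>M\<^esub> m)"
    using lact_act[of ?f "bc \<alpha> m" ?b] by (simp add: bc_def)
  finally show ?thesis
    using bc_arr[OF assms(1)] by (simp add: mu_def)
qed

lemma bc_eta:
  assumes "\<alpha> \<in> hom (Comm C) A B" "m \<in> Obj M"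
  shows "bc \<alpha> m \<bullet> eta A m = eta B m"
proof -
  note h = comm_homD[OF assms(1)]
  note [simp] = comm_monoidD(1-7)[OF h(1)] comm_monoidD(1-7)[OF h(2)] assms(2) h(1-7)
  have e: "(und \<alpha> \<lhd> m) \<bullet> (unt A \<lhd> m) = unt B \<lhd> m"
    using h(9) by (simp add: act_comp)
  show ?thesis
    using M.whisker[OF e] by (simp add: bc_def eta_def)
qed

lemma bc_comp:
  assumes "\<alpha> \<in> hom (Comm C) A B" "\<beta> \<in> hom (Comm C) B B'" "m \<in> Obj M"
  shows "bc (\<beta> \<cdot>\<^bsub>Comm C\<^esub> \<alpha>) m = bc \<beta> m \<bullet> bc \<alpha> m"
  using assms(3) comm_homD[OF assms(1)] comm_homD[OF assms(2)] by (simp add: bc_def ract_comp)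

lemma bc_ident: "is_comm_monoid C A \<Longrightarrow> m \<in> Obj M \<Longrightarrow> bc (Ident (Comm C) A) m = Ident M (carr A \<boxtimes>\<^bsub>M\<^esub> m)"
  using comm_monoidD(1)[of C A] by (simp add: bc_def)

end

section \<open>Modules and restriction of scalars\<close>

lemma Mod_simps [simp]:
  "Obj (Mod C M A) = {X. is_module C M A X}" "Dom (Mod C M A) = sdom" "Cod (Mod C M A) = scod"
  "Ident (Mod C M A) X = SArr X (Ident M (mcarr X)) X"
  "\<psi> \<cdot>\<^bsub>Mod C M A\<^esub> \<phi> = SArr (sdom \<phi>) (und \<psi> \<cdot>\<^bsub>M\<^esub> und \<phi>) (scod \<psi>)"
  by (simp_all add: Mod_def)

context left_actegory
begin

lemma module_iff:
  assumes "is_comm_monoid C A"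
  shows "is_module C M A X \<longleftrightarrow> mcarr X \<in> Obj M \<and> maction X \<in> Arr M \<and>
    Dom M (maction X) = carr A \<boxtimes>\<^bsub>M\<^esub> mcarr X \<and> Cod M (maction X) = mcarr X \<and>
    maction X \<bullet> mu A (mcarr X) = maction X \<bullet> (carr A \<rhd> maction X) \<and>
    maction X \<bullet> eta A (mcarr X) = Ident M (mcarr X)" (is "_ \<longleftrightarrow> ?R")
proof -
  obtain m \<rho> where X: "X = LMod m \<rho>" by (cases X)
  obtain a \<mu> \<iota> where A: "A = Mon a \<mu> \<iota>" by (cases A)
  note [simp] = comm_monoidD(1-7)[OF assms, unfolded A, simplified]
  have "\<rho> \<bullet> (\<iota> \<lhd> m) = act_unit M m \<longleftrightarrow> \<rho> \<bullet> eta A m = Ident M m"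
    if [simp]: "m \<in> Obj M" "\<rho> \<in> Arr M" "Dom M \<rho> = a \<boxtimes>\<^bsub>M\<^esub> m"
  proof
    assume e: "\<rho> \<bullet> (\<iota> \<lhd> m) = act_unit M m"
    show "\<rho> \<bullet> eta A m = Ident M m"
      using M.whisker[OF e] by (simp add: eta_def A)
  next
    assume "\<rho> \<bullet> eta A m = Ident M m"
    then have e: "\<rho> \<bullet> (\<iota> \<lhd> m) \<bullet> iso_inv M (act_unit M m) = Ident M m"
      by (simp add: eta_def A)
    have "\<rho> \<bullet> (\<iota> \<lhd> m)
        = (\<rho> \<bullet> (\<iota> \<lhd> m) \<bullet> iso_inv M (act_unit M m)) \<bullet> act_unit M m"
      by simp
    then show "\<rho> \<bullet> (\<iota> \<lhd> m) = act_unit M m"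
      unfolding e by simp
  qed
  then show ?thesis
    unfolding is_module_def X A by (auto simp: hom_def mu_def lact_def)
qed

lemma moduleD:
  assumes "is_module C M A X" "is_comm_monoid C A"
  shows "mcarr X \<in> Obj M" "maction X \<in> Arr M" "Dom M (maction X) = carr A \<boxtimes>\<^bsub>M\<^esub> mcarr X"
    "Cod M (maction X) = mcarr X"
    and "maction X \<bullet> mu A (mcarr X) = maction X \<bullet> (carr A \<rhd> maction X)"
    "maction X \<bullet> eta A (mcarr X) = Ident M (mcarr X)"
  using assms module_iff by blast+

lemma mod_hom_iff:
  "\<phi> \<in> hom (Mod C M A) X Y \<longleftrightarrow> is_module C M A X \<and> is_module C M A Y \<and> sdom \<phi> = X \<and> scod \<phi> = Y \<and>
    und \<phi> \<in> Arr M \<and> Dom M (und \<phi>) = mcarr X \<and> Cod M (und \<phi>) = mcarr Y \<and>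
    und \<phi> \<bullet> maction X = maction Y \<bullet> (carr A \<rhd> und \<phi>)"
  by (cases \<phi>) (auto simp: hom_def Mod_def is_module_hom_def lact_def)

lemma mod_arr_hom: "\<phi> \<in> Arr (Mod C M A) \<Longrightarrow> \<phi> \<in> hom (Mod C M A) (sdom \<phi>) (scod \<phi>)"
  by (simp add: hom_def)

lemma category_Mod:
  assumes A: "is_comm_monoid C A"
  shows "category (Mod C M A)"
proof (rule categoryI)
  have a [simp]: "carr A \<in> Obj C" using A by (rule comm_monoidD)
  fix \<phi> assume \<phi>: "\<phi> \<in> Arr (Mod C M A)"
  note p = mod_arr_hom[OF \<phi>, unfolded mod_hom_iff]
  note [simp] = moduleD(1-4)[OF conjunct1[OF p] A]
  show "Dom (Mod C M A) \<phi> \<in> Obj (Mod C M A)" "Cod (Mod C M A) \<phi> \<in> Obj (Mod C M A)"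
    using p by simp_all
  show "\<phi> \<cdot>\<^bsub>Mod C M A\<^esub> Ident (Mod C M A) (Dom (Mod C M A) \<phi>) = \<phi>"
    "Ident (Mod C M A) (Cod (Mod C M A) \<phi>) \<cdot>\<^bsub>Mod C M A\<^esub> \<phi> = \<phi>"
    using p by simp_all
  fix \<psi> assume \<psi>: "\<psi> \<in> Arr (Mod C M A)" and c: "Dom (Mod C M A) \<psi> = Cod (Mod C M A) \<phi>"
  note q = mod_arr_hom[OF \<psi>, unfolded mod_hom_iff]
  from c have c': "sdom \<psi> = scod \<phi>" by simp
  have m: "is_module C M A (sdom \<phi>)" "is_module C M A (scod \<phi>)" "is_module C M A (scod \<psi>)"
    using p q by simp_all
  note [simp] = moduleD(1-4)[OF m(1) A] moduleD(1-4)[OF m(2) A] moduleD(1-4)[OF m(3) A]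
  have [simp]: "und \<phi> \<in> Arr M" "Dom M (und \<phi>) = mcarr (sdom \<phi>)" "Cod M (und \<phi>) = mcarr (scod \<phi>)"
    "und \<psi> \<in> Arr M" "Dom M (und \<psi>) = mcarr (scod \<phi>)" "Cod M (und \<psi>) = mcarr (scod \<psi>)"
    using p q c' by simp_all
  have pe: "und \<phi> \<bullet> maction (sdom \<phi>) = maction (scod \<phi>) \<bullet> (carr A \<rhd> und \<phi>)"
    and qe: "und \<psi> \<bullet> maction (scod \<phi>) = maction (scod \<psi>) \<bullet> (carr A \<rhd> und \<psi>)"
    using p q c' by simp_all
  show "\<psi> \<cdot>\<^bsub>Mod C M A\<^esub> \<phi> \<in> hom (Mod C M A) (Dom (Mod C M A) \<phi>) (Cod (Mod C M A) \<psi>)"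
    using m M.whisker[OF qe] by (simp add: mod_hom_iff pe)
next
  fix X assume X: "X \<in> Obj (Mod C M A)"
  then show "Ident (Mod C M A) X \<in> hom (Mod C M A) X X"
    using moduleD(1-4)[OF _ A, of X] comm_monoidD(1)[OF A] by (simp add: mod_hom_iff)
next
  fix \<phi> \<psi> \<theta> assume h: "\<phi> \<in> Arr (Mod C M A)" "\<psi> \<in> Arr (Mod C M A)" "\<theta> \<in> Arr (Mod C M A)"
    "Dom (Mod C M A) \<psi> = Cod (Mod C M A) \<phi>" "Dom (Mod C M A) \<theta> = Cod (Mod C M A) \<psi>"
  then show "(\<theta> \<cdot>\<^bsub>Mod C M A\<^esub> \<psi>) \<cdot>\<^bsub>Mod C M A\<^esub> \<phi> = \<theta> \<cdot>\<^bsub>Mod C M A\<^esub> (\<psi> \<cdot>\<^bsub>Mod C M A\<^esub> \<phi>)"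
    using mod_arr_hom[OF h(1), unfolded mod_hom_iff] mod_arr_hom[OF h(2), unfolded mod_hom_iff]
      mod_arr_hom[OF h(3), unfolded mod_hom_iff] by simp
qed

text \<open>The inverse of a module homomorphism in the underlying category is a module homomorphism, so
  the forgetful functors reflect isomorphisms; restriction of scalars does not change the underlying
  arrow and is therefore conservative.\<close>

lemma mod_iso_iff:
  assumes A: "is_comm_monoid C A" and \<phi>: "\<phi> \<in> hom (Mod C M A) X Y"
  shows "is_iso (Mod C M A) \<phi> \<longleftrightarrow> is_iso M (und \<phi>)"
proof
  note p = \<phi>[unfolded mod_hom_iff]
  assume "is_iso (Mod C M A) \<phi>"
  then obtain \<psi> where \<psi>: "\<psi> \<in> hom (Mod C M A) (scod \<phi>) (sdom \<phi>)"
    and e: "\<psi> \<cdot>\<^bsub>Mod C M A\<^esub> \<phi> = Ident (Mod C M A) (sdom \<phi>)"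
      "\<phi> \<cdot>\<^bsub>Mod C M A\<^esub> \<psi> = Ident (Mod C M A) (scod \<phi>)"
    unfolding is_iso_def by auto
  show "is_iso M (und \<phi>)"
    by (rule is_isoI[of _ _ "mcarr X" "mcarr Y" "und \<psi>"])
      (use e p \<psi>[unfolded mod_hom_iff] in \<open>auto intro!: homI\<close>)
next
  note p = \<phi>[unfolded mod_hom_iff]
  assume i: "is_iso M (und \<phi>)"
  let ?g = "iso_inv M (und \<phi>)"
  have a [simp]: "carr A \<in> Obj C" using A by (rule comm_monoidD)
  have m: "is_module C M A X" "is_module C M A Y" using p by blast+
  note [simp] = moduleD(1-4)[OF m(1) A] moduleD(1-4)[OF m(2) A] i
  have [simp]: "und \<phi> \<in> Arr M" "Dom M (und \<phi>) = mcarr X" "Cod M (und \<phi>) = mcarr Y" "sdom \<phi> = X" "scod \<phi> = Y"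
    and pe: "und \<phi> \<bullet> maction X = maction Y \<bullet> (carr A \<rhd> und \<phi>)"
    using p by simp_all
  have "(carr A \<rhd> und \<phi>) \<bullet> (carr A \<rhd> ?g) = Ident M (carr A \<boxtimes>\<^bsub>M\<^esub> mcarr Y)"
    using lact_comp[of "carr A" ?g "und \<phi>"] by simp
  then have "?g \<bullet> maction Y = ?g \<bullet> (maction Y \<bullet> (carr A \<rhd> und \<phi>)) \<bullet> (carr A \<rhd> ?g)"
    by simp
  also have "\<dots> = maction X \<bullet> (carr A \<rhd> ?g)"
    unfolding pe[symmetric] by simp
  finally have "SArr Y ?g X \<in> hom (Mod C M A) Y X"
    using m by (simp add: mod_hom_iff)
  then show "is_iso (Mod C M A) \<phi>"
    by (rule is_isoI[OF \<phi>]) simp_all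
qed

lemma restrict_simps [simp]:
  "mcarr (restrict_obj M \<alpha> X) = mcarr X" "maction (restrict_obj M \<alpha> X) = maction X \<bullet> bc \<alpha> (mcarr X)"
  "fob (restriction M \<alpha>) = restrict_obj M \<alpha>"
  "far (restriction M \<alpha>) \<phi> = SArr (restrict_obj M \<alpha> (sdom \<phi>)) (und \<phi>) (restrict_obj M \<alpha> (scod \<phi>))"
  by (simp_all add: restrict_obj_def restriction_def bc_def)

lemma lmod_eqI: "mcarr X = mcarr Y \<Longrightarrow> maction X = maction Y \<Longrightarrow> X = Y"
  by (simp add: lmod.expand)

lemma sarr_eqI: "sdom f = sdom g \<Longrightarrow> und f = und g \<Longrightarrow> scod f = scod g \<Longrightarrow> f = g"
  by (simp add: sarr.expand)

lemma restrict_module: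
  assumes \<alpha>: "\<alpha> \<in> hom (Comm C) A B" and X: "is_module C M B X"
  shows "is_module C M A (restrict_obj M \<alpha> X)"
proof -
  note h = comm_homD(1,2)[OF \<alpha>]
  note m = moduleD[OF X h(2)]
  note [simp] = m(1-4) bc_arr[OF \<alpha>] h comm_monoidD(1)[OF h(1)] comm_monoidD(1)[OF h(2)]
  let ?\<rho> = "maction X" and ?m = "mcarr X"
  have "(?\<rho> \<bullet> bc \<alpha> ?m) \<bullet> mu A ?m
      = (?\<rho> \<bullet> mu B ?m) \<bullet> (carr B \<rhd> bc \<alpha> ?m) \<bullet> bc \<alpha> (carr A \<boxtimes>\<^bsub>M\<^esub> ?m)"
    by (simp add: bc_mu[OF \<alpha>])
  also have "\<dots> = (?\<rho> \<bullet> bc \<alpha> ?m) \<bullet> (carr A \<rhd> (?\<rho> \<bullet> bc \<alpha> ?m))"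
    unfolding m(5) using M.whisker[OF bc_nat[OF \<alpha>]] bc_nat[OF \<alpha>] by simp
  finally show ?thesis
    using m(6) by (simp add: module_iff bc_eta[OF \<alpha>])
qed

lemma restriction_functor:
  assumes \<alpha>: "\<alpha> \<in> hom (Comm C) A B"
  shows "is_functor (Mod C M B) (Mod C M A) (restriction M \<alpha>)"
proof (rule is_functorI)
  note h = comm_homD(1,2)[OF \<alpha>]
  note [simp] = bc_arr[OF \<alpha>] comm_monoidD(1)[OF h(1)] comm_monoidD(1)[OF h(2)]
  show "category (Mod C M B)" "category (Mod C M A)"
    using h category_Mod by blast+
  fix \<phi> assume "\<phi> \<in> Arr (Mod C M B)"
  note p = mod_arr_hom[OF this, unfolded mod_hom_iff]
  have m: "is_module C M B (sdom \<phi>)" "is_module C M B (scod \<phi>)"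
    using p by simp_all
  have pe: "und \<phi> \<bullet> maction (sdom \<phi>) = maction (scod \<phi>) \<bullet> (carr B \<rhd> und \<phi>)"
    using p by simp
  note [simp] = moduleD(1-4)[OF m(1) h(2)] moduleD(1-4)[OF m(2) h(2)]
  have [simp]: "und \<phi> \<in> Arr M" "Dom M (und \<phi>) = mcarr (sdom \<phi>)" "Cod M (und \<phi>) = mcarr (scod \<phi>)"
    using p by simp_all
  show "far (restriction M \<alpha>) \<phi> \<in> hom (Mod C M A) (fob (restriction M \<alpha>) (Dom (Mod C M B) \<phi>))
      (fob (restriction M \<alpha>) (Cod (Mod C M B) \<phi>))"
    using restrict_module[OF \<alpha> m(1)] restrict_module[OF \<alpha> m(2)] bc_nat[OF \<alpha>, of "und \<phi>"] M.whisker[OF pe]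
    by (simp add: mod_hom_iff)
qed (simp_all add: restrict_module[OF \<alpha>])

lemma module_hom_iff:
  "is_module_hom C M A X f Y \<longleftrightarrow> f \<in> Arr M \<and> Dom M f = mcarr X \<and> Cod M f = mcarr Y \<and>
    f \<bullet> maction X = maction Y \<bullet> (carr A \<rhd> f)"
  by (auto simp: is_module_hom_def hom_def lact_def)

lemma restriction_universalI:
  assumes \<alpha>: "\<alpha> \<in> hom (Comm C) A B" and X: "is_module C M A X" and Y: "is_module C M B Y"
    and u: "is_module_hom C M A X u (restrict_obj M \<alpha> Y)"
    and ex1: "\<And>Z f. is_module C M B Z \<Longrightarrow> is_module_hom C M A X f (restrict_obj M \<alpha> Z) \<Longrightarrow>
      \<exists>!h. is_module_hom C M B Y h Z \<and> h \<bullet> u = f"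
  shows "universal (Mod C M A) (Mod C M B) (restriction M \<alpha>) X Y (SArr X u (restrict_obj M \<alpha> Y))"
  unfolding universal_def
proof (intro conjI ballI)
  show "Y \<in> Obj (Mod C M B)" "SArr X u (restrict_obj M \<alpha> Y) \<in> hom (Mod C M A) X (fob (restriction M \<alpha>) Y)"
    using X Y u restrict_module[OF \<alpha> Y] by (simp_all add: mod_hom_iff module_hom_iff)
  fix Z f assume "Z \<in> Obj (Mod C M B)" and f: "f \<in> hom (Mod C M A) X (fob (restriction M \<alpha>) Z)"
  then have Z: "is_module C M B Z" and "is_module_hom C M A X (und f) (restrict_obj M \<alpha> Z)"
    by (simp_all add: mod_hom_iff module_hom_iff)
  from ex1[OF this] have "\<exists>!h. SArr Y h Z \<in> hom (Mod C M B) Y Z \<and> h \<bullet> u = und f"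
    using Y Z by (simp add: mod_hom_iff module_hom_iff)
  moreover have "far (restriction M \<alpha>) h \<cdot>\<^bsub>Mod C M A\<^esub> SArr X u (restrict_obj M \<alpha> Y) = f \<longleftrightarrow> und h \<bullet> u = und f"
    and "h = SArr Y (und h) Z" if "h \<in> hom (Mod C M B) Y Z" for h
    using that f by (cases f; cases h; simp add: mod_hom_iff)+
  ultimately show "\<exists>!h. h \<in> hom (Mod C M B) Y Z \<and>
      far (restriction M \<alpha>) h \<cdot>\<^bsub>Mod C M A\<^esub> SArr X u (restrict_obj M \<alpha> Y) = f"
    by (metis sarr.sel(2))
qed

lemma restriction_conservative:
  assumes \<alpha>: "\<alpha> \<in> hom (Comm C) A B"
  shows "conservative (Mod C M B) (Mod C M A) (restriction M \<alpha>)"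
  unfolding conservative_def
proof (intro conjI ballI)
  note h = comm_homD(1,2)[OF \<alpha>]
  note F = restriction_functor[OF \<alpha>]
  show "is_functor (Mod C M B) (Mod C M A) (restriction M \<alpha>)" by (rule F)
  fix \<phi> assume \<phi>: "\<phi> \<in> Arr (Mod C M B)"
  have "far (restriction M \<alpha>) \<phi> \<in> hom (Mod C M A) (restrict_obj M \<alpha> (sdom \<phi>)) (restrict_obj M \<alpha> (scod \<phi>))"
    using functor_arr[OF F \<phi>] by (simp add: hom_def)
  from mod_iso_iff[OF h(1) this] mod_iso_iff[OF h(2) mod_arr_hom[OF \<phi>]]
  show "is_iso (Mod C M B) \<phi> \<longleftrightarrow> is_iso (Mod C M A) (far (restriction M \<alpha>) \<phi>)"
    by simp
qed

lemma restrict_obj_comp: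
  assumes \<alpha>: "\<alpha> \<in> hom (Comm C) A B" and \<beta>: "\<beta> \<in> hom (Comm C) B D" and X: "is_module C M D X"
  shows "restrict_obj M (\<beta> \<cdot>\<^bsub>Comm C\<^esub> \<alpha>) X = restrict_obj M \<alpha> (restrict_obj M \<beta> X)"
  using moduleD[OF X comm_homD(2)[OF \<beta>]] bc_arr[OF \<alpha>] bc_arr[OF \<beta>] bc_comp[OF \<alpha> \<beta>]
  by (intro lmod_eqI) (simp_all del: Comm_simps)

lemma restrict_obj_ident:
  assumes A: "is_comm_monoid C A" and X: "is_module C M A X"
  shows "restrict_obj M (Ident (Comm C) A) X = X"
  using moduleD[OF X A] bc_ident[OF A] by (intro lmod_eqI) (simp_all del: Comm_simps)

end

section \<open>Extension of scalars\<close>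

locale right_exact_actegory = left_actegory +
  assumes lact_coequalizer: "\<lbrakk>a \<in> Obj C; is_coequalizer M f g z q\<rbrakk> \<Longrightarrow>
      is_coequalizer M (a \<rhd> f) (a \<rhd> g) (a \<boxtimes>\<^bsub>M\<^esub> z) (a \<rhd> q)"
    and ract_coequalizer: "\<lbrakk>m \<in> Obj M; is_coequalizer C f' g' z' q'\<rbrakk> \<Longrightarrow>
      is_coequalizer M (f' \<lhd> m) (g' \<lhd> m) (z' \<boxtimes>\<^bsub>M\<^esub> m) (q' \<lhd> m)"
begin

text \<open>Oriented as rewrite rules, the laws move \<open>mu\<close>, \<open>eta\<close> and \<open>bc\<close> to the left.  Each law is also
  provided inside a longer composite and under a functor \<open>c \<boxtimes> _\<close>.\<close>

lemma mu_left:
  assumes "is_comm_monoid C A" "f \<in> Arr M" "Dom M f = x"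
  shows "(carr A \<rhd> f) \<bullet> mu A x = mu A (Cod M f) \<bullet> (carr A \<rhd> carr A \<rhd> f)"
  using mu_nat[OF assms(1,2)] assms(3) by simp

lemma eta_left:
  assumes "is_comm_monoid C A" "f \<in> Arr M" "Dom M f = x"
  shows "(carr A \<rhd> f) \<bullet> eta A x = eta A (Cod M f) \<bullet> f"
  using eta_nat[OF assms(1,2)] assms(3) by simp

lemma bc_left:
  assumes "\<alpha> \<in> hom (Comm C) A B" "f \<in> Arr M" "Dom M f = x"
  shows "(carr B \<rhd> f) \<bullet> bc \<alpha> x = bc \<alpha> (Cod M f) \<bullet> (carr A \<rhd> f)"
  using bc_nat[OF assms(1,2)] assms(3) by simp

lemma lact_eq:
  assumes "g \<bullet> f = h" "c \<in> Obj C" "f \<in> Arr M" "g \<in> Arr M" "Dom M g = Cod M f"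
  shows "(c \<rhd> g) \<bullet> (c \<rhd> f) = c \<rhd> h"
  using lact_comp[OF assms(2-5)] assms(1) by simp

lemmas monad_left = mu_left eta_left mu_assoc mu_eta_left mu_eta_right
lemmas monad_rules = monad_left monad_left[THEN M.whisker]
  monad_left[THEN lact_eq] monad_left[THEN lact_eq, THEN M.whisker]
lemmas bc_basic = bc_left bc_mu bc_eta
lemmas bc_rules = bc_basic bc_basic[THEN M.whisker]
  bc_basic[THEN lact_eq] bc_basic[THEN lact_eq, THEN M.whisker]

text \<open>\<open>is_ext_coeq \<alpha> X z p\<close>: \<open>p : b \<boxtimes> m \<rightarrow> z\<close> presents \<open>z\<close> as \<open>b \<boxtimes>\<^sub>a m\<close>, for
  \<open>\<alpha> : a \<rightarrow> b\<close> and \<open>m\<close> the carrier of \<open>X\<close>.\<close>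

definition is_ext_coeq where
  "is_ext_coeq \<alpha> X z p \<longleftrightarrow> is_coequalizer M (carr (scod \<alpha>) \<rhd> maction X)
    (mu (scod \<alpha>) (mcarr X) \<bullet> (carr (scod \<alpha>) \<rhd> bc \<alpha> (mcarr X))) z p"

lemma ext_pair_eq:
  assumes \<alpha>: "\<alpha> \<in> hom (Comm C) A B" and m: "m \<in> Obj M"
  shows "mu B m \<bullet> (carr B \<rhd> bc \<alpha> m) =
    ((mult B \<cdot> (Ident C (carr B) \<otimes>\<^sub>a und \<alpha>)) \<lhd> m) \<bullet> act_assoc M (carr B) (carr A) m"
proof -
  note h = comm_homD[OF \<alpha>]
  note [simp] = comm_monoidD(1-7)[OF h(1)] comm_monoidD(1-7)[OF h(2)] m h(1-7)
  show ?thesis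
    using assoc_lact_ract[of "carr B" m "und \<alpha>" "carr B"]
    by (simp add: mu_def bc_def ract_comp)
qed

text \<open>The action of \<open>b\<close> on \<open>b \<boxtimes>\<^sub>a m\<close> is induced by the multiplication of \<open>b\<close>, because
  \<open>b \<boxtimes> _\<close> preserves the coequalizer; the unit \<open>m \<rightarrow> b \<boxtimes>\<^sub>a m\<close> is universal, because a
  homomorphism \<open>h\<close> out of \<open>b \<boxtimes>\<^sub>a m\<close> is determined on \<open>b \<boxtimes> m\<close> by linearity.\<close>

lemma extension_module:
  assumes \<alpha>: "\<alpha> \<in> hom (Comm C) A B" and X: "is_module C M A X" and p: "is_ext_coeq \<alpha> X z p"
  obtains y where "is_module C M B (LMod z y)"
    "y \<bullet> (carr B \<rhd> p) = p \<bullet> mu B (mcarr X)"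
    "universal (Mod C M A) (Mod C M B) (restriction M \<alpha>) X (LMod z y)
      (SArr X (p \<bullet> eta B (mcarr X)) (restrict_obj M \<alpha> (LMod z y)))"
proof -
  note h = comm_homD[OF \<alpha>]
  let ?a = "carr A" and ?b = "carr B" and ?m = "mcarr X" and ?\<rho> = "maction X"
  note X' = moduleD[OF X h(1)]
  note [simp] = comm_monoidD(1)[OF h(1)] comm_monoidD(1)[OF h(2)] h(1-4) X'(1-4) bc_arr[OF \<alpha>]
  have p': "is_coequalizer M (?b \<rhd> ?\<rho>) (mu B ?m \<bullet> (?b \<rhd> bc \<alpha> ?m)) z p"
    using p by (simp add: is_ext_coeq_def)
  note bp = lact_coequalizer[OF h(2)[THEN comm_monoidD(1)] p']
  note bbp = lact_coequalizer[OF h(2)[THEN comm_monoidD(1)] bp]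
  have [simp]: "p \<in> Arr M" "Dom M p = ?b \<boxtimes>\<^bsub>M\<^esub> ?m" "Cod M p = z" "z \<in> Obj M"
    using coequalizer_arr(3,7)[OF p'] coequalizer_arr(4)[OF p', symmetric] M.cod_obj by auto
  have pe: "p \<bullet> (?b \<rhd> ?\<rho>) = p \<bullet> mu B ?m \<bullet> (?b \<rhd> bc \<alpha> ?m)"
    using coequalizerD(4)[OF p'] .
  have "(p \<bullet> mu B ?m) \<bullet> (?b \<rhd> ?b \<rhd> ?\<rho>)
      = (p \<bullet> (?b \<rhd> ?\<rho>)) \<bullet> mu B (?a \<boxtimes>\<^bsub>M\<^esub> ?m)"
    by (simp add: mu_left)
  also have "\<dots> = (p \<bullet> mu B ?m) \<bullet> (?b \<rhd> (mu B ?m \<bullet> (?b \<rhd> bc \<alpha> ?m)))"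
    unfolding pe by (simp add: monad_rules)
  finally obtain y where [simp]: "y \<in> Arr M" "Dom M y = ?b \<boxtimes>\<^bsub>M\<^esub> z" "Cod M y = z"
    and y: "y \<bullet> (?b \<rhd> p) = p \<bullet> mu B ?m"
    using coequalizer_factor[OF bp, of "p \<bullet> mu B ?m"] by auto
  note yw = y M.whisker[OF y]
  have Y: "is_module C M B (LMod z y)"
  proof -
    have "y \<bullet> mu B z = y \<bullet> (?b \<rhd> y)"
    proof (rule M.coequalizer_eq[OF bbp])
      have "(y \<bullet> mu B z) \<bullet> (?b \<rhd> ?b \<rhd> p) = (y \<bullet> (?b \<rhd> p)) \<bullet> mu B (?b \<boxtimes>\<^bsub>M\<^esub> ?m)"
        by (simp add: mu_left)
      also have "\<dots> = (y \<bullet> (?b \<rhd> p)) \<bullet> (?b \<rhd> mu B ?m)"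
        unfolding y by (simp add: mu_assoc)
      also have "\<dots> = y \<bullet> (?b \<rhd> (y \<bullet> (?b \<rhd> p)))"
        by (simp add: yw)
      finally show "(y \<bullet> mu B z) \<bullet> (?b \<rhd> ?b \<rhd> p) = (y \<bullet> (?b \<rhd> y)) \<bullet> (?b \<rhd> ?b \<rhd> p)"
        by simp
    qed simp_all
    moreover have "y \<bullet> eta B z = Ident M z"
    proof (rule M.coequalizer_eq[OF p'])
      have "(y \<bullet> eta B z) \<bullet> p = (y \<bullet> (?b \<rhd> p)) \<bullet> eta B (?b \<boxtimes>\<^bsub>M\<^esub> ?m)"
        by (simp add: eta_left)
      then show "(y \<bullet> eta B z) \<bullet> p = Ident M z \<bullet> p"
        unfolding y by (simp add: monad_rules)
    qed simp_all
    ultimately show ?thesis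
      by (simp add: module_iff)
  qed
  have "universal (Mod C M A) (Mod C M B) (restriction M \<alpha>) X (LMod z y)
      (SArr X (p \<bullet> eta B ?m) (restrict_obj M \<alpha> (LMod z y)))"
  proof (rule restriction_universalI[OF \<alpha> X Y])
    have "(p \<bullet> eta B ?m) \<bullet> ?\<rho> = (p \<bullet> (?b \<rhd> ?\<rho>)) \<bullet> eta B (?a \<boxtimes>\<^bsub>M\<^esub> ?m)"
      by (simp add: eta_left)
    also have "\<dots> = p \<bullet> bc \<alpha> ?m"
      unfolding pe by (simp add: monad_rules)
    also have "\<dots> = (y \<bullet> (?b \<rhd> p)) \<bullet> (?b \<rhd> eta B ?m) \<bullet> bc \<alpha> ?m"
      unfolding y by (simp add: mu_eta_right mu_eta_right[THEN M.whisker])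
    also have "\<dots> = (y \<bullet> bc \<alpha> z) \<bullet> (?a \<rhd> (p \<bullet> eta B ?m))"
      by (simp add: bc_rules[OF \<alpha>])
    finally show "is_module_hom C M A X (p \<bullet> eta B ?m) (restrict_obj M \<alpha> (LMod z y))"
      by (simp add: module_hom_iff)
  next
    fix Z f assume Z: "is_module C M B Z" and f_hom: "is_module_hom C M A X f (restrict_obj M \<alpha> Z)"
    note Z' = moduleD[OF Z h(2)]
    let ?w = "mcarr Z" and ?\<zeta> = "maction Z"
    note [simp] = Z'(1-4)
    have [simp]: "f \<in> Arr M" "Dom M f = ?m" "Cod M f = ?w"
      and f: "f \<bullet> ?\<rho> = ?\<zeta> \<bullet> bc \<alpha> ?w \<bullet> (?a \<rhd> f)"
      using f_hom by (simp_all add: module_hom_iff)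
    have "(?\<zeta> \<bullet> (?b \<rhd> f)) \<bullet> (?b \<rhd> ?\<rho>) = ?\<zeta> \<bullet> (?b \<rhd> (f \<bullet> ?\<rho>))"
      by simp
    also have "\<dots> = (?\<zeta> \<bullet> mu B ?w) \<bullet> (?b \<rhd> (bc \<alpha> ?w \<bullet> (?a \<rhd> f)))"
      unfolding f Z'(5) by simp
    also have "\<dots> = (?\<zeta> \<bullet> (?b \<rhd> f)) \<bullet> mu B ?m \<bullet> (?b \<rhd> bc \<alpha> ?m)"
      by (simp add: mu_left[THEN M.whisker] bc_nat[OF \<alpha>])
    finally obtain k where [simp]: "k \<in> Arr M" "Dom M k = z" "Cod M k = ?w"
      and k: "k \<bullet> p = ?\<zeta> \<bullet> (?b \<rhd> f)"
      using coequalizer_factor[OF p', of "?\<zeta> \<bullet> (?b \<rhd> f)"] by auto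
    show "\<exists>!h. is_module_hom C M B (LMod z y) h Z \<and> h \<bullet> p \<bullet> eta B ?m = f"
    proof (rule ex1I[of _ k], rule conjI)
      have "k \<bullet> y = ?\<zeta> \<bullet> (?b \<rhd> k)"
      proof (rule M.coequalizer_eq[OF bp])
        have "(k \<bullet> y) \<bullet> (?b \<rhd> p) = (k \<bullet> p) \<bullet> mu B ?m"
          by (simp add: y)
        also have "\<dots> = (?\<zeta> \<bullet> mu B ?w) \<bullet> (?b \<rhd> ?b \<rhd> f)"
          unfolding k by (simp add: mu_left)
        also have "\<dots> = ?\<zeta> \<bullet> (?b \<rhd> (k \<bullet> p))"
          unfolding k Z'(5) by simp
        finally show "(k \<bullet> y) \<bullet> (?b \<rhd> p) = (?\<zeta> \<bullet> (?b \<rhd> k)) \<bullet> (?b \<rhd> p)"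
          by simp
      qed simp_all
      then show "is_module_hom C M B (LMod z y) k Z"
        by (simp add: module_hom_iff)
      have "k \<bullet> p \<bullet> eta B ?m = (k \<bullet> p) \<bullet> eta B ?m"
        by simp
      also have "\<dots> = f"
        unfolding k by (simp add: eta_left Z'(6) M.whisker[OF Z'(6)])
      finally show "k \<bullet> p \<bullet> eta B ?m = f" .
    next
      fix l assume "is_module_hom C M B (LMod z y) l Z \<and> l \<bullet> p \<bullet> eta B ?m = f"
      then have [simp]: "l \<in> Arr M" "Dom M l = z" "Cod M l = ?w"
        and l: "l \<bullet> y = ?\<zeta> \<bullet> (?b \<rhd> l)" and lf: "l \<bullet> p \<bullet> eta B ?m = f"
        by (simp_all add: module_hom_iff)
      show "l = k"
      proof (rule M.coequalizer_eq[OF p'])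
        have "l \<bullet> p = l \<bullet> (p \<bullet> mu B ?m) \<bullet> (?b \<rhd> eta B ?m)"
          by (simp add: mu_eta_right)
        also have "\<dots> = (l \<bullet> y) \<bullet> (?b \<rhd> p) \<bullet> (?b \<rhd> eta B ?m)"
          unfolding y[symmetric] by simp
        also have "\<dots> = ?\<zeta> \<bullet> (?b \<rhd> (l \<bullet> p \<bullet> eta B ?m))"
          unfolding l by simp
        finally show "l \<bullet> p = k \<bullet> p"
          unfolding lf k .
      qed simp_all
    qed
  qed
  with Y y show ?thesis by (rule that)
qed

section \<open>Base change along a tensor product of monoids\<close>

text \<open>The functor \<open>_ \<boxtimes> m\<close> preserves the coequalizer \<open>k : a' \<otimes> b \<rightarrow> P\<close> that defines \<open>a' \<otimes>\<^sub>a b\<close>, and the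
  associativity constraints carry its parallel pair to the two actions of \<open>a\<close> on
  \<open>a' \<boxtimes> (b \<boxtimes> m)\<close>; the pentagon is needed for the action on \<open>a'\<close>.\<close>

lemma ract_tensor_coequalizer:
  assumes \<alpha>: "\<alpha> \<in> hom (Comm C) A A'" and \<beta>: "\<beta> \<in> hom (Comm C) A B" and m: "m \<in> Obj M"
    and k: "is_coequalizer C (Ident C (carr A') \<otimes>\<^sub>a (mult B \<cdot> (und \<beta> \<otimes>\<^sub>a Ident C (carr B))))
      (((mult A' \<cdot> (Ident C (carr A') \<otimes>\<^sub>a und \<alpha>)) \<otimes>\<^sub>a Ident C (carr B)) \<cdot> assoc C (carr A') (carr A) (carr B)) P k"
  shows "is_coequalizer M (carr A' \<rhd> (mu B m \<bullet> bc \<beta> (carr B \<boxtimes>\<^bsub>M\<^esub> m)))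
    (mu A' (carr B \<boxtimes>\<^bsub>M\<^esub> m) \<bullet> (carr A' \<rhd> bc \<alpha> (carr B \<boxtimes>\<^bsub>M\<^esub> m)))
    (P \<boxtimes>\<^bsub>M\<^esub> m) ((k \<lhd> m) \<bullet> act_assoc M (carr A') (carr B) m)"
proof -
  note ha = comm_homD[OF \<alpha>] and hb = comm_homD[OF \<beta>]
  let ?a = "carr A" and ?a' = "carr A'" and ?b = "carr B" and ?I = "Ident M m" and ?L = "act_assoc M"
  note [simp] = comm_monoidD(1-7)[OF ha(1)] comm_monoidD(1-7)[OF ha(2)] comm_monoidD(1-7)[OF hb(2)] m
    ha(1-7) hb(2-7) bc_arr[OF \<alpha>] bc_arr[OF \<beta>]
  have kd [simp]: "Dom C k = ?a' \<otimes> ?b" "k \<in> Arr C"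
    using coequalizer_arr(3,4)[OF k] by simp_all
  have e: "mu B m \<bullet> bc \<beta> (?b \<boxtimes>\<^bsub>M\<^esub> m) = ((mult B \<cdot> (und \<beta> \<otimes>\<^sub>a Ident C ?b)) \<lhd> m) \<bullet> ?L ?a ?b m"
    using assoc_ract[of ?b m "und \<beta>" ?b] by (simp add: mu_def bc_def ract_comp)
  let ?j = "?L ?a' ?b m" and ?i = "?L ?a' (?a \<otimes> ?b) m \<bullet> (?a' \<rhd> ?L ?a ?b m)"
  have li: "is_iso M (?a' \<rhd> ?L ?a ?b m)"
  proof -
    have "is_functor M M (act_on_left C M ?a')"
      by (rule is_functorI[OF M.category_axioms M.category_axioms])
        (auto simp: act_on_left_def hom_def simp flip: lact_def)
    from functor_iso[OF this, of "?L ?a ?b m"] show ?thesis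
      by (simp add: act_on_left_def lact_def)
  qed
  show ?thesis
  proof (rule M.coequalizer_precomp_iso[OF ract_coequalizer[OF m k], of ?i])
    show "is_iso M ?i"
      by (rule M.is_iso_comp[OF li]) simp_all
    show "?j \<bullet> (?a' \<rhd> (mu B m \<bullet> bc \<beta> (?b \<boxtimes>\<^bsub>M\<^esub> m)))
      = ((Ident C ?a' \<otimes>\<^sub>a (mult B \<cdot> (und \<beta> \<otimes>\<^sub>a Ident C ?b))) \<lhd> m) \<bullet> ?i"
      unfolding e using M.whisker[OF assoc_lact_ract[of ?a' m "mult B \<cdot> (und \<beta> \<otimes>\<^sub>a Ident C ?b)" ?b]] by simp
    have "?j \<bullet> (mu A' (?b \<boxtimes>\<^bsub>M\<^esub> m) \<bullet> (?a' \<rhd> bc \<alpha> (?b \<boxtimes>\<^bsub>M\<^esub> m)))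
        = (((mult A' \<cdot> (Ident C ?a' \<otimes>\<^sub>a und \<alpha>)) \<otimes>\<^sub>a Ident C ?b) \<lhd> m) \<bullet>
          ?L (?a' \<otimes> ?a) ?b m \<bullet> ?L ?a' ?a (?b \<boxtimes>\<^bsub>M\<^esub> m)"
      unfolding ext_pair_eq[OF \<alpha> act_obj[OF comm_monoidD(1)[OF hb(2)] m]]
      using M.whisker[OF assoc_ract[of ?b m "mult A' \<cdot> (Ident C ?a' \<otimes>\<^sub>a und \<alpha>)" ?a']] by simp
    also have "?L (?a' \<otimes> ?a) ?b m \<bullet> ?L ?a' ?a (?b \<boxtimes>\<^bsub>M\<^esub> m) = (assoc C ?a' ?a ?b \<lhd> m) \<bullet> ?i"
      using act_pentagon[of ?a' ?a ?b m] by (simp add: lact_def)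
    finally show "?j \<bullet> (mu A' (?b \<boxtimes>\<^bsub>M\<^esub> m) \<bullet> (?a' \<rhd> bc \<alpha> (?b \<boxtimes>\<^bsub>M\<^esub> m)))
      = ((((mult A' \<cdot> (Ident C ?a' \<otimes>\<^sub>a und \<alpha>)) \<otimes>\<^sub>a Ident C ?b) \<cdot> assoc C ?a' ?a ?b) \<lhd> m) \<bullet> ?i"
      by (simp add: ract_comp)
  qed (auto intro!: homI)
qed

text \<open>For a \<open>b\<close>-module \<open>n\<close>, the quotient map \<open>K : a' \<boxtimes> (b \<boxtimes> n) \<rightarrow> b' \<boxtimes> n\<close> turns \<open>b' \<boxtimes>\<^sub>b n\<close> into a
  quotient of \<open>a' \<boxtimes> (b \<boxtimes> n)\<close>.  An \<open>a\<close>-homomorphism \<open>f\<close> from \<open>n\<close> to an \<open>a'\<close>-module \<open>w\<close> gives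
  \<open>a' \<boxtimes> (b \<boxtimes> n) \<rightarrow> w\<close>, \<open>(x, y, t) \<mapsto> x f (y t)\<close>, and this map factors through both quotients.
  Hence the unit of \<open>b' \<boxtimes>\<^sub>b n\<close> is also universal among \<open>a\<close>-homomorphisms into \<open>a'\<close>-modules.\<close>

lemma base_change_universal:
  assumes \<alpha>: "\<alpha> \<in> hom (Comm C) A A'" and \<beta>: "\<beta> \<in> hom (Comm C) A B"
    and \<alpha>': "\<alpha>' \<in> hom (Comm C) B B'" and \<beta>': "\<beta>' \<in> hom (Comm C) A' B'"
    and sq: "\<alpha>' \<cdot>\<^bsub>Comm C\<^esub> \<beta> = \<beta>' \<cdot>\<^bsub>Comm C\<^esub> \<alpha>"
    and k: "is_coequalizer C (Ident C (carr A') \<otimes>\<^sub>a (mult B \<cdot> (und \<beta> \<otimes>\<^sub>a Ident C (carr B))))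
      (((mult A' \<cdot> (Ident C (carr A') \<otimes>\<^sub>a und \<alpha>)) \<otimes>\<^sub>a Ident C (carr B)) \<cdot> assoc C (carr A') (carr A) (carr B))
      (carr B') (mult B' \<cdot> (und \<beta>' \<otimes>\<^sub>a und \<alpha>'))"
    and N: "is_module C M B N" and p: "is_ext_coeq \<alpha>' N z p"
    and Y: "is_module C M B' (LMod z y)" and y: "y \<bullet> (carr B' \<rhd> p) = p \<bullet> mu B' (mcarr N)"
  shows "universal (Mod C M A) (Mod C M A') (restriction M \<alpha>) (restrict_obj M \<beta> N)
    (restrict_obj M \<beta>' (LMod z y))
    (SArr (restrict_obj M \<beta> N) (p \<bullet> eta B' (mcarr N)) (restrict_obj M \<alpha> (restrict_obj M \<beta>' (LMod z y))))"
proof -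
  note ha = comm_homD[OF \<alpha>] and hb = comm_homD[OF \<alpha>']
  note CM = ha(1,2) hb(1,2)
  let ?a = "carr A" and ?a' = "carr A'" and ?b = "carr B" and ?b' = "carr B'"
  let ?n = "mcarr N" and ?\<nu> = "maction N"
  note N' = moduleD[OF N hb(1)]
  note O = comm_monoidD(1)[OF CM(1)] comm_monoidD(1)[OF CM(2)] comm_monoidD(1)[OF CM(3)] comm_monoidD(1)[OF CM(4)]
  note [simp] = O N'(1-4) CM hb(4)
    bc_arr[OF \<alpha>] bc_arr[OF \<beta>] bc_arr[OF \<alpha>'] bc_arr[OF \<beta>']
  define K where "K m = mu B' m \<bullet> bc \<beta>' (?b' \<boxtimes>\<^bsub>M\<^esub> m) \<bullet> (?a' \<rhd> bc \<alpha>' m)" for m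
  have K_arr [simp]: "K m \<in> Arr M" "Dom M (K m) = ?a' \<boxtimes>\<^bsub>M\<^esub> (?b \<boxtimes>\<^bsub>M\<^esub> m)" "Cod M (K m) = ?b' \<boxtimes>\<^bsub>M\<^esub> m"
    if "m \<in> Obj M" for m
    using that by (simp_all add: K_def)
  have Kq: "is_coequalizer M (?a' \<rhd> (mu B m \<bullet> bc \<beta> (?b \<boxtimes>\<^bsub>M\<^esub> m)))
      (mu A' (?b \<boxtimes>\<^bsub>M\<^esub> m) \<bullet> (?a' \<rhd> bc \<alpha> (?b \<boxtimes>\<^bsub>M\<^esub> m))) (?b' \<boxtimes>\<^bsub>M\<^esub> m) (K m)"
    if m: "m \<in> Obj M" for m
  proof -
    note h = comm_homD[OF \<beta>'] and h' = comm_homD[OF \<alpha>']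
    note [simp] = m comm_monoidD(1-7)[OF CM(2)] comm_monoidD(1-7)[OF CM(3)] comm_monoidD(1-7)[OF CM(4)] h(5-7) h'(5-7)
    have "((und \<beta>' \<otimes>\<^sub>a und \<alpha>') \<lhd> m) \<bullet> act_assoc M ?a' ?b m
        = act_assoc M ?b' ?b' m \<bullet> (und \<beta>' \<boxtimes>\<^sub>a\<^bsub>M\<^esub> (und \<alpha>' \<lhd> m))"
      using act_assoc_natural[of "und \<beta>'" ?a' ?b' "und \<alpha>'" ?b ?b' "Ident M m" m m] by (simp add: hom_def)
    also have "und \<beta>' \<boxtimes>\<^sub>a\<^bsub>M\<^esub> (und \<alpha>' \<lhd> m) = bc \<beta>' (?b' \<boxtimes>\<^bsub>M\<^esub> m) \<bullet> (?a' \<rhd> bc \<alpha>' m)"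
      using act_lact[of "und \<beta>'" "bc \<alpha>' m" ?a'] by (simp add: bc_def)
    finally have "((mult B' \<cdot> (und \<beta>' \<otimes>\<^sub>a und \<alpha>')) \<lhd> m) \<bullet> act_assoc M ?a' ?b m = K m"
      by (simp add: K_def mu_def ract_comp)
    then show ?thesis
      using ract_tensor_coequalizer[OF \<alpha> \<beta> m k] by simp
  qed
  have p': "is_coequalizer M (?b' \<rhd> ?\<nu>) (mu B' ?n \<bullet> (?b' \<rhd> bc \<alpha>' ?n)) z p"
    using p by (simp add: is_ext_coeq_def)
  have [simp]: "p \<in> Arr M" "Dom M p = ?b' \<boxtimes>\<^bsub>M\<^esub> ?n" "Cod M p = z" "z \<in> Obj M"
    using coequalizer_arr(3,7)[OF p'] coequalizer_arr(4)[OF p', symmetric] M.cod_obj by auto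
  have pe: "p \<bullet> (?b' \<rhd> ?\<nu>) = p \<bullet> mu B' ?n \<bullet> (?b' \<rhd> bc \<alpha>' ?n)"
    using coequalizerD(4)[OF p'] .
  have [simp]: "y \<in> Arr M" "Dom M y = ?b' \<boxtimes>\<^bsub>M\<^esub> z" "Cod M y = z"
    using moduleD(1-4)[OF Y hb(2)] by simp_all
  note bcr = bc_rules[OF \<alpha>] bc_rules[OF \<beta>] bc_rules[OF \<alpha>'] bc_rules[OF \<beta>']
  note rules = monad_rules bcr
  let ?u = "p \<bullet> eta B' ?n"
  have u_lin: "?u \<bullet> ?\<nu> = p \<bullet> bc \<alpha>' ?n"
  proof -
    have "?u \<bullet> ?\<nu> = (p \<bullet> (?b' \<rhd> ?\<nu>)) \<bullet> eta B' (?b \<boxtimes>\<^bsub>M\<^esub> ?n)"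
      by (simp add: eta_left)
    also have "\<dots> = p \<bullet> bc \<alpha>' ?n"
      unfolding pe by (simp add: rules)
    finally show ?thesis .
  qed
  have sq': "bc \<alpha>' m \<bullet> bc \<beta> m = bc \<beta>' m \<bullet> bc \<alpha> m" if "m \<in> Obj M" for m
    using bc_comp[OF \<beta> \<alpha>' that] bc_comp[OF \<alpha> \<beta>' that] unfolding sq by simp
  show ?thesis
  proof (rule restriction_universalI[OF \<alpha> restrict_module[OF \<beta> N] restrict_module[OF \<beta>' Y]])
    have "?u \<bullet> ?\<nu> \<bullet> bc \<beta> ?n = (?u \<bullet> ?\<nu>) \<bullet> bc \<beta> ?n"
      by simp
    also have "\<dots> = p \<bullet> bc \<beta>' ?n \<bullet> bc \<alpha> ?n"
      unfolding u_lin using sq'[of ?n] by simp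
    also have "\<dots> = (y \<bullet> (?b' \<rhd> p)) \<bullet> (?b' \<rhd> eta B' ?n) \<bullet> bc \<beta>' ?n \<bullet> bc \<alpha> ?n"
      unfolding y by (simp add: mu_eta_right mu_eta_right[THEN M.whisker])
    also have "\<dots> = y \<bullet> bc \<beta>' z \<bullet> bc \<alpha> z \<bullet> (?a \<rhd> ?u)"
      by (simp add: bcr)
    finally show "is_module_hom C M A (restrict_obj M \<beta> N) ?u (restrict_obj M \<alpha> (restrict_obj M \<beta>' (LMod z y)))"
      by (simp add: module_hom_iff)
  next
    fix Z f assume Z: "is_module C M A' Z"
      and f_hom: "is_module_hom C M A (restrict_obj M \<beta> N) f (restrict_obj M \<alpha> Z)"
    note Z' = moduleD[OF Z ha(2)]
    let ?w = "mcarr Z" and ?\<zeta> = "maction Z"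
    note [simp] = Z'(1-4)
    have [simp]: "f \<in> Arr M" "Dom M f = ?n" "Cod M f = ?w"
      and f: "f \<bullet> ?\<nu> \<bullet> bc \<beta> ?n = ?\<zeta> \<bullet> bc \<alpha> ?w \<bullet> (?a \<rhd> f)"
      using f_hom by (simp_all add: module_hom_iff)
    \<comment> \<open>\<open>\<phi>\<close> is \<open>(x, y, t) \<mapsto> x f (y t)\<close>; it identifies the two actions of \<open>a\<close> because \<open>f\<close> is linear over \<open>a\<close>\<close>
    define \<phi> where "\<phi> = ?\<zeta> \<bullet> (?a' \<rhd> (f \<bullet> ?\<nu>))"
    have [simp]: "\<phi> \<in> Arr M" "Dom M \<phi> = ?a' \<boxtimes>\<^bsub>M\<^esub> (?b \<boxtimes>\<^bsub>M\<^esub> ?n)" "Cod M \<phi> = ?w"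
      by (simp_all add: \<phi>_def)
    have "\<phi> \<bullet> (?a' \<rhd> (mu B ?n \<bullet> bc \<beta> (?b \<boxtimes>\<^bsub>M\<^esub> ?n)))
        = ?\<zeta> \<bullet> (?a' \<rhd> (f \<bullet> (?\<nu> \<bullet> mu B ?n) \<bullet> bc \<beta> (?b \<boxtimes>\<^bsub>M\<^esub> ?n)))"
      by (simp add: \<phi>_def)
    also have "\<dots> = ?\<zeta> \<bullet> (?a' \<rhd> ((f \<bullet> ?\<nu> \<bullet> bc \<beta> ?n) \<bullet> (?a \<rhd> ?\<nu>)))"
      unfolding N'(5) by (simp add: bcr)
    also have "\<dots> = (?\<zeta> \<bullet> (?a' \<rhd> ?\<zeta>)) \<bullet> (?a' \<rhd> (bc \<alpha> ?w \<bullet> (?a \<rhd> (f \<bullet> ?\<nu>))))"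
      unfolding f by simp
    also have "bc \<alpha> ?w \<bullet> (?a \<rhd> (f \<bullet> ?\<nu>)) = (?a' \<rhd> (f \<bullet> ?\<nu>)) \<bullet> bc \<alpha> (?b \<boxtimes>\<^bsub>M\<^esub> ?n)"
      using bc_nat[OF \<alpha>, of "f \<bullet> ?\<nu>" ?w] by simp
    also have "(?\<zeta> \<bullet> (?a' \<rhd> ?\<zeta>)) \<bullet> (?a' \<rhd> ((?a' \<rhd> (f \<bullet> ?\<nu>)) \<bullet> bc \<alpha> (?b \<boxtimes>\<^bsub>M\<^esub> ?n)))
        = \<phi> \<bullet> mu A' (?b \<boxtimes>\<^bsub>M\<^esub> ?n) \<bullet> (?a' \<rhd> bc \<alpha> (?b \<boxtimes>\<^bsub>M\<^esub> ?n))"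
      unfolding Z'(5)[symmetric] \<phi>_def by (simp add: monad_rules)
    finally obtain \<psi> where [simp]: "\<psi> \<in> Arr M" "Dom M \<psi> = ?b' \<boxtimes>\<^bsub>M\<^esub> ?n" "Cod M \<psi> = ?w"
      and \<psi>: "\<psi> \<bullet> K ?n = \<phi>"
      using coequalizer_factor[OF Kq[OF N'(1)], of \<phi>] by auto
    have "\<psi> \<bullet> (?b' \<rhd> ?\<nu>) = \<psi> \<bullet> mu B' ?n \<bullet> (?b' \<rhd> bc \<alpha>' ?n)"
    proof (rule M.coequalizer_eq[OF Kq])
      have "(\<psi> \<bullet> (?b' \<rhd> ?\<nu>)) \<bullet> K (?b \<boxtimes>\<^bsub>M\<^esub> ?n) = (\<psi> \<bullet> K ?n) \<bullet> (?a' \<rhd> ?b \<rhd> ?\<nu>)"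
        by (simp add: K_def rules)
      also have "\<dots> = ?\<zeta> \<bullet> (?a' \<rhd> (f \<bullet> (?\<nu> \<bullet> mu B ?n)))"
        unfolding \<psi> N'(5) \<phi>_def by simp
      also have "\<dots> = (\<psi> \<bullet> K ?n) \<bullet> (?a' \<rhd> mu B ?n)"
        unfolding \<psi> \<phi>_def by simp
      also have "\<dots> = (\<psi> \<bullet> mu B' ?n \<bullet> (?b' \<rhd> bc \<alpha>' ?n)) \<bullet> K (?b \<boxtimes>\<^bsub>M\<^esub> ?n)"
        by (simp add: K_def rules)
      finally show "(\<psi> \<bullet> (?b' \<rhd> ?\<nu>)) \<bullet> K (?b \<boxtimes>\<^bsub>M\<^esub> ?n)
          = (\<psi> \<bullet> mu B' ?n \<bullet> (?b' \<rhd> bc \<alpha>' ?n)) \<bullet> K (?b \<boxtimes>\<^bsub>M\<^esub> ?n)" .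
    qed simp_all
    then obtain g where [simp]: "g \<in> Arr M" "Dom M g = z" "Cod M g = ?w" and g: "g \<bullet> p = \<psi>"
      using coequalizer_factor[OF p', of \<psi>] by auto
    have \<phi>_eq: "\<phi> = g \<bullet> p \<bullet> K ?n"
      unfolding \<psi>[symmetric] g[symmetric] by simp
    \<comment> \<open>on representatives: the class of \<open>x y \<otimes> t\<close> is \<open>x\<close> times the image of \<open>y t\<close>, which yields uniqueness\<close>
    have pK: "p \<bullet> K ?n = y \<bullet> bc \<beta>' z \<bullet> (?a' \<rhd> ?u) \<bullet> (?a' \<rhd> ?\<nu>)"
    proof -
      have "p \<bullet> K ?n = (p \<bullet> mu B' ?n) \<bullet> bc \<beta>' (?b' \<boxtimes>\<^bsub>M\<^esub> ?n) \<bullet> (?a' \<rhd> bc \<alpha>' ?n)"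
        by (simp add: K_def)
      also have "\<dots> = y \<bullet> bc \<beta>' z \<bullet> (?a' \<rhd> (p \<bullet> bc \<alpha>' ?n))"
        unfolding y[symmetric] by (simp add: bcr)
      finally show ?thesis
        unfolding u_lin[symmetric] by simp
    qed
    show "\<exists>!h. is_module_hom C M A' (restrict_obj M \<beta>' (LMod z y)) h Z \<and> h \<bullet> ?u = f"
    proof (rule ex1I[of _ g], rule conjI)
      have "g \<bullet> y \<bullet> bc \<beta>' z = ?\<zeta> \<bullet> (?a' \<rhd> g)"
      proof (rule M.coequalizer_eq[OF lact_coequalizer[OF O(2) p']])
        show "(g \<bullet> y \<bullet> bc \<beta>' z) \<bullet> (?a' \<rhd> p) = (?\<zeta> \<bullet> (?a' \<rhd> g)) \<bullet> (?a' \<rhd> p)"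
        proof (rule M.coequalizer_eq[OF lact_coequalizer[OF O(2) Kq[OF N'(1)]]])
          have "((g \<bullet> y \<bullet> bc \<beta>' z) \<bullet> (?a' \<rhd> p)) \<bullet> (?a' \<rhd> K ?n)
              = g \<bullet> (y \<bullet> (?b' \<rhd> p)) \<bullet> (?b' \<rhd> K ?n) \<bullet> bc \<beta>' (?a' \<boxtimes>\<^bsub>M\<^esub> (?b \<boxtimes>\<^bsub>M\<^esub> ?n))"
            by (simp add: bcr)
          also have "\<dots> = (g \<bullet> p \<bullet> K ?n) \<bullet> mu A' (?b \<boxtimes>\<^bsub>M\<^esub> ?n)"
            unfolding y by (simp add: K_def rules)
          also have "\<dots> = (?\<zeta> \<bullet> mu A' ?w) \<bullet> (?a' \<rhd> ?a' \<rhd> (f \<bullet> ?\<nu>))"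
            unfolding \<phi>_eq[symmetric] \<phi>_def by (simp add: rules)
          also have "\<dots> = ?\<zeta> \<bullet> (?a' \<rhd> \<phi>)"
            unfolding Z'(5) \<phi>_def by simp
          finally show "((g \<bullet> y \<bullet> bc \<beta>' z) \<bullet> (?a' \<rhd> p)) \<bullet> (?a' \<rhd> K ?n)
              = ((?\<zeta> \<bullet> (?a' \<rhd> g)) \<bullet> (?a' \<rhd> p)) \<bullet> (?a' \<rhd> K ?n)"
            unfolding \<phi>_eq by simp
        qed simp_all
      qed simp_all
      then show "is_module_hom C M A' (restrict_obj M \<beta>' (LMod z y)) g Z"
        by (simp add: module_hom_iff)
      have "g \<bullet> ?u = (g \<bullet> p \<bullet> K ?n) \<bullet> eta A' (?b \<boxtimes>\<^bsub>M\<^esub> ?n) \<bullet> eta B ?n"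
        by (simp add: K_def rules)
      also have "\<dots> = (?\<zeta> \<bullet> eta A' ?w) \<bullet> f \<bullet> ?\<nu> \<bullet> eta B ?n"
        unfolding \<phi>_eq[symmetric] \<phi>_def by (simp add: rules)
      also have "\<dots> = f"
        unfolding Z'(6) N'(6) by simp
      finally show "g \<bullet> ?u = f" .
    next
      fix l assume "is_module_hom C M A' (restrict_obj M \<beta>' (LMod z y)) l Z \<and> l \<bullet> ?u = f"
      then have [simp]: "l \<in> Arr M" "Dom M l = z" "Cod M l = ?w"
        and l: "l \<bullet> y \<bullet> bc \<beta>' z = ?\<zeta> \<bullet> (?a' \<rhd> l)" and lf: "l \<bullet> ?u = f"
        by (simp_all add: module_hom_iff)
      show "l = g"
      proof (rule M.coequalizer_eq[OF p'])
        show "l \<bullet> p = g \<bullet> p"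
        proof (rule M.coequalizer_eq[OF Kq[OF N'(1)]])
          have "(l \<bullet> p) \<bullet> K ?n = l \<bullet> (p \<bullet> K ?n)"
            by simp
          also have "\<dots> = (l \<bullet> y \<bullet> bc \<beta>' z) \<bullet> (?a' \<rhd> ?u) \<bullet> (?a' \<rhd> ?\<nu>)"
            unfolding pK by simp
          also have "\<dots> = ?\<zeta> \<bullet> (?a' \<rhd> (l \<bullet> ?u)) \<bullet> (?a' \<rhd> ?\<nu>)"
            unfolding l by simp
          also have "\<dots> = (g \<bullet> p) \<bullet> K ?n"
            unfolding lf using \<phi>_eq by (simp add: \<phi>_def)
          finally show "(l \<bullet> p) \<bullet> K ?n = (g \<bullet> p) \<bullet> K ?n" .
        qed simp_all
      qed simp_all
    qed
  qed
qed

end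

section \<open>Coherence in symmetric monoidal categories\<close>

context symmetric_monoidal_category
begin

lemma rtensor_comp:
  assumes "x \<in> Obj C" "f \<in> Arr C" "g \<in> Arr C" "Dom C g = Cod C f"
  shows "(g \<cdot> f) \<otimes>\<^sub>a Ident C x = (g \<otimes>\<^sub>a Ident C x) \<cdot> (f \<otimes>\<^sub>a Ident C x)"
  using assms by (simp add: tensor_comp)

lemma ltensor_comp:
  assumes "x \<in> Obj C" "f \<in> Arr C" "g \<in> Arr C" "Dom C g = Cod C f"
  shows "Ident C x \<otimes>\<^sub>a (g \<cdot> f) = (Ident C x \<otimes>\<^sub>a g) \<cdot> (Ident C x \<otimes>\<^sub>a f)"
  using assms by (simp add: tensor_comp)

lemma assoc_nat:
  assumes "f \<in> Arr C" "g \<in> Arr C" "h \<in> Arr C" "Cod C f = a" "Cod C g = b" "Cod C h = c"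
  shows "assoc C a b c \<cdot> (f \<otimes>\<^sub>a (g \<otimes>\<^sub>a h)) = ((f \<otimes>\<^sub>a g) \<otimes>\<^sub>a h) \<cdot> assoc C (Dom C f) (Dom C g) (Dom C h)"
  using assoc_natural[of f "Dom C f" a g "Dom C g" b h "Dom C h" c] assms by (simp add: hom_def)

lemma runit_nat:
  "f \<in> Arr C \<Longrightarrow> Cod C f = a \<Longrightarrow> runit C a \<cdot> (f \<otimes>\<^sub>a Ident C \<one>) = f \<cdot> runit C (Dom C f)"
  using runit_natural[of f "Dom C f" a] by (simp add: hom_def)

lemma lunit_nat:
  "f \<in> Arr C \<Longrightarrow> Cod C f = a \<Longrightarrow> lunit C a \<cdot> (Ident C \<one> \<otimes>\<^sub>a f) = f \<cdot> lunit C (Dom C f)"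
  using lunit_natural[of f "Dom C f" a] by (simp add: hom_def)

lemma symm_nat:
  "f \<in> Arr C \<Longrightarrow> g \<in> Arr C \<Longrightarrow> Cod C f = a \<Longrightarrow> Cod C g = b \<Longrightarrow>
    symm C a b \<cdot> (f \<otimes>\<^sub>a g) = (g \<otimes>\<^sub>a f) \<cdot> symm C (Dom C f) (Dom C g)"
  using symm_natural[of f "Dom C f" a g "Dom C g" b] by (simp add: hom_def)

lemma rtensor_functor: "x \<in> Obj C \<Longrightarrow> is_functor C C \<lparr>fob = (\<lambda>a. a \<otimes> x), far = (\<lambda>f. f \<otimes>\<^sub>a Ident C x)\<rparr>"
  by (rule is_functorI) (auto simp: category_axioms hom_def rtensor_comp)

lemma ltensor_functor: "x \<in> Obj C \<Longrightarrow> is_functor C C \<lparr>fob = (\<lambda>a. x \<otimes> a), far = (\<lambda>f. Ident C x \<otimes>\<^sub>a f)\<rparr>"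
  by (rule is_functorI) (auto simp: category_axioms hom_def ltensor_comp)

lemma rtensor_iso: "x \<in> Obj C \<Longrightarrow> is_iso C f \<Longrightarrow> is_iso C (f \<otimes>\<^sub>a Ident C x)"
  using functor_iso[OF rtensor_functor, of x f] by simp

lemma ltensor_iso: "x \<in> Obj C \<Longrightarrow> is_iso C f \<Longrightarrow> is_iso C (Ident C x \<otimes>\<^sub>a f)"
  using functor_iso[OF ltensor_functor, of x f] by simp

text \<open>Tensoring with the unit object is faithful, being naturally isomorphic to the identity.\<close>

lemma tensor_unit_cancel_left:
  assumes "Ident C \<one> \<otimes>\<^sub>a f = Ident C \<one> \<otimes>\<^sub>a g" "f \<in> Arr C" "g \<in> Arr C" "Dom C f = Dom C g" "Cod C f = Cod C g"
  shows "f = g"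
proof (rule iso_cancel_right[of "lunit C (Dom C g)"])
  show "f \<cdot> lunit C (Dom C g) = g \<cdot> lunit C (Dom C g)"
    using lunit_nat[of f "Cod C g"] lunit_nat[of g "Cod C g"] assms by simp
qed (use assms in auto)

lemma tensor_unit_cancel_right:
  assumes "f \<otimes>\<^sub>a Ident C \<one> = g \<otimes>\<^sub>a Ident C \<one>" "f \<in> Arr C" "g \<in> Arr C" "Dom C f = Dom C g" "Cod C f = Cod C g"
  shows "f = g"
proof (rule iso_cancel_right[of "runit C (Dom C g)"])
  show "f \<cdot> runit C (Dom C g) = g \<cdot> runit C (Dom C g)"
    using runit_nat[of f "Cod C g"] runit_nat[of g "Cod C g"] assms by simp
qed (use assms in auto)

text \<open>Kelly's derivation of the remaining unit coherences from the pentagon and the triangle.\<close>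

lemma lunit_tensor:
  assumes [simp]: "a \<in> Obj C" "b \<in> Obj C"
  shows "(lunit C a \<otimes>\<^sub>a Ident C b) \<cdot> assoc C \<one> a b = lunit C (a \<otimes> b)"
proof (rule tensor_unit_cancel_left)
  let ?r = "(runit C \<one> \<otimes>\<^sub>a Ident C a) \<otimes>\<^sub>a Ident C b" and ?l = "(lunit C a \<otimes>\<^sub>a Ident C b) \<cdot> assoc C \<one> a b"
  have "assoc C \<one> a b \<cdot> (Ident C \<one> \<otimes>\<^sub>a ?l) = ((Ident C \<one> \<otimes>\<^sub>a lunit C a) \<otimes>\<^sub>a Ident C b) \<cdot>
      assoc C \<one> (\<one> \<otimes> a) b \<cdot> (Ident C \<one> \<otimes>\<^sub>a assoc C \<one> a b)"
    using whisker[OF assoc_nat[of "Ident C \<one>" "lunit C a" "Ident C b" \<one> a b]]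
    by (simp add: ltensor_comp)
  also have "\<dots> = ?r \<cdot> (assoc C \<one> \<one> a \<otimes>\<^sub>a Ident C b) \<cdot> assoc C \<one> (\<one> \<otimes> a) b \<cdot> (Ident C \<one> \<otimes>\<^sub>a assoc C \<one> a b)"
    using triangle[of \<one> a, symmetric] by (simp add: rtensor_comp)
  also have "\<dots> = (?r \<cdot> assoc C (\<one> \<otimes> \<one>) a b) \<cdot> assoc C \<one> \<one> (a \<otimes> b)"
    using pentagon[of \<one> \<one> a b] by simp
  also have "?r \<cdot> assoc C (\<one> \<otimes> \<one>) a b = assoc C \<one> a b \<cdot> (runit C \<one> \<otimes>\<^sub>a Ident C (a \<otimes> b))"
    using assoc_nat[of "runit C \<one>" "Ident C a" "Ident C b" \<one> a b] by simp
  also have "(assoc C \<one> a b \<cdot> (runit C \<one> \<otimes>\<^sub>a Ident C (a \<otimes> b))) \<cdot> assoc C \<one> \<one> (a \<otimes> b)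
      = assoc C \<one> a b \<cdot> (Ident C \<one> \<otimes>\<^sub>a lunit C (a \<otimes> b))"
    using triangle[of \<one> "a \<otimes> b"] by simp
  finally show "Ident C \<one> \<otimes>\<^sub>a ?l = Ident C \<one> \<otimes>\<^sub>a lunit C (a \<otimes> b)"
    by (rule iso_cancel_left[rotated]) simp_all
qed simp_all

lemma runit_tensor:
  assumes [simp]: "a \<in> Obj C" "b \<in> Obj C"
  shows "runit C (a \<otimes> b) \<cdot> assoc C a b \<one> = Ident C a \<otimes>\<^sub>a runit C b"
proof (rule tensor_unit_cancel_right)
  let ?i = "assoc C a (b \<otimes> \<one>) \<one> \<cdot> (Ident C a \<otimes>\<^sub>a assoc C b \<one> \<one>)"
  have "((runit C (a \<otimes> b) \<cdot> assoc C a b \<one>) \<otimes>\<^sub>a Ident C \<one>) \<cdot> ?i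
      = ((runit C (a \<otimes> b) \<otimes>\<^sub>a Ident C \<one>) \<cdot> assoc C (a \<otimes> b) \<one> \<one>) \<cdot> assoc C a b (\<one> \<otimes> \<one>)"
    using pentagon[of a b \<one> \<one>] by (simp add: rtensor_comp)
  also have "\<dots> = (Ident C (a \<otimes> b) \<otimes>\<^sub>a lunit C \<one>) \<cdot> assoc C a b (\<one> \<otimes> \<one>)"
    using triangle[of "a \<otimes> b" \<one>] by simp
  also have "\<dots> = assoc C a b \<one> \<cdot> (Ident C a \<otimes>\<^sub>a (Ident C b \<otimes>\<^sub>a lunit C \<one>))"
    using assoc_nat[of "Ident C a" "Ident C b" "lunit C \<one>" a b \<one>] by simp
  also have "\<dots> = (assoc C a b \<one> \<cdot> (Ident C a \<otimes>\<^sub>a (runit C b \<otimes>\<^sub>a Ident C \<one>))) \<cdot> (Ident C a \<otimes>\<^sub>a assoc C b \<one> \<one>)"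
    unfolding triangle[OF assms(2) unit_obj, symmetric] by (simp add: ltensor_comp)
  also have "\<dots> = ((Ident C a \<otimes>\<^sub>a runit C b) \<otimes>\<^sub>a Ident C \<one>) \<cdot> ?i"
    using assoc_nat[of "Ident C a" "runit C b" "Ident C \<one>" a b \<one>] by simp
  finally show "(runit C (a \<otimes> b) \<cdot> assoc C a b \<one>) \<otimes>\<^sub>a Ident C \<one> = (Ident C a \<otimes>\<^sub>a runit C b) \<otimes>\<^sub>a Ident C \<one>"
    by (rule iso_cancel_right[rotated]) (auto intro!: is_iso_comp ltensor_iso)
qed simp_all

lemma lunit_one: "lunit C \<one> = runit C \<one>"
proof (rule tensor_unit_cancel_right)
  have "lunit C (\<one> \<otimes> \<one>) = Ident C \<one> \<otimes>\<^sub>a lunit C \<one>"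
  proof (rule iso_cancel_left[of "lunit C \<one>"])
    show "lunit C \<one> \<cdot> lunit C (\<one> \<otimes> \<one>) = lunit C \<one> \<cdot> (Ident C \<one> \<otimes>\<^sub>a lunit C \<one>)"
      using lunit_nat[of "lunit C \<one>" \<one>] by simp
  qed simp_all
  then have "(lunit C \<one> \<otimes>\<^sub>a Ident C \<one>) \<cdot> assoc C \<one> \<one> \<one> = (runit C \<one> \<otimes>\<^sub>a Ident C \<one>) \<cdot> assoc C \<one> \<one> \<one>"
    using lunit_tensor[of \<one> \<one>] triangle[of \<one> \<one>] by simp
  then show "lunit C \<one> \<otimes>\<^sub>a Ident C \<one> = runit C \<one> \<otimes>\<^sub>a Ident C \<one>"
    by (rule iso_cancel_right[rotated]) simp_all
qed simp_all

text \<open>The hexagon for two unit objects and \<open>c\<close>, composed with the right unit constraint: every other arrow in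
  it can be cancelled.\<close>

lemma lunit_symm:
  assumes c [simp]: "c \<in> Obj C"
  shows "lunit C c \<cdot> symm C c \<one> = runit C c"
proof -
  have "runit C c \<cdot> symm C \<one> c = lunit C c"
  proof (rule tensor_unit_cancel_left)
    let ?I = "Ident C \<one>" and ?s = "symm C \<one> c"
    have "?s \<cdot> (?I \<otimes>\<^sub>a (runit C c \<cdot> ?s)) = ?s \<cdot> ((?I \<otimes>\<^sub>a runit C c) \<cdot> (?I \<otimes>\<^sub>a ?s))"
      by (simp add: ltensor_comp)
    also have "\<dots> = (?s \<cdot> runit C (\<one> \<otimes> c)) \<cdot> assoc C \<one> c \<one> \<cdot> (?I \<otimes>\<^sub>a ?s)"
      using runit_tensor[of \<one> c, symmetric] by simp
    also have "\<dots> = runit C (c \<otimes> \<one>) \<cdot> ((?s \<otimes>\<^sub>a ?I) \<cdot> assoc C \<one> c \<one> \<cdot> (?I \<otimes>\<^sub>a ?s))"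
      using runit_nat[of ?s "c \<otimes> \<one>"] whisker[OF runit_nat[of ?s "c \<otimes> \<one>"]] by simp
    also have "\<dots> = (runit C (c \<otimes> \<one>) \<cdot> assoc C c \<one> \<one>) \<cdot> symm C (\<one> \<otimes> \<one>) c \<cdot> assoc C \<one> \<one> c"
      using hexagon[of \<one> \<one> c] by simp
    also have "\<dots> = ((Ident C c \<otimes>\<^sub>a runit C \<one>) \<cdot> symm C (\<one> \<otimes> \<one>) c) \<cdot> assoc C \<one> \<one> c"
      using runit_tensor[of c \<one>] by simp
    also have "\<dots> = ?s \<cdot> (runit C \<one> \<otimes>\<^sub>a Ident C c) \<cdot> assoc C \<one> \<one> c"
      using symm_nat[of "runit C \<one>" "Ident C c" \<one> c, symmetric] by simp
    also have "\<dots> = ?s \<cdot> (?I \<otimes>\<^sub>a lunit C c)"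
      using triangle[of \<one> c] by simp
    finally have "symm C c \<one> \<cdot> (?s \<cdot> (?I \<otimes>\<^sub>a (runit C c \<cdot> ?s))) = symm C c \<one> \<cdot> (?s \<cdot> (?I \<otimes>\<^sub>a lunit C c))"
      by simp
    then show "?I \<otimes>\<^sub>a (runit C c \<cdot> ?s) = ?I \<otimes>\<^sub>a lunit C c"
      using whisker[OF symm_symm[of \<one> c]] by simp
  qed simp_all
  then have "lunit C c \<cdot> symm C c \<one> = runit C c \<cdot> symm C \<one> c \<cdot> symm C c \<one>"
    using whisker[of "runit C c" "symm C \<one> c" "lunit C c" "symm C c \<one>"] by simp
  then show ?thesis by simp
qed

text \<open>When \<open>x\<close> and \<open>y\<close> both act on an object, the symmetry enters through this arrow
  \<open>x \<otimes> (y \<otimes> z) \<rightarrow> y \<otimes> (x \<otimes> z)\<close>, which exchanges the two actions.\<close>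

definition interchange where
  "interchange x y z = iso_inv C (assoc C y x z) \<cdot> (symm C x y \<otimes>\<^sub>a Ident C z) \<cdot> assoc C x y z"

lemma interchange_arr [simp]:
  assumes "x \<in> Obj C" "y \<in> Obj C" "z \<in> Obj C"
  shows "interchange x y z \<in> Arr C" "Dom C (interchange x y z) = x \<otimes> (y \<otimes> z)"
    "Cod C (interchange x y z) = y \<otimes> (x \<otimes> z)"
  using assms by (simp_all add: interchange_def)

lemma interchange_nat:
  assumes "f \<in> Arr C" "g \<in> Arr C" "h \<in> Arr C" "Cod C f = x" "Cod C g = y" "Cod C h = z"
  shows "interchange x y z \<cdot> (f \<otimes>\<^sub>a (g \<otimes>\<^sub>a h)) = (g \<otimes>\<^sub>a (f \<otimes>\<^sub>a h)) \<cdot> interchange (Dom C f) (Dom C g) (Dom C h)"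
proof -
  have [simp]: "x \<in> Obj C" "y \<in> Obj C" "z \<in> Obj C" using assms cod_obj by blast+
  note [simp] = assms
  have "assoc C y x z \<cdot> (interchange x y z \<cdot> (f \<otimes>\<^sub>a (g \<otimes>\<^sub>a h)))
      = ((symm C x y \<cdot> (f \<otimes>\<^sub>a g)) \<otimes>\<^sub>a h) \<cdot> assoc C (Dom C f) (Dom C g) (Dom C h)"
    using tensor_comp[of "f \<otimes>\<^sub>a g" "symm C x y" h "Ident C z"]
      whisker[OF tensor_comp[of "f \<otimes>\<^sub>a g" "symm C x y" h "Ident C z"]]
    by (simp add: interchange_def assoc_nat)
  also have "\<dots> = ((g \<otimes>\<^sub>a f) \<otimes>\<^sub>a h) \<cdot> (symm C (Dom C f) (Dom C g) \<otimes>\<^sub>a Ident C (Dom C h)) \<cdot> assoc C (Dom C f) (Dom C g) (Dom C h)"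
    using tensor_comp[of "symm C (Dom C f) (Dom C g)" "g \<otimes>\<^sub>a f" "Ident C (Dom C h)" h]
      whisker[OF tensor_comp[of "symm C (Dom C f) (Dom C g)" "g \<otimes>\<^sub>a f" "Ident C (Dom C h)" h]]
    by (simp add: symm_nat)
  also have "\<dots> = assoc C y x z \<cdot> ((g \<otimes>\<^sub>a (f \<otimes>\<^sub>a h)) \<cdot> interchange (Dom C f) (Dom C g) (Dom C h))"
    using whisker[OF assoc_nat[of g f h y x z]] by (simp add: interchange_def)
  finally show ?thesis
    by (rule iso_cancel_left[rotated]) simp_all
qed

lemma interchange_interchange [simp]:
  assumes "x \<in> Obj C" "y \<in> Obj C" "z \<in> Obj C"
  shows "interchange y x z \<cdot> interchange x y z = Ident C (x \<otimes> (y \<otimes> z))"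
proof -
  have "(symm C y x \<otimes>\<^sub>a Ident C z) \<cdot> (symm C x y \<otimes>\<^sub>a Ident C z) = Ident C ((x \<otimes> y) \<otimes> z)"
    using assms by (simp add: tensor_comp)
  from whisker[OF this] show ?thesis
    using assms by (simp add: interchange_def)
qed

lemma interchange_unit:
  assumes [simp]: "x \<in> Obj C" "z \<in> Obj C"
  shows "lunit C (x \<otimes> z) \<cdot> interchange x \<one> z = Ident C x \<otimes>\<^sub>a lunit C z"
proof -
  have "lunit C (x \<otimes> z) \<cdot> interchange x \<one> z = ((lunit C x \<cdot> symm C x \<one>) \<otimes>\<^sub>a Ident C z) \<cdot> assoc C x \<one> z"
    by (simp add: lunit_tensor[symmetric] interchange_def rtensor_comp)
  then show ?thesis
    by (simp add: lunit_symm triangle)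
qed

lemma interchange_runit:
  assumes [simp]: "x \<in> Obj C" "y \<in> Obj C"
  shows "(Ident C y \<otimes>\<^sub>a runit C x) \<cdot> interchange x y \<one> = symm C x y \<cdot> (Ident C x \<otimes>\<^sub>a runit C y)"
proof -
  have "(Ident C y \<otimes>\<^sub>a runit C x) \<cdot> interchange x y \<one> = (runit C (y \<otimes> x) \<cdot> (symm C x y \<otimes>\<^sub>a Ident C \<one>)) \<cdot> assoc C x y \<one>"
    by (simp add: runit_tensor[symmetric] interchange_def)
  also have "\<dots> = symm C x y \<cdot> (Ident C x \<otimes>\<^sub>a runit C y)"
    by (simp add: runit_nat runit_tensor)
  finally show ?thesis .
qed

text \<open>The hexagon axiom describes \<open>symm C (y \<otimes> z) x\<close>; this is its inverse.\<close>

lemma symm_tensor: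
  assumes [simp]: "x \<in> Obj C" "y \<in> Obj C" "z \<in> Obj C"
  shows "symm C x (y \<otimes> z) = assoc C y z x \<cdot> (Ident C y \<otimes>\<^sub>a symm C x z) \<cdot> interchange x y z"
proof -
  let ?h = "(symm C y x \<otimes>\<^sub>a Ident C z) \<cdot> assoc C y x z \<cdot> (Ident C y \<otimes>\<^sub>a symm C z x)"
  let ?k = "(Ident C y \<otimes>\<^sub>a symm C x z) \<cdot> iso_inv C (assoc C y x z) \<cdot> (symm C x y \<otimes>\<^sub>a Ident C z)"
  have "(symm C x y \<otimes>\<^sub>a Ident C z) \<cdot> (symm C y x \<otimes>\<^sub>a Ident C z) = Ident C ((y \<otimes> x) \<otimes> z)"
    "(symm C y x \<otimes>\<^sub>a Ident C z) \<cdot> (symm C x y \<otimes>\<^sub>a Ident C z) = Ident C ((x \<otimes> y) \<otimes> z)"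
    "(Ident C y \<otimes>\<^sub>a symm C x z) \<cdot> (Ident C y \<otimes>\<^sub>a symm C z x) = Ident C (y \<otimes> (z \<otimes> x))"
    "(Ident C y \<otimes>\<^sub>a symm C z x) \<cdot> (Ident C y \<otimes>\<^sub>a symm C x z) = Ident C (y \<otimes> (x \<otimes> z))"
    by (simp_all add: tensor_comp)
  note e = this this[THEN whisker]
  have kh: "?h \<cdot> ?k = Ident C ((x \<otimes> y) \<otimes> z)"
    by (simp add: e)
  have "symm C x (y \<otimes> z) \<cdot> iso_inv C (assoc C x y z) = assoc C y z x \<cdot> ?k"
  proof -
    have "assoc C y z x \<cdot> ?k = symm C x (y \<otimes> z) \<cdot> symm C (y \<otimes> z) x \<cdot> assoc C y z x \<cdot> ?k"
      using whisker[OF symm_symm[of "y \<otimes> z" x]] by simp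
    also have "\<dots> = symm C x (y \<otimes> z) \<cdot> iso_inv C (assoc C x y z) \<cdot> ((assoc C x y z \<cdot> symm C (y \<otimes> z) x \<cdot> assoc C y z x) \<cdot> ?k)"
      by simp
    also have "\<dots> = symm C x (y \<otimes> z) \<cdot> iso_inv C (assoc C x y z)"
      unfolding hexagon[OF assms(2,3,1)] kh by simp
    finally show ?thesis by simp
  qed
  then have "(symm C x (y \<otimes> z) \<cdot> iso_inv C (assoc C x y z)) \<cdot> assoc C x y z = (assoc C y z x \<cdot> ?k) \<cdot> assoc C x y z"
    by simp
  then show ?thesis
    by (simp add: interchange_def)
qed

lemma interchange_symm:
  assumes [simp]: "x \<in> Obj C" "y \<in> Obj C" "z \<in> Obj C"
  shows "(Ident C y \<otimes>\<^sub>a symm C z x) \<cdot> iso_inv C (assoc C y z x) \<cdot> symm C x (y \<otimes> z) = interchange x y z"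
proof -
  have "(Ident C y \<otimes>\<^sub>a symm C z x) \<cdot> (Ident C y \<otimes>\<^sub>a symm C x z) = Ident C (y \<otimes> (x \<otimes> z))"
    by (simp add: tensor_comp)
  from whisker[OF this] show ?thesis
    by (simp add: symm_tensor)
qed

lemma pentagon_inv:
  assumes [simp]: "a \<in> Obj C" "b \<in> Obj C" "c \<in> Obj C" "d \<in> Obj C"
  shows "(iso_inv C (assoc C a b c) \<otimes>\<^sub>a Ident C d) \<cdot> assoc C (a \<otimes> b) c d =
      assoc C a (b \<otimes> c) d \<cdot> (Ident C a \<otimes>\<^sub>a assoc C b c d) \<cdot> iso_inv C (assoc C a b (c \<otimes> d))"
proof -
  have e: "(iso_inv C (assoc C a b c) \<otimes>\<^sub>a Ident C d) \<cdot> (assoc C a b c \<otimes>\<^sub>a Ident C d) = Ident C ((a \<otimes> (b \<otimes> c)) \<otimes> d)"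
    by (simp add: tensor_comp)
  have "(iso_inv C (assoc C a b c) \<otimes>\<^sub>a Ident C d) \<cdot> assoc C (a \<otimes> b) c d
      = (iso_inv C (assoc C a b c) \<otimes>\<^sub>a Ident C d) \<cdot> (assoc C (a \<otimes> b) c d \<cdot> assoc C a b (c \<otimes> d)) \<cdot> iso_inv C (assoc C a b (c \<otimes> d))"
    by simp
  also have "\<dots> = assoc C a (b \<otimes> c) d \<cdot> (Ident C a \<otimes>\<^sub>a assoc C b c d) \<cdot> iso_inv C (assoc C a b (c \<otimes> d))"
    unfolding pentagon[OF assms] using whisker[OF e] by simp
  finally show "(iso_inv C (assoc C a b c) \<otimes>\<^sub>a Ident C d) \<cdot> assoc C (a \<otimes> b) c d =
      assoc C a (b \<otimes> c) d \<cdot> (Ident C a \<otimes>\<^sub>a assoc C b c d) \<cdot> iso_inv C (assoc C a b (c \<otimes> d))" .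
qed

lemma interchange_assoc_right:
  assumes [simp]: "b \<in> Obj C" "a \<in> Obj C" "d \<in> Obj C" "x \<in> Obj C"
  shows "(interchange b a d \<otimes>\<^sub>a Ident C x) \<cdot> assoc C b (a \<otimes> d) x \<cdot> (Ident C b \<otimes>\<^sub>a assoc C a d x) =
    assoc C a (b \<otimes> d) x \<cdot> (Ident C a \<otimes>\<^sub>a assoc C b d x) \<cdot> interchange b a (d \<otimes> x)"
proof -
  let ?s = "(symm C b a \<otimes>\<^sub>a Ident C d) \<otimes>\<^sub>a Ident C x"
  have "(interchange b a d \<otimes>\<^sub>a Ident C x) \<cdot> assoc C b (a \<otimes> d) x \<cdot> (Ident C b \<otimes>\<^sub>a assoc C a d x)
      = (iso_inv C (assoc C a b d) \<otimes>\<^sub>a Ident C x) \<cdot> ?s \<cdot> ((assoc C b a d \<otimes>\<^sub>a Ident C x) \<cdot>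
          assoc C b (a \<otimes> d) x \<cdot> (Ident C b \<otimes>\<^sub>a assoc C a d x))"
    by (simp add: interchange_def rtensor_comp)
  also have "\<dots> = (iso_inv C (assoc C a b d) \<otimes>\<^sub>a Ident C x) \<cdot> (?s \<cdot> assoc C (b \<otimes> a) d x) \<cdot> assoc C b a (d \<otimes> x)"
    unfolding pentagon[OF assms, symmetric] by simp
  also have "?s \<cdot> assoc C (b \<otimes> a) d x = assoc C (a \<otimes> b) d x \<cdot> (symm C b a \<otimes>\<^sub>a Ident C (d \<otimes> x))"
    using assoc_nat[of "symm C b a" "Ident C d" "Ident C x" "a \<otimes> b" d x] by simp
  also have "(iso_inv C (assoc C a b d) \<otimes>\<^sub>a Ident C x) \<cdot> (assoc C (a \<otimes> b) d x \<cdot> (symm C b a \<otimes>\<^sub>a Ident C (d \<otimes> x))) \<cdot> assoc C b a (d \<otimes> x)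
     = assoc C a (b \<otimes> d) x \<cdot> (Ident C a \<otimes>\<^sub>a assoc C b d x) \<cdot> interchange b a (d \<otimes> x)"
    using whisker[OF pentagon_inv[of a b d x]] by (simp add: interchange_def)
  finally show ?thesis .
qed

text \<open>The hexagon tensored with \<open>w\<close>, where pentagons move the associativity constraints past \<open>w\<close>.  It lets
  an interchange pass a multiplication.\<close>

lemma interchange_tensor:
  assumes [simp]: "x \<in> Obj C" "y \<in> Obj C" "z \<in> Obj C" "w \<in> Obj C"
  shows "interchange x (y \<otimes> z) w \<cdot> (Ident C x \<otimes>\<^sub>a assoc C y z w) =
    assoc C y z (x \<otimes> w) \<cdot> (Ident C y \<otimes>\<^sub>a interchange x z w) \<cdot> interchange x y (z \<otimes> w)"
proof (rule iso_cancel_left[of "assoc C (y \<otimes> z) x w"])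
  have e: "assoc C y (z \<otimes> x) w \<cdot> (Ident C y \<otimes>\<^sub>a (symm C x z \<otimes>\<^sub>a Ident C w)) =
      ((Ident C y \<otimes>\<^sub>a symm C x z) \<otimes>\<^sub>a Ident C w) \<cdot> assoc C y (x \<otimes> z) w"
    using assoc_nat[of "Ident C y" "symm C x z" "Ident C w" y "z \<otimes> x" w] by simp
  have z: "(Ident C y \<otimes>\<^sub>a assoc C z x w) \<cdot> (Ident C y \<otimes>\<^sub>a iso_inv C (assoc C z x w)) = Ident C (y \<otimes> ((z \<otimes> x) \<otimes> w))"
    by (simp add: tensor_comp)
  have "assoc C (y \<otimes> z) x w \<cdot> interchange x (y \<otimes> z) w \<cdot> (Ident C x \<otimes>\<^sub>a assoc C y z w)
      = (assoc C y z x \<otimes>\<^sub>a Ident C w) \<cdot> ((Ident C y \<otimes>\<^sub>a symm C x z) \<otimes>\<^sub>a Ident C w) \<cdot>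
        ((interchange x y z \<otimes>\<^sub>a Ident C w) \<cdot> assoc C x (y \<otimes> z) w \<cdot> (Ident C x \<otimes>\<^sub>a assoc C y z w))"
    by (simp add: interchange_def[of x "y \<otimes> z"] symm_tensor rtensor_comp)
  also have "\<dots> = (assoc C y z x \<otimes>\<^sub>a Ident C w) \<cdot> (((Ident C y \<otimes>\<^sub>a symm C x z) \<otimes>\<^sub>a Ident C w) \<cdot> assoc C y (x \<otimes> z) w) \<cdot>
        (Ident C y \<otimes>\<^sub>a assoc C x z w) \<cdot> interchange x y (z \<otimes> w)"
    unfolding interchange_assoc_right[OF assms] by simp
  also have "\<dots> = ((assoc C y z x \<otimes>\<^sub>a Ident C w) \<cdot> assoc C y (z \<otimes> x) w \<cdot> (Ident C y \<otimes>\<^sub>a assoc C z x w)) \<cdot>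
        (Ident C y \<otimes>\<^sub>a interchange x z w) \<cdot> interchange x y (z \<otimes> w)"
    unfolding e[symmetric] using whisker[OF z] by (simp add: interchange_def[of x z] ltensor_comp)
  also have "\<dots> = assoc C (y \<otimes> z) x w \<cdot> assoc C y z (x \<otimes> w) \<cdot> (Ident C y \<otimes>\<^sub>a interchange x z w) \<cdot> interchange x y (z \<otimes> w)"
    unfolding pentagon[OF assms(2,3,1,4), symmetric] by simp
  finally show "assoc C (y \<otimes> z) x w \<cdot> interchange x (y \<otimes> z) w \<cdot> (Ident C x \<otimes>\<^sub>a assoc C y z w) = \<dots>" .
qed simp_all

end

section \<open>The monoidal category acting on itself\<close>

definition self_act :: "('o, 'm, 'z) smc_scheme \<Rightarrow> ('o, 'm, 'o, 'm) actegory" where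
  "self_act C = \<lparr>Obj = Obj C, Arr = Arr C, Dom = Dom C, Cod = Cod C, Ident = Ident C, Comp = Comp C,
    act = tensor C, act_assoc = assoc C, act_unit = lunit C\<rparr>"

lemma self_act_simps [simp]:
  "Obj (self_act C) = Obj C" "Arr (self_act C) = Arr C" "Dom (self_act C) = Dom C" "Cod (self_act C) = Cod C"
  "Ident (self_act C) = Ident C" "Comp (self_act C) = Comp C"
  "act (self_act C) = tensor C" "act_assoc (self_act C) = assoc C" "act_unit (self_act C) = lunit C"
  by (simp_all add: self_act_def)

lemma self_act_hom [simp]: "hom (self_act C) = hom C"
  by (simp add: hom_def fun_eq_iff)

lemma self_act_is_iso [simp]: "is_iso (self_act C) = is_iso C"
  by (simp add: is_iso_def fun_eq_iff)

lemma self_act_iso_inv [simp]: "iso_inv (self_act C) = iso_inv C"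
  by (simp add: iso_inv_def fun_eq_iff)

lemma self_act_is_coequalizer [simp]: "is_coequalizer (self_act C) = is_coequalizer C"
  by (simp add: is_coequalizer_def fun_eq_iff)

text \<open>The only actegory axiom that is not an axiom of \<open>C\<close> is the coherence of the left unit constraint with
  the associativity constraint, which is \<open>lunit_tensor\<close>.\<close>

lemma (in symmetric_monoidal_category) left_actegory_self: "left_actegory C (self_act C)"
proof -
  have cat: "category (self_act C)"
    by (rule categoryI) (auto simp: hom_def)
  have "prod_cat C (self_act C) = prod_cat C C"
    by (simp add: prod_cat_def)
  then have "is_functor (prod_cat C (self_act C)) (self_act C) (tensor C)"
    using tensor_functor cat by (simp add: is_functor_def)
  then show ?thesis
    using cat pentagon assoc_natural lunit_natural triangle
    by unfold_locales
      (auto simp: category_def hom_def lunit_tensor)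
qed

locale right_exact_monoidal_category = symmetric_monoidal_category +
  assumes rtensor_coequalizer: "\<lbrakk>x \<in> Obj C; is_coequalizer C f g z q\<rbrakk> \<Longrightarrow>
      is_coequalizer C (f \<otimes>\<^sub>a Ident C x) (g \<otimes>\<^sub>a Ident C x) (z \<otimes> x) (q \<otimes>\<^sub>a Ident C x)"
    and ltensor_coequalizer: "\<lbrakk>x \<in> Obj C; is_coequalizer C f g z q\<rbrakk> \<Longrightarrow>
      is_coequalizer C (Ident C x \<otimes>\<^sub>a f) (Ident C x \<otimes>\<^sub>a g) (x \<otimes> z) (Ident C x \<otimes>\<^sub>a q)"

text \<open>By closedness \<open>_ \<otimes> x\<close> is a left adjoint, and the symmetry transports the result to \<open>x \<otimes> _\<close>.\<close>

lemma (in closed_symmetric_monoidal_category) right_exact: "right_exact_monoidal_category C"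
proof unfold_locales
  fix x f g z q assume x [simp]: "x \<in> Obj C" and q: "is_coequalizer C f g z q"
  obtain H where "left_adjoint C C \<lparr>fob = (\<lambda>a. a \<otimes> x), far = (\<lambda>f. f \<otimes>\<^sub>a Ident C x)\<rparr> H"
    using internal_hom[OF x] by blast
  from left_adjoint_preserves_coequalizer[OF this q]
  show r: "is_coequalizer C (f \<otimes>\<^sub>a Ident C x) (g \<otimes>\<^sub>a Ident C x) (z \<otimes> x) (q \<otimes>\<^sub>a Ident C x)"
    by simp
  note [simp] = coequalizer_arr[OF q]
  have z [simp]: "z \<in> Obj C" using coequalizer_arr(3,7)[OF q] cod_obj by blast
  have i: "is_iso C (symm C y y')" if "y \<in> Obj C" "y' \<in> Obj C" for y y'
    using that by (intro is_isoI[of _ _ "y \<otimes> y'" "y' \<otimes> y" "symm C y' y"] homI) simp_all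
  have "is_coequalizer C (Ident C x \<otimes>\<^sub>a f) (Ident C x \<otimes>\<^sub>a g) (z \<otimes> x) ((q \<otimes>\<^sub>a Ident C x) \<cdot> symm C x (Dom C q))"
    by (rule coequalizer_precomp_iso[OF r, of "symm C x (Dom C f)" "x \<otimes> Dom C f" _ "x \<otimes> Dom C q"])
      (auto intro!: homI i simp: symm_nat)
  from coequalizer_postcomp_iso[OF this i[of z x]]
  have "is_coequalizer C (Ident C x \<otimes>\<^sub>a f) (Ident C x \<otimes>\<^sub>a g) (x \<otimes> z) (symm C z x \<cdot> (q \<otimes>\<^sub>a Ident C x) \<cdot> symm C x (Dom C q))"
    by simp
  also have "symm C z x \<cdot> (q \<otimes>\<^sub>a Ident C x) \<cdot> symm C x (Dom C q) = Ident C x \<otimes>\<^sub>a q"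
    using whisker[OF symm_nat[of q "Ident C x" z x]] by simp
  finally show "is_coequalizer C (Ident C x \<otimes>\<^sub>a f) (Ident C x \<otimes>\<^sub>a g) (x \<otimes> z) (Ident C x \<otimes>\<^sub>a q)" .
qed

sublocale right_exact_monoidal_category \<subseteq> self: right_exact_actegory C "self_act C"
  rewrites "Obj (self_act C) = Obj C" and "Arr (self_act C) = Arr C" and "Dom (self_act C) = Dom C"
    and "Cod (self_act C) = Cod C" and "Ident (self_act C) = Ident C" and "Comp (self_act C) = Comp C"
    and "act (self_act C) = tensor C" and "act_assoc (self_act C) = assoc C"
    and "act_unit (self_act C) = lunit C" and "hom (self_act C) = hom C"
    and "is_iso (self_act C) = is_iso C" and "iso_inv (self_act C) = iso_inv C"
    and "is_coequalizer (self_act C) = is_coequalizer C"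
proof -
  interpret s: left_actegory C "self_act C" by (rule left_actegory_self)
  show "right_exact_actegory C (self_act C)"
    using rtensor_coequalizer ltensor_coequalizer
    by unfold_locales (simp_all add: s.lact_def)
qed simp_all

context right_exact_monoidal_category
begin

abbreviation ltensor (infixr "\<rhd>" 74) where "x \<rhd> f \<equiv> self.lact x f"
abbreviation rtensor (infixl "\<lhd>" 75) where "f \<lhd> x \<equiv> f \<otimes>\<^sub>a Ident C x"

lemma assoc_mu:
  assumes A: "is_comm_monoid C A" and [simp]: "d \<in> Obj C" "x \<in> Obj C"
  shows "assoc C (carr A) d x \<cdot> self.mu A (d \<otimes> x) =
    (self.mu A d \<otimes>\<^sub>a Ident C x) \<cdot> assoc C (carr A) (carr A \<otimes> d) x \<cdot> (carr A \<rhd> assoc C (carr A) d x)"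
proof -
  let ?a = "carr A"
  note [simp] = A comm_monoidD(1-7)[OF A]
  have "assoc C ?a d x \<cdot> self.mu A (d \<otimes> x) = ((mult A \<otimes>\<^sub>a Ident C d) \<otimes>\<^sub>a Ident C x) \<cdot>
      (assoc C (?a \<otimes> ?a) d x \<cdot> assoc C ?a ?a (d \<otimes> x))"
    using whisker[OF assoc_nat[of "mult A" "Ident C d" "Ident C x" ?a d x]] by (simp add: self.mu_def)
  also have "\<dots> = (self.mu A d \<otimes>\<^sub>a Ident C x) \<cdot> assoc C ?a (?a \<otimes> d) x \<cdot> (?a \<rhd> assoc C ?a d x)"
    unfolding pentagon[OF comm_monoidD(1)[OF A] comm_monoidD(1)[OF A] assms(2,3)]
    by (simp add: self.mu_def rtensor_comp self.lact_def)
  finally show ?thesis .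
qed

lemma assoc_eta:
  assumes A: "is_comm_monoid C A" and [simp]: "d \<in> Obj C" "x \<in> Obj C"
  shows "assoc C (carr A) d x \<cdot> self.eta A (d \<otimes> x) = self.eta A d \<otimes>\<^sub>a Ident C x"
proof -
  let ?a = "carr A"
  note [simp] = A comm_monoidD(1-7)[OF A]
  have l: "assoc C \<one> d x \<cdot> iso_inv C (lunit C (d \<otimes> x)) = iso_inv C (lunit C d) \<otimes>\<^sub>a Ident C x"
  proof (rule iso_cancel_left[of "lunit C d \<otimes>\<^sub>a Ident C x"])
    show "(lunit C d \<otimes>\<^sub>a Ident C x) \<cdot> assoc C \<one> d x \<cdot> iso_inv C (lunit C (d \<otimes> x)) =
        (lunit C d \<otimes>\<^sub>a Ident C x) \<cdot> (iso_inv C (lunit C d) \<otimes>\<^sub>a Ident C x)"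
      using whisker[OF lunit_tensor[of d x]] by (simp add: tensor_comp)
  qed (simp_all add: rtensor_iso)
  have "assoc C ?a d x \<cdot> self.eta A (d \<otimes> x) = ((unt A \<otimes>\<^sub>a Ident C d) \<otimes>\<^sub>a Ident C x) \<cdot>
      (assoc C \<one> d x \<cdot> iso_inv C (lunit C (d \<otimes> x)))"
    using whisker[OF assoc_nat[of "unt A" "Ident C d" "Ident C x" ?a d x]] by (simp add: self.eta_def)
  also have "\<dots> = self.eta A d \<otimes>\<^sub>a Ident C x"
    unfolding l by (simp add: self.eta_def rtensor_comp)
  finally show ?thesis .
qed

text \<open>The next lemmas say that the interchange is a distributive law between the monads of two monoids.
  The laws for the monoid on the left follow from those for the monoid on the right, because the
  interchange is invertible.\<close>

lemma interchange_lact: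
  assumes "f \<in> Arr C" "Cod C f = z" "x \<in> Obj C" "y \<in> Obj C"
  shows "interchange x y z \<cdot> (x \<rhd> y \<rhd> f) = (y \<rhd> x \<rhd> f) \<cdot> interchange x y (Dom C f)"
  using assms interchange_nat[of "Ident C x" "Ident C y" f x y z] by (simp add: self.lact_def)

lemma interchange_ract:
  assumes "f \<in> Arr C" "Cod C f = x" "z \<in> Obj C" "y \<in> Obj C"
  shows "interchange x y z \<cdot> (f \<otimes>\<^sub>a Ident C (y \<otimes> z)) = (y \<rhd> (f \<otimes>\<^sub>a Ident C z)) \<cdot> interchange (Dom C f) y z"
  using assms interchange_nat[of f "Ident C y" "Ident C z" x y z] by (simp add: self.lact_def)

lemma interchange_lact_ract:
  assumes "f \<in> Arr C" "Cod C f = y" "z \<in> Obj C" "x \<in> Obj C"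
  shows "interchange x y z \<cdot> (x \<rhd> (f \<otimes>\<^sub>a Ident C z)) = (f \<otimes>\<^sub>a Ident C (x \<otimes> z)) \<cdot> interchange x (Dom C f) z"
  using assms interchange_nat[of "Ident C x" f "Ident C z" x y z] by (simp add: self.lact_def)

lemma interchange_bc:
  assumes \<beta>: "\<beta> \<in> hom (Comm C) A B" and [simp]: "y \<in> Obj C" "z \<in> Obj C"
  shows "interchange (carr B) y z \<cdot> self.bc \<beta> (y \<otimes> z) = (y \<rhd> self.bc \<beta> z) \<cdot> interchange (carr A) y z"
    "interchange y (carr B) z \<cdot> (y \<rhd> self.bc \<beta> z) = self.bc \<beta> (y \<otimes> z) \<cdot> interchange y (carr A) z"
  using comm_homD(5-7)[OF \<beta>] interchange_ract[of "und \<beta>" "carr B" z y] interchange_lact_ract[of "und \<beta>" "carr B" z y]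
  by (simp_all add: self.bc_def)

lemma interchange_mu_right:
  assumes A: "is_comm_monoid C A" and [simp]: "b \<in> Obj C" "x \<in> Obj C"
  shows "interchange b (carr A) x \<cdot> (b \<rhd> self.mu A x) =
    self.mu A (b \<otimes> x) \<cdot> (carr A \<rhd> interchange b (carr A) x) \<cdot> interchange b (carr A) (carr A \<otimes> x)"
proof -
  let ?a = "carr A"
  note [simp] = A comm_monoidD(1-7)[OF A]
  have "interchange b ?a x \<cdot> (b \<rhd> self.mu A x) = (mult A \<otimes>\<^sub>a Ident C (b \<otimes> x)) \<cdot>
      (interchange b (?a \<otimes> ?a) x \<cdot> (b \<rhd> assoc C ?a ?a x))"
    using whisker[OF interchange_lact_ract[of "mult A" ?a x b]] by (simp add: self.mu_def)
  also have "\<dots> = self.mu A (b \<otimes> x) \<cdot> (?a \<rhd> interchange b ?a x) \<cdot> interchange b ?a (?a \<otimes> x)"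
    using interchange_tensor[of b ?a ?a x] by (simp add: self.mu_def self.lact_def)
  finally show ?thesis .
qed

lemma interchange_eta_right:
  assumes A: "is_comm_monoid C A" and [simp]: "b \<in> Obj C" "x \<in> Obj C"
  shows "interchange b (carr A) x \<cdot> (b \<rhd> self.eta A x) = self.eta A (b \<otimes> x)"
proof -
  let ?a = "carr A"
  note [simp] = A comm_monoidD(1-7)[OF A]
  have l: "interchange b \<one> x \<cdot> (b \<rhd> iso_inv C (lunit C x)) = iso_inv C (lunit C (b \<otimes> x))"
  proof (rule iso_cancel_left[of "lunit C (b \<otimes> x)"])
    show "lunit C (b \<otimes> x) \<cdot> interchange b \<one> x \<cdot> (b \<rhd> iso_inv C (lunit C x)) =
        lunit C (b \<otimes> x) \<cdot> iso_inv C (lunit C (b \<otimes> x))"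
      using whisker[OF interchange_unit[of b x]] by (simp add: tensor_comp self.lact_def)
  qed simp_all
  have "interchange b ?a x \<cdot> (b \<rhd> self.eta A x) = (unt A \<otimes>\<^sub>a Ident C (b \<otimes> x)) \<cdot>
      (interchange b \<one> x \<cdot> (b \<rhd> iso_inv C (lunit C x)))"
    using whisker[OF interchange_lact_ract[of "unt A" ?a x b]] by (simp add: self.eta_def)
  then show ?thesis
    unfolding l by (simp add: self.eta_def)
qed

lemma interchange_cancel:
  assumes [simp]: "x \<in> Obj C" "y \<in> Obj C" "z \<in> Obj C" "f \<in> Arr C" "g \<in> Arr C"
    "Cod C f = x \<otimes> (y \<otimes> z)" "Cod C g = x \<otimes> (y \<otimes> z)"
    and e: "interchange x y z \<cdot> f = interchange x y z \<cdot> g"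
  shows "f = g"
proof -
  have "interchange y x z \<cdot> interchange x y z \<cdot> f = interchange y x z \<cdot> interchange x y z \<cdot> g"
    using e by simp
  then show ?thesis
    by (simp add: whisker[OF interchange_interchange])
qed

lemma interchange_mu_left:
  assumes B: "is_comm_monoid C B" and [simp]: "a \<in> Obj C" "x \<in> Obj C"
  shows "interchange (carr B) a x \<cdot> self.mu B (a \<otimes> x) =
    (a \<rhd> self.mu B x) \<cdot> interchange (carr B) a (carr B \<otimes> x) \<cdot> (carr B \<rhd> interchange (carr B) a x)"
proof (rule interchange_cancel[of a "carr B" x])
  let ?b = "carr B"
  note [simp] = B comm_monoidD(1)[OF B]
  have e: "(?b \<rhd> interchange a ?b x) \<cdot> (?b \<rhd> interchange ?b a x) = Ident C (?b \<otimes> (?b \<otimes> (a \<otimes> x)))"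
    by (subst self.lact_comp[symmetric]) (simp_all del: self.lact_comp)
  show "interchange a ?b x \<cdot> interchange ?b a x \<cdot> self.mu B (a \<otimes> x) = interchange a ?b x \<cdot>
      (a \<rhd> self.mu B x) \<cdot> interchange ?b a (?b \<otimes> x) \<cdot> (?b \<rhd> interchange ?b a x)"
    by (simp add: whisker[OF interchange_interchange] whisker[OF interchange_mu_right[OF B]] e)
qed (simp_all add: B comm_monoidD(1)[OF B])

lemma interchange_eta_left:
  assumes B: "is_comm_monoid C B" and [simp]: "a \<in> Obj C" "x \<in> Obj C"
  shows "interchange (carr B) a x \<cdot> self.eta B (a \<otimes> x) = a \<rhd> self.eta B x"
  by (rule interchange_cancel[of a "carr B" x])
    (simp_all add: B comm_monoidD(1)[OF B] whisker[OF interchange_interchange] interchange_eta_right[OF B])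

lemma mu_interchange:
  assumes B: "is_comm_monoid C B" and [simp]: "x \<in> Obj C"
  shows "self.mu B x \<cdot> interchange (carr B) (carr B) x = self.mu B x"
proof -
  note [simp] = B comm_monoidD(1-7)[OF B]
  have "(mult B \<otimes>\<^sub>a Ident C x) \<cdot> (symm C (carr B) (carr B) \<otimes>\<^sub>a Ident C x) = mult B \<otimes>\<^sub>a Ident C x"
    using comm_monoidD(11)[OF B] by (simp add: tensor_comp)
  from whisker[OF this] show ?thesis
    by (simp add: self.mu_def interchange_def)
qed

lemma mult_mu:
  assumes B: "is_comm_monoid C B"
  shows "mult B \<cdot> self.mu B (carr B) = mult B \<cdot> (carr B \<rhd> mult B)" "mult B \<cdot> self.eta B (carr B) = Ident C (carr B)"
proof -
  note [simp] = B comm_monoidD(1-7)[OF B]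
  show "mult B \<cdot> self.mu B (carr B) = mult B \<cdot> (carr B \<rhd> mult B)"
    using comm_monoidD(8)[OF B] by (simp add: self.mu_def self.lact_def)
  show "mult B \<cdot> self.eta B (carr B) = Ident C (carr B)"
    using whisker[OF comm_monoidD(9)[OF B]] by (simp add: self.eta_def)
qed

text \<open>For an action \<open>f : c \<otimes> d \<rightarrow> d\<close> this is the induced action of \<open>c\<close> on \<open>d \<otimes> x\<close>; for a multiplication
  \<open>f : c \<otimes> c \<rightarrow> c\<close> it is \<open>mu\<close>.\<close>

definition rmul where
  "rmul c d f x = (f \<otimes>\<^sub>a Ident C x) \<cdot> assoc C c d x"

lemma rmul_arr [simp]:
  assumes "c \<in> Obj C" "d \<in> Obj C" "x \<in> Obj C" "f \<in> Arr C" "Dom C f = c \<otimes> d"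
  shows "rmul c d f x \<in> Arr C" "Dom C (rmul c d f x) = c \<otimes> (d \<otimes> x)" "Cod C (rmul c d f x) = Cod C f \<otimes> x"
  using assms by (simp_all add: rmul_def)

lemma rmul_lact:
  assumes "c \<in> Obj C" "h \<in> Arr C" "x \<in> Obj C" "f \<in> Arr C" "Dom C f = c \<otimes> d" "Cod C h = d"
  shows "rmul c d f x \<cdot> (c \<rhd> (h \<otimes>\<^sub>a Ident C x)) = rmul c (Dom C h) (f \<cdot> (c \<rhd> h)) x"
  using assms self.assoc_lact_ract[of c x h d] cod_obj[of h]
  by (simp add: rmul_def rtensor_comp self.lact_def)

lemma rmul_nat:
  assumes "c \<in> Obj C" "d \<in> Obj C" "h \<in> Arr C" "f \<in> Arr C" "Dom C f = c \<otimes> d" "Cod C h = x"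
  shows "rmul c d f x \<cdot> (c \<rhd> d \<rhd> h) = (Cod C f \<rhd> h) \<cdot> rmul c d f (Dom C h)"
proof -
  have [simp]: "x \<in> Obj C" using assms cod_obj by blast
  note [simp] = assms
  have "rmul c d f x \<cdot> (c \<rhd> d \<rhd> h) = ((f \<otimes>\<^sub>a Ident C x) \<cdot> ((c \<otimes> d) \<rhd> h)) \<cdot> assoc C c d (Dom C h)"
    using self.assoc_lact[of c d h x] by (simp add: rmul_def)
  also have "(f \<otimes>\<^sub>a Ident C x) \<cdot> ((c \<otimes> d) \<rhd> h) = (Cod C f \<rhd> h) \<cdot> (f \<otimes>\<^sub>a Ident C (Dom C h))"
    by (simp add: self.lact_def tensor_comp)
  finally show ?thesis by (simp add: rmul_def)
qed

lemma rmul_rmul: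
  assumes [simp]: "c \<in> Obj C" "d \<in> Obj C" "d' \<in> Obj C" "x \<in> Obj C" "f \<in> Arr C" "h \<in> Arr C"
    "Dom C h = d \<otimes> d'" "Dom C f = c \<otimes> Cod C h"
  shows "rmul c (Cod C h) f x \<cdot> (c \<rhd> rmul d d' h x) =
    ((f \<cdot> (c \<rhd> h)) \<otimes>\<^sub>a Ident C x) \<cdot> assoc C c (d \<otimes> d') x \<cdot> (c \<rhd> assoc C d d' x)"
  using whisker[OF self.assoc_lact_ract[of c x h "Cod C h"]]
  by (simp add: rmul_def rtensor_comp ltensor_comp self.lact_def)

end

section \<open>The tensor product of commutative monoids over a commutative monoid\<close>

text \<open>\<open>q : a' \<otimes> b \<rightarrow> P\<close> presents \<open>P\<close> as \<open>a' \<otimes>\<^sub>a b\<close>.\<close>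

locale monoid_span_tensor = right_exact_monoidal_category C
  for C :: "('o, 'm, 'z) smc_scheme" (structure) +
  fixes A A' B :: "('o, 'm) mon" and \<alpha> \<beta> :: "(('o, 'm) mon, 'm) sarr" and P :: 'o and q :: 'm
  assumes alpha: "\<alpha> \<in> hom (Comm C) A A'" and beta: "\<beta> \<in> hom (Comm C) A B"
    and q_coeq: "is_coequalizer C (carr A' \<rhd> (mult B \<cdot> self.bc \<beta> (carr B)))
      (self.mu A' (carr B) \<cdot> (carr A' \<rhd> self.bc \<alpha> (carr B))) P q"
begin

abbreviation "a \<equiv> carr A"
abbreviation "a' \<equiv> carr A'"
abbreviation "b \<equiv> carr B"
abbreviation "\<mu>\<^sub>b \<equiv> mult B"

lemmas ha = comm_homD[OF alpha] and hb = comm_homD[OF beta]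
lemmas CM = ha(1,2) hb(2)
lemmas CMD = comm_monoidD(1-7)[OF ha(1)] comm_monoidD(1-7)[OF ha(2)] comm_monoidD(1-7)[OF hb(2)]

declare CM [simp] CMD [simp] self.bc_arr[OF alpha, simp] self.bc_arr[OF beta, simp]

lemma q_arr [simp]: "q \<in> Arr C" "Dom C q = a' \<otimes> b" "Cod C q = P" "P \<in> Obj C"
  using coequalizer_arr(3,7)[OF q_coeq] coequalizer_arr(4)[OF q_coeq] cod_obj by auto

lemmas mu_rules = self.monad_rules
lemma qe: "q \<cdot> (a' \<rhd> \<mu>\<^sub>b) \<cdot> (a' \<rhd> self.bc \<beta> b) = q \<cdot> self.mu A' b \<cdot> (a' \<rhd> self.bc \<alpha> b)"
  using coequalizerD(4)[OF q_coeq] by simp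

text \<open>As a module over \<open>a'\<close>, \<open>P\<close> is the extension of scalars of \<open>b\<close> along \<open>\<alpha>\<close>, for \<open>C\<close> acting on itself;
  the action comes from \<open>extension_module\<close>.\<close>

lemma left_action_ex:
  obtains s where "s \<in> Arr C" "Dom C s = a' \<otimes> P" "Cod C s = P" "s \<cdot> (a' \<rhd> q) = q \<cdot> self.mu A' b"
    "s \<cdot> self.mu A' P = s \<cdot> (a' \<rhd> s)" "s \<cdot> self.eta A' P = Ident C P"
proof -
  let ?S = "self_act C"
  have N: "is_module C ?S B (LMod b \<mu>\<^sub>b)"
    using mult_mu[OF hb(2)] by (simp add: self.module_iff)
  have X: "is_module C ?S A (restrict_obj ?S \<beta> (LMod b \<mu>\<^sub>b))"
    by (rule self.restrict_module[OF beta N])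
  have "self.is_ext_coeq \<alpha> (restrict_obj ?S \<beta> (LMod b \<mu>\<^sub>b)) P q"
    using q_coeq by (simp add: self.is_ext_coeq_def ha(4))
  from self.extension_module[OF alpha X this] obtain s where s: "is_module C ?S A' (LMod P s)"
    and e: "s \<cdot> (a' \<rhd> q) = q \<cdot> self.mu A' b"
    by auto
  show ?thesis
    by (rule that[of s]) (use self.moduleD[OF s CM(2)] e in simp_all)
qed

definition s where
  "s = (SOME s. s \<in> Arr C \<and> Dom C s = a' \<otimes> P \<and> Cod C s = P \<and> s \<cdot> (a' \<rhd> q) = q \<cdot> self.mu A' b \<and>
    s \<cdot> self.mu A' P = s \<cdot> (a' \<rhd> s) \<and> s \<cdot> self.eta A' P = Ident C P)"

lemma s_props: "s \<in> Arr C \<and> Dom C s = a' \<otimes> P \<and> Cod C s = P \<and> s \<cdot> (a' \<rhd> q) = q \<cdot> self.mu A' b \<and>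
    s \<cdot> self.mu A' P = s \<cdot> (a' \<rhd> s) \<and> s \<cdot> self.eta A' P = Ident C P"
  unfolding s_def by (rule someI_ex) (rule left_action_ex, blast)

lemma s_arr [simp]: "s \<in> Arr C" "Dom C s = a' \<otimes> P" "Cod C s = P"
  using s_props by blast+

lemma s_q: "s \<cdot> (a' \<rhd> q) = q \<cdot> self.mu A' b" and s_mu: "s \<cdot> self.mu A' P = s \<cdot> (a' \<rhd> s)"
  and s_eta: "s \<cdot> self.eta A' P = Ident C P"
  using s_props by blast+

text \<open>The monoid \<open>b\<close> acts on \<open>P\<close> from the right factor, across \<open>a'\<close>.  The action is well defined
  because \<open>b\<close> is commutative: \<open>\<beta>(x) (y z) = y (\<beta>(x) z)\<close> for \<open>x\<close> in \<open>a\<close> and \<open>y\<close>, \<open>z\<close> in \<open>b\<close>.\<close>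

lemma base_central:
  "\<mu>\<^sub>b \<cdot> self.bc \<beta> b \<cdot> (a \<rhd> \<mu>\<^sub>b) \<cdot> interchange b a b = \<mu>\<^sub>b \<cdot> (b \<rhd> \<mu>\<^sub>b) \<cdot> (b \<rhd> self.bc \<beta> b)"
proof -
  have "\<mu>\<^sub>b \<cdot> self.bc \<beta> b \<cdot> (a \<rhd> \<mu>\<^sub>b) \<cdot> interchange b a b
      = \<mu>\<^sub>b \<cdot> (b \<rhd> \<mu>\<^sub>b) \<cdot> self.bc \<beta> (b \<otimes> b) \<cdot> interchange b a b"
    using whisker[OF self.bc_nat[OF beta, of \<mu>\<^sub>b b]] by simp
  also have "\<dots> = (\<mu>\<^sub>b \<cdot> self.mu B b) \<cdot> self.bc \<beta> (b \<otimes> b) \<cdot> interchange b a b"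
    unfolding mult_mu(1)[OF hb(2)] by simp
  also have "\<dots> = \<mu>\<^sub>b \<cdot> (self.mu B b \<cdot> interchange b b b) \<cdot> (b \<rhd> self.bc \<beta> b)"
    using interchange_bc(2)[OF beta, of b b] by simp
  also have "\<dots> = (\<mu>\<^sub>b \<cdot> self.mu B b) \<cdot> (b \<rhd> self.bc \<beta> b)"
    by (simp add: mu_interchange)
  also have "\<dots> = \<mu>\<^sub>b \<cdot> (b \<rhd> \<mu>\<^sub>b) \<cdot> (b \<rhd> self.bc \<beta> b)"
    unfolding mult_mu(1)[OF hb(2)] by simp
  finally show ?thesis .
qed

lemma right_action_ex:
  obtains t where "t \<in> Arr C" "Dom C t = b \<otimes> P" "Cod C t = P"
    "t \<cdot> (b \<rhd> q) = q \<cdot> (a' \<rhd> \<mu>\<^sub>b) \<cdot> interchange b a' b"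
proof -
  let ?k = "q \<cdot> (a' \<rhd> \<mu>\<^sub>b) \<cdot> interchange b a' b"
  have "?k \<cdot> (b \<rhd> (self.mu A' b \<cdot> (a' \<rhd> self.bc \<alpha> b)))
      = q \<cdot> (a' \<rhd> \<mu>\<^sub>b) \<cdot> self.mu A' (b \<otimes> b) \<cdot> (a' \<rhd> interchange b a' b) \<cdot>
        interchange b a' (a' \<otimes> b) \<cdot> (b \<rhd> a' \<rhd> self.bc \<alpha> b)"
    by (simp add: whisker[OF interchange_mu_right])
  also have "interchange b a' (a' \<otimes> b) \<cdot> (b \<rhd> a' \<rhd> self.bc \<alpha> b) = (a' \<rhd> b \<rhd> self.bc \<alpha> b) \<cdot> interchange b a' (a \<otimes> b)"
    by (simp add: interchange_lact)
  also have "q \<cdot> (a' \<rhd> \<mu>\<^sub>b) \<cdot> self.mu A' (b \<otimes> b) \<cdot> (a' \<rhd> interchange b a' b) \<cdot>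
        ((a' \<rhd> b \<rhd> self.bc \<alpha> b) \<cdot> interchange b a' (a \<otimes> b))
      = q \<cdot> self.mu A' b \<cdot> (a' \<rhd> a' \<rhd> \<mu>\<^sub>b) \<cdot> (a' \<rhd> (interchange b a' b \<cdot> (b \<rhd> self.bc \<alpha> b))) \<cdot> interchange b a' (a \<otimes> b)"
    by (simp add: mu_rules)
  also have "interchange b a' b \<cdot> (b \<rhd> self.bc \<alpha> b) = self.bc \<alpha> (b \<otimes> b) \<cdot> interchange b a b"
    by (simp add: interchange_bc(2)[OF alpha])
  also have "q \<cdot> self.mu A' b \<cdot> (a' \<rhd> a' \<rhd> \<mu>\<^sub>b) \<cdot> (a' \<rhd> (self.bc \<alpha> (b \<otimes> b) \<cdot> interchange b a b)) \<cdot> interchange b a' (a \<otimes> b)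
      = (q \<cdot> self.mu A' b \<cdot> (a' \<rhd> self.bc \<alpha> b)) \<cdot> (a' \<rhd> a \<rhd> \<mu>\<^sub>b) \<cdot> (a' \<rhd> interchange b a b) \<cdot> interchange b a' (a \<otimes> b)"
    by (simp add: self.bc_rules[OF alpha])
  also have "\<dots> = q \<cdot> (a' \<rhd> (\<mu>\<^sub>b \<cdot> self.bc \<beta> b \<cdot> (a \<rhd> \<mu>\<^sub>b) \<cdot> interchange b a b)) \<cdot> interchange b a' (a \<otimes> b)"
    unfolding qe[symmetric] by simp
  also have "\<dots> = ?k \<cdot> (b \<rhd> a' \<rhd> (\<mu>\<^sub>b \<cdot> self.bc \<beta> b))"
    unfolding base_central by (simp add: interchange_lact whisker[OF interchange_lact])
  finally show ?thesis
    using coequalizer_factor[OF self.lact_coequalizer[OF comm_monoidD(1)[OF hb(2)] q_coeq], of ?k] that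
    by auto
qed

definition t where
  "t = (SOME t. t \<in> Arr C \<and> Dom C t = b \<otimes> P \<and> Cod C t = P \<and>
    t \<cdot> (b \<rhd> q) = q \<cdot> (a' \<rhd> \<mu>\<^sub>b) \<cdot> interchange b a' b)"

lemma t_props: "t \<in> Arr C \<and> Dom C t = b \<otimes> P \<and> Cod C t = P \<and>
    t \<cdot> (b \<rhd> q) = q \<cdot> (a' \<rhd> \<mu>\<^sub>b) \<cdot> interchange b a' b"
  unfolding t_def by (rule someI_ex) (rule right_action_ex, blast)

lemma t_arr [simp]: "t \<in> Arr C" "Dom C t = b \<otimes> P" "Cod C t = P"
  using t_props by blast+

lemma t_q: "t \<cdot> (b \<rhd> q) = q \<cdot> (a' \<rhd> \<mu>\<^sub>b) \<cdot> interchange b a' b"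
  using t_props by blast

lemma lact_q_eq:
  assumes "x \<in> Obj C" "(h::'m) \<in> Arr C" "h' \<in> Arr C" "Dom C h = x \<otimes> P" "Dom C h' = x \<otimes> P"
    "h \<cdot> (x \<rhd> q) = h' \<cdot> (x \<rhd> q)"
  shows "h = h'"
  using coequalizer_eq[OF self.lact_coequalizer[OF assms(1) q_coeq]] assms(2-) by blast

lemma lact_lact_q_eq:
  assumes "x \<in> Obj C" "y \<in> Obj C" "(h::'m) \<in> Arr C" "h' \<in> Arr C" "Dom C h = x \<otimes> (y \<otimes> P)" "Dom C h' = x \<otimes> (y \<otimes> P)"
    "h \<cdot> (x \<rhd> y \<rhd> q) = h' \<cdot> (x \<rhd> y \<rhd> q)"
  shows "h = h'"
  using coequalizer_eq[OF self.lact_coequalizer[OF assms(1) self.lact_coequalizer[OF assms(2) q_coeq]]]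
    assms(3-) by blast

lemma t_mu: "t \<cdot> self.mu B P = t \<cdot> (b \<rhd> t)"
proof (rule lact_lact_q_eq[of b b])
  have "(t \<cdot> self.mu B P) \<cdot> (b \<rhd> b \<rhd> q) = (t \<cdot> (b \<rhd> q)) \<cdot> self.mu B (a' \<otimes> b)"
    by (simp add: self.mu_nat)
  also have "\<dots> = q \<cdot> (a' \<rhd> (\<mu>\<^sub>b \<cdot> self.mu B b)) \<cdot> interchange b a' (b \<otimes> b) \<cdot> (b \<rhd> interchange b a' b)"
    unfolding t_q by (simp add: interchange_mu_left)
  also have "\<dots> = (q \<cdot> (a' \<rhd> \<mu>\<^sub>b) \<cdot> interchange b a' b) \<cdot> (b \<rhd> a' \<rhd> \<mu>\<^sub>b) \<cdot> (b \<rhd> interchange b a' b)"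
    unfolding mult_mu(1)[OF hb(2)] by (simp add: whisker[OF interchange_lact])
  also have "\<dots> = t \<cdot> (b \<rhd> (q \<cdot> (a' \<rhd> \<mu>\<^sub>b) \<cdot> interchange b a' b))"
    by (simp add: whisker[OF t_q])
  also have "\<dots> = (t \<cdot> (b \<rhd> t)) \<cdot> (b \<rhd> b \<rhd> q)"
    unfolding t_q[symmetric] by simp
  finally show "(t \<cdot> self.mu B P) \<cdot> (b \<rhd> b \<rhd> q) = (t \<cdot> (b \<rhd> t)) \<cdot> (b \<rhd> b \<rhd> q)" .
qed simp_all

lemma t_eta: "t \<cdot> self.eta B P = Ident C P"
proof (rule coequalizer_eq[OF q_coeq])
  have "(t \<cdot> self.eta B P) \<cdot> q = (t \<cdot> (b \<rhd> q)) \<cdot> self.eta B (a' \<otimes> b)"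
    by (simp add: self.eta_nat)
  also have "\<dots> = q \<cdot> (a' \<rhd> (\<mu>\<^sub>b \<cdot> self.eta B b))"
    unfolding t_q by (simp add: interchange_eta_left)
  also have "\<dots> = Ident C P \<cdot> q"
    by (simp add: mult_mu(2) del: self.lact_comp)
  finally show "(t \<cdot> self.eta B P) \<cdot> q = Ident C P \<cdot> q" .
qed simp_all

lemma s_t_commute: "s \<cdot> (a' \<rhd> t) \<cdot> interchange b a' P = t \<cdot> (b \<rhd> s)"
proof (rule lact_lact_q_eq[of b a'])
  have "(s \<cdot> (a' \<rhd> t) \<cdot> interchange b a' P) \<cdot> (b \<rhd> a' \<rhd> q) = s \<cdot> (a' \<rhd> (t \<cdot> (b \<rhd> q))) \<cdot> interchange b a' (a' \<otimes> b)"
    by (simp add: interchange_lact)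
  also have "\<dots> = (s \<cdot> (a' \<rhd> q)) \<cdot> (a' \<rhd> a' \<rhd> \<mu>\<^sub>b) \<cdot> (a' \<rhd> interchange b a' b) \<cdot> interchange b a' (a' \<otimes> b)"
    unfolding t_q by simp
  also have "\<dots> = (q \<cdot> (a' \<rhd> \<mu>\<^sub>b) \<cdot> interchange b a' b) \<cdot> (b \<rhd> self.mu A' b)"
    unfolding s_q by (simp add: interchange_mu_right mu_rules)
  also have "\<dots> = t \<cdot> (b \<rhd> (q \<cdot> self.mu A' b))"
    unfolding t_q[symmetric] by simp
  also have "\<dots> = (t \<cdot> (b \<rhd> s)) \<cdot> (b \<rhd> a' \<rhd> q)"
    unfolding s_q[symmetric] by simp
  finally show "(s \<cdot> (a' \<rhd> t) \<cdot> interchange b a' P) \<cdot> (b \<rhd> a' \<rhd> q) = (t \<cdot> (b \<rhd> s)) \<cdot> (b \<rhd> a' \<rhd> q)" .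
qed simp_all

text \<open>The two actions of \<open>a\<close> on \<open>P\<close> agree, because \<open>q\<close> identifies \<open>x \<alpha>(z) \<otimes> y\<close> with \<open>x \<otimes> \<beta>(z) y\<close> and \<open>a'\<close>
  is commutative.\<close>

lemma s_t_base: "s \<cdot> self.bc \<alpha> P = t \<cdot> self.bc \<beta> P"
proof (rule lact_q_eq[of a])
  have "(s \<cdot> self.bc \<alpha> P) \<cdot> (a \<rhd> q) = (s \<cdot> (a' \<rhd> q)) \<cdot> self.bc \<alpha> (a' \<otimes> b)"
    by (simp add: self.bc_nat[OF alpha])
  also have "\<dots> = q \<cdot> (self.mu A' b \<cdot> interchange a' a' b) \<cdot> self.bc \<alpha> (a' \<otimes> b)"
    unfolding s_q by (simp add: mu_interchange)
  also have "\<dots> = (q \<cdot> self.mu A' b \<cdot> (a' \<rhd> self.bc \<alpha> b)) \<cdot> interchange a a' b"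
    by (simp add: interchange_bc(1)[OF alpha])
  also have "\<dots> = (q \<cdot> (a' \<rhd> \<mu>\<^sub>b) \<cdot> interchange b a' b) \<cdot> self.bc \<beta> (a' \<otimes> b)"
    unfolding qe[symmetric] by (simp add: interchange_bc(1)[OF beta])
  also have "\<dots> = (t \<cdot> self.bc \<beta> P) \<cdot> (a \<rhd> q)"
    unfolding t_q[symmetric] by (simp add: self.bc_nat[OF beta])
  finally show "(s \<cdot> self.bc \<alpha> P) \<cdot> (a \<rhd> q) = (t \<cdot> self.bc \<beta> P) \<cdot> (a \<rhd> q)" .
qed simp_all

text \<open>Equations between arrows out of \<open>P \<otimes> x\<close> are tested after composition with
  \<open>Q x : a' \<otimes> (b \<otimes> x) \<rightarrow> P \<otimes> x\<close>, which presents \<open>P \<otimes> x\<close> as \<open>q\<close> presents \<open>P\<close>.\<close>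

abbreviation "Q x \<equiv> rmul a' b q x"

lemma Q_coeq:
  assumes x: "x \<in> Obj C"
  shows "is_coequalizer C (a' \<rhd> (self.mu B x \<cdot> self.bc \<beta> (b \<otimes> x)))
    (self.mu A' (b \<otimes> x) \<cdot> (a' \<rhd> self.bc \<alpha> (b \<otimes> x))) (P \<otimes> x) (Q x)"
proof -
  have "is_coequalizer C (Ident C a' \<otimes>\<^sub>a (\<mu>\<^sub>b \<cdot> (und \<beta> \<otimes>\<^sub>a Ident C b)))
      (((mult A' \<cdot> (Ident C a' \<otimes>\<^sub>a und \<alpha>)) \<otimes>\<^sub>a Ident C b) \<cdot> assoc C a' a b) P q"
    using q_coeq self.ext_pair_eq[OF alpha comm_monoidD(1)[OF hb(2)]]
    by (simp add: self.lact_def self.bc_def)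
  from self.ract_tensor_coequalizer[OF alpha beta x this] show ?thesis
    by (simp add: rmul_def)
qed

lemma Q_eq:
  assumes "x \<in> Obj C" "(h::'m) \<in> Arr C" "h' \<in> Arr C" "Dom C h = P \<otimes> x" "Dom C h' = P \<otimes> x" "h \<cdot> Q x = h' \<cdot> Q x"
  shows "h = h'"
  using coequalizer_eq[OF Q_coeq[OF assms(1)]] assms(2-) by blast

lemma lact_Q_eq:
  assumes "y \<in> Obj C" "x \<in> Obj C" "(h::'m) \<in> Arr C" "h' \<in> Arr C" "Dom C h = y \<otimes> (P \<otimes> x)" "Dom C h' = y \<otimes> (P \<otimes> x)"
    "h \<cdot> (y \<rhd> Q x) = h' \<cdot> (y \<rhd> Q x)"
  shows "h = h'"
  using coequalizer_eq[OF self.lact_coequalizer[OF assms(1) Q_coeq[OF assms(2)]]] assms(3-) by blast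

lemma Q_arr [simp]:
  assumes "x \<in> Obj C"
  shows "Q x \<in> Arr C" "Dom C (Q x) = a' \<otimes> (b \<otimes> x)" "Cod C (Q x) = P \<otimes> x"
  using assms by simp_all

lemma s_Q:
  assumes [simp]: "x \<in> Obj C"
  shows "rmul a' P s x \<cdot> (a' \<rhd> Q x) = Q x \<cdot> self.mu A' (b \<otimes> x)"
proof -
  have "rmul a' P s x \<cdot> (a' \<rhd> Q x) = ((q \<cdot> self.mu A' b) \<otimes>\<^sub>a Ident C x) \<cdot> assoc C a' (a' \<otimes> b) x \<cdot> (a' \<rhd> assoc C a' b x)"
    using rmul_rmul[of a' a' b x s q] s_q by simp
  then show ?thesis
    by (simp add: rmul_def rtensor_comp assoc_mu)
qed

lemma t_Q:
  assumes [simp]: "x \<in> Obj C"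
  shows "rmul b P t x \<cdot> (b \<rhd> Q x) = Q x \<cdot> (a' \<rhd> self.mu B x) \<cdot> interchange b a' (b \<otimes> x)"
proof -
  let ?I = "Ident C x"
  have m: "assoc C a' b x \<cdot> (a' \<rhd> (\<mu>\<^sub>b \<lhd> x)) = ((a' \<rhd> \<mu>\<^sub>b) \<lhd> x) \<cdot> assoc C a' (b \<otimes> b) x"
    using self.assoc_lact_ract[of a' x \<mu>\<^sub>b b] by (simp add: self.lact_def)
  have "rmul b P t x \<cdot> (b \<rhd> Q x) = ((q \<cdot> (a' \<rhd> \<mu>\<^sub>b) \<cdot> interchange b a' b) \<lhd> x) \<cdot>
      assoc C b (a' \<otimes> b) x \<cdot> (b \<rhd> assoc C a' b x)"
    using rmul_rmul[of b a' b x t q] t_q by simp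
  also have "\<dots> = (q \<lhd> x) \<cdot> ((a' \<rhd> \<mu>\<^sub>b) \<lhd> x) \<cdot>
      ((interchange b a' b \<lhd> x) \<cdot> assoc C b (a' \<otimes> b) x \<cdot> (b \<rhd> assoc C a' b x))"
    by (simp add: rtensor_comp)
  also have "\<dots> = (q \<lhd> x) \<cdot> (((a' \<rhd> \<mu>\<^sub>b) \<lhd> x) \<cdot> assoc C a' (b \<otimes> b) x) \<cdot> (a' \<rhd> assoc C b b x) \<cdot>
      interchange b a' (b \<otimes> x)"
    using interchange_assoc_right[of b a' b x] by (simp add: self.lact_def)
  also have "\<dots> = Q x \<cdot> (a' \<rhd> self.mu B x) \<cdot> interchange b a' (b \<otimes> x)"
    unfolding m[symmetric] by (simp add: rmul_def self.mu_def)
  finally show ?thesis .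
qed

text \<open>The multiplication \<open>m\<close> of \<open>P\<close> lets the class of \<open>x \<otimes> y\<close> act on \<open>P\<close> by \<open>y\<close> followed by \<open>x\<close>.  This is
  well defined because the two actions of \<open>a\<close> agree.\<close>

lemma multiplication_ex:
  obtains m where "m \<in> Arr C" "Dom C m = P \<otimes> P" "Cod C m = P" "m \<cdot> Q P = s \<cdot> (a' \<rhd> t)"
proof -
  have "(s \<cdot> (a' \<rhd> t)) \<cdot> (a' \<rhd> (self.mu B P \<cdot> self.bc \<beta> (b \<otimes> P)))
      = s \<cdot> (a' \<rhd> ((t \<cdot> self.mu B P) \<cdot> self.bc \<beta> (b \<otimes> P)))"
    by simp
  also have "\<dots> = s \<cdot> (a' \<rhd> ((t \<cdot> self.bc \<beta> P) \<cdot> (a \<rhd> t)))"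
    unfolding t_mu by (simp add: self.bc_rules[OF beta])
  also have "\<dots> = (s \<cdot> (a' \<rhd> s)) \<cdot> (a' \<rhd> (self.bc \<alpha> P \<cdot> (a \<rhd> t)))"
    unfolding s_t_base[symmetric] by simp
  also have "\<dots> = (s \<cdot> (a' \<rhd> t)) \<cdot> self.mu A' (b \<otimes> P) \<cdot> (a' \<rhd> self.bc \<alpha> (b \<otimes> P))"
    unfolding s_mu[symmetric] by (simp add: mu_rules self.bc_rules[OF alpha])
  finally show ?thesis
    using coequalizer_factor[OF Q_coeq[of P], of "s \<cdot> (a' \<rhd> t)"] that by auto
qed

definition m where
  "m = (SOME m. m \<in> Arr C \<and> Dom C m = P \<otimes> P \<and> Cod C m = P \<and> m \<cdot> Q P = s \<cdot> (a' \<rhd> t))"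

lemma m_props: "m \<in> Arr C \<and> Dom C m = P \<otimes> P \<and> Cod C m = P \<and> m \<cdot> Q P = s \<cdot> (a' \<rhd> t)"
  unfolding m_def by (rule someI_ex) (rule multiplication_ex, blast)

lemma m_arr [simp]: "m \<in> Arr C" "Dom C m = P \<otimes> P" "Cod C m = P"
  using m_props by blast+

lemma m_Q: "m \<cdot> Q P = s \<cdot> (a' \<rhd> t)"
  using m_props by blast

text \<open>The actions of \<open>a'\<close> and \<open>b\<close> on \<open>P\<close> commute with right multiplication: for \<open>a'\<close> because \<open>s\<close> is an
  action, for \<open>b\<close> because the two actions commute.  Associativity of \<open>m\<close> follows, since left
  multiplication is composed of the two actions.\<close>

lemma m_s: "m \<cdot> rmul a' P s P = s \<cdot> (a' \<rhd> m)"
proof (rule lact_Q_eq[of a' P])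
  have "(m \<cdot> rmul a' P s P) \<cdot> (a' \<rhd> Q P) = (m \<cdot> Q P) \<cdot> self.mu A' (b \<otimes> P)"
    by (simp add: s_Q)
  also have "\<dots> = (s \<cdot> self.mu A' P) \<cdot> (a' \<rhd> a' \<rhd> t)"
    unfolding m_Q by (simp add: mu_rules)
  also have "\<dots> = s \<cdot> (a' \<rhd> (m \<cdot> Q P))"
    unfolding m_Q s_mu by simp
  finally show "(m \<cdot> rmul a' P s P) \<cdot> (a' \<rhd> Q P) = (s \<cdot> (a' \<rhd> m)) \<cdot> (a' \<rhd> Q P)"
    by simp
qed simp_all

lemma m_t: "m \<cdot> rmul b P t P = t \<cdot> (b \<rhd> m)"
proof (rule lact_Q_eq[of b P])
  have "(m \<cdot> rmul b P t P) \<cdot> (b \<rhd> Q P) = (m \<cdot> Q P) \<cdot> (a' \<rhd> self.mu B P) \<cdot> interchange b a' (b \<otimes> P)"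
    by (simp add: t_Q)
  also have "\<dots> = s \<cdot> (a' \<rhd> (t \<cdot> self.mu B P)) \<cdot> interchange b a' (b \<otimes> P)"
    unfolding m_Q by simp
  also have "\<dots> = (s \<cdot> (a' \<rhd> t) \<cdot> interchange b a' P) \<cdot> (b \<rhd> a' \<rhd> t)"
    unfolding t_mu by (simp add: interchange_lact)
  also have "\<dots> = t \<cdot> (b \<rhd> (m \<cdot> Q P))"
    unfolding s_t_commute m_Q by simp
  finally show "(m \<cdot> rmul b P t P) \<cdot> (b \<rhd> Q P) = (t \<cdot> (b \<rhd> m)) \<cdot> (b \<rhd> Q P)"
    by simp
qed simp_all

lemma m_assoc: "m \<cdot> rmul P P m P = m \<cdot> (P \<rhd> m)"
proof (rule Q_eq[of "P \<otimes> P"])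
  have e: "assoc C P P P \<cdot> (q \<otimes>\<^sub>a Ident C (P \<otimes> P)) = ((q \<otimes>\<^sub>a Ident C P) \<otimes>\<^sub>a Ident C P) \<cdot> assoc C (a' \<otimes> b) P P"
    using self.assoc_ract[of P P q P] by simp
  have "rmul P P m P \<cdot> Q (P \<otimes> P) = (m \<otimes>\<^sub>a Ident C P) \<cdot> ((q \<otimes>\<^sub>a Ident C P) \<otimes>\<^sub>a Ident C P) \<cdot>
      (assoc C (a' \<otimes> b) P P \<cdot> assoc C a' b (P \<otimes> P))"
    by (simp add: rmul_def whisker[OF e])
  also have "\<dots> = ((m \<cdot> Q P) \<otimes>\<^sub>a Ident C P) \<cdot> assoc C a' (b \<otimes> P) P \<cdot> (a' \<rhd> assoc C b P P)"
    by (simp add: pentagon rmul_def rtensor_comp self.lact_def)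
  also have "\<dots> = rmul a' P s P \<cdot> (a' \<rhd> rmul b P t P)"
    unfolding m_Q using rmul_rmul[of a' b P P s t] by simp
  finally have "(m \<cdot> rmul P P m P) \<cdot> Q (P \<otimes> P) = (m \<cdot> rmul a' P s P) \<cdot> (a' \<rhd> rmul b P t P)"
    by simp
  also have "\<dots> = s \<cdot> (a' \<rhd> (m \<cdot> rmul b P t P))"
    unfolding m_s by simp
  also have "\<dots> = (s \<cdot> (a' \<rhd> t)) \<cdot> (a' \<rhd> b \<rhd> m)"
    unfolding m_t by simp
  also have "\<dots> = m \<cdot> Q P \<cdot> (a' \<rhd> b \<rhd> m)"
    unfolding m_Q[symmetric] by simp
  also have "\<dots> = (m \<cdot> (P \<rhd> m)) \<cdot> Q (P \<otimes> P)"
    using rmul_nat[of a' b m q P] by simp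
  finally show "(m \<cdot> rmul P P m P) \<cdot> Q (P \<otimes> P) = (m \<cdot> (P \<rhd> m)) \<cdot> Q (P \<otimes> P)" .
qed simp_all

text \<open>On elements, \<open>j\<close> is \<open>y \<mapsto> 1 \<otimes> y\<close>, and \<open>i\<close> lets \<open>x\<close> act on the unit \<open>u = 1 \<otimes> 1\<close> of \<open>P\<close>.\<close>

definition j where "j = q \<cdot> self.eta A' b"
definition u where "u = j \<cdot> unt B"
definition i where "i = s \<cdot> (a' \<rhd> u) \<cdot> iso_inv C (runit C a')"

lemma j_arr [simp]: "j \<in> Arr C" "Dom C j = b" "Cod C j = P"
  by (simp_all add: j_def)

lemma u_arr [simp]: "u \<in> Arr C" "Dom C u = \<one>" "Cod C u = P"
  by (simp_all add: u_def)

lemma i_arr [simp]: "i \<in> Arr C" "Dom C i = a'" "Cod C i = P"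
  by (simp_all add: i_def)

lemma i_runit: "i \<cdot> runit C a' = s \<cdot> (a' \<rhd> u)"
  by (simp add: i_def)

lemma mult_unt_b: "\<mu>\<^sub>b \<cdot> (b \<rhd> unt B) = runit C b"
  using comm_monoidD(10)[OF hb(2)] by (simp add: self.lact_def)

lemma j_runit: "j \<cdot> runit C b = t \<cdot> (b \<rhd> u)"
proof -
  have "t \<cdot> (b \<rhd> u) = (t \<cdot> (b \<rhd> q)) \<cdot> (b \<rhd> self.eta A' b) \<cdot> (b \<rhd> unt B)"
    by (simp add: u_def j_def)
  also have "\<dots> = q \<cdot> (a' \<rhd> \<mu>\<^sub>b) \<cdot> self.eta A' (b \<otimes> b) \<cdot> (b \<rhd> unt B)"
    unfolding t_q by (simp add: whisker[OF interchange_eta_right])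
  also have "\<dots> = q \<cdot> self.eta A' b \<cdot> (\<mu>\<^sub>b \<cdot> (b \<rhd> unt B))"
    by (simp add: mu_rules)
  also have "\<dots> = j \<cdot> runit C b"
    unfolding mult_unt_b by (simp add: j_def)
  finally show ?thesis by simp
qed

lemma s_j: "s \<cdot> (a' \<rhd> j) = q"
proof -
  have "s \<cdot> (a' \<rhd> j) = (s \<cdot> (a' \<rhd> q)) \<cdot> (a' \<rhd> self.eta A' b)"
    by (simp add: j_def)
  then show ?thesis
    unfolding s_q by (simp add: mu_rules)
qed

lemma m_u_left: "m \<cdot> (u \<otimes>\<^sub>a Ident C P) = lunit C P"
proof (rule iso_cancel_right[of "iso_inv C (lunit C P)"])
  have "(u \<otimes>\<^sub>a Ident C P) \<cdot> iso_inv C (lunit C P)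
      = (q \<otimes>\<^sub>a Ident C P) \<cdot> (self.eta A' b \<otimes>\<^sub>a Ident C P) \<cdot> self.eta B P"
    by (simp add: u_def j_def rtensor_comp self.eta_def[of B])
  also have "\<dots> = Q P \<cdot> self.eta A' (b \<otimes> P) \<cdot> self.eta B P"
    by (simp add: rmul_def assoc_eta[symmetric])
  finally have "(m \<cdot> (u \<otimes>\<^sub>a Ident C P)) \<cdot> iso_inv C (lunit C P) = (m \<cdot> Q P) \<cdot> self.eta A' (b \<otimes> P) \<cdot> self.eta B P"
    by simp
  also have "\<dots> = (s \<cdot> self.eta A' P) \<cdot> (t \<cdot> self.eta B P)"
    unfolding m_Q by (simp add: mu_rules)
  also have "\<dots> = lunit C P \<cdot> iso_inv C (lunit C P)"
    unfolding s_eta t_eta by simp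
  finally show "(m \<cdot> (u \<otimes>\<^sub>a Ident C P)) \<cdot> iso_inv C (lunit C P) = lunit C P \<cdot> iso_inv C (lunit C P)" .
qed (simp_all add: is_iso_inv)

lemma m_u_right: "m \<cdot> (P \<rhd> u) = runit C P"
proof (rule Q_eq[of \<one>])
  have "(m \<cdot> (P \<rhd> u)) \<cdot> Q \<one> = (m \<cdot> Q P) \<cdot> (a' \<rhd> b \<rhd> u)"
    using rmul_nat[of a' b u q P] by simp
  also have "\<dots> = s \<cdot> (a' \<rhd> (t \<cdot> (b \<rhd> u)))"
    unfolding m_Q by simp
  also have "\<dots> = (s \<cdot> (a' \<rhd> j)) \<cdot> (a' \<rhd> runit C b)"
    unfolding j_runit[symmetric] by simp
  also have "\<dots> = runit C P \<cdot> Q \<one>"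
    unfolding s_j using whisker[OF runit_nat[of q P]] by (simp add: rmul_def self.lact_def runit_tensor)
  finally show "(m \<cdot> (P \<rhd> u)) \<cdot> Q \<one> = runit C P \<cdot> Q \<one>" .
qed simp_all

end

section \<open>Commutativity and the universal property of the tensor product\<close>

context monoid_span_tensor
begin

text \<open>As \<open>f\<close> commutes with right multiplication, \<open>f(x, p) = f(x, 1 p) = f(x, 1) p\<close>.  So the action is left
  multiplication by its values \<open>e(x) = f(x, 1)\<close> at the unit, and the laws of an action make \<open>e\<close> a
  homomorphism.\<close>

lemma action_hom:
  assumes X: "is_comm_monoid C X" and f: "f \<in> Arr C" "Dom C f = carr X \<otimes> P" "Cod C f = P"
    and f_mu: "f \<cdot> self.mu X P = f \<cdot> (carr X \<rhd> f)" and f_eta: "f \<cdot> self.eta X P = Ident C P"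
    and m_f: "m \<cdot> rmul (carr X) P f P = f \<cdot> (carr X \<rhd> m)"
    and e: "e \<in> Arr C" "Dom C e = carr X" "Cod C e = P" "e \<cdot> runit C (carr X) = f \<cdot> (carr X \<rhd> u)"
  shows "m \<cdot> (e \<otimes>\<^sub>a Ident C P) = f" "e \<cdot> mult X = m \<cdot> (e \<otimes>\<^sub>a e)" "e \<cdot> unt X = u"
proof -
  let ?x = "carr X"
  note [simp] = X comm_monoidD(1-7)[OF X] f e(1-3)
  show me: "m \<cdot> (e \<otimes>\<^sub>a Ident C P) = f"
  proof (rule iso_cancel_right[of "?x \<rhd> lunit C P"])
    have "(m \<cdot> (e \<otimes>\<^sub>a Ident C P)) \<cdot> (?x \<rhd> lunit C P)
        = m \<cdot> ((e \<cdot> runit C ?x) \<otimes>\<^sub>a Ident C P) \<cdot> assoc C ?x \<one> P"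
      using triangle[of ?x P] by (simp add: rtensor_comp self.lact_def)
    also have "\<dots> = (m \<cdot> rmul ?x P f P) \<cdot> (?x \<rhd> (u \<otimes>\<^sub>a Ident C P))"
      unfolding e(4) using rmul_lact[of ?x u P f P] by (simp add: rmul_def)
    also have "\<dots> = f \<cdot> (?x \<rhd> (m \<cdot> (u \<otimes>\<^sub>a Ident C P)))"
      unfolding m_f by simp
    finally show "(m \<cdot> (e \<otimes>\<^sub>a Ident C P)) \<cdot> (?x \<rhd> lunit C P) = f \<cdot> (?x \<rhd> lunit C P)"
      unfolding m_u_left .
  qed (simp_all add: self.lact_def ltensor_iso)
  show "e \<cdot> mult X = m \<cdot> (e \<otimes>\<^sub>a e)"
  proof (rule iso_cancel_right[of "?x \<rhd> runit C ?x"])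
    have n: "runit C ?x \<cdot> (mult X \<otimes>\<^sub>a Ident C \<one>) = mult X \<cdot> runit C (?x \<otimes> ?x)"
      using runit_nat[of "mult X" ?x] by simp
    have "(e \<cdot> mult X) \<cdot> (?x \<rhd> runit C ?x) = e \<cdot> (mult X \<cdot> runit C (?x \<otimes> ?x)) \<cdot> assoc C ?x ?x \<one>"
      using runit_tensor[of ?x ?x] by (simp add: self.lact_def)
    also have "\<dots> = (e \<cdot> runit C ?x) \<cdot> self.mu X \<one>"
      unfolding n[symmetric] by (simp add: self.mu_def)
    also have "\<dots> = (f \<cdot> self.mu X P) \<cdot> (?x \<rhd> ?x \<rhd> u)"
      unfolding e(4) by (simp add: self.monad_rules)
    also have "\<dots> = f \<cdot> (?x \<rhd> (e \<cdot> runit C ?x))"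
      unfolding f_mu e(4) by simp
    also have "\<dots> = (m \<cdot> (e \<otimes>\<^sub>a Ident C P) \<cdot> (?x \<rhd> e)) \<cdot> (?x \<rhd> runit C ?x)"
      using whisker[OF me] by simp
    also have "(e \<otimes>\<^sub>a Ident C P) \<cdot> (?x \<rhd> e) = e \<otimes>\<^sub>a e"
      by (simp add: self.lact_def tensor_comp)
    finally show "(e \<cdot> mult X) \<cdot> (?x \<rhd> runit C ?x) = (m \<cdot> (e \<otimes>\<^sub>a e)) \<cdot> (?x \<rhd> runit C ?x)" .
  qed (simp_all add: self.lact_def ltensor_iso)
  show "e \<cdot> unt X = u"
  proof (rule iso_cancel_right[of "lunit C \<one>"])
    have "(e \<cdot> unt X) \<cdot> lunit C \<one> = (e \<cdot> runit C ?x) \<cdot> (unt X \<otimes>\<^sub>a Ident C \<one>)"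
      using runit_nat[of "unt X" ?x] by (simp add: lunit_one)
    also have "\<dots> = f \<cdot> (unt X \<otimes>\<^sub>a Ident C P) \<cdot> (\<one> \<rhd> u)"
      unfolding e(4) by (simp add: self.lact_def tensor_comp)
    also have "\<dots> = (f \<cdot> self.eta X P) \<cdot> lunit C P \<cdot> (\<one> \<rhd> u)"
      by (simp add: self.eta_def)
    also have "\<dots> = u \<cdot> lunit C \<one>"
      unfolding f_eta using lunit_nat[of u P] by (simp add: self.lact_def)
    finally show "(e \<cdot> unt X) \<cdot> lunit C \<one> = u \<cdot> lunit C \<one>" .
  qed simp_all
qed

lemmas i_hom = action_hom[OF CM(2) s_arr s_mu s_eta m_s i_arr i_runit]
lemmas j_hom = action_hom[OF CM(3) t_arr t_mu t_eta m_t j_arr j_runit]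

lemma q_eq_ij: "m \<cdot> (i \<otimes>\<^sub>a j) = q"
proof -
  have "m \<cdot> (i \<otimes>\<^sub>a j) = (m \<cdot> (i \<otimes>\<^sub>a Ident C P)) \<cdot> (a' \<rhd> j)"
    by (simp add: self.lact_def tensor_comp)
  then show ?thesis
    unfolding i_hom(1) s_j .
qed

lemma ij_base: "i \<cdot> und \<alpha> = j \<cdot> und \<beta>"
proof (rule iso_cancel_right[of "runit C a"])
  note [simp] = ha(5-7) hb(5-7)
  have n: "f \<cdot> runit C (Dom C f) = runit C (Cod C f) \<cdot> (f \<otimes>\<^sub>a Ident C \<one>)" if "f \<in> Arr C" for f
    using runit_nat[of f] that by simp
  have "(i \<cdot> und \<alpha>) \<cdot> runit C a = (i \<cdot> runit C a') \<cdot> (und \<alpha> \<otimes>\<^sub>a Ident C \<one>)"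
    using n[of "und \<alpha>"] by simp
  also have "\<dots> = (s \<cdot> self.bc \<alpha> P) \<cdot> (a \<rhd> u)"
    unfolding i_runit by (simp add: self.lact_def self.bc_def tensor_comp)
  also have "\<dots> = (j \<cdot> runit C b) \<cdot> (und \<beta> \<otimes>\<^sub>a Ident C \<one>)"
    unfolding s_t_base j_runit by (simp add: self.lact_def self.bc_def tensor_comp)
  also have "\<dots> = (j \<cdot> und \<beta>) \<cdot> runit C a"
    using n[of "und \<beta>"] by simp
  finally show "(i \<cdot> und \<alpha>) \<cdot> runit C a = (j \<cdot> und \<beta>) \<cdot> runit C a" .
qed (simp_all add: ha hb)

text \<open>The images of \<open>i\<close> and \<open>j\<close> commute with each other, which is \<open>t_i\<close>, and with themselves, because \<open>a'\<close>
  and \<open>b\<close> are commutative.  Hence both commute with \<open>q = m \<cdot> (i \<otimes> j)\<close>, that is, with everything; and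
  then so does \<open>q\<close>.\<close>

lemma t_i: "t \<cdot> (b \<rhd> i) = q \<cdot> symm C b a'"
proof (rule iso_cancel_right[of "b \<rhd> runit C a'"])
  have "(t \<cdot> (b \<rhd> i)) \<cdot> (b \<rhd> runit C a') = t \<cdot> (b \<rhd> (i \<cdot> runit C a'))"
    by simp
  also have "\<dots> = (s \<cdot> (a' \<rhd> t) \<cdot> interchange b a' P) \<cdot> (b \<rhd> a' \<rhd> u)"
    unfolding i_runit s_t_commute by simp
  also have "\<dots> = s \<cdot> (a' \<rhd> (t \<cdot> (b \<rhd> u))) \<cdot> interchange b a' \<one>"
    by (simp add: interchange_lact)
  also have "\<dots> = (s \<cdot> (a' \<rhd> j)) \<cdot> (a' \<rhd> runit C b) \<cdot> interchange b a' \<one>"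
    unfolding j_runit[symmetric] by simp
  also have "\<dots> = (q \<cdot> symm C b a') \<cdot> (b \<rhd> runit C a')"
    unfolding s_j using interchange_runit[of b a'] by (simp add: self.lact_def)
  finally show "(t \<cdot> (b \<rhd> i)) \<cdot> (b \<rhd> runit C a') = (q \<cdot> symm C b a') \<cdot> (b \<rhd> runit C a')" .
qed (simp_all add: self.lact_def ltensor_iso)

lemma t_j: "t \<cdot> (b \<rhd> j) = j \<cdot> \<mu>\<^sub>b"
proof -
  have "t \<cdot> (b \<rhd> j) = (m \<cdot> (j \<otimes>\<^sub>a Ident C P)) \<cdot> (b \<rhd> j)"
    unfolding j_hom(1) ..
  also have "\<dots> = m \<cdot> (j \<otimes>\<^sub>a j)"
    by (simp add: self.lact_def tensor_comp)
  finally show ?thesis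
    unfolding j_hom(2) .
qed

text \<open>Right multiplication by \<open>f\<close> is moved to the left by the symmetry and computed on representatives, so that
  \<open>t_i\<close> and \<open>t_j\<close> apply.\<close>

lemma right_mult_q:
  assumes [simp]: "f \<in> Arr C" "Cod C f = P" "Dom C f = x" "x \<in> Obj C"
  shows "m \<cdot> (P \<rhd> f) \<cdot> symm C x P \<cdot> (x \<rhd> q)
    = s \<cdot> (a' \<rhd> (t \<cdot> (b \<rhd> f))) \<cdot> iso_inv C (assoc C a' b x) \<cdot> symm C x (a' \<otimes> b)"
proof -
  have n: "symm C x P \<cdot> (x \<rhd> q) = (q \<otimes>\<^sub>a Ident C x) \<cdot> symm C x (a' \<otimes> b)"
    using symm_nat[of "Ident C x" q x P] by (simp add: self.lact_def)
  have r: "(P \<rhd> f) \<cdot> Q x = Q P \<cdot> (a' \<rhd> b \<rhd> f)"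
    using rmul_nat[of a' b f q P] by simp
  have "q \<otimes>\<^sub>a Ident C x = Q x \<cdot> iso_inv C (assoc C a' b x)"
    by (simp add: rmul_def)
  then have "m \<cdot> (P \<rhd> f) \<cdot> symm C x P \<cdot> (x \<rhd> q)
      = m \<cdot> ((P \<rhd> f) \<cdot> Q x) \<cdot> iso_inv C (assoc C a' b x) \<cdot> symm C x (a' \<otimes> b)"
    unfolding n by simp
  also have "\<dots> = (m \<cdot> Q P) \<cdot> (a' \<rhd> b \<rhd> f) \<cdot> iso_inv C (assoc C a' b x) \<cdot> symm C x (a' \<otimes> b)"
    unfolding r by simp
  finally show ?thesis
    unfolding m_Q by simp
qed

lemma i_central: "m \<cdot> (P \<rhd> i) \<cdot> symm C a' P = s"
proof (rule lact_q_eq[of a'])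
  have "(m \<cdot> (P \<rhd> i) \<cdot> symm C a' P) \<cdot> (a' \<rhd> q)
      = s \<cdot> (a' \<rhd> (t \<cdot> (b \<rhd> i))) \<cdot> iso_inv C (assoc C a' b a') \<cdot> symm C a' (a' \<otimes> b)"
    using right_mult_q[of i a'] by simp
  also have "\<dots> = (s \<cdot> (a' \<rhd> q)) \<cdot> (a' \<rhd> symm C b a') \<cdot> iso_inv C (assoc C a' b a') \<cdot> symm C a' (a' \<otimes> b)"
    unfolding t_i by simp
  also have "\<dots> = q \<cdot> (self.mu A' b \<cdot> interchange a' a' b)"
    unfolding s_q using interchange_symm[of a' a' b] by (simp add: self.lact_def)
  also have "\<dots> = s \<cdot> (a' \<rhd> q)"
    unfolding s_q by (simp add: mu_interchange)
  finally show "(m \<cdot> (P \<rhd> i) \<cdot> symm C a' P) \<cdot> (a' \<rhd> q) = s \<cdot> (a' \<rhd> q)" .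
qed simp_all

lemma j_central: "m \<cdot> (P \<rhd> j) \<cdot> symm C b P = t"
proof (rule lact_q_eq[of b])
  have c: "\<mu>\<^sub>b \<cdot> symm C b b = \<mu>\<^sub>b"
    using comm_monoidD(11)[OF hb(2)] .
  have "(m \<cdot> (P \<rhd> j) \<cdot> symm C b P) \<cdot> (b \<rhd> q)
      = s \<cdot> (a' \<rhd> (t \<cdot> (b \<rhd> j))) \<cdot> iso_inv C (assoc C a' b b) \<cdot> symm C b (a' \<otimes> b)"
    using right_mult_q[of j b] by simp
  also have "\<dots> = (s \<cdot> (a' \<rhd> j)) \<cdot> (a' \<rhd> (\<mu>\<^sub>b \<cdot> symm C b b)) \<cdot> iso_inv C (assoc C a' b b) \<cdot> symm C b (a' \<otimes> b)"
    unfolding t_j c by simp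
  also have "\<dots> = q \<cdot> (a' \<rhd> \<mu>\<^sub>b) \<cdot> interchange b a' b"
    unfolding s_j using interchange_symm[of b a' b] by (simp add: self.lact_def ltensor_comp)
  finally show "(m \<cdot> (P \<rhd> j) \<cdot> symm C b P) \<cdot> (b \<rhd> q) = t \<cdot> (b \<rhd> q)"
    unfolding t_q .
qed simp_all

lemma m_symm: "m \<cdot> symm C P P = m"
proof (rule Q_eq[of P])
  have "(m \<cdot> symm C P P) \<cdot> Q P = m \<cdot> (P \<rhd> q) \<cdot> symm C (a' \<otimes> b) P \<cdot> assoc C a' b P"
    using whisker[OF symm_nat[of q "Ident C P" P P]] by (simp add: rmul_def self.lact_def)
  also have "P \<rhd> q = (P \<rhd> m) \<cdot> (P \<rhd> (i \<otimes>\<^sub>a j))"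
    using self.lact_comp[of P "i \<otimes>\<^sub>a j" m] by (simp add: q_eq_ij)
  also have "m \<cdot> ((P \<rhd> m) \<cdot> (P \<rhd> (i \<otimes>\<^sub>a j))) \<cdot> symm C (a' \<otimes> b) P \<cdot> assoc C a' b P
      = (m \<cdot> (P \<rhd> m)) \<cdot> (P \<rhd> (i \<otimes>\<^sub>a j)) \<cdot> symm C (a' \<otimes> b) P \<cdot> assoc C a' b P"
    by simp
  also have "\<dots> = m \<cdot> (m \<otimes>\<^sub>a Ident C P) \<cdot> ((P \<rhd> i) \<otimes>\<^sub>a j) \<cdot> (assoc C P a' b \<cdot> symm C (a' \<otimes> b) P \<cdot> assoc C a' b P)"
    unfolding m_assoc[symmetric] using whisker[OF assoc_nat[of "Ident C P" i j P P P]]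
    by (simp add: rmul_def self.lact_def)
  also have "\<dots> = m \<cdot> ((m \<otimes>\<^sub>a Ident C P) \<cdot> ((P \<rhd> i) \<otimes>\<^sub>a j) \<cdot> (symm C a' P \<otimes>\<^sub>a Ident C b)) \<cdot> assoc C a' P b \<cdot> (a' \<rhd> symm C b P)"
    unfolding hexagon[OF CMD(8) CMD(15) q_arr(4)] by (simp add: self.lact_def)
  also have "(m \<otimes>\<^sub>a Ident C P) \<cdot> ((P \<rhd> i) \<otimes>\<^sub>a j) \<cdot> (symm C a' P \<otimes>\<^sub>a Ident C b) = (m \<cdot> (P \<rhd> i) \<cdot> symm C a' P) \<otimes>\<^sub>a j"
    by (simp add: tensor_comp)
  also have "m \<cdot> ((m \<cdot> (P \<rhd> i) \<cdot> symm C a' P) \<otimes>\<^sub>a j) \<cdot> assoc C a' P b \<cdot> (a' \<rhd> symm C b P)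
      = (m \<cdot> rmul a' P s P) \<cdot> (a' \<rhd> ((P \<rhd> j) \<cdot> symm C b P))"
  proof -
    have e1: "assoc C a' P P \<cdot> (a' \<rhd> P \<rhd> j) = ((a' \<otimes> P) \<rhd> j) \<cdot> assoc C a' P b"
      using self.assoc_lact[of a' P j P] by simp
    have e2: "(s \<otimes>\<^sub>a Ident C P) \<cdot> ((a' \<otimes> P) \<rhd> j) = s \<otimes>\<^sub>a j"
      by (simp add: self.lact_def tensor_comp)
    show ?thesis
      unfolding i_central by (simp add: rmul_def whisker[OF e1] whisker[OF e2])
  qed
  also have "\<dots> = s \<cdot> (a' \<rhd> (m \<cdot> (P \<rhd> j) \<cdot> symm C b P))"
    unfolding m_s by simp
  also have "\<dots> = m \<cdot> Q P"
    unfolding j_central m_Q ..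
  finally show "(m \<cdot> symm C P P) \<cdot> Q P = m \<cdot> Q P" .
qed simp_all

definition tensor_monoid where "tensor_monoid = Mon P m u"

lemma tensor_monoid: "is_comm_monoid C tensor_monoid"
  using m_assoc m_u_left m_u_right m_symm
  by (simp add: is_comm_monoid_def tensor_monoid_def hom_def rmul_def self.lact_def)

lemma tensor_monoid_simps [simp]: "carr tensor_monoid = P" "mult tensor_monoid = m" "unt tensor_monoid = u"
  by (simp_all add: tensor_monoid_def)

lemma coprojections:
  "SArr A' i tensor_monoid \<in> hom (Comm C) A' tensor_monoid" "SArr B j tensor_monoid \<in> hom (Comm C) B tensor_monoid"
  by (rule comm_homI; simp add: hom_def tensor_monoid i_hom(2,3) j_hom(2,3))+

text \<open>The arrow \<open>x \<otimes> y \<mapsto> \<beta>'(x) \<alpha>'(y)\<close> respects the identification made by \<open>q\<close>.  The induced \<open>g\<close> is linear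
  over \<open>a'\<close> (\<open>gs\<close>) and, by commutativity of \<open>b'\<close>, over \<open>b\<close> (\<open>gt\<close>); as \<open>m\<close> is composed of these two
  actions, \<open>g\<close> is multiplicative.\<close>

lemma tensor_monoid_map:
  assumes \<alpha>': "\<alpha>' \<in> hom (Comm C) B B'" and \<beta>': "\<beta>' \<in> hom (Comm C) A' B'"
    and sq: "und \<alpha>' \<cdot> und \<beta> = und \<beta>' \<cdot> und \<alpha>"
  obtains g where "SArr tensor_monoid g B' \<in> hom (Comm C) tensor_monoid B'"
    "g \<cdot> q = mult B' \<cdot> (und \<beta>' \<otimes>\<^sub>a und \<alpha>')"
proof -
  note h = comm_homD[OF \<alpha>'] and h' = comm_homD[OF \<beta>']
  let ?b' = "carr B'" and ?\<mu>' = "mult B'" and ?f = "und \<alpha>'" and ?g = "und \<beta>'"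
  note [simp] = h(2) comm_monoidD(1-7)[OF h(2)] h(5-7) h'(5-7) self.bc_arr[OF \<alpha>'] self.bc_arr[OF \<beta>']
  note M = mult_mu[OF h(2)]
  have k: "?\<mu>' \<cdot> (?g \<otimes>\<^sub>a ?f) = ?\<mu>' \<cdot> self.bc \<beta>' ?b' \<cdot> (a' \<rhd> ?f)"
    by (simp add: self.bc_def self.lact_def tensor_comp)
  have f_mult: "?f \<cdot> \<mu>\<^sub>b = ?\<mu>' \<cdot> self.bc \<alpha>' ?b' \<cdot> (b \<rhd> ?f)"
    unfolding h(8) by (simp add: self.bc_def self.lact_def tensor_comp)
  have sq': "self.bc \<alpha>' x \<cdot> self.bc \<beta> x = self.bc \<beta>' x \<cdot> self.bc \<alpha> x" if "x \<in> Obj C" for x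
    using that sq ha(5-7) hb(5-7) by (simp add: self.bc_def flip: rtensor_comp)
  have g_mu: "?\<mu>' \<cdot> self.bc \<beta>' ?b' \<cdot> self.mu A' ?b'
      = ?\<mu>' \<cdot> self.bc \<beta>' ?b' \<cdot> (a' \<rhd> (?\<mu>' \<cdot> self.bc \<beta>' ?b'))"
  proof -
    have "?\<mu>' \<cdot> self.bc \<beta>' ?b' \<cdot> self.mu A' ?b' = (?\<mu>' \<cdot> self.mu B' ?b') \<cdot> (?b' \<rhd> self.bc \<beta>' ?b') \<cdot> self.bc \<beta>' (a' \<otimes> ?b')"
      by (simp add: self.bc_mu[OF \<beta>'])
    also have "\<dots> = ?\<mu>' \<cdot> self.bc \<beta>' ?b' \<cdot> (a' \<rhd> (?\<mu>' \<cdot> self.bc \<beta>' ?b'))"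
      unfolding M(1) by (simp add: self.bc_rules[OF \<beta>'])
    finally show ?thesis .
  qed
  let ?k = "?\<mu>' \<cdot> self.bc \<beta>' ?b' \<cdot> (a' \<rhd> ?f)"
  have "?k \<cdot> (a' \<rhd> (\<mu>\<^sub>b \<cdot> self.bc \<beta> b)) = ?\<mu>' \<cdot> self.bc \<beta>' ?b' \<cdot> (a' \<rhd> ((?f \<cdot> \<mu>\<^sub>b) \<cdot> self.bc \<beta> b))"
    by simp
  also have "\<dots> = ?\<mu>' \<cdot> self.bc \<beta>' ?b' \<cdot> (a' \<rhd> (?\<mu>' \<cdot> (self.bc \<alpha>' ?b' \<cdot> self.bc \<beta> ?b') \<cdot> (a \<rhd> ?f)))"
    unfolding f_mult by (simp add: self.bc_rules[OF beta])
  also have "\<dots> = (?\<mu>' \<cdot> self.bc \<beta>' ?b' \<cdot> (a' \<rhd> (?\<mu>' \<cdot> self.bc \<beta>' ?b'))) \<cdot> (a' \<rhd> (self.bc \<alpha> ?b' \<cdot> (a \<rhd> ?f)))"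
    unfolding sq'[OF comm_monoidD(1)[OF h(2)]] by simp
  also have "\<dots> = ?k \<cdot> self.mu A' b \<cdot> (a' \<rhd> self.bc \<alpha> b)"
    unfolding g_mu[symmetric] by (simp add: self.monad_rules self.bc_rules[OF alpha])
  finally obtain g where [simp]: "g \<in> Arr C" "Dom C g = P" "Cod C g = ?b'" and g: "g \<cdot> q = ?k"
    using coequalizer_factor[OF q_coeq, of ?k] by auto
  have gs: "g \<cdot> s = ?\<mu>' \<cdot> self.bc \<beta>' ?b' \<cdot> (a' \<rhd> g)"
  proof (rule lact_q_eq[of a'])
    have "(g \<cdot> s) \<cdot> (a' \<rhd> q) = (g \<cdot> q) \<cdot> self.mu A' b"
      by (simp add: s_q)
    also have "\<dots> = (?\<mu>' \<cdot> self.bc \<beta>' ?b' \<cdot> self.mu A' ?b') \<cdot> (a' \<rhd> a' \<rhd> ?f)"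
      unfolding g by (simp add: self.monad_rules)
    also have "\<dots> = ?\<mu>' \<cdot> self.bc \<beta>' ?b' \<cdot> (a' \<rhd> (g \<cdot> q))"
      unfolding g g_mu by simp
    finally show "(g \<cdot> s) \<cdot> (a' \<rhd> q) = (?\<mu>' \<cdot> self.bc \<beta>' ?b' \<cdot> (a' \<rhd> g)) \<cdot> (a' \<rhd> q)"
      by simp
  qed simp_all
  have gt: "g \<cdot> t = ?\<mu>' \<cdot> self.bc \<alpha>' ?b' \<cdot> (b \<rhd> g)"
  proof (rule lact_q_eq[of b])
    \<comment> \<open>exchanging the images of \<open>\<alpha>'\<close> and \<open>\<beta>'\<close> in \<open>b'\<close>\<close>
    have cross: "self.bc \<beta>' (?b' \<otimes> ?b') \<cdot> (a' \<rhd> self.bc \<alpha>' ?b') \<cdot> interchange b a' ?b'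
        = interchange ?b' ?b' ?b' \<cdot> self.bc \<alpha>' (?b' \<otimes> ?b') \<cdot> (b \<rhd> self.bc \<beta>' ?b')"
    proof -
      have "self.bc \<beta>' (?b' \<otimes> ?b') \<cdot> (a' \<rhd> self.bc \<alpha>' ?b') \<cdot> interchange b a' ?b'
          = (?b' \<rhd> self.bc \<alpha>' ?b') \<cdot> self.bc \<beta>' (b \<otimes> ?b') \<cdot> interchange b a' ?b'"
        using whisker[OF self.bc_nat[OF \<beta>', of "self.bc \<alpha>' ?b'" "?b' \<otimes> ?b'"]] by simp
      also have "\<dots> = (?b' \<rhd> self.bc \<alpha>' ?b') \<cdot> interchange b ?b' ?b' \<cdot> (b \<rhd> self.bc \<beta>' ?b')"
        using interchange_bc(2)[OF \<beta>', of b ?b'] by simp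
      also have "\<dots> = interchange ?b' ?b' ?b' \<cdot> self.bc \<alpha>' (?b' \<otimes> ?b') \<cdot> (b \<rhd> self.bc \<beta>' ?b')"
        using whisker[OF interchange_bc(1)[OF \<alpha>', of ?b' ?b']] by simp
      finally show ?thesis .
    qed
    have "(g \<cdot> t) \<cdot> (b \<rhd> q) = (g \<cdot> q) \<cdot> (a' \<rhd> \<mu>\<^sub>b) \<cdot> interchange b a' b"
      by (simp add: t_q)
    also have "\<dots> = ?\<mu>' \<cdot> self.bc \<beta>' ?b' \<cdot> (a' \<rhd> (?f \<cdot> \<mu>\<^sub>b)) \<cdot> interchange b a' b"
      unfolding g by simp
    also have "\<dots> = (?\<mu>' \<cdot> (?b' \<rhd> ?\<mu>')) \<cdot> (self.bc \<beta>' (?b' \<otimes> ?b') \<cdot> (a' \<rhd> self.bc \<alpha>' ?b') \<cdot> interchange b a' ?b') \<cdot> (b \<rhd> a' \<rhd> ?f)"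
      unfolding f_mult by (simp add: interchange_lact self.bc_rules[OF \<beta>'])
    also have "\<dots> = ?\<mu>' \<cdot> (self.mu B' ?b' \<cdot> interchange ?b' ?b' ?b') \<cdot> self.bc \<alpha>' (?b' \<otimes> ?b') \<cdot> (b \<rhd> self.bc \<beta>' ?b') \<cdot> (b \<rhd> a' \<rhd> ?f)"
      unfolding cross M(1)[symmetric] by simp
    also have "\<dots> = (?\<mu>' \<cdot> self.mu B' ?b') \<cdot> self.bc \<alpha>' (?b' \<otimes> ?b') \<cdot> (b \<rhd> self.bc \<beta>' ?b') \<cdot> (b \<rhd> a' \<rhd> ?f)"
      by (simp add: mu_interchange)
    also have "\<dots> = ?\<mu>' \<cdot> self.bc \<alpha>' ?b' \<cdot> (b \<rhd> (g \<cdot> q))"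
      unfolding M(1) g by (simp add: self.bc_rules[OF \<alpha>'])
    finally show "(g \<cdot> t) \<cdot> (b \<rhd> q) = (?\<mu>' \<cdot> self.bc \<alpha>' ?b' \<cdot> (b \<rhd> g)) \<cdot> (b \<rhd> q)"
      by simp
  qed simp_all
  have gm: "g \<cdot> m = ?\<mu>' \<cdot> (g \<otimes>\<^sub>a g)"
  proof (rule Q_eq[of P])
    have "(g \<cdot> m) \<cdot> Q P = (g \<cdot> s) \<cdot> (a' \<rhd> t)"
      by (simp add: m_Q)
    also have "\<dots> = ?\<mu>' \<cdot> self.bc \<beta>' ?b' \<cdot> (a' \<rhd> (g \<cdot> t))"
      unfolding gs by simp
    also have "\<dots> = (?\<mu>' \<cdot> (?b' \<rhd> ?\<mu>')) \<cdot> (?g \<otimes>\<^sub>a (?f \<otimes>\<^sub>a g))"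
      unfolding gt by (simp add: self.bc_def self.lact_def tensor_comp)
    also have "\<dots> = ?\<mu>' \<cdot> self.mu B' ?b' \<cdot> (?g \<otimes>\<^sub>a (?f \<otimes>\<^sub>a g))"
      unfolding M(1)[symmetric] by simp
    also have "\<dots> = ?\<mu>' \<cdot> ((?\<mu>' \<cdot> (?g \<otimes>\<^sub>a ?f)) \<otimes>\<^sub>a g) \<cdot> assoc C a' b P"
    proof -
      have "(?\<mu>' \<otimes>\<^sub>a Ident C ?b') \<cdot> ((?g \<otimes>\<^sub>a ?f) \<otimes>\<^sub>a g) = (?\<mu>' \<cdot> (?g \<otimes>\<^sub>a ?f)) \<otimes>\<^sub>a g"
        by (simp add: tensor_comp)
      from whisker[OF this] show ?thesis
        using assoc_nat[of ?g ?f g ?b' ?b' ?b'] by (simp add: self.mu_def)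
    qed
    also have "\<dots> = (?\<mu>' \<cdot> (g \<otimes>\<^sub>a g)) \<cdot> Q P"
    proof -
      have "(g \<otimes>\<^sub>a g) \<cdot> (q \<otimes>\<^sub>a Ident C P) = (g \<cdot> q) \<otimes>\<^sub>a g"
        by (simp add: tensor_comp)
      from whisker[OF this] show ?thesis
        unfolding k g[symmetric] by (simp add: rmul_def)
    qed
    finally show "(g \<cdot> m) \<cdot> Q P = (?\<mu>' \<cdot> (g \<otimes>\<^sub>a g)) \<cdot> Q P" .
  qed simp_all
  have "g \<cdot> u = (g \<cdot> q) \<cdot> self.eta A' b \<cdot> unt B"
    by (simp add: u_def j_def)
  also have "\<dots> = ?\<mu>' \<cdot> (self.bc \<beta>' ?b' \<cdot> self.eta A' ?b') \<cdot> (?f \<cdot> unt B)"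
    unfolding g by (simp add: self.monad_rules)
  also have "\<dots> = (?\<mu>' \<cdot> self.eta B' ?b') \<cdot> unt B'"
    unfolding h(9) self.bc_eta[OF \<beta>' comm_monoidD(1)[OF h(2)]] by simp
  also have "\<dots> = unt B'"
    unfolding M(2) by simp
  finally have "SArr tensor_monoid g B' \<in> hom (Comm C) tensor_monoid B'"
    using gm tensor_monoid h(2) by (intro comm_homI) (simp_all add: hom_def)
  then show ?thesis
    using g k that by simp
qed

text \<open>The pushout \<open>b'\<close> maps to the commutative monoid \<open>P\<close> by its universal property (\<open>h\<close>), and \<open>P\<close> maps back
  (\<open>g\<close>).  The composite \<open>h \<cdot> g\<close> is the identity because \<open>q\<close> is epi, and \<open>g \<cdot> h\<close> is the identity by
  uniqueness in the pushout.\<close>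

lemma pushout_coequalizer:
  assumes \<alpha>': "\<alpha>' \<in> hom (Comm C) B B'" and \<beta>': "\<beta>' \<in> hom (Comm C) A' B'"
    and po: "is_pushout (Comm C) \<alpha> \<beta> \<alpha>' \<beta>'"
  shows "is_coequalizer C (a' \<rhd> (\<mu>\<^sub>b \<cdot> self.bc \<beta> b)) (self.mu A' b \<cdot> (a' \<rhd> self.bc \<alpha> b))
    (carr B') (mult B' \<cdot> (und \<beta>' \<otimes>\<^sub>a und \<alpha>'))"
proof -
  interpret K: category "Comm C" by (rule category_Comm)
  note h = comm_homD[OF \<alpha>'] and h' = comm_homD[OF \<beta>']
  let ?T = tensor_monoid and ?b' = "carr B'" and ?f = "und \<alpha>'" and ?g = "und \<beta>'"
  note [simp] = h(2) comm_monoidD(1-7)[OF h(2)] h(5-7) h'(5-7)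
  have dom [simp]: "Dom (Comm C) \<alpha>' = B" "Cod (Comm C) \<alpha>' = B'" "Dom (Comm C) \<beta>' = A'" "sdom \<alpha>' = B" "scod \<alpha>' = B'" "sdom \<beta>' = A'" "scod \<beta>' = B'"
    "sdom \<alpha> = A" "sdom \<beta> = A"
    using h(3,4) h'(3,4) ha(3) hb(3) by simp_all
  have sq: "\<alpha>' \<cdot>\<^bsub>Comm C\<^esub> \<beta> = \<beta>' \<cdot>\<^bsub>Comm C\<^esub> \<alpha>"
    and ex: "\<And>c v w. v \<in> hom (Comm C) B c \<Longrightarrow> w \<in> hom (Comm C) A' c \<Longrightarrow> v \<cdot>\<^bsub>Comm C\<^esub> \<beta> = w \<cdot>\<^bsub>Comm C\<^esub> \<alpha> \<Longrightarrow>
      \<exists>!h. h \<in> hom (Comm C) B' c \<and> h \<cdot>\<^bsub>Comm C\<^esub> \<alpha>' = v \<and> h \<cdot>\<^bsub>Comm C\<^esub> \<beta>' = w"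
  proof -
    from po obtain x x' y y' where *: "\<alpha> \<in> hom (Comm C) x x'" "\<beta> \<in> hom (Comm C) x y" "\<alpha>' \<in> hom (Comm C) y y'"
      "\<alpha>' \<cdot>\<^bsub>Comm C\<^esub> \<beta> = \<beta>' \<cdot>\<^bsub>Comm C\<^esub> \<alpha>"
      and u: "\<forall>c. \<forall>u \<in> hom (Comm C) y c. \<forall>v \<in> hom (Comm C) x' c. u \<cdot>\<^bsub>Comm C\<^esub> \<beta> = v \<cdot>\<^bsub>Comm C\<^esub> \<alpha> \<longrightarrow>
        (\<exists>!h. h \<in> hom (Comm C) y' c \<and> h \<cdot>\<^bsub>Comm C\<^esub> \<alpha>' = u \<and> h \<cdot>\<^bsub>Comm C\<^esub> \<beta>' = v)"
      unfolding is_pushout_def by (elim exE conjE) (rule that)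
    have "x' = A'" "y = B" "y' = B'"
      using *(1-3) alpha beta \<alpha>' unfolding hom_def by auto
    with u * show "\<alpha>' \<cdot>\<^bsub>Comm C\<^esub> \<beta> = \<beta>' \<cdot>\<^bsub>Comm C\<^esub> \<alpha>"
      and "\<And>c v w. v \<in> hom (Comm C) B c \<Longrightarrow> w \<in> hom (Comm C) A' c \<Longrightarrow> v \<cdot>\<^bsub>Comm C\<^esub> \<beta> = w \<cdot>\<^bsub>Comm C\<^esub> \<alpha> \<Longrightarrow>
        \<exists>!h. h \<in> hom (Comm C) B' c \<and> h \<cdot>\<^bsub>Comm C\<^esub> \<alpha>' = v \<and> h \<cdot>\<^bsub>Comm C\<^esub> \<beta>' = w"
      by blast+
  qed
  have sq_und: "?f \<cdot> und \<beta> = ?g \<cdot> und \<alpha>"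
    using arg_cong[OF sq, of und] by simp
  obtain g where gh: "SArr ?T g B' \<in> hom (Comm C) ?T B'" and gq: "g \<cdot> q = mult B' \<cdot> (?g \<otimes>\<^sub>a ?f)"
    by (rule tensor_monoid_map[OF \<alpha>' \<beta>' sq_und])
  have [simp]: "g \<in> Arr C" "Dom C g = P" "Cod C g = ?b'"
    using comm_homD(5-7)[OF gh] by simp_all
  have "SArr B j ?T \<cdot>\<^bsub>Comm C\<^esub> \<beta> = SArr A' i ?T \<cdot>\<^bsub>Comm C\<^esub> \<alpha>"
    using ij_base by simp
  from ex[OF coprojections(2,1) this] obtain h' where h': "h' \<in> hom (Comm C) B' ?T"
    and e: "h' \<cdot>\<^bsub>Comm C\<^esub> \<alpha>' = SArr B j ?T" "h' \<cdot>\<^bsub>Comm C\<^esub> \<beta>' = SArr A' i ?T"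
    by blast
  define h where "h = und h'"
  note hh = comm_homD[OF h', folded h_def]
  have [simp]: "h \<in> Arr C" "Dom C h = ?b'" "Cod C h = P" "sdom h' = B'" "scod h' = ?T"
    using hh by simp_all
  have hj: "h \<cdot> ?f = j" and hi: "h \<cdot> ?g = i"
    using arg_cong[OF e(1), of und] arg_cong[OF e(2), of und] by (simp_all add: h_def)
  have "h \<cdot> g = Ident C P"
  proof (rule coequalizer_eq[OF q_coeq])
    have "(h \<cdot> g) \<cdot> q = (h \<cdot> mult B') \<cdot> (?g \<otimes>\<^sub>a ?f)"
      by (simp add: gq)
    also have "\<dots> = m \<cdot> ((h \<cdot> ?g) \<otimes>\<^sub>a (h \<cdot> ?f))"
      unfolding hh(8) by (simp add: tensor_comp)
    also have "\<dots> = Ident C P \<cdot> q"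
      unfolding hi hj q_eq_ij by simp
    finally show "(h \<cdot> g) \<cdot> q = Ident C P \<cdot> q" .
  qed simp_all
  moreover have "g \<cdot> h = Ident C ?b'"
  proof -
    have gj: "g \<cdot> j = ?f"
    proof -
      have "g \<cdot> j = (g \<cdot> q) \<cdot> self.eta A' b"
        by (simp add: j_def)
      also have "\<dots> = mult B' \<cdot> self.bc \<beta>' ?b' \<cdot> (a' \<rhd> ?f) \<cdot> self.eta A' b"
      proof -
        have "?g \<otimes>\<^sub>a ?f = self.bc \<beta>' ?b' \<cdot> (a' \<rhd> ?f)"
          by (simp add: self.bc_def self.lact_def tensor_comp)
        then show ?thesis
          unfolding gq using self.bc_arr[OF \<beta>'] by simp
      qed
      also have "\<dots> = mult B' \<cdot> (self.bc \<beta>' ?b' \<cdot> self.eta A' ?b') \<cdot> ?f"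
        using self.bc_arr[OF \<beta>'] by (simp add: self.monad_rules)
      also have "\<dots> = ?f"
        unfolding self.bc_eta[OF \<beta>' comm_monoidD(1)[OF h(2)]]
        using whisker[OF mult_mu(2)[OF h(2)]] by simp
      finally show ?thesis .
    qed
    have gi: "g \<cdot> i = ?g"
    proof (rule iso_cancel_right[of "runit C a'"])
      have "(g \<cdot> i) \<cdot> runit C a' = g \<cdot> (i \<cdot> runit C a')"
        by simp
      also have "\<dots> = g \<cdot> (s \<cdot> (a' \<rhd> j)) \<cdot> (a' \<rhd> unt B)"
        unfolding i_runit by (simp add: u_def)
      also have "\<dots> = (g \<cdot> q) \<cdot> (a' \<rhd> unt B)"
        unfolding s_j by simp
      also have "\<dots> = mult B' \<cdot> (?g \<otimes>\<^sub>a (?f \<cdot> unt B))"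
        unfolding gq by (simp add: self.lact_def tensor_comp)
      also have "\<dots> = (mult B' \<cdot> (Ident C ?b' \<otimes>\<^sub>a unt B')) \<cdot> (?g \<otimes>\<^sub>a Ident C \<one>)"
        unfolding h(9) by (simp add: tensor_comp)
      also have "\<dots> = ?g \<cdot> runit C a'"
        unfolding comm_monoidD(10)[OF h(2)] using runit_nat[of ?g ?b'] by simp
      finally show "(g \<cdot> i) \<cdot> runit C a' = ?g \<cdot> runit C a'" .
    qed simp_all
    have "SArr ?T g B' \<cdot>\<^bsub>Comm C\<^esub> h' \<in> hom (Comm C) B' B'"
      using K.comp_hom[OF h' gh] .
    moreover have "(SArr ?T g B' \<cdot>\<^bsub>Comm C\<^esub> h') \<cdot>\<^bsub>Comm C\<^esub> \<alpha>' = \<alpha>'"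
      by (rule self.sarr_eqI) (simp_all add: hj gj flip: h_def)
    moreover have "(SArr ?T g B' \<cdot>\<^bsub>Comm C\<^esub> h') \<cdot>\<^bsub>Comm C\<^esub> \<beta>' = \<beta>'"
      by (rule self.sarr_eqI) (simp_all add: hi gi flip: h_def)
    moreover have "Ident (Comm C) B' \<in> hom (Comm C) B' B'"
      using K.ident_hom[of B'] by simp
    moreover have "Ident (Comm C) B' \<cdot>\<^bsub>Comm C\<^esub> \<alpha>' = \<alpha>'" "Ident (Comm C) B' \<cdot>\<^bsub>Comm C\<^esub> \<beta>' = \<beta>'"
      by (rule self.sarr_eqI; simp)+
    ultimately have "SArr ?T g B' \<cdot>\<^bsub>Comm C\<^esub> h' = Ident (Comm C) B'"
      using ex[OF \<alpha>' \<beta>' sq] by blast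
    then have "und (SArr ?T g B' \<cdot>\<^bsub>Comm C\<^esub> h') = und (Ident (Comm C) B')"
      by simp
    then show ?thesis
      by (simp add: h_def)
  qed
  ultimately have "is_iso C g"
    by (intro is_isoI[of g _ P ?b' h] homI) simp_all
  from coequalizer_postcomp_iso[OF q_coeq this] show ?thesis
    by (simp add: gq)
qed

end

section \<open>The pseudo-functor of modules and base change\<close>

context left_actegory
begin

lemma restriction_comp:
  assumes \<alpha>: "\<alpha> \<in> hom (Comm C) A B" and \<beta>: "\<beta> \<in> hom (Comm C) B D"
  shows "X \<in> Obj (Mod C M D) \<Longrightarrow>
      fob (restriction M (\<beta> \<cdot>\<^bsub>Comm C\<^esub> \<alpha>)) X = fob (restriction M \<alpha>) (fob (restriction M \<beta>) X)"
    and "f \<in> Arr (Mod C M D) \<Longrightarrow>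
      far (restriction M (\<beta> \<cdot>\<^bsub>Comm C\<^esub> \<alpha>)) f = far (restriction M \<alpha>) (far (restriction M \<beta>) f)"
proof -
  show "X \<in> Obj (Mod C M D) \<Longrightarrow>
      fob (restriction M (\<beta> \<cdot>\<^bsub>Comm C\<^esub> \<alpha>)) X = fob (restriction M \<alpha>) (fob (restriction M \<beta>) X)"
    using restrict_obj_comp[OF \<alpha> \<beta>, of X] by (simp del: Comm_simps)
  assume "f \<in> Arr (Mod C M D)"
  from mod_arr_hom[OF this] have "is_module C M D (sdom f)" "is_module C M D (scod f)"
    by (simp_all add: mod_hom_iff)
  then show "far (restriction M (\<beta> \<cdot>\<^bsub>Comm C\<^esub> \<alpha>)) f = far (restriction M \<alpha>) (far (restriction M \<beta>) f)"
    using restrict_obj_comp[OF \<alpha> \<beta>] by (simp del: Comm_simps)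
qed

lemma restriction_ident:
  assumes A: "is_comm_monoid C A"
  shows "X \<in> Obj (Mod C M A) \<Longrightarrow> fob (restriction M (Ident (Comm C) A)) X = X"
    and "f \<in> Arr (Mod C M A) \<Longrightarrow> far (restriction M (Ident (Comm C) A)) f = f"
proof -
  show "X \<in> Obj (Mod C M A) \<Longrightarrow> fob (restriction M (Ident (Comm C) A)) X = X"
    using restrict_obj_ident[OF A, of X] by (simp del: Comm_simps)
  assume "f \<in> Arr (Mod C M A)"
  from mod_arr_hom[OF this] have "is_module C M A (sdom f)" "is_module C M A (scod f)"
    by (simp_all add: mod_hom_iff)
  then show "far (restriction M (Ident (Comm C) A)) f = f"
    using restrict_obj_ident[OF A] by (intro sarr_eqI) (simp_all del: Comm_simps)
qed

end

locale actegory_with_coequalizers = right_exact_actegory +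
  assumes coequalizer_ex: "\<lbrakk>f \<in> hom M x y; g \<in> hom M x y\<rbrakk> \<Longrightarrow> \<exists>z q. is_coequalizer M f g z q"
begin

lemma ext_coeq_ex:
  assumes \<alpha>: "\<alpha> \<in> hom (Comm C) A B" and X: "is_module C M A X"
  obtains z p where "is_ext_coeq \<alpha> X z p"
proof -
  note h = comm_homD[OF \<alpha>]
  note [simp] = h(1-4) comm_monoidD(1)[OF h(1)] comm_monoidD(1)[OF h(2)] moduleD(1-4)[OF X h(1)] bc_arr[OF \<alpha>]
  have "carr B \<rhd> maction X \<in> hom M (carr B \<boxtimes>\<^bsub>M\<^esub> (carr A \<boxtimes>\<^bsub>M\<^esub> mcarr X)) (carr B \<boxtimes>\<^bsub>M\<^esub> mcarr X)"
    "mu B (mcarr X) \<bullet> (carr B \<rhd> bc \<alpha> (mcarr X)) \<in>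
      hom M (carr B \<boxtimes>\<^bsub>M\<^esub> (carr A \<boxtimes>\<^bsub>M\<^esub> mcarr X)) (carr B \<boxtimes>\<^bsub>M\<^esub> mcarr X)"
    by (auto intro!: homI)
  from coequalizer_ex[OF this] that show ?thesis
    by (auto simp: is_ext_coeq_def)
qed

text \<open>The functor \<open>extension C M \<alpha>\<close> is an arbitrary choice, so it suffices that one extension exists; it is
  assembled from the modules of \<open>extension_module\<close>.\<close>

lemma is_extension_extension:
  assumes \<alpha>: "\<alpha> \<in> hom (Comm C) A B"
  shows "is_extension C M \<alpha> (extension C M \<alpha>)"
proof -
  note h = comm_homD[OF \<alpha>]
  have "\<forall>X \<in> Obj (Mod C M A). \<exists>Y u. universal (Mod C M A) (Mod C M B) (restriction M \<alpha>) X Y u \<and>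
      (\<exists>p. is_ext_coeq \<alpha> X (mcarr Y) p)"
  proof
    fix X assume "X \<in> Obj (Mod C M A)"
    then have X: "is_module C M A X" by simp
    obtain z p where p: "is_ext_coeq \<alpha> X z p"
      by (rule ext_coeq_ex[OF \<alpha> X])
    obtain y where "universal (Mod C M A) (Mod C M B) (restriction M \<alpha>) X (LMod z y)
        (SArr X (p \<bullet> eta B (mcarr X)) (restrict_obj M \<alpha> (LMod z y)))"
      by (rule extension_module[OF \<alpha> X p])
    with p show "\<exists>Y u. universal (Mod C M A) (Mod C M B) (restriction M \<alpha>) X Y u \<and> (\<exists>p. is_ext_coeq \<alpha> X (mcarr Y) p)"
      by (intro exI[of _ "LMod z y"]) auto
  qed
  then obtain F\<^sub>0 \<eta> where u: "\<And>X. X \<in> Obj (Mod C M A) \<Longrightarrow>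
        universal (Mod C M A) (Mod C M B) (restriction M \<alpha>) X (F\<^sub>0 X) (\<eta> X)"
    and p: "\<And>X. X \<in> Obj (Mod C M A) \<Longrightarrow> \<exists>p. is_ext_coeq \<alpha> X (mcarr (F\<^sub>0 X)) p"
    by metis
  obtain F where F: "left_adjoint (Mod C M A) (Mod C M B) F (restriction M \<alpha>)" "fob F = F\<^sub>0"
    by (rule left_adjoint_of_universal[OF restriction_functor[OF \<alpha>] u])
  have "is_extension C M \<alpha> F"
    unfolding is_extension_def Let_def h(3,4)
  proof (intro conjI allI impI)
    show "left_adjoint (Mod C M A) (Mod C M B) F (restriction M \<alpha>)" by (rule F)
    fix m \<rho> assume X: "LMod m \<rho> \<in> Obj (Mod C M A)"
    then have "m \<in> Obj M"
      using moduleD(1)[of A "LMod m \<rho>"] h(1) by simp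
    with p[OF X] show "\<exists>q. is_coequalizer M (Ident C (carr B) \<boxtimes>\<^sub>a\<^bsub>M\<^esub> \<rho>)
        (((mult B \<cdot> (Ident C (carr B) \<otimes>\<^sub>a und \<alpha>)) \<lhd> m) \<bullet> act_assoc M (carr B) (carr A) m)
        (mcarr (fob F (LMod m \<rho>))) q"
      using ext_pair_eq[OF \<alpha>, of m] h(4) by (simp add: is_ext_coeq_def F(2) lact_def)
  qed
  then show ?thesis
    unfolding extension_def by (rule someI)
qed

lemma extension_left_adjoint:
  assumes \<alpha>: "\<alpha> \<in> hom (Comm C) A B"
  shows "left_adjoint (Mod C M A) (Mod C M B) (extension C M \<alpha>) (restriction M \<alpha>)"
  using is_extension_extension[OF \<alpha>] comm_homD(3,4)[OF \<alpha>] by (simp add: is_extension_def Let_def)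

lemma modules_pseudofunctor: "\<exists>\<gamma> \<delta>. pseudofunctor_to_Cat (Comm C) (Mod C M) (extension C M) \<gamma> \<delta>"
proof (rule pseudofunctor_of_left_adjoints[where R = "restriction M"])
  fix \<alpha> assume \<alpha>: "\<alpha> \<in> Arr (Comm C)"
  then show "left_adjoint (Mod C M (Dom (Comm C) \<alpha>)) (Mod C M (Cod (Comm C) \<alpha>)) (extension C M \<alpha>) (restriction M \<alpha>)"
    using extension_left_adjoint[OF Comm_arr_hom[OF \<alpha>]] by simp
next
  fix \<alpha> \<beta> assume "\<alpha> \<in> Arr (Comm C)" "\<beta> \<in> Arr (Comm C)" "Dom (Comm C) \<beta> = Cod (Comm C) \<alpha>"
  then have "\<alpha> \<in> hom (Comm C) (sdom \<alpha>) (scod \<alpha>)" "\<beta> \<in> hom (Comm C) (scod \<alpha>) (scod \<beta>)"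
    by (simp_all add: hom_def)
  from restriction_comp[OF this]
  show "(\<forall>x\<in>Obj (Mod C M (Cod (Comm C) \<beta>)).
       fob (restriction M (\<beta> \<cdot>\<^bsub>Comm C\<^esub> \<alpha>)) x = fob (restriction M \<alpha>) (fob (restriction M \<beta>) x)) \<and>
    (\<forall>f\<in>Arr (Mod C M (Cod (Comm C) \<beta>)).
       far (restriction M (\<beta> \<cdot>\<^bsub>Comm C\<^esub> \<alpha>)) f = far (restriction M \<alpha>) (far (restriction M \<beta>) f))"
    by (simp only: Comm_simps(3)) blast
next
  fix A assume "A \<in> Obj (Comm C)"
  then have "is_comm_monoid C A" by simp
  from restriction_ident[OF this]
  show "(\<forall>x\<in>Obj (Mod C M A). fob (restriction M (Ident (Comm C) A)) x = x) \<and>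
    (\<forall>f\<in>Arr (Mod C M A). far (restriction M (Ident (Comm C) A)) f = f)"
    by blast
qed (simp_all add: C.category_Comm category_Mod)

text \<open>There are two universal arrows from \<open>\<beta>\<^sub>* n\<close> to \<open>\<alpha>\<^sub>*\<close>: the unit of \<open>\<alpha>\<^sup>*\<close>, and the restriction along
  \<open>\<beta>\<close> of the unit of \<open>\<alpha>'\<^sup>*\<close>.  The isomorphism is the comparison between them.\<close>

lemma base_change_iso:
  assumes \<alpha>: "\<alpha> \<in> hom (Comm C) A A'" and \<beta>: "\<beta> \<in> hom (Comm C) A B"
    and \<alpha>': "\<alpha>' \<in> hom (Comm C) B B'" and \<beta>': "\<beta>' \<in> hom (Comm C) A' B'"
    and sq: "\<alpha>' \<cdot>\<^bsub>Comm C\<^esub> \<beta> = \<beta>' \<cdot>\<^bsub>Comm C\<^esub> \<alpha>"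
    and k: "is_coequalizer C (Ident C (carr A') \<otimes>\<^sub>a (mult B \<cdot> (und \<beta> \<otimes>\<^sub>a Ident C (carr B))))
      (((mult A' \<cdot> (Ident C (carr A') \<otimes>\<^sub>a und \<alpha>)) \<otimes>\<^sub>a Ident C (carr B)) \<cdot> assoc C (carr A') (carr A) (carr B))
      (carr B') (mult B' \<cdot> (und \<beta>' \<otimes>\<^sub>a und \<alpha>'))"
  shows "\<exists>\<theta>. nat_iso (Mod C M B) (Mod C M A')
     (extension C M \<alpha> \<circ>\<circ> restriction M \<beta>) (restriction M \<beta>' \<circ>\<circ> extension C M \<alpha>') \<theta>"
proof -
  let ?E = "extension C M \<alpha>" and ?E' = "extension C M \<alpha>'"
  let ?ra = "restriction M \<alpha>" and ?rb = "restriction M \<beta>"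
    and ?ra' = "restriction M \<alpha>'" and ?rb' = "restriction M \<beta>'"
  note adj = extension_left_adjoint[OF \<alpha>] and adj' = extension_left_adjoint[OF \<alpha>']
  note Ra = restriction_functor[OF \<alpha>] and Rb = restriction_functor[OF \<beta>]
    and Ra' = restriction_functor[OF \<alpha>'] and Rb' = restriction_functor[OF \<beta>']
  have E: "is_functor (Mod C M A) (Mod C M A') ?E" and E': "is_functor (Mod C M B) (Mod C M B') ?E'"
    using adj adj' by (simp_all add: left_adjoint_def)
  interpret MA: category "Mod C M A" using Ra by (simp add: is_functor_def)
  interpret MA': category "Mod C M A'" using Ra by (simp add: is_functor_def)
  interpret MB: category "Mod C M B" using Rb by (simp add: is_functor_def)
  interpret MB': category "Mod C M B'" using Rb' by (simp add: is_functor_def)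
  have sq_ob: "fob ?rb (fob ?ra' Y) = fob ?ra (fob ?rb' Y)" if "Y \<in> Obj (Mod C M B')" for Y
    using restriction_comp(1)[OF \<beta> \<alpha>' that] restriction_comp(1)[OF \<alpha> \<beta>' that] sq by simp
  have sq_ar: "far ?rb (far ?ra' f) = far ?ra (far ?rb' f)" if "f \<in> Arr (Mod C M B')" for f
    using restriction_comp(2)[OF \<beta> \<alpha>' that] restriction_comp(2)[OF \<alpha> \<beta>' that] sq by simp
  obtain \<eta> where u: "\<And>X. X \<in> Obj (Mod C M A) \<Longrightarrow> universal (Mod C M A) (Mod C M A') ?ra X (fob ?E X) (\<eta> X)"
    and u_nat: "\<And>f. f \<in> Arr (Mod C M A) \<Longrightarrow>
      \<eta> (Cod (Mod C M A) f) \<cdot>\<^bsub>Mod C M A\<^esub> f = far ?ra (far ?E f) \<cdot>\<^bsub>Mod C M A\<^esub> \<eta> (Dom (Mod C M A) f)"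
    by (rule left_adjoint_universal[OF adj]) blast
  obtain \<eta>' where u': "\<And>N. N \<in> Obj (Mod C M B) \<Longrightarrow> universal (Mod C M B) (Mod C M B') ?ra' N (fob ?E' N) (\<eta>' N)"
    and u'_nat: "\<And>f. f \<in> Arr (Mod C M B) \<Longrightarrow>
      \<eta>' (Cod (Mod C M B) f) \<cdot>\<^bsub>Mod C M B\<^esub> f = far ?ra' (far ?E' f) \<cdot>\<^bsub>Mod C M B\<^esub> \<eta>' (Dom (Mod C M B) f)"
    by (rule left_adjoint_universal[OF adj']) blast
  have v: "universal (Mod C M A) (Mod C M A') ?ra (fob ?rb N) (fob ?rb' (fob ?E' N)) (far ?rb (\<eta>' N))"
    if N: "N \<in> Obj (Mod C M B)" for N
  proof -
    from N have N': "is_module C M B N" by simp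
    obtain z p where p: "is_ext_coeq \<alpha>' N z p"
      by (rule ext_coeq_ex[OF \<alpha>' N'])
    obtain y where Y: "is_module C M B' (LMod z y)"
      and y: "y \<bullet> (carr B' \<rhd> p) = p \<bullet> mu B' (mcarr N)"
      and w: "universal (Mod C M B) (Mod C M B') ?ra' N (LMod z y)
        (SArr N (p \<bullet> eta B' (mcarr N)) (restrict_obj M \<alpha>' (LMod z y)))"
      by (rule extension_module[OF \<alpha>' N' p])
    let ?Y = "LMod z y"
    let ?w = "SArr N (p \<bullet> eta B' (mcarr N)) (restrict_obj M \<alpha>' ?Y)"
    have YO: "?Y \<in> Obj (Mod C M B')" using Y by simp
    \<comment> \<open>\<open>base_change_universal\<close> concerns the module built on \<open>p\<close>; the isomorphism \<open>e\<close> carries it to the chosen extension\<close>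
    obtain e where e: "e \<in> hom (Mod C M B') ?Y (fob ?E' N)" "far ?ra' e \<cdot>\<^bsub>Mod C M B\<^esub> ?w = \<eta>' N"
      using universal_ex[OF w universal_arr(1)[OF u'[OF N]], of "\<eta>' N"] universal_arr(2-4)[OF u'[OF N]]
      by (auto simp: hom_def simp del: Mod_simps restrict_simps)
    have e_iso: "is_iso (Mod C M B') e"
      by (rule universal_comparison_iso[OF w u'[OF N] Ra' e])
    have eA: "e \<in> Arr (Mod C M B')" "Dom (Mod C M B') e = ?Y" "Cod (Mod C M B') e = fob ?E' N"
      using e(1) by (simp_all add: hom_def)
    have w': "far ?rb ?w = SArr (restrict_obj M \<beta> N) (p \<bullet> eta B' (mcarr N)) (restrict_obj M \<alpha> (restrict_obj M \<beta>' ?Y))"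
      using sq_ob[OF YO] by simp
    have "universal (Mod C M A) (Mod C M A') ?ra (fob ?rb N) (fob ?rb' ?Y) (far ?rb ?w)"
      unfolding w' using base_change_universal[OF \<alpha> \<beta> \<alpha>' \<beta>' sq k N' p Y y] by simp
    from universal_transfer[OF this Ra functor_iso[OF Rb' e_iso]]
    have "universal (Mod C M A) (Mod C M A') ?ra (fob ?rb N) (fob ?rb' (fob ?E' N))
        (far ?ra (far ?rb' e) \<cdot>\<^bsub>Mod C M A\<^esub> far ?rb ?w)"
      using functor_arr[OF Rb' eA(1)] eA by simp
    moreover have "far ?ra (far ?rb' e) \<cdot>\<^bsub>Mod C M A\<^esub> far ?rb ?w = far ?rb (\<eta>' N)"
      using functor_comp[OF Rb, of ?w "far ?ra' e"] functor_arr[OF Ra' eA(1)] eA universal_arr(2-4)[OF w]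
      unfolding sq_ar[OF eA(1), symmetric] e(2)[symmetric] by (simp del: Mod_simps restrict_simps)
    ultimately show ?thesis by simp
  qed
  have v_nat: "far ?rb (\<eta>' (Cod (Mod C M B) f)) \<cdot>\<^bsub>Mod C M A\<^esub> far ?rb f =
      far ?ra (far (?rb' \<circ>\<circ> ?E') f) \<cdot>\<^bsub>Mod C M A\<^esub> far ?rb (\<eta>' (Dom (Mod C M B) f))"
    if f: "f \<in> Arr (Mod C M B)" for f
  proof -
    note [simp del] = Mod_simps restrict_simps and [simp] = f universal_arr[OF u'] functor_arr[OF E'] functor_arr[OF Ra']
    have "far ?rb (\<eta>' (Cod (Mod C M B) f)) \<cdot>\<^bsub>Mod C M A\<^esub> far ?rb f = far ?rb (\<eta>' (Cod (Mod C M B) f) \<cdot>\<^bsub>Mod C M B\<^esub> f)"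
      by (simp add: functor_comp[OF Rb])
    also have "\<dots> = far ?rb (far ?ra' (far ?E' f)) \<cdot>\<^bsub>Mod C M A\<^esub> far ?rb (\<eta>' (Dom (Mod C M B) f))"
      unfolding u'_nat[OF f] by (simp add: functor_comp[OF Rb])
    finally show ?thesis
      by (simp add: sq_ar)
  qed
  have "\<forall>N \<in> Obj (Mod C M B). \<exists>t. t \<in> hom (Mod C M A') (fob ?E (fob ?rb N)) (fob ?rb' (fob ?E' N)) \<and>
      far ?ra t \<cdot>\<^bsub>Mod C M A\<^esub> \<eta> (fob ?rb N) = far ?rb (\<eta>' N)"
  proof
    fix N assume N: "N \<in> Obj (Mod C M B)"
    have "far ?rb (\<eta>' N) \<in> hom (Mod C M A) (fob ?rb N) (fob ?ra (fob ?rb' (fob ?E' N)))"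
      using universal_arr(2-4)[OF v[OF N]] by (simp add: hom_def)
    from universal_ex[OF u[OF functor_obj[OF Rb N]] universal_arr(1)[OF v[OF N]] this]
    show "\<exists>t. t \<in> hom (Mod C M A') (fob ?E (fob ?rb N)) (fob ?rb' (fob ?E' N)) \<and>
      far ?ra t \<cdot>\<^bsub>Mod C M A\<^esub> \<eta> (fob ?rb N) = far ?rb (\<eta>' N)"
      by blast
  qed
  from bchoice[OF this] obtain t where
    t: "\<And>N. N \<in> Obj (Mod C M B) \<Longrightarrow> t N \<in> hom (Mod C M A') (fob ?E (fob ?rb N)) (fob ?rb' (fob ?E' N))"
    and tu: "\<And>N. N \<in> Obj (Mod C M B) \<Longrightarrow> far ?ra (t N) \<cdot>\<^bsub>Mod C M A\<^esub> \<eta> (fob ?rb N) = far ?rb (\<eta>' N)"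
    by blast
  have "nat_iso (Mod C M B) (Mod C M A') (?E \<circ>\<circ> ?rb) (?rb' \<circ>\<circ> ?E') t"
  proof (rule nat_iso_of_universal[OF Ra Rb is_functor_comp[OF Rb E] is_functor_comp[OF E' Rb']])
    fix N assume N: "N \<in> Obj (Mod C M B)"
    show "universal (Mod C M A) (Mod C M A') ?ra (fob ?rb N) (fob (?E \<circ>\<circ> ?rb) N) (\<eta> (fob ?rb N))"
      using u[OF functor_obj[OF Rb N]] by simp
    show "universal (Mod C M A) (Mod C M A') ?ra (fob ?rb N) (fob (?rb' \<circ>\<circ> ?E') N) (far ?rb (\<eta>' N))"
      using v[OF N] by simp
    show "t N \<in> hom (Mod C M A') (fob (?E \<circ>\<circ> ?rb) N) (fob (?rb' \<circ>\<circ> ?E') N)"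
      using t[OF N] by simp
    show "far ?ra (t N) \<cdot>\<^bsub>Mod C M A\<^esub> \<eta> (fob ?rb N) = far ?rb (\<eta>' N)"
      by (rule tu[OF N])
  next
    fix f assume f: "f \<in> Arr (Mod C M B)"
    show "\<eta> (fob ?rb (Cod (Mod C M B) f)) \<cdot>\<^bsub>Mod C M A\<^esub> far ?rb f =
        far ?ra (far (?E \<circ>\<circ> ?rb) f) \<cdot>\<^bsub>Mod C M A\<^esub> \<eta> (fob ?rb (Dom (Mod C M B) f))"
      using u_nat[of "far ?rb f"] functor_arr[OF Rb f] by (simp del: Mod_simps restrict_simps)
    show "far ?rb (\<eta>' (Cod (Mod C M B) f)) \<cdot>\<^bsub>Mod C M A\<^esub> far ?rb f =
        far ?ra (far (?rb' \<circ>\<circ> ?E') f) \<cdot>\<^bsub>Mod C M A\<^esub> far ?rb (\<eta>' (Dom (Mod C M B) f))"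
      by (rule v_nat[OF f])
  qed
  then show ?thesis by blast
qed

end

lemma (in right_exact_monoidal_category) pushout_is_tensor:
  assumes coeq: "\<And>f g x y. f \<in> hom C x y \<Longrightarrow> g \<in> hom C x y \<Longrightarrow> \<exists>z q. is_coequalizer C f g z q"
    and \<alpha>: "\<alpha> \<in> hom (Comm C) A A'" and \<beta>: "\<beta> \<in> hom (Comm C) A B"
    and \<alpha>': "\<alpha>' \<in> hom (Comm C) B B'" and \<beta>': "\<beta>' \<in> hom (Comm C) A' B'"
    and po: "is_pushout (Comm C) \<alpha> \<beta> \<alpha>' \<beta>'"
  shows "is_coequalizer C (Ident C (carr A') \<otimes>\<^sub>a (mult B \<cdot> (und \<beta> \<otimes>\<^sub>a Ident C (carr B))))
      (((mult A' \<cdot> (Ident C (carr A') \<otimes>\<^sub>a und \<alpha>)) \<otimes>\<^sub>a Ident C (carr B)) \<cdot> assoc C (carr A') (carr A) (carr B))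
      (carr B') (mult B' \<cdot> (und \<beta>' \<otimes>\<^sub>a und \<alpha>'))"
proof -
  note ha = comm_homD[OF \<alpha>] and hb = comm_homD[OF \<beta>]
  note [simp] = ha(1,2) hb(2) comm_monoidD(1-7)[OF ha(1)] comm_monoidD(1-7)[OF ha(2)]
    comm_monoidD(1-7)[OF hb(2)] self.bc_arr[OF \<alpha>] self.bc_arr[OF \<beta>]
  have "carr A' \<rhd> (mult B \<cdot> self.bc \<beta> (carr B)) \<in> hom C (carr A' \<otimes> (carr A \<otimes> carr B)) (carr A' \<otimes> carr B)"
    "self.mu A' (carr B) \<cdot> (carr A' \<rhd> self.bc \<alpha> (carr B)) \<in> hom C (carr A' \<otimes> (carr A \<otimes> carr B)) (carr A' \<otimes> carr B)"
    by (auto intro!: homI)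
  from coeq[OF this] obtain P q where "is_coequalizer C (carr A' \<rhd> (mult B \<cdot> self.bc \<beta> (carr B)))
      (self.mu A' (carr B) \<cdot> (carr A' \<rhd> self.bc \<alpha> (carr B))) P q"
    by blast
  then interpret monoid_span_tensor C A A' B \<alpha> \<beta> P q
    using \<alpha> \<beta> by unfold_locales
  show ?thesis
    using pushout_coequalizer[OF \<alpha>' \<beta>' po] self.ext_pair_eq[OF \<alpha> comm_monoidD(1)[OF hb(2)]]
    by (simp add: self.lact_def self.bc_def)
qed

theorem proposition2p6:
  fixes C :: "('co, 'cm) smc"
    and M :: "('co, 'cm, 'o, 'm) actegory"
  assumes universe: "infinite (UNIV :: 'u set)"
    and C_closed: "closed_symmetric_monoidal_category C"
    and C_complete: "complete TYPE('u) C"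
    and C_cocomplete: "cocomplete TYPE('u) C"
    and M_actegory: "left_actegory C M"
    and M_complete: "complete TYPE('u) M"
    and M_cocomplete: "cocomplete TYPE('u) M"
    and act_left: "\<And>a. a \<in> Obj C \<Longrightarrow> preserves_colimits TYPE('u) M M (act_on_left C M a)"
    and act_right: "\<And>m. m \<in> Obj M \<Longrightarrow> preserves_colimits TYPE('u) C M (act_on_right M m)"
  shows
    "(\<exists>\<gamma> \<delta>. pseudofunctor_to_Cat (Comm C) (Mod C M) (extension C M) \<gamma> \<delta>) \<and>
     (\<forall>a b. \<forall>\<alpha> \<in> hom (Comm C) a b.
        conservative (Mod C M b) (Mod C M a) (restriction M \<alpha>)) \<and>
     (\<forall>a a' b b'. \<forall>\<alpha> \<in> hom (Comm C) a a'. \<forall>\<beta> \<in> hom (Comm C) a b.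
        \<forall>\<alpha>' \<in> hom (Comm C) b b'. \<forall>\<beta>' \<in> hom (Comm C) a' b'.
        is_pushout (Comm C) \<alpha> \<beta> \<alpha>' \<beta>' \<longrightarrow>
        (\<exists>\<theta>. nat_iso (Mod C M b) (Mod C M a')
           (extension C M \<alpha> \<circ>\<circ> restriction M \<beta>) (restriction M \<beta>' \<circ>\<circ> extension C M \<alpha>') \<theta>))"
proof -
  interpret C: closed_symmetric_monoidal_category C by (rule C_closed)
  interpret C: right_exact_monoidal_category C by (rule C.right_exact)
  interpret M: left_actegory C M by (rule M_actegory)
  interpret M: actegory_with_coequalizers C M
  proof unfold_locales
    show "is_coequalizer M (M.lact a f) (M.lact a g) (a \<boxtimes>\<^bsub>M\<^esub> z) (M.lact a q)"
      if "a \<in> Obj C" "is_coequalizer M f g z q" for a f g z q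
      using preserves_coequalizer[OF universe act_left[OF that(1)] that(2)]
      by (simp add: act_on_left_def M.lact_def)
    show "is_coequalizer M (f \<boxtimes>\<^sub>a\<^bsub>M\<^esub> Ident M m) (g \<boxtimes>\<^sub>a\<^bsub>M\<^esub> Ident M m) (z \<boxtimes>\<^bsub>M\<^esub> m) (q \<boxtimes>\<^sub>a\<^bsub>M\<^esub> Ident M m)"
      if "m \<in> Obj M" "is_coequalizer C f g z q" for m f g z q
      using preserves_coequalizer[OF universe act_right[OF that(1)] that(2)]
      by (simp add: act_on_right_def)
    show "\<exists>z q. is_coequalizer M f g z q" if "f \<in> hom M x y" "g \<in> hom M x y" for f g x y
      using cocomplete_coequalizer[OF universe M_cocomplete that] by blast
  qed
  have coeq: "\<exists>z q. is_coequalizer C f g z q" if "f \<in> hom C x y" "g \<in> hom C x y" for f g x y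
    using cocomplete_coequalizer[OF universe C_cocomplete that] by blast
  show ?thesis
  proof (intro conjI allI ballI impI)
    show "\<exists>\<gamma> \<delta>. pseudofunctor_to_Cat (Comm C) (Mod C M) (extension C M) \<gamma> \<delta>"
      by (rule M.modules_pseudofunctor)
    show "conservative (Mod C M b) (Mod C M a) (restriction M \<alpha>)" if "\<alpha> \<in> hom (Comm C) a b" for a b \<alpha>
      by (rule M.restriction_conservative[OF that])
    fix a a' b b' \<alpha> \<beta> \<alpha>' \<beta>'
    assume h: "\<alpha> \<in> hom (Comm C) a a'" "\<beta> \<in> hom (Comm C) a b" "\<alpha>' \<in> hom (Comm C) b b'" "\<beta>' \<in> hom (Comm C) a' b'"
      and po: "is_pushout (Comm C) \<alpha> \<beta> \<alpha>' \<beta>'"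
    have sq: "\<alpha>' \<cdot>\<^bsub>Comm C\<^esub> \<beta> = \<beta>' \<cdot>\<^bsub>Comm C\<^esub> \<alpha>"
      using po by (auto simp: is_pushout_def simp del: Comm_simps)
    show "\<exists>\<theta>. nat_iso (Mod C M b) (Mod C M a')
           (extension C M \<alpha> \<circ>\<circ> restriction M \<beta>) (restriction M \<beta>' \<circ>\<circ> extension C M \<alpha>') \<theta>"
      by (rule M.base_change_iso[OF h sq C.pushout_is_tensor[OF coeq h po]])
  qed
qed

end
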